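(* Let $G$ be a finite group, $[\alpha]\in H^2(G,\mathbb{C}^* )$, $N\lhd G$ a normal subgroup, and let $[\mathcal{G}]=[(\mathbb{C}^{\alpha}G)/N]$ be the quotient $G/N$-grading class of the twisted group algebra grading class $[\mathbb{C}^{\alpha}G]$. For $[M]\in \mathrm{Irr}(\mathbb{C}^{\alpha}N)$ let $\mathcal{I}_M<G/N$ be the stabilizer of $[M]$ under the $G/N$-action on $\mathrm{Irr}(\mathbb{C}^{\alpha}N)$ described in the context, and let $T_M$ be a transversal set of $\mathcal{I}_M$ in $G/N$ (so the orbit of $[M]$ is $\{[t(M)]\}_{t\in T_M}$). Then: (1) There is a one-to-one correspondence between the simply-graded (i.e. graded-simple) summands of $[\mathcal{G}]$ and the orbits in $\mathrm{Irr}(\mathbb{C}^{\alpha}N)$ under the $G/N$-action. (2) Let $[\mathcal{G}_M]$ be the simply-graded summand of $[\mathcal{G}]$ which corresponds to the $G/N$-orbit of $[M]\in\mathrm{Irr}(\mathbb{C}^{\alpha}N)$. Then $$[\mathcal{G}_M]=\left[x_M(\mathbb{C}^{\omega}\mathcal{I}_M)\right],$$ where $x_M=\dim_{\mathbb{C}}(M)\cdot\sum_{t\in T_M}t\in\mathbb{N}[G/N]$ and $[\omega]=\omega_{\mathcal{G}}([M])\in H^2(\mathcal{I}_M,\mathbb{C}^* )$ is Mackey's obstruction cohomology class corresponding to $[M]$.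
   Context: Gradings. A $\Gamma$-grading of a complex algebra $\mathcal{A}$ by a group $\Gamma$ is a decomposition $\mathcal{A}=\bigoplus_{\gamma\in\Gamma}\mathcal{A}_\gamma$ with $\mathcal{A}_{\gamma_1}\mathcal{A}_{\gamma_2}\subseteq\mathcal{A}_{\gamma_1\gamma_2}$. A $\Gamma_1$-grading of $\mathcal{A}$ and a $\Gamma_2$-grading of $\mathcal{B}$ are graded-equivalent if there are an algebra isomorphism $\psi:\mathcal{A}\to\mathcal{B}$ and a group isomorphism $\phi:\Gamma_1\to\Gamma_2$ with $\psi(\mathcal{A}_\gamma)\subseteq\mathcal{B}_{\phi(\gamma)}$ for all $\gamma$; $[\cdot]$ denotes the graded-equivalence class. For $N\lhd\Gamma$, the quotient grading $\mathcal{G}_{\mathcal{A}}/N$ is the $\Gamma/N$-grading with $\mathcal{A}_{\bar\gamma}=\bigoplus_{\gamma\in\bar\gamma}\mathcal{A}_\gamma$. A graded ideal is a two-sided ideal $I$ with $I=\bigoplus_\gamma (I\cap\mathcal{A}_\gamma)$; a graded algebra is graded-simple (simply-graded) if it has no non-trivial graded ideals. Any group grading of a finite-dimensional semisimple algebra is a direct sum of graded-simple algebras, its simply-graded summands. Twisted group algebras. For $\alpha\in Z^2(G,\mathbb{C}^* )$ (trivial action), $\mathbb{C}^{\alpha}G=\bigoplus_{g\in G}\mathbb{C}u_g$ with $u_{g}u_{h}=\alpha(g,h)u_{gh}$, graded by $G$ via $(\mathbb{C}^{\alpha}G)_g=\mathbb{C}u_g$. For $N<G$ the restriction of $\alpha$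 to $N$ is again denoted $\alpha$. $\mathrm{Irr}(\mathbb{C}^{\alpha}N)$ is the set of isomorphism types of irreducible left $\mathbb{C}^{\alpha}N$-modules. Induction. Let $G<\Gamma$ and let $\mathcal{A}$ be $G$-graded (regarded as $\Gamma$-graded, with zero components outside $G$). For $x=\sum_{i=1}^r\gamma_i\in\mathbb{N}[\Gamma]$ (group semiring, $0\in\mathbb{N}$), the induced grading $x(\mathcal{G}_{\mathcal{A}})$ is the $\Gamma$-grading of $M_r(\mathcal{A})\cong M_r(\mathbb{C})\otimes\mathcal{A}$ in which $E_{i,j}\otimes\mathcal{A}_\gamma$ is homogeneous of degree $\gamma_i\gamma\gamma_j^{-1}$. Action. $G/N$ acts on $\mathrm{Irr}(\mathbb{C}^{\alpha}N)$: for $\gamma\in G/N$ choose $g\in\gamma$; $\gamma([M])=[{}^{\gamma}M]$, where ${}^{\gamma}M$ has the same underlying space as $M$ and the action $a\star m:=(u_g^{-1}au_g)(m)$ for $a\in\mathbb{C}^{\alpha}N$, $m\in M$ (well defined up to isomorphism). Mackey's obstruction class. The left $\mathbb{C}^{\alpha}G$-module $W=\mathbb{C}^{\alpha}G\otimes_{\mathbb{C}^{\alpha}N}M$ is $G/N$-graded by $W_{gN}=u_g\mathbb{C}^{\alpha}N\otimes_{\mathbb{C}^{\alpha}N}M$. Let $\mathrm{End}^{r(G/N)}_{\mathbb{C}^{\alpha}G}(W)$ be the $G/N$-graded algebra of $\mathbb{C}^{\alpha}G$-module endomorphisms of $W$, acting on $W$ from the right (so the product $\varphi\psi$ means first $\varphi$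 and then $\psi$), where $\varphi$ is of degree $\gamma$ if $\varphi(W_{\gamma'})\subseteq W_{\gamma'\gamma}$ for all $\gamma'$. Then $\omega_{\mathcal{G}}([M])\in H^2(\mathcal{I}_M,\mathbb{C}^* )$ is the unique class such that $\mathrm{End}^{r(G/N)}_{\mathbb{C}^{\alpha}G}(W)$ is isomorphic as a $G/N$-graded algebra (with the identity map on $G/N$) to $\mathbb{C}^{\omega}\mathcal{I}_M$ for any 2-cocycle $\omega$ in this class. *)

theory Defs
  imports
    "Jordan_Normal_Form.VS_Connect"
    "HOL-Algebra.Ideal"
    "HOL-Algebra.QuotRing"
    "HOL-Algebra.Group_Action"
    "HOL-Algebra.Free_Abelian_Groups"
    "HOL-Library.Multiset"
begin

section \<open>Second cohomology with trivial coefficients in the nonzero complex numbers\<close>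

definition cocycles2 :: "('g, 'x) monoid_scheme \<Rightarrow> ('g \<Rightarrow> 'g \<Rightarrow> complex) set" where
  "cocycles2 G = {\<alpha>.
     (\<forall>g\<in>carrier G. \<forall>h\<in>carrier G. \<alpha> g h \<noteq> 0) \<and>
     (\<forall>g\<in>carrier G. \<forall>h\<in>carrier G. \<forall>k\<in>carrier G.
        \<alpha> g h * \<alpha> (g \<otimes>\<^bsub>G\<^esub> h) k = \<alpha> g (h \<otimes>\<^bsub>G\<^esub> k) * \<alpha> h k)}"

definition cohomologous ::
  "('g, 'x) monoid_scheme \<Rightarrow> (('g \<Rightarrow> 'g \<Rightarrow> complex) \<times> ('g \<Rightarrow> 'g \<Rightarrow> complex)) set" where
  "cohomologous G = {(\<alpha>, \<beta>). \<alpha> \<in> cocycles2 G \<and> \<beta> \<in> cocycles2 G \<and>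
     (\<exists>f. (\<forall>g\<in>carrier G. f g \<noteq> 0) \<and>
       (\<forall>g\<in>carrier G. \<forall>h\<in>carrier G. \<beta> g h = f g * f h / f (g \<otimes>\<^bsub>G\<^esub> h) * \<alpha> g h))}"

definition H2 :: "('g, 'x) monoid_scheme \<Rightarrow> ('g \<Rightarrow> 'g \<Rightarrow> complex) set set" where
  "H2 G = cocycles2 G // cohomologous G"


section \<open>Complex algebras and gradings\<close>

text \<open>
  The library locale \<open>algebra\<close> is restricted to commutative algebras.
\<close>

locale complex_algebra = ring A + Module.module class_ring A
  for A :: "(complex, 'a, 'x) module_scheme" (structure) +
  assumes smult_mult_left:
      "\<lbrakk>x \<in> carrier A; y \<in> carrier A\<rbrakk> \<Longrightarrow> (c \<odot> x) \<otimes> y = c \<odot> (x \<otimes> y)"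
    and smult_mult_right:
      "\<lbrakk>x \<in> carrier A; y \<in> carrier A\<rbrakk> \<Longrightarrow> x \<otimes> (c \<odot> y) = c \<odot> (x \<otimes> y)"

definition family_sum :: "('a, 'x) ring_scheme \<Rightarrow> 'i set \<Rightarrow> ('i \<Rightarrow> 'a set) \<Rightarrow> 'a set" where
  "family_sum A I D = {finsum A f J | f J. finite J \<and> J \<subseteq> I \<and> f \<in> Pi J D}"

definition internal_direct_sum ::
  "('a, 'x) ring_scheme \<Rightarrow> 'a set \<Rightarrow> 'i set \<Rightarrow> ('i \<Rightarrow> 'a set) \<Rightarrow> bool" where
  "internal_direct_sum A X I D \<longleftrightarrow>
     X = family_sum A I D \<and>
     (\<forall>J f. finite J \<and> J \<subseteq> I \<and> f \<in> Pi J D \<and> finsum A f J = \<zero>\<^bsub>A\<^esub>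
        \<longrightarrow> (\<forall>j\<in>J. f j = \<zero>\<^bsub>A\<^esub>))"

definition graded_algebra ::
  "('g, 'y) monoid_scheme \<Rightarrow> (complex, 'a, 'x) module_scheme \<Rightarrow> ('g \<Rightarrow> 'a set) \<Rightarrow> bool" where
  "graded_algebra \<Gamma> A D \<longleftrightarrow>
     group \<Gamma> \<and> complex_algebra A \<and>
     (\<forall>\<gamma>\<in>carrier \<Gamma>. Module.submodule (D \<gamma>) class_ring A) \<and>
     internal_direct_sum A (carrier A) (carrier \<Gamma>) D \<and>
     (\<forall>\<gamma>\<in>carrier \<Gamma>. \<forall>\<delta>\<in>carrier \<Gamma>. \<forall>x\<in>D \<gamma>. \<forall>y\<in>D \<delta>. x \<otimes>\<^bsub>A\<^esub> y \<in> D (\<gamma> \<otimes>\<^bsub>\<Gamma>\<^esub> \<delta>))"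

definition algebra_iso ::
  "(complex, 'a, 'x) module_scheme \<Rightarrow> (complex, 'b, 'y) module_scheme \<Rightarrow> ('a \<Rightarrow> 'b) set" where
  "algebra_iso A B = ring_iso A B \<inter> LinearCombinations.module_hom class_ring A B"

definition graded_equivalent ::
  "('g, 'u) monoid_scheme \<Rightarrow> (complex, 'a, 'x) module_scheme \<Rightarrow> ('g \<Rightarrow> 'a set) \<Rightarrow>
   ('h, 'v) monoid_scheme \<Rightarrow> (complex, 'b, 'y) module_scheme \<Rightarrow> ('h \<Rightarrow> 'b set) \<Rightarrow> bool" where
  "graded_equivalent \<Gamma>\<^sub>1 A D \<Gamma>\<^sub>2 B E \<longleftrightarrow>
     graded_algebra \<Gamma>\<^sub>1 A D \<and> graded_algebra \<Gamma>\<^sub>2 B E \<and>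
     (\<exists>\<psi>\<in>algebra_iso A B. \<exists>\<phi>\<in>iso \<Gamma>\<^sub>1 \<Gamma>\<^sub>2. \<forall>\<gamma>\<in>carrier \<Gamma>\<^sub>1. \<psi> ` D \<gamma> \<subseteq> E (\<phi> \<gamma>))"

definition graded_isomorphic ::
  "('g, 'u) monoid_scheme \<Rightarrow> (complex, 'a, 'x) module_scheme \<Rightarrow> ('g \<Rightarrow> 'a set) \<Rightarrow>
   (complex, 'b, 'y) module_scheme \<Rightarrow> ('g \<Rightarrow> 'b set) \<Rightarrow> bool" where
  "graded_isomorphic \<Gamma> A D B E \<longleftrightarrow>
     graded_algebra \<Gamma> A D \<and> graded_algebra \<Gamma> B E \<and>
     (\<exists>\<psi>\<in>algebra_iso A B. \<forall>\<gamma>\<in>carrier \<Gamma>. \<psi> ` D \<gamma> \<subseteq> E \<gamma>)"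

text \<open>
  The argument \<open>C\<close> of a quotient grading is a coset, i.e. an element of \<open>carrier (\<Gamma> Mod N)\<close>.
\<close>

definition quotient_grading ::
  "(complex, 'a, 'x) module_scheme \<Rightarrow> ('g \<Rightarrow> 'a set) \<Rightarrow> 'g set \<Rightarrow> 'a set" where
  "quotient_grading A D C = family_sum A C D"

definition extend_grading ::
  "(complex, 'a, 'x) module_scheme \<Rightarrow> 'g set \<Rightarrow> ('g \<Rightarrow> 'a set) \<Rightarrow> 'g \<Rightarrow> 'a set" where
  "extend_grading A H D \<gamma> = (if \<gamma> \<in> H then D \<gamma> else {\<zero>\<^bsub>A\<^esub>})"


section \<open>Graded-simple summands\<close>

definition graded_ideal ::
  "('g, 'y) monoid_scheme \<Rightarrow> (complex, 'a, 'x) module_scheme \<Rightarrow> ('g \<Rightarrow> 'a set) \<Rightarrow> 'a set \<Rightarrow> bool" where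
  "graded_ideal \<Gamma> A D I \<longleftrightarrow>
     ideal I A \<and> internal_direct_sum A I (carrier \<Gamma>) (\<lambda>\<gamma>. I \<inter> D \<gamma>)"

definition graded_simple ::
  "('g, 'y) monoid_scheme \<Rightarrow> (complex, 'a, 'x) module_scheme \<Rightarrow> ('g \<Rightarrow> 'a set) \<Rightarrow> bool" where
  "graded_simple \<Gamma> A D \<longleftrightarrow>
     graded_algebra \<Gamma> A D \<and> carrier A \<noteq> {\<zero>\<^bsub>A\<^esub>} \<and>
     (\<forall>I. graded_ideal \<Gamma> A D I \<longrightarrow> I = {\<zero>\<^bsub>A\<^esub>} \<or> I = carrier A)"

text \<open>
  A direct summand of a unital algebra is an algebra with its own unit element, not that of the
  ambient algebra.
\<close>

definition ideal_algebra ::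
  "(complex, 'a, 'x) module_scheme \<Rightarrow> 'a set \<Rightarrow> (complex, 'a, 'x) module_scheme" where
  "ideal_algebra A I =
     A\<lparr>carrier := I, one := (THE e. e \<in> I \<and> (\<forall>x\<in>I. e \<otimes>\<^bsub>A\<^esub> x = x \<and> x \<otimes>\<^bsub>A\<^esub> e = x))\<rparr>"

definition simply_graded_decomposition ::
  "('g, 'y) monoid_scheme \<Rightarrow> (complex, 'a, 'x) module_scheme \<Rightarrow> ('g \<Rightarrow> 'a set) \<Rightarrow> 'a set set \<Rightarrow> bool"
  where
  "simply_graded_decomposition \<Gamma> A D S \<longleftrightarrow>
     (\<forall>I\<in>S. graded_ideal \<Gamma> A D I \<and>
             graded_simple \<Gamma> (ideal_algebra A I) (\<lambda>\<gamma>. I \<inter> D \<gamma>)) \<and>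
     internal_direct_sum A (carrier A) S (\<lambda>I. I)"

definition simply_graded_summands ::
  "('g, 'y) monoid_scheme \<Rightarrow> (complex, 'a, 'x) module_scheme \<Rightarrow> ('g \<Rightarrow> 'a set) \<Rightarrow> 'a set set" where
  "simply_graded_summands \<Gamma> A D = \<Union> {S. simply_graded_decomposition \<Gamma> A D S}"


section \<open>Twisted group algebras\<close>

text \<open>
  The function \<open>f\<close> stands for the sum of all \<open>f g\<close> times \<open>basis_elt g\<close>; this is meant for finite groups.
  Cocycles are not assumed to be normalised, so the unit element is \<open>basis_elt \<one>\<close> divided by \<open>\<alpha> \<one> \<one>\<close>.
  As functions vanish outside the group, the algebra of a subgroup is a subset of that of the group.
\<close>

definition twisted_group_algebra ::
  "('g, 'x) monoid_scheme \<Rightarrow> ('g \<Rightarrow> 'g \<Rightarrow> complex) \<Rightarrow> (complex, 'g \<Rightarrow> complex) module" where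
  "twisted_group_algebra G \<alpha> = \<lparr>
     carrier = {f. \<forall>x. x \<notin> carrier G \<longrightarrow> f x = 0},
     monoid.mult = (\<lambda>f h x.
       \<Sum>(g, k) \<in> {(g, k). g \<in> carrier G \<and> k \<in> carrier G \<and> g \<otimes>\<^bsub>G\<^esub> k = x}. f g * h k * \<alpha> g k),
     one = (\<lambda>x. if x = \<one>\<^bsub>G\<^esub> then inverse (\<alpha> \<one>\<^bsub>G\<^esub> \<one>\<^bsub>G\<^esub>) else 0),
     ring.zero = (\<lambda>x. 0),
     add = (\<lambda>f h x. f x + h x),
     smult = (\<lambda>c f x. c * f x)\<rparr>"

definition basis_elt :: "'g \<Rightarrow> 'g \<Rightarrow> complex" where
  "basis_elt g = (\<lambda>x. if x = g then 1 else 0)"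

definition twisted_grading :: "'g \<Rightarrow> ('g \<Rightarrow> complex) set" where
  "twisted_grading g = range (\<lambda>c x. c * basis_elt g x)"


section \<open>Induced gradings of matrix algebras\<close>

definition matrix_algebra ::
  "nat \<Rightarrow> (complex, 'a, 'x) module_scheme \<Rightarrow> (complex, nat \<times> nat \<Rightarrow> 'a) module" where
  "matrix_algebra r A = \<lparr>
     carrier = ({..<r} \<times> {..<r}) \<rightarrow>\<^sub>E carrier A,
     monoid.mult = (\<lambda>X Y. \<lambda>(i, j)\<in>{..<r} \<times> {..<r}. \<Oplus>\<^bsub>A\<^esub>k\<in>{..<r}. X (i, k) \<otimes>\<^bsub>A\<^esub> Y (k, j)),
     one = (\<lambda>(i, j)\<in>{..<r} \<times> {..<r}. if i = j then \<one>\<^bsub>A\<^esub> else \<zero>\<^bsub>A\<^esub>),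
     ring.zero = (\<lambda>p\<in>{..<r} \<times> {..<r}. \<zero>\<^bsub>A\<^esub>),
     add = (\<lambda>X Y. \<lambda>p\<in>{..<r} \<times> {..<r}. X p \<oplus>\<^bsub>A\<^esub> Y p),
     smult = (\<lambda>c X. \<lambda>p\<in>{..<r} \<times> {..<r}. c \<odot>\<^bsub>A\<^esub> X p)\<rparr>"

text \<open>
  The list \<open>\<gamma>s\<close> enumerates the terms of an element of the group semiring. A matrix with the single
  entry \<open>a\<close> of degree \<open>\<delta>\<close> at \<open>(i, j)\<close> has degree \<open>\<gamma>\<^sub>i \<delta> \<gamma>\<^sub>j\<inverse>\<close>, so in a matrix of degree \<open>\<gamma>\<close> the
  entry at \<open>(i, j)\<close> has degree \<open>\<gamma>\<^sub>i\<inverse> \<gamma> \<gamma>\<^sub>j\<close>.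
\<close>

definition induced_grading ::
  "('g, 'y) monoid_scheme \<Rightarrow> 'g list \<Rightarrow> (complex, 'a, 'x) module_scheme \<Rightarrow> ('g \<Rightarrow> 'a set) \<Rightarrow>
   'g \<Rightarrow> (nat \<times> nat \<Rightarrow> 'a) set" where
  "induced_grading \<Gamma> \<gamma>s A D \<gamma> =
     {X \<in> carrier (matrix_algebra (length \<gamma>s) A).
        \<forall>i<length \<gamma>s. \<forall>j<length \<gamma>s. X (i, j) \<in> D (inv\<^bsub>\<Gamma>\<^esub> (\<gamma>s ! i) \<otimes>\<^bsub>\<Gamma>\<^esub> \<gamma> \<otimes>\<^bsub>\<Gamma>\<^esub> (\<gamma>s ! j))}"


section \<open>Left modules over noncommutative rings\<close>

text \<open>
  The library locale \<open>module\<close> is restricted to commutative rings. The fields \<open>mult\<close> and \<open>one\<close> of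
  a module record are irrelevant.
\<close>

locale left_module = R?: ring R + M?: abelian_group M
  for R :: "('a, 'x) ring_scheme" (structure) and M :: "('a, 'm, 'y) module_scheme" (structure) +
  assumes smult_closed:
      "\<lbrakk>a \<in> carrier R; m \<in> carrier M\<rbrakk> \<Longrightarrow> a \<odot>\<^bsub>M\<^esub> m \<in> carrier M"
    and smult_l_distr:
      "\<lbrakk>a \<in> carrier R; b \<in> carrier R; m \<in> carrier M\<rbrakk> \<Longrightarrow>
        (a \<oplus>\<^bsub>R\<^esub> b) \<odot>\<^bsub>M\<^esub> m = a \<odot>\<^bsub>M\<^esub> m \<oplus>\<^bsub>M\<^esub> b \<odot>\<^bsub>M\<^esub> m"
    and smult_r_distr:
      "\<lbrakk>a \<in> carrier R; m \<in> carrier M; n \<in> carrier M\<rbrakk> \<Longrightarrow>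
        a \<odot>\<^bsub>M\<^esub> (m \<oplus>\<^bsub>M\<^esub> n) = a \<odot>\<^bsub>M\<^esub> m \<oplus>\<^bsub>M\<^esub> a \<odot>\<^bsub>M\<^esub> n"
    and smult_assoc:
      "\<lbrakk>a \<in> carrier R; b \<in> carrier R; m \<in> carrier M\<rbrakk> \<Longrightarrow>
        (a \<otimes>\<^bsub>R\<^esub> b) \<odot>\<^bsub>M\<^esub> m = a \<odot>\<^bsub>M\<^esub> (b \<odot>\<^bsub>M\<^esub> m)"
    and smult_one:
      "m \<in> carrier M \<Longrightarrow> \<one>\<^bsub>R\<^esub> \<odot>\<^bsub>M\<^esub> m = m"

definition irreducible_module ::
  "('a, 'x) ring_scheme \<Rightarrow> ('a, 'm, 'y) module_scheme \<Rightarrow> bool" where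
  "irreducible_module R M \<longleftrightarrow>
     left_module R M \<and> carrier M \<noteq> {\<zero>\<^bsub>M\<^esub>} \<and>
     (\<forall>H. Module.submodule H R M \<longrightarrow> H = {\<zero>\<^bsub>M\<^esub>} \<or> H = carrier M)"

definition module_isomorphic ::
  "('a, 'x) ring_scheme \<Rightarrow> ('a, 'm, 'y) module_scheme \<Rightarrow> ('a, 'n, 'z) module_scheme \<Rightarrow> bool" where
  "module_isomorphic R M M' \<longleftrightarrow> (\<exists>f\<in>LinearCombinations.module_hom R M M'. bij_betw f (carrier M) (carrier M'))"

text \<open>
  Isomorphism types are formed among the modules whose elements have the type of the ring elements.
  For a twisted group algebra of a finite group this loses nothing: every irreducible module is
  isomorphic to a left ideal.
\<close>

definition module_type ::
  "('a, 'x) ring_scheme \<Rightarrow> ('a, 'a) module \<Rightarrow> ('a, 'a) module set" where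
  "module_type R M = {M'. irreducible_module R M' \<and> module_isomorphic R M M'}"

definition Irr :: "('a, 'x) ring_scheme \<Rightarrow> ('a, 'a) module set set" where
  "Irr R = {module_type R M | M. irreducible_module R M}"

definition complex_dim ::
  "(complex, 'a, 'x) module_scheme \<Rightarrow> ('a, 'm, 'y) module_scheme \<Rightarrow> nat" where
  "complex_dim R M = vectorspace.dim (class_ring :: complex ring)
     \<lparr>carrier = carrier M, monoid.mult = monoid.mult M, one = one M,
      ring.zero = ring.zero M, add = add M,
      smult = (\<lambda>c m. (c \<odot>\<^bsub>R\<^esub> \<one>\<^bsub>R\<^esub>) \<odot>\<^bsub>M\<^esub> m)\<rparr>"


section \<open>The action of the quotient group on the irreducible modules\<close>

definition conjugate_module ::
  "('a, 'x) ring_scheme \<Rightarrow> 'a \<Rightarrow> ('a, 'm) module \<Rightarrow> ('a, 'm) module" where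
  "conjugate_module A v M = M\<lparr>smult := (\<lambda>a m. (inv\<^bsub>A\<^esub> v \<otimes>\<^bsub>A\<^esub> a \<otimes>\<^bsub>A\<^esub> v) \<odot>\<^bsub>M\<^esub> m)\<rparr>"

abbreviation twisted_subgroup_algebra ::
  "('g, 'x) monoid_scheme \<Rightarrow> ('g \<Rightarrow> 'g \<Rightarrow> complex) \<Rightarrow> 'g set \<Rightarrow> (complex, 'g \<Rightarrow> complex) module" where
  "twisted_subgroup_algebra G \<alpha> H \<equiv> twisted_group_algebra (G\<lparr>carrier := H\<rparr>) \<alpha>"

text \<open>
  All choices of a representative \<open>g\<close> of the coset \<open>C\<close> and of a module \<open>M\<close> of type \<open>c\<close> yield the
  same isomorphism type.
\<close>

definition irr_action ::
  "('g, 'x) monoid_scheme \<Rightarrow> ('g \<Rightarrow> 'g \<Rightarrow> complex) \<Rightarrow> 'g set \<Rightarrow> 'g set \<Rightarrow>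
   ('g \<Rightarrow> complex, 'g \<Rightarrow> complex) module set \<Rightarrow> ('g \<Rightarrow> complex, 'g \<Rightarrow> complex) module set" where
  "irr_action G \<alpha> N C c =
     (\<Union>g\<in>C. \<Union>M\<in>c. module_type (twisted_subgroup_algebra G \<alpha> N)
        (conjugate_module (twisted_group_algebra G \<alpha>) (basis_elt g) M))"

definition inertia_group ::
  "('g, 'x) monoid_scheme \<Rightarrow> ('g \<Rightarrow> 'g \<Rightarrow> complex) \<Rightarrow> 'g set \<Rightarrow>
   ('g \<Rightarrow> complex, 'g \<Rightarrow> complex) module \<Rightarrow> 'g set set" where
  "inertia_group G \<alpha> N M =
     stabilizer (G Mod N) (irr_action G \<alpha> N) (module_type (twisted_subgroup_algebra G \<alpha> N) M)"

definition left_transversal :: "('g, 'x) monoid_scheme \<Rightarrow> 'g set \<Rightarrow> 'g set \<Rightarrow> bool" where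
  "left_transversal \<Gamma> H T \<longleftrightarrow>
     T \<subseteq> carrier \<Gamma> \<and> (\<forall>x\<in>carrier \<Gamma>. \<exists>!t. t \<in> T \<and> x \<in> t <#\<^bsub>\<Gamma>\<^esub> H)"


section \<open>Extension of scalars\<close>

text \<open>
  The tensor product of \<open>A\<close>, as a right module over its subring \<open>R\<close>, with the left \<open>R\<close>-module \<open>M\<close>:
  the free abelian group on pairs modulo the balanced bilinear relations. In the scalar
  multiplication, the cosets in the union all coincide.
\<close>

abbreviation tensor_free ::
  "('a, 'x) ring_scheme \<Rightarrow> ('a, 'm, 'z) module_scheme \<Rightarrow> ('a \<times> 'm \<Rightarrow>\<^sub>0 int) monoid" where
  "tensor_free A M \<equiv> free_Abelian_group (carrier A \<times> carrier M)"

definition tensor_relations ::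
  "('a, 'x) ring_scheme \<Rightarrow> ('a, 'y) ring_scheme \<Rightarrow> ('a, 'm, 'z) module_scheme \<Rightarrow>
   ('a \<times> 'm \<Rightarrow>\<^sub>0 int) set" where
  "tensor_relations A R M = generate (tensor_free A M)
    ({frag_of (x \<oplus>\<^bsub>A\<^esub> y, m) - frag_of (x, m) - frag_of (y, m) | x y m.
        x \<in> carrier A \<and> y \<in> carrier A \<and> m \<in> carrier M} \<union>
     {frag_of (x, m \<oplus>\<^bsub>M\<^esub> n) - frag_of (x, m) - frag_of (x, n) | x m n.
        x \<in> carrier A \<and> m \<in> carrier M \<and> n \<in> carrier M} \<union>
     {frag_of (x \<otimes>\<^bsub>A\<^esub> r, m) - frag_of (x, r \<odot>\<^bsub>M\<^esub> m) | x r m.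
        x \<in> carrier A \<and> r \<in> carrier R \<and> m \<in> carrier M})"

definition pure_tensor ::
  "('a, 'x) ring_scheme \<Rightarrow> ('a, 'y) ring_scheme \<Rightarrow> ('a, 'm, 'z) module_scheme \<Rightarrow>
   'a \<Rightarrow> 'm \<Rightarrow> ('a \<times> 'm \<Rightarrow>\<^sub>0 int) set" where
  "pure_tensor A R M x m = tensor_relations A R M #>\<^bsub>tensor_free A M\<^esub> frag_of (x, m)"

definition extension_of_scalars ::
  "('a, 'x) ring_scheme \<Rightarrow> ('a, 'y) ring_scheme \<Rightarrow> ('a, 'm, 'z) module_scheme \<Rightarrow>
   ('a, ('a \<times> 'm \<Rightarrow>\<^sub>0 int) set) module" where
  "extension_of_scalars A R M = (let Q = tensor_free A M Mod tensor_relations A R M in \<lparr>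
     carrier = carrier Q,
     monoid.mult = undefined,
     one = undefined,
     ring.zero = \<one>\<^bsub>Q\<^esub>,
     add = monoid.mult Q,
     smult = (\<lambda>a w. \<Union>z\<in>w. tensor_relations A R M #>\<^bsub>tensor_free A M\<^esub>
       frag_extend (\<lambda>(x, m). frag_of (a \<otimes>\<^bsub>A\<^esub> x, m)) z)\<rparr>)"


section \<open>Mackey's obstruction class\<close>

definition right_endomorphism_algebra ::
  "(complex, 'a, 'x) module_scheme \<Rightarrow> ('a, 'w, 'y) module_scheme \<Rightarrow> (complex, 'w \<Rightarrow> 'w) module" where
  "right_endomorphism_algebra A W = \<lparr>
     carrier = LinearCombinations.module_hom A W W \<inter> extensional (carrier W),
     monoid.mult = (\<lambda>\<phi> \<psi>. \<lambda>w\<in>carrier W. \<psi> (\<phi> w)),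
     one = (\<lambda>w\<in>carrier W. w),
     ring.zero = (\<lambda>w\<in>carrier W. \<zero>\<^bsub>W\<^esub>),
     add = (\<lambda>\<phi> \<psi>. \<lambda>w\<in>carrier W. \<phi> w \<oplus>\<^bsub>W\<^esub> \<psi> w),
     smult = (\<lambda>c \<phi>. \<lambda>w\<in>carrier W. (c \<odot>\<^bsub>A\<^esub> \<one>\<^bsub>A\<^esub>) \<odot>\<^bsub>W\<^esub> \<phi> w)\<rparr>"

definition endomorphism_grading ::
  "('g, 'z) monoid_scheme \<Rightarrow> (complex, 'a, 'x) module_scheme \<Rightarrow> ('a, 'w, 'y) module_scheme \<Rightarrow>
   ('g \<Rightarrow> 'w set) \<Rightarrow> 'g \<Rightarrow> ('w \<Rightarrow> 'w) set" where
  "endomorphism_grading \<Gamma> A W D \<gamma> =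
     {\<phi> \<in> carrier (right_endomorphism_algebra A W).
        \<forall>\<gamma>'\<in>carrier \<Gamma>. \<phi> ` D \<gamma>' \<subseteq> D (\<gamma>' \<otimes>\<^bsub>\<Gamma>\<^esub> \<gamma>)}"

abbreviation mackey_module ::
  "('g, 'x) monoid_scheme \<Rightarrow> ('g \<Rightarrow> 'g \<Rightarrow> complex) \<Rightarrow> 'g set \<Rightarrow>
   ('g \<Rightarrow> complex, 'm) module \<Rightarrow> ('g \<Rightarrow> complex, (('g \<Rightarrow> complex) \<times> 'm \<Rightarrow>\<^sub>0 int) set) module" where
  "mackey_module G \<alpha> N M \<equiv>
     extension_of_scalars (twisted_group_algebra G \<alpha>) (twisted_subgroup_algebra G \<alpha> N) M"

definition mackey_component ::
  "('g, 'x) monoid_scheme \<Rightarrow> ('g \<Rightarrow> 'g \<Rightarrow> complex) \<Rightarrow> 'g set \<Rightarrow>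
   ('g \<Rightarrow> complex, 'm) module \<Rightarrow> 'g set \<Rightarrow> (('g \<Rightarrow> complex) \<times> 'm \<Rightarrow>\<^sub>0 int) set set" where
  "mackey_component G \<alpha> N M C = generate (add_monoid (mackey_module G \<alpha> N M))
     {pure_tensor (twisted_group_algebra G \<alpha>) (twisted_subgroup_algebra G \<alpha> N) M
        (basis_elt g \<otimes>\<^bsub>twisted_group_algebra G \<alpha>\<^esub> r) m | g r m.
        g \<in> C \<and> r \<in> carrier (twisted_subgroup_algebra G \<alpha> N) \<and> m \<in> carrier M}"

definition mackey_class ::
  "('g, 'x) monoid_scheme \<Rightarrow> ('g \<Rightarrow> 'g \<Rightarrow> complex) \<Rightarrow> 'g set \<Rightarrow>
   ('g \<Rightarrow> complex, 'g \<Rightarrow> complex) module \<Rightarrow> ('g set \<Rightarrow> 'g set \<Rightarrow> complex) set" where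
  "mackey_class G \<alpha> N M =
    (let A = twisted_group_algebra G \<alpha>; W = mackey_module G \<alpha> N M; I = inertia_group G \<alpha> N M in
     THE c. c \<in> H2 ((G Mod N)\<lparr>carrier := I\<rparr>) \<and>
       (\<forall>\<omega>\<in>c. graded_isomorphic (G Mod N)
          (right_endomorphism_algebra A W)
          (endomorphism_grading (G Mod N) A W (mackey_component G \<alpha> N M))
          (twisted_subgroup_algebra (G Mod N) \<omega> I)
          (extend_grading (twisted_subgroup_algebra (G Mod N) \<omega> I) I twisted_grading)))"

end

theory Submission
  imports Defs "Jordan_Normal_Form.Spectral_Radius"
begin

text \<open>
  Write \<open>A\<close> for the twisted group algebra of \<open>G\<close>, \<open>B\<close> for that of \<open>N\<close> and \<open>\<Gamma>\<close> for \<open>G/N\<close>. The algebra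
  \<open>B\<close> is semisimple, as it carries a positive definite form with adjoints, so each set of isomorphism
  types of irreducible modules has a central idempotent, and a nonzero ideal contains the idempotent of
  some type. The idempotent of an orbit is central in \<open>A\<close> and a nonzero graded ideal of \<open>A\<close> contains
  one of them; hence the graded-simple summands correspond to the orbits.

  Let \<open>W\<close> be the module induced from \<open>M\<close>. By Schur's lemma the homogeneous component of degree \<open>C\<close> of
  its endomorphism algebra \<open>E\<close> is one-dimensional if \<open>C\<close> stabilises the type of \<open>M\<close> and zero otherwise,
  so \<open>E\<close> is a twisted group algebra of the stabiliser, whose cocycle is determined up to coboundaries.
  The elements \<open>u\<^sub>t \<otimes> b\<close>, where \<open>t\<close> runs over a transversal and \<open>b\<close> over a basis of \<open>M\<close>, form a
  homogeneous basis of \<open>W\<close> over \<open>E\<close>. Writing the action of the summand on \<open>W\<close> in this basis yields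
  matrices over \<open>E\<close>. The map is injective as \<open>W\<close> is faithful, and surjective by the density theorem
  for the pairwise non-isomorphic conjugates of \<open>M\<close>.
\<close>

section \<open>Modules over noncommutative rings\<close>

text \<open>Semisimplicity enters through two facts only: the irreducible modules are jointly
  faithful, and by density an element can be prescribed freely on bases of pairwise non-isomorphic
  ones. Surjectivity is never a count of dimensions. The cocycle is given by the statement and need
  not be unimodular, so positivity comes from a weighted form. The passage from \<open>A\<close> to
  \<open>B\<close> rests on every coset containing units: a homogeneous element of a graded ideal is
  shifted into the neutral degree by one of them, and conjugation by the others reaches the whole
  orbit. A choice of units is in general not multiplicative. Coordinates on \<open>W\<close> are
  therefore indexed by units instead of degrees, and the obstruction cocycle is the scalar left over
  when the units and intertwiners chosen in two degrees are compared with those of the product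
  degree. \<open>E\<close> acts on \<open>W\<close> from the right and commutes with
  \<open>A\<close>; so coordinates over \<open>E\<close> turn the action of \<open>A\<close> into
  matrices in the right order, with no opposite algebra. The algebra laws of \<open>E\<close> and of
  the matrices are transported along the bijections instead of being checked.\<close>

lemma module_homI:
  assumes "\<And>m. m \<in> carrier M ==> f m \<in> carrier M'"
    and "\<And>m n. m \<in> carrier M ==> n \<in> carrier M ==> f (m \<oplus>\<^bsub>M\<^esub> n) = f m \<oplus>\<^bsub>M'\<^esub> f n"
    and "\<And>r m. r \<in> carrier R ==> m \<in> carrier M ==> f (r \<odot>\<^bsub>M\<^esub> m) = r \<odot>\<^bsub>M'\<^esub> f m"
  shows "f \<in> LinearCombinations.module_hom R M M'"
  using assms by (auto simp: LinearCombinations.module_hom_def)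

lemma module_homD:
  assumes "f \<in> LinearCombinations.module_hom R M M'"
  shows "m \<in> carrier M ==> f m \<in> carrier M'"
    and "m \<in> carrier M ==> n \<in> carrier M ==> f (m \<oplus>\<^bsub>M\<^esub> n) = f m \<oplus>\<^bsub>M'\<^esub> f n"
    and "r \<in> carrier R ==> m \<in> carrier M ==> f (r \<odot>\<^bsub>M\<^esub> m) = r \<odot>\<^bsub>M'\<^esub> f m"
  using assms by (auto simp: LinearCombinations.module_hom_def)

text \<open>Stated, like the next two lemmas, for bare additive maps: they serve scalar actions,
  coordinate maps and projections, not only module homomorphisms.\<close>

lemma additive_zero:
  assumes "abelian_group M" "abelian_group M'" "\<And>m. m \<in> carrier M ==> f m \<in> carrier M'"
    and "\<And>m n. m \<in> carrier M ==> n \<in> carrier M ==> f (m \<oplus>\<^bsub>M\<^esub> n) = f m \<oplus>\<^bsub>M'\<^esub> f n"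
  shows "f \<zero>\<^bsub>M\<^esub> = \<zero>\<^bsub>M'\<^esub>"
proof -
  interpret M: abelian_group M by fact
  interpret M': abelian_group M' by fact
  have "f \<zero>\<^bsub>M\<^esub> \<oplus>\<^bsub>M'\<^esub> f \<zero>\<^bsub>M\<^esub> = f \<zero>\<^bsub>M\<^esub>"
    by (metis M.zero_closed M.l_zero assms(4))
  then show ?thesis
    by (metis M.zero_closed M'.add.l_cancel_one' assms(3))
qed

lemma additive_minus:
  assumes "abelian_group M" "abelian_group M'" "\<And>m. m \<in> carrier M ==> f m \<in> carrier M'"
    and "\<And>m n. m \<in> carrier M ==> n \<in> carrier M ==> f (m \<oplus>\<^bsub>M\<^esub> n) = f m \<oplus>\<^bsub>M'\<^esub> f n"
    and "m \<in> carrier M"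
  shows "f (\<ominus>\<^bsub>M\<^esub> m) = \<ominus>\<^bsub>M'\<^esub> f m"
proof -
  interpret M: abelian_group M by fact
  interpret M': abelian_group M' by fact
  have "f (\<ominus>\<^bsub>M\<^esub> m) \<oplus>\<^bsub>M'\<^esub> f m = \<zero>\<^bsub>M'\<^esub>"
    by (metis M.a_inv_closed M.l_neg additive_zero assms)
  then show ?thesis
    by (metis M.a_inv_closed M'.minus_equality assms(3,5))
qed

lemma additive_finsum:
  assumes "abelian_group M" "abelian_group M'" "\<And>m. m \<in> carrier M ==> f m \<in> carrier M'"
    and "\<And>m n. m \<in> carrier M ==> n \<in> carrier M ==> f (m \<oplus>\<^bsub>M\<^esub> n) = f m \<oplus>\<^bsub>M'\<^esub> f n"
    and "\<And>i. i \<in> I ==> x i \<in> carrier M"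
  shows "f (finsum M x I) = finsum M' (\<lambda>i. f (x i)) I"
proof -
  interpret M: abelian_group M by fact
  interpret M': abelian_group M' by fact
  show ?thesis
    using assms(5)
  proof (induction I rule: infinite_finite_induct)
    case (infinite I)
    then show ?case using additive_zero[of M M' f] assms by simp
  next
    case empty
    then show ?case using additive_zero[of M M' f] assms by simp
  next
    case (insert i I)
    then show ?case
      by (simp add: Pi_iff M.finsum_insert M'.finsum_insert assms(3,4) M.finsum_closed)
  qed
qed

lemma finsum_single:
  assumes "abelian_group M" "finite I" "j \<in> I" "x j \<in> carrier M" "\<And>i. i \<in> I ==> i \<noteq> j ==> x i = \<zero>\<^bsub>M\<^esub>"
  shows "finsum M x I = x j"
proof -
  interpret M: abelian_group M by fact
  have x: "x i \<in> carrier M" if "i \<in> I" for i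
    using assms that by (cases "i = j") auto
  have "finsum M x I = finsum M (\<lambda>i. if j = i then x i else \<zero>\<^bsub>M\<^esub>) I"
    using assms by (intro M.finsum_cong') (auto simp: Pi_iff)
  also have "\<dots> = x j"
    using assms x by (intro M.add.finprod_singleton) auto
  finally show ?thesis .
qed

context left_module
begin

lemma smult_zero_left [simp]: "m \<in> carrier M ==> \<zero> \<odot>\<^bsub>M\<^esub> m = \<zero>\<^bsub>M\<^esub>"
  by (rule additive_zero[of R M "\<lambda>a. a \<odot>\<^bsub>M\<^esub> m"])
    (auto simp: smult_closed smult_l_distr R.is_abelian_group M.abelian_group_axioms)

lemma smult_zero_right [simp]: "a \<in> carrier R ==> a \<odot>\<^bsub>M\<^esub> \<zero>\<^bsub>M\<^esub> = \<zero>\<^bsub>M\<^esub>"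
  by (rule additive_zero[of M M "\<lambda>m. a \<odot>\<^bsub>M\<^esub> m"])
    (auto simp: smult_closed smult_r_distr M.abelian_group_axioms)

lemma smult_minus_left: "a \<in> carrier R ==> m \<in> carrier M ==> (\<ominus> a) \<odot>\<^bsub>M\<^esub> m = \<ominus>\<^bsub>M\<^esub> (a \<odot>\<^bsub>M\<^esub> m)"
  by (rule additive_minus[of R M "\<lambda>a. a \<odot>\<^bsub>M\<^esub> m"])
    (auto simp: smult_closed smult_l_distr R.is_abelian_group M.abelian_group_axioms)

lemma smult_finsum_left:
  "(\<And>i. i \<in> I ==> x i \<in> carrier R) ==> m \<in> carrier M ==>
    finsum R x I \<odot>\<^bsub>M\<^esub> m = finsum M (\<lambda>i. x i \<odot>\<^bsub>M\<^esub> m) I"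
  by (rule additive_finsum[of R M "\<lambda>a. a \<odot>\<^bsub>M\<^esub> m"])
    (auto simp: smult_closed smult_l_distr R.is_abelian_group M.abelian_group_axioms)

lemma smult_finsum_right:
  "(\<And>i. i \<in> I ==> x i \<in> carrier M) ==> a \<in> carrier R ==>
    a \<odot>\<^bsub>M\<^esub> finsum M x I = finsum M (\<lambda>i. a \<odot>\<^bsub>M\<^esub> x i) I"
  by (rule additive_finsum[of M M "\<lambda>m. a \<odot>\<^bsub>M\<^esub> m"])
    (auto simp: smult_closed smult_r_distr M.abelian_group_axioms)

lemma minus_conv_smult: "m \<in> carrier M ==> \<ominus>\<^bsub>M\<^esub> m = (\<ominus> \<one>) \<odot>\<^bsub>M\<^esub> m"
  by (simp add: smult_minus_left smult_one)

text \<open>Closure under negatives comes from the action of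
  \<open>\<ominus> \<one>\<close>.\<close>

lemma submodI:
  assumes "H \<subseteq> carrier M" "\<zero>\<^bsub>M\<^esub> \<in> H" "\<And>m n. m \<in> H ==> n \<in> H ==> m \<oplus>\<^bsub>M\<^esub> n \<in> H"
    and "\<And>a m. a \<in> carrier R ==> m \<in> H ==> a \<odot>\<^bsub>M\<^esub> m \<in> H"
  shows "Module.submodule H R M"
proof (intro Module.submodule.intro Module.submodule_axioms.intro subgroup.intro)
  fix x assume "x \<in> H"
  then have "\<ominus>\<^bsub>M\<^esub> x \<in> H"
    using assms(1,4) minus_conv_smult[of x] by auto
  then show "inv\<^bsub>add_monoid M\<^esub> x \<in> H"
    by (simp add: a_inv_def)
qed (use assms in auto)

end

lemma submodD:
  assumes "Module.submodule H R M"
  shows "H \<subseteq> carrier M" "\<zero>\<^bsub>M\<^esub> \<in> H" "m \<in> H ==> n \<in> H ==> m \<oplus>\<^bsub>M\<^esub> n \<in> H"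
    "a \<in> carrier R ==> m \<in> H ==> a \<odot>\<^bsub>M\<^esub> m \<in> H"
proof -
  interpret Module.submodule H R M by fact
  show "H \<subseteq> carrier M" "\<zero>\<^bsub>M\<^esub> \<in> H" "m \<in> H ==> n \<in> H ==> m \<oplus>\<^bsub>M\<^esub> n \<in> H"
    "a \<in> carrier R ==> m \<in> H ==> a \<odot>\<^bsub>M\<^esub> m \<in> H"
    using subset one_closed m_closed smult_closed by auto
qed

lemma irreducible_left_module: "irreducible_module R M ==> left_module R M"
  by (simp add: irreducible_module_def)

lemma module_hom_zero:
  assumes "left_module R M" "left_module R M'" "f \<in> LinearCombinations.module_hom R M M'"
  shows "f \<zero>\<^bsub>M\<^esub> = \<zero>\<^bsub>M'\<^esub>"
  using assms by (intro additive_zero) (auto simp: left_module_def dest: module_homD)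

lemma module_hom_minus:
  assumes "left_module R M" "left_module R M'" "f \<in> LinearCombinations.module_hom R M M'"
    "m \<in> carrier M"
  shows "f (\<ominus>\<^bsub>M\<^esub> m) = \<ominus>\<^bsub>M'\<^esub> f m"
  using assms by (intro additive_minus) (auto simp: left_module_def dest: module_homD)

lemma module_hom_inj_onI:
  assumes "left_module R M" "left_module R M'" "f \<in> LinearCombinations.module_hom R M M'"
    "\<And>m. m \<in> carrier M ==> f m = \<zero>\<^bsub>M'\<^esub> ==> m = \<zero>\<^bsub>M\<^esub>"
  shows "inj_on f (carrier M)"
proof (rule inj_onI)
  interpret M: left_module R M by fact
  interpret M': left_module R M' by fact
  fix m n assume mn: "m \<in> carrier M" "n \<in> carrier M" "f m = f n"
  have "f (m \<oplus>\<^bsub>M\<^esub> \<ominus>\<^bsub>M\<^esub> n) = f m \<oplus>\<^bsub>M'\<^esub> \<ominus>\<^bsub>M'\<^esub> f n"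
    using mn module_homD(2)[OF assms(3)] module_hom_minus[OF assms(1-3)] by simp
  also have "\<dots> = \<zero>\<^bsub>M'\<^esub>"
    using mn module_homD(1)[OF assms(3)] by (simp add: M'.M.r_neg)
  finally have "m \<oplus>\<^bsub>M\<^esub> \<ominus>\<^bsub>M\<^esub> n = \<zero>\<^bsub>M\<^esub>"
    using assms(4) mn by simp
  then show "m = n"
    using mn by (metis M.M.a_inv_closed M.M.minus_equality M.M.minus_minus)
qed

lemma module_hom_inverse:
  assumes "left_module R M" "f \<in> LinearCombinations.module_hom R M M'" "bij_betw f (carrier M) (carrier M')"
  shows "the_inv_into (carrier M) f \<in> LinearCombinations.module_hom R M' M"
    "bij_betw (the_inv_into (carrier M) f) (carrier M') (carrier M)"
proof -
  interpret M: left_module R M by fact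
  note inj = bij_betw_imp_inj_on[OF assms(3)]
  show b: "bij_betw (the_inv_into (carrier M) f) (carrier M') (carrier M)"
    by (rule bij_betw_the_inv_into[OF assms(3)])
  have cl: "the_inv_into (carrier M) f m \<in> carrier M" if "m \<in> carrier M'" for m
    using b that by (auto simp: bij_betw_def)
  have f: "f (the_inv_into (carrier M) f m) = m" if "m \<in> carrier M'" for m
    using f_the_inv_into_f_bij_betw[OF assms(3)] that by auto
  show "the_inv_into (carrier M) f \<in> LinearCombinations.module_hom R M' M"
  proof (rule module_homI)
    fix m n assume "m \<in> carrier M'" "n \<in> carrier M'"
    then show "the_inv_into (carrier M) f (m \<oplus>\<^bsub>M'\<^esub> n)
        = the_inv_into (carrier M) f m \<oplus>\<^bsub>M\<^esub> the_inv_into (carrier M) f n"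
      by (intro the_inv_into_f_eq[OF inj]) (auto simp: module_homD(2)[OF assms(2)] cl f)
  next
    fix r m assume "r \<in> carrier R" "m \<in> carrier M'"
    then show "the_inv_into (carrier M) f (r \<odot>\<^bsub>M'\<^esub> m) = r \<odot>\<^bsub>M\<^esub> the_inv_into (carrier M) f m"
      by (intro the_inv_into_f_eq[OF inj])
        (auto simp: module_homD(3)[OF assms(2)] cl f M.smult_closed)
  qed (rule cl)
qed

lemma module_hom_comp:
  assumes "f \<in> LinearCombinations.module_hom R M M'" "g \<in> LinearCombinations.module_hom R M' M''"
  shows "g \<circ> f \<in> LinearCombinations.module_hom R M M''"
  using assms by (intro module_homI) (auto simp: module_homD)

lemma module_isomorphic_refl: "module_isomorphic R M M"
  unfolding module_isomorphic_def
  by (rule bexI[of _ id]) (auto intro!: module_homI)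

lemma module_isomorphic_sym:
  "left_module R M ==> module_isomorphic R M M' ==> module_isomorphic R M' M"
  unfolding module_isomorphic_def using module_hom_inverse by blast

lemma module_isomorphic_trans:
  "module_isomorphic R M M' ==> module_isomorphic R M' M'' ==> module_isomorphic R M M''"
  unfolding module_isomorphic_def by (meson bij_betw_trans module_hom_comp)

lemma module_type_eq_iff:
  assumes "irreducible_module R M" "irreducible_module R M'"
  shows "module_type R M = module_type R M' \<longleftrightarrow> module_isomorphic R M M'"
proof
  assume "module_type R M = module_type R M'"
  moreover have "M' \<in> module_type R M'"
    using assms by (auto simp: module_type_def module_isomorphic_refl)
  ultimately show "module_isomorphic R M M'"
    by (auto simp: module_type_def)
next
  assume "module_isomorphic R M M'"
  moreover have "module_isomorphic R M' M"
    using calculation assms by (auto intro: module_isomorphic_sym irreducible_left_module)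
  ultimately show "module_type R M = module_type R M'"
    by (auto simp: module_type_def intro: module_isomorphic_trans)
qed

section \<open>Generation of irreducible modules and Schur's lemma\<close>

lemma irreducibleD:
  assumes "irreducible_module R M" "H \<subseteq> carrier M" "\<zero>\<^bsub>M\<^esub> \<in> H"
    "\<And>m n. m \<in> H ==> n \<in> H ==> m \<oplus>\<^bsub>M\<^esub> n \<in> H"
    "\<And>a m. a \<in> carrier R ==> m \<in> H ==> a \<odot>\<^bsub>M\<^esub> m \<in> H"
    "m \<in> H" "m \<noteq> \<zero>\<^bsub>M\<^esub>"
  shows "H = carrier M"
proof -
  interpret left_module R M
    using assms(1) by (rule irreducible_left_module)
  have "Module.submodule H R M"
    using assms by (intro submodI)
  then show ?thesis
    using assms by (auto simp: irreducible_module_def)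
qed

lemma irreducible_nonzero:
  assumes "irreducible_module R M" obtains m where "m \<in> carrier M" "m \<noteq> \<zero>\<^bsub>M\<^esub>"
proof -
  interpret left_module R M using assms by (rule irreducible_left_module)
  show ?thesis using assms that M.zero_closed by (auto simp: irreducible_module_def)
qed

text \<open>The vectors \<open>x \<odot> m\<close> with \<open>x\<close> in \<open>L\<close> form a
  submodule, nonzero by assumption. A left ideal \<open>L\<close> instead of the whole ring is what
  the density theorem needs, where \<open>L\<close> annihilates other vectors.\<close>

lemma irreducible_ideal_transitive:
  assumes irr: "irreducible_module R M"
    and L: "L \<subseteq> carrier R" "\<zero>\<^bsub>R\<^esub> \<in> L" "\<And>x y. x \<in> L ==> y \<in> L ==> x \<oplus>\<^bsub>R\<^esub> y \<in> L"
      "\<And>a x. a \<in> carrier R ==> x \<in> L ==> a \<otimes>\<^bsub>R\<^esub> x \<in> L"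
    and x: "x \<in> L" "m \<in> carrier M" "x \<odot>\<^bsub>M\<^esub> m \<noteq> \<zero>\<^bsub>M\<^esub>" and n: "n \<in> carrier M"
  shows "\<exists>y\<in>L. y \<odot>\<^bsub>M\<^esub> m = n"
proof -
  interpret left_module R M using irr by (rule irreducible_left_module)
  let ?H = "(\<lambda>x. x \<odot>\<^bsub>M\<^esub> m) ` L"
  have "?H = carrier M"
  proof (rule irreducibleD[OF irr])
    show "?H \<subseteq> carrier M" using L x by (auto intro: smult_closed)
    show "\<zero>\<^bsub>M\<^esub> \<in> ?H" using L(2) x(2) by (metis image_eqI smult_zero_left)
    show "p \<oplus>\<^bsub>M\<^esub> q \<in> ?H" if pq: "p \<in> ?H" "q \<in> ?H" for p q
    proof -
      obtain a b where ab: "a \<in> L" "b \<in> L" "p = a \<odot>\<^bsub>M\<^esub> m" "q = b \<odot>\<^bsub>M\<^esub> m"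
        using pq by auto
      then have "p \<oplus>\<^bsub>M\<^esub> q = (a \<oplus>\<^bsub>R\<^esub> b) \<odot>\<^bsub>M\<^esub> m"
        using L(1) x(2) smult_l_distr[of a b m] by (metis subsetD)
      then show ?thesis using L(3) ab by auto
    qed
    show "a \<odot>\<^bsub>M\<^esub> p \<in> ?H" if ap: "a \<in> carrier R" "p \<in> ?H" for a p
    proof -
      obtain b where b: "b \<in> L" "p = b \<odot>\<^bsub>M\<^esub> m" using ap by auto
      then have "a \<odot>\<^bsub>M\<^esub> p = (a \<otimes>\<^bsub>R\<^esub> b) \<odot>\<^bsub>M\<^esub> m"
        using L(1) x(2) ap smult_assoc[of a b m] by (metis subsetD)
      then show ?thesis using L(4) ap b by auto
    qed
    show "x \<odot>\<^bsub>M\<^esub> m \<in> ?H" using x by auto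
  qed (rule x)
  then show ?thesis using n by (metis (no_types, lifting) imageE)
qed

lemma irreducible_transitive:
  assumes irr: "irreducible_module R M" and x: "m \<in> carrier M" "m \<noteq> \<zero>\<^bsub>M\<^esub>" and n: "n \<in> carrier M"
  shows "\<exists>y\<in>carrier R. y \<odot>\<^bsub>M\<^esub> m = n"
proof -
  interpret left_module R M using irr by (rule irreducible_left_module)
  show ?thesis
    using irreducible_ideal_transitive[OF irr, of "carrier R" "\<one>\<^bsub>R\<^esub>" m n] x n smult_one[of m]
    by simp
qed

text \<open>A nonzero vector of the kernel would generate \<open>m\<close> and force
  \<open>h m\<close> to vanish; the image is a submodule containing the nonzero
  \<open>h m\<close>.\<close>

lemma schur:
  assumes irr: "irreducible_module R M" "irreducible_module R M'"
    and h: "h \<in> LinearCombinations.module_hom R M M'" and m: "m \<in> carrier M" "h m \<noteq> \<zero>\<^bsub>M'\<^esub>"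
  shows "bij_betw h (carrier M) (carrier M')"
proof -
  interpret M: left_module R M using irr(1) by (rule irreducible_left_module)
  interpret M': left_module R M' using irr(2) by (rule irreducible_left_module)
  have z: "h \<zero>\<^bsub>M\<^esub> = \<zero>\<^bsub>M'\<^esub>"
    by (rule module_hom_zero[OF M.left_module_axioms M'.left_module_axioms h])
  have "inj_on h (carrier M)"
  proof (rule module_hom_inj_onI[OF M.left_module_axioms M'.left_module_axioms h])
    fix k assume k: "k \<in> carrier M" "h k = \<zero>\<^bsub>M'\<^esub>"
    show "k = \<zero>\<^bsub>M\<^esub>"
    proof (rule ccontr)
      assume "k \<noteq> \<zero>\<^bsub>M\<^esub>"
      then obtain y where y: "y \<in> carrier R" "y \<odot>\<^bsub>M\<^esub> k = m"
        using irreducible_transitive[OF irr(1) k(1) _ m(1)] by auto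
      have "h m = y \<odot>\<^bsub>M'\<^esub> h k"
        using module_homD(3)[OF h y(1) k(1)] y by simp
      then show False
        using y k m by simp
    qed
  qed
  moreover have "h ` carrier M = carrier M'"
  proof (rule irreducibleD[OF irr(2), of _ "h m"])
    show "h ` carrier M \<subseteq> carrier M'"
      using module_homD(1)[OF h] by (rule image_subsetI)
    show "\<zero>\<^bsub>M'\<^esub> \<in> h ` carrier M"
      using imageI[OF M.M.zero_closed, of h] z by simp
    fix p q assume "p \<in> h ` carrier M" "q \<in> h ` carrier M"
    then obtain a b where "a \<in> carrier M" "b \<in> carrier M" "p = h a" "q = h b"
      by (elim imageE)
    then show "p \<oplus>\<^bsub>M'\<^esub> q \<in> h ` carrier M"
      using imageI[of "a \<oplus>\<^bsub>M\<^esub> b" "carrier M" h] by (simp add: module_homD(2)[OF h])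
  next
    fix a p assume "a \<in> carrier R" "p \<in> h ` carrier M"
    moreover from this obtain b where "b \<in> carrier M" "p = h b" by (elim imageE)
    ultimately show "a \<odot>\<^bsub>M'\<^esub> p \<in> h ` carrier M"
      using imageI[of "a \<odot>\<^bsub>M\<^esub> b" "carrier M" h]
      by (simp add: module_homD(3)[OF h] M.smult_closed)
  qed (use m in \<open>simp_all\<close>)
  ultimately show ?thesis by (simp add: bij_betw_def)
qed

section \<open>Coordinates and density\<close>

text \<open>Modules here carry no complex structure of their own: a scalar acts through the
  corresponding multiple of the unit of the algebra, as in \<open>complex_dim\<close>.\<close>

definition cscale ::
  "(complex, 'a, 'x) module_scheme \<Rightarrow> ('a, 'm, 'y) module_scheme \<Rightarrow> complex \<Rightarrow> 'm \<Rightarrow> 'm" where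
  "cscale R M c m = (c \<odot>\<^bsub>R\<^esub> \<one>\<^bsub>R\<^esub>) \<odot>\<^bsub>M\<^esub> m"

lemma (in complex_algebra) scalar_closed [simp]: "c \<odot> \<one> \<in> carrier A"
  by simp

lemma (in complex_algebra) smult_closed_complex [simp]: "a \<in> carrier A ==> c \<odot> a \<in> carrier A"
  by simp

lemma (in complex_algebra) scalar_mult_left: "a \<in> carrier A ==> (c \<odot> \<one>) \<otimes> a = c \<odot> a"
  by (simp add: smult_mult_left)

lemma (in complex_algebra) scalar_mult_right: "a \<in> carrier A ==> a \<otimes> (c \<odot> \<one>) = c \<odot> a"
  by (simp add: smult_mult_right)

locale complex_left_module = alg?: complex_algebra R + left_module R M
  for R :: "(complex, 'a, 'x) module_scheme" and M :: "('a, 'm, 'y) module_scheme"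
begin

lemma cscale_closed [simp]: "m \<in> carrier M ==> cscale R M c m \<in> carrier M"
  by (simp add: cscale_def smult_closed)

lemma cscale_add: "m \<in> carrier M ==> n \<in> carrier M ==>
    cscale R M c (m \<oplus>\<^bsub>M\<^esub> n) = cscale R M c m \<oplus>\<^bsub>M\<^esub> cscale R M c n"
  by (simp add: cscale_def smult_r_distr)

lemma cscale_add_left: "m \<in> carrier M ==>
    cscale R M (c + d) m = cscale R M c m \<oplus>\<^bsub>M\<^esub> cscale R M d m"
proof -
  have "(c + d) \<odot>\<^bsub>R\<^esub> \<one>\<^bsub>R\<^esub> = c \<odot>\<^bsub>R\<^esub> \<one>\<^bsub>R\<^esub> \<oplus>\<^bsub>R\<^esub> d \<odot>\<^bsub>R\<^esub> \<one>\<^bsub>R\<^esub>"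
    using alg.smult_l_distr[of c d "\<one>\<^bsub>R\<^esub>"] by simp
  then show "m \<in> carrier M ==> ?thesis"
    by (simp add: cscale_def smult_l_distr)
qed

lemma cscale_cscale: "m \<in> carrier M ==> cscale R M c (cscale R M d m) = cscale R M (c * d) m"
proof -
  have "(c * d) \<odot>\<^bsub>R\<^esub> \<one>\<^bsub>R\<^esub> = (c \<odot>\<^bsub>R\<^esub> \<one>\<^bsub>R\<^esub>) \<otimes>\<^bsub>R\<^esub> (d \<odot>\<^bsub>R\<^esub> \<one>\<^bsub>R\<^esub>)"
    using alg.smult_assoc1[of c d "\<one>\<^bsub>R\<^esub>"] by (simp add: scalar_mult_left)
  then show "m \<in> carrier M ==> ?thesis"
    by (simp add: cscale_def smult_assoc)
qed

lemma cscale_one [simp]: "m \<in> carrier M ==> cscale R M 1 m = m"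
proof -
  have "(1::complex) \<odot>\<^bsub>R\<^esub> \<one>\<^bsub>R\<^esub> = \<one>\<^bsub>R\<^esub>"
    using alg.smult_one[of "\<one>\<^bsub>R\<^esub>"] by simp
  then show "m \<in> carrier M ==> ?thesis"
    by (simp add: cscale_def smult_one)
qed

lemma cscale_zero [simp]: "m \<in> carrier M ==> cscale R M 0 m = \<zero>\<^bsub>M\<^esub>"
proof -
  have "(0::complex) \<odot>\<^bsub>R\<^esub> \<one>\<^bsub>R\<^esub> = \<zero>\<^bsub>R\<^esub>"
    using alg.smult_l_null[of "\<one>\<^bsub>R\<^esub>"] by simp
  then show "m \<in> carrier M ==> ?thesis"
    by (simp add: cscale_def)
qed

lemma cscale_zero_right [simp]: "cscale R M c \<zero>\<^bsub>M\<^esub> = \<zero>\<^bsub>M\<^esub>"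
  by (simp add: cscale_def)

lemma smult_cscale: "a \<in> carrier R ==> m \<in> carrier M ==>
    a \<odot>\<^bsub>M\<^esub> cscale R M c m = cscale R M c (a \<odot>\<^bsub>M\<^esub> m)"
  unfolding cscale_def
  by (simp add: smult_assoc[symmetric] scalar_mult_left scalar_mult_right del: alg.smult_closed)

lemma smult_smult: "a \<in> carrier R ==> m \<in> carrier M ==>
    (c \<odot>\<^bsub>R\<^esub> a) \<odot>\<^bsub>M\<^esub> m = cscale R M c (a \<odot>\<^bsub>M\<^esub> m)"
  unfolding cscale_def by (simp add: smult_assoc[symmetric] scalar_mult_left)

lemma cscale_finsum: "(\<And>i. i \<in> I ==> x i \<in> carrier M) ==>
    cscale R M c (finsum M x I) = finsum M (\<lambda>i. cscale R M c (x i)) I"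
  unfolding cscale_def by (rule smult_finsum_right) auto

lemma minus_conv_cscale: "m \<in> carrier M ==> \<ominus>\<^bsub>M\<^esub> m = cscale R M (- 1) m"
proof (rule M.minus_equality)
  assume m: "m \<in> carrier M"
  show "cscale R M (- 1) m \<oplus>\<^bsub>M\<^esub> m = \<zero>\<^bsub>M\<^esub>"
    using m cscale_add_left[of m "- 1" 1] by simp
qed auto

end

lemma module_hom_cscale:
  assumes "complex_algebra R" "f \<in> LinearCombinations.module_hom R M M'" "m \<in> carrier M"
  shows "f (cscale R M c m) = cscale R M' c (f m)"
proof -
  interpret complex_algebra R by fact
  show ?thesis using module_homD(3)[OF assms(2), of "c \<odot>\<^bsub>R\<^esub> \<one>\<^bsub>R\<^esub>" m] assms(3) by (simp add: cscale_def)
qed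

text \<open>
  The family \<open>b\<close> is a basis of \<open>M\<close> with dual basis \<open>\<kappa>\<close>.
\<close>

definition coord_system ::
  "(complex, 'a, 'x) module_scheme \<Rightarrow> ('a, 'm, 'y) module_scheme \<Rightarrow> 'i set \<Rightarrow> ('i \<Rightarrow> 'm) \<Rightarrow>
    ('i \<Rightarrow> 'm \<Rightarrow> complex) \<Rightarrow> bool" where
  "coord_system R M I b \<kappa> \<longleftrightarrow> finite I \<and> (\<forall>i\<in>I. b i \<in> carrier M) \<and>
     (\<forall>i\<in>I. \<forall>m\<in>carrier M. \<forall>n\<in>carrier M. \<kappa> i (m \<oplus>\<^bsub>M\<^esub> n) = \<kappa> i m + \<kappa> i n) \<and>
     (\<forall>i\<in>I. \<forall>c. \<forall>m\<in>carrier M. \<kappa> i (cscale R M c m) = c * \<kappa> i m) \<and>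
     (\<forall>i\<in>I. \<forall>j\<in>I. \<kappa> i (b j) = (if i = j then 1 else 0)) \<and>
     (\<forall>m\<in>carrier M. m = finsum M (\<lambda>i. cscale R M (\<kappa> i m) (b i)) I)"

lemma coord_systemD:
  assumes "coord_system R M I b \<kappa>"
  shows "finite I" "i \<in> I ==> b i \<in> carrier M"
    "i \<in> I ==> m \<in> carrier M ==> n \<in> carrier M ==> \<kappa> i (m \<oplus>\<^bsub>M\<^esub> n) = \<kappa> i m + \<kappa> i n"
    "i \<in> I ==> m \<in> carrier M ==> \<kappa> i (cscale R M c m) = c * \<kappa> i m"
    "i \<in> I ==> j \<in> I ==> \<kappa> i (b j) = (if i = j then 1 else 0)"
    "m \<in> carrier M ==> m = finsum M (\<lambda>i. cscale R M (\<kappa> i m) (b i)) I"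
  using assms unfolding coord_system_def by simp_all

text \<open>Serves to index bases by natural numbers: once for the matrix of an endomorphism, once
  for the positions in the list of degrees.\<close>

lemma coord_system_reindex:
  assumes "complex_left_module R M" "coord_system R M I b \<kappa>" "bij_betw f J I"
  shows "coord_system R M J (\<lambda>j. b (f j)) (\<lambda>j. \<kappa> (f j))"
proof -
  interpret complex_left_module R M by fact
  note c = coord_systemD[OF assms(2)]
  have f: "inj_on f J" "I = f ` J" "\<And>j. j \<in> J ==> f j \<in> I"
    using assms(3) by (auto simp: bij_betw_def)
  have "m = finsum M (\<lambda>j. cscale R M (\<kappa> (f j) m) (b (f j))) J" if m: "m \<in> carrier M" for m
  proof -
    have "finsum M (\<lambda>i. cscale R M (\<kappa> i m) (b i)) (f ` J) =
        finsum M (\<lambda>j. cscale R M (\<kappa> (f j) m) (b (f j))) J"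
      by (rule M.finsum_reindex) (use c f in auto)
    then show ?thesis using c(6)[OF m] f(2) by simp
  qed
  moreover have "finite J"
    using assms(3) c(1) bij_betw_finite by blast
  ultimately show ?thesis
    unfolding coord_system_def using c f(3) inj_on_eq_iff[OF f(1)] by auto
qed

context complex_left_module
begin

lemma coord_zero:
  assumes "coord_system R M I b \<kappa>" "i \<in> I"
  shows "\<kappa> i \<zero>\<^bsub>M\<^esub> = 0"
  using coord_systemD(4)[OF assms(1) assms(2), of "\<zero>\<^bsub>M\<^esub>" 0] by simp

lemma coord_finsum:
  assumes "coord_system R M I b \<kappa>" "i \<in> I" "finite J" "\<And>j. j \<in> J ==> x j \<in> carrier M"
  shows "\<kappa> i (finsum M x J) = (\<Sum>j\<in>J. \<kappa> i (x j))"
  using assms(3,4)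
proof (induction J rule: finite_induct)
  case empty
  then show ?case using coord_zero[OF assms(1,2)] by simp
next
  case (insert j J)
  then show ?case
    using assms by (simp add: Pi_iff M.finsum_insert coord_systemD(3)[OF assms(1,2)] M.finsum_closed)
qed

lemma coord_eqI:
  assumes "coord_system R M I b \<kappa>" "m \<in> carrier M" "n \<in> carrier M" "\<And>i. i \<in> I ==> \<kappa> i m = \<kappa> i n"
  shows "m = n"
proof -
  have "m = finsum M (\<lambda>i. cscale R M (\<kappa> i m) (b i)) I"
    by (rule coord_systemD(6)[OF assms(1,2)])
  also have "\<dots> = finsum M (\<lambda>i. cscale R M (\<kappa> i n) (b i)) I"
    by (rule M.finsum_cong') (use assms(4) coord_systemD(2)[OF assms(1)] in auto)
  also have "\<dots> = n"
    by (rule coord_systemD(6)[OF assms(1,3), symmetric])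
  finally show ?thesis .
qed

lemma coord_lincomb:
  assumes "coord_system R M I b \<kappa>" "i \<in> I"
  shows "\<kappa> i (finsum M (\<lambda>j. cscale R M (x j) (b j)) I) = x i"
proof -
  note c = coord_systemD[OF assms(1)]
  have "\<kappa> i (finsum M (\<lambda>j. cscale R M (x j) (b j)) I) = (\<Sum>j\<in>I. \<kappa> i (cscale R M (x j) (b j)))"
    using c(1,2) by (intro coord_finsum[OF assms]) auto
  also have "\<dots> = (\<Sum>j\<in>I. if j = i then x i else 0)"
    using c assms(2) by (intro sum.cong) auto
  also have "\<dots> = x i"
    using c(1) assms(2) by simp
  finally show ?thesis .
qed

text \<open>Spelled out field by field to be the very record inside \<open>complex_dim\<close>, so
  that the size of a basis is that dimension.\<close>

abbreviation cspace :: "(complex, 'm) module" where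
  "cspace \<equiv> \<lparr>carrier = carrier M, monoid.mult = monoid.mult M, one = one M,
      ring.zero = ring.zero M, add = add M,
      Module.module.smult = (\<lambda>c m. (c \<odot>\<^bsub>R\<^esub> \<one>\<^bsub>R\<^esub>) \<odot>\<^bsub>M\<^esub> m)\<rparr>"

lemma finsum_cspace: "finsum cspace = finsum M"
  by (simp add: finsum_def fun_eq_iff finprod_def)

lemma vectorspace_cspace: "vectorspace class_ring cspace"
proof -
  have "abelian_group cspace"
    by (rule abelian_groupI) (auto simp: M.a_assoc intro: M.a_comm M.l_neg bexI[where x = "\<ominus>\<^bsub>M\<^esub> _"])
  then have "Module.module (class_ring :: complex ring) cspace"
    by (intro Module.moduleI)
      (use alg.R.cring_axioms cscale_add_left cscale_cscale cscale_one
        in \<open>auto simp: cscale_def smult_closed smult_r_distr\<close>)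
  then show ?thesis
    by (simp add: vectorspace_def class_field)
qed

text \<open>The assumption \<open>span\<close> says that \<open>S\<close> spans \<open>M\<close>,
  phrased as minimality: a subspace containing \<open>S\<close> is everything. Applied to
  \<open>V.span S\<close> it gives finite dimension, hence a basis with unique coordinates.\<close>

lemma coord_system_exists:
  assumes "finite S" "S \<subseteq> carrier M"
    and span: "\<And>H. H \<subseteq> carrier M ==> S \<subseteq> H ==> \<zero>\<^bsub>M\<^esub> \<in> H ==>
      (\<And>m n. m \<in> H ==> n \<in> H ==> m \<oplus>\<^bsub>M\<^esub> n \<in> H) ==>
      (\<And>c m. m \<in> H ==> cscale R M c m \<in> H) ==> H = carrier M"
  shows "\<exists>\<beta> \<kappa>. coord_system R M \<beta> (\<lambda>x. x) \<kappa> \<and> card \<beta> = complex_dim R M"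
proof -
  interpret V: vectorspace "class_ring :: complex ring" cspace by (rule vectorspace_cspace)
  have S: "S \<subseteq> carrier cspace" using assms by simp
  have sub: "LinearCombinations.submodule class_ring (V.span S) cspace"
    using V.span_is_submodule[OF S] .
  have "V.span S = carrier M"
  proof (rule span)
    show "V.span S \<subseteq> carrier M"
      using V.span_is_subset2[OF S] by simp
    show "S \<subseteq> V.span S"
      using V.in_own_span[OF S] .
    show "\<zero>\<^bsub>M\<^esub> \<in> V.span S"
      using LinearCombinations.submodule.zero_closed[OF sub] V.span_zero by simp
    show "m \<oplus>\<^bsub>M\<^esub> n \<in> V.span S" if "m \<in> V.span S" "n \<in> V.span S" for m n
      using LinearCombinations.submodule.m_closed[OF sub that] by simp
    show "cscale R M c m \<in> V.span S" if "m \<in> V.span S" for c m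
      using LinearCombinations.submodule.smult_closed[OF sub, of c m] that by (simp add: cscale_def)
  qed
  then have "V.fin_dim"
    unfolding V.fin_dim_def using assms(1) S by (intro exI[of _ S]) simp
  then obtain \<beta> where \<beta>: "finite \<beta>" "V.basis \<beta>"
    using V.finite_basis_exists by auto
  have \<beta>M: "\<beta> \<subseteq> carrier M"
    using \<beta>(2) by (simp add: V.basis_def)
  have dim: "card \<beta> = complex_dim R M"
    using V.dim_basis[OF \<beta>] by (simp add: complex_dim_def)
  have lc: "V.lincomb a \<beta> = finsum M (\<lambda>x. cscale R M (a x) x) \<beta>" for a
    by (simp add: V.lincomb_def finsum_cspace cscale_def)
  have ex1: "\<exists>!a. a \<in> \<beta> \<rightarrow>\<^sub>E UNIV \<and> finsum M (\<lambda>x. cscale R M (a x) x) \<beta> = m" if "m \<in> carrier M" for m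
    using V.basis_criterion[OF \<beta>(1)] \<beta>M \<beta>(2) that unfolding lc by simp
  define co where "co m = (THE a. a \<in> \<beta> \<rightarrow>\<^sub>E UNIV \<and> finsum M (\<lambda>x. cscale R M (a x) x) \<beta> = m)" for m
  have co: "co m \<in> \<beta> \<rightarrow>\<^sub>E UNIV" "finsum M (\<lambda>x. cscale R M (co m x) x) \<beta> = m" if "m \<in> carrier M" for m
    using theI'[OF ex1[OF that]] unfolding co_def by blast+
  \<comment> \<open>Any coefficients that sum up to \<open>m\<close> are its coordinates.
    Additivity, homogeneity and duality below reduce to exhibiting suitable coefficients.\<close>
  have coI: "co m x = a x" if "m \<in> carrier M" "finsum M (\<lambda>x. cscale R M (a x) x) \<beta> = m" "x \<in> \<beta>" for a m x
  proof -
    have "finsum M (\<lambda>x. cscale R M (restrict a \<beta> x) x) \<beta> = finsum M (\<lambda>x. cscale R M (a x) x) \<beta>"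
      by (rule M.finsum_cong') (use \<beta>M in auto)
    then have "co m = restrict a \<beta>"
      unfolding co_def using that by (intro the1_equality[OF ex1]) auto
    then show ?thesis using that by simp
  qed
  have "coord_system R M \<beta> (\<lambda>x. x) (\<lambda>x m. co m x)"
    unfolding coord_system_def
  proof (intro conjI ballI allI)
    fix x m n assume x: "x \<in> \<beta>" and m: "m \<in> carrier M" "n \<in> carrier M"
    show "co (m \<oplus>\<^bsub>M\<^esub> n) x = co m x + co n x"
    proof (rule coI[OF _ _ x])
      have "finsum M (\<lambda>x. cscale R M (co m x + co n x) x) \<beta>
          = finsum M (\<lambda>x. cscale R M (co m x) x \<oplus>\<^bsub>M\<^esub> cscale R M (co n x) x) \<beta>"
        by (rule M.finsum_cong') (use \<beta>M in \<open>auto simp: cscale_add_left\<close>)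
      also have "\<dots> = m \<oplus>\<^bsub>M\<^esub> n"
        using \<beta>M by (subst M.finsum_addf) (auto simp: co m)
      finally show "finsum M (\<lambda>x. cscale R M (co m x + co n x) x) \<beta> = m \<oplus>\<^bsub>M\<^esub> n" .
    qed (use m in auto)
  next
    fix x c m assume x: "x \<in> \<beta>" and m: "m \<in> carrier M"
    show "co (cscale R M c m) x = c * co m x"
    proof (rule coI[OF _ _ x])
      have "finsum M (\<lambda>x. cscale R M (c * co m x) x) \<beta>
          = finsum M (\<lambda>x. cscale R M c (cscale R M (co m x) x)) \<beta>"
        by (rule M.finsum_cong') (use \<beta>M in \<open>auto simp: cscale_cscale\<close>)
      also have "\<dots> = cscale R M c m"
        using \<beta>M by (subst cscale_finsum[symmetric]) (auto simp: co m)
      finally show "finsum M (\<lambda>x. cscale R M (c * co m x) x) \<beta> = cscale R M c m" .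
    qed (use m in auto)
  next
    fix x y assume x: "x \<in> \<beta>" and y: "y \<in> \<beta>"
    have yM: "y \<in> carrier M" using y \<beta>M by auto
    show "co y x = (if x = y then 1 else 0)"
    proof (rule coI[OF yM _ x])
      have "finsum M (\<lambda>x. cscale R M (if x = y then 1 else 0) x) \<beta> = cscale R M (if y = y then 1 else 0) y"
        by (rule finsum_single) (use \<beta>M \<beta>(1) y yM M.abelian_group_axioms in auto)
      then show "finsum M (\<lambda>x. cscale R M (if x = y then 1 else 0) x) \<beta> = y"
        using yM by simp
    qed
  qed (use \<beta>(1) \<beta>M co(2) in auto)
  then show ?thesis using dim by blast
qed

end

text \<open>Over the complex numbers the matrix of \<open>h\<close> has an eigenvector; the
  eigenspace is a nonzero submodule, because scalars commute with the ring, and so it is all of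
  \<open>M\<close>.\<close>

lemma schur_scalar:
  assumes alg: "complex_algebra R" and irr: "irreducible_module R M"
    and co: "coord_system R M I b \<kappa>" and h: "h \<in> LinearCombinations.module_hom R M M"
  shows "\<exists>c. \<forall>m\<in>carrier M. h m = cscale R M c m"
proof -
  interpret complex_left_module R M
    using alg irreducible_left_module[OF irr] by (simp add: complex_left_module_def)
  obtain e :: "nat \<Rightarrow> _" where e: "bij_betw e {..<card I} I"
    using coord_systemD(1)[OF co] ex_bij_betw_nat_finite[of I] by (auto simp: atLeast0LessThan)
  define n where "n = card I"
  define v where "v = (\<lambda>j. b (e j))"
  define \<mu> where "\<mu> = (\<lambda>j. \<kappa> (e j))"
  have co': "coord_system R M {..<n} v \<mu>"
    unfolding v_def \<mu>_def n_def by (rule coord_system_reindex[OF _ co e]) unfold_locales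
  note c = coord_systemD[OF co']
  obtain m0 where m0: "m0 \<in> carrier M" "m0 \<noteq> \<zero>\<^bsub>M\<^esub>"
    using irreducible_nonzero[OF irr] by auto
  have "n > 0"
  proof (rule ccontr)
    assume "\<not> n > 0"
    then have "m0 = \<zero>\<^bsub>M\<^esub>" using c(6)[OF m0(1)] by simp
    then show False using m0 by simp
  qed
  \<comment> \<open>The matrix of \<open>h\<close> in the basis \<open>v\<close>, column
    \<open>j\<close> holding the coordinates of \<open>h (v j)\<close>.\<close>
  define H where "H = mat n n (\<lambda>(i, j). \<mu> i (h (v j)))"
  have H: "H \<in> carrier_mat n n" by (simp add: H_def)
  obtain k where "eigenvalue H k"
    using spectrum_non_empty[OF H \<open>n > 0\<close>] by (auto simp: spectrum_def)
  then obtain x where x: "x \<in> carrier_vec n" "x \<noteq> 0\<^sub>v n" "H *\<^sub>v x = k \<cdot>\<^sub>v x"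
    using H by (auto simp: eigenvalue_def eigenvector_def)
  define y where "y = finsum M (\<lambda>j. cscale R M (x $ j) (v j)) {..<n}"
  have v: "v j \<in> carrier M" if "j < n" for j using c(2) that by simp
  have y: "y \<in> carrier M" unfolding y_def by (rule M.finsum_closed) (use v in auto)
  have hM: "h m \<in> carrier M" if "m \<in> carrier M" for m using module_homD(1)[OF h that] .
  have y0: "y \<noteq> \<zero>\<^bsub>M\<^esub>"
  proof
    assume "y = \<zero>\<^bsub>M\<^esub>"
    then have "x $ i = 0" if "i < n" for i
      using coord_lincomb[OF co', of i "\<lambda>j. x $ j"] coord_zero[OF co'] that by (simp add: y_def)
    then have "x = 0\<^sub>v n" using x(1) by auto
    then show False using x by simp
  qed
  have hy: "h y = cscale R M k y"
  proof (rule coord_eqI[OF co'])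
    fix i assume i: "i \<in> {..<n}"
    have "h y = finsum M (\<lambda>j. h (cscale R M (x $ j) (v j))) {..<n}"
      unfolding y_def
      by (rule additive_finsum)
        (use M.abelian_group_axioms hM module_homD(2)[OF h] v in auto)
    also have "\<dots> = finsum M (\<lambda>j. cscale R M (x $ j) (h (v j))) {..<n}"
      by (rule M.finsum_cong') (use v hM module_hom_cscale[OF alg h] in auto)
    finally have "\<mu> i (h y) = (\<Sum>j<n. \<mu> i (cscale R M (x $ j) (h (v j))))"
      using coord_finsum[OF co' i, of "{..<n}" "\<lambda>j. cscale R M (x $ j) (h (v j))"] v hM by simp
    also have "\<dots> = (\<Sum>j<n. \<mu> i (h (v j)) * x $ j)"
      by (rule sum.cong) (use c(4)[OF i] v hM in auto)
    also have "\<dots> = (H *\<^sub>v x) $ i"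
      using i x(1) by (simp add: H_def scalar_prod_def atLeast0LessThan)
    also have "\<dots> = k * x $ i"
      using i x by simp
    also have "\<dots> = \<mu> i (cscale R M k y)"
      using c(4)[OF i y] coord_lincomb[OF co' i, of "\<lambda>j. x $ j"] by (simp add: y_def)
    finally show "\<mu> i (h y) = \<mu> i (cscale R M k y)" .
  qed (use y hM in auto)
  have "{m \<in> carrier M. h m = cscale R M k m} = carrier M"
  proof (rule irreducibleD[OF irr, of _ y])
    show "\<zero>\<^bsub>M\<^esub> \<in> {m \<in> carrier M. h m = cscale R M k m}"
      using module_hom_zero[OF irreducible_left_module[OF irr] irreducible_left_module[OF irr] h] by simp
  qed (use y y0 hy module_homD(2,3)[OF h] in \<open>auto simp: cscale_add smult_cscale smult_closed\<close>)
  then show ?thesis by blast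
qed

text \<open>
  The density theorem, phrased with functionals: an element \<open>v\<close> that is killed by every ring
  element killing all \<open>v j\<close> lies in the span of those \<open>v j\<close> that belong to the same module.
\<close>

lemma density_functional:
  assumes alg: "complex_algebra R" and "finite J"
    and irr: "\<And>j. j \<in> J ==> irreducible_module R (X j)" "irreducible_module R X0"
    and v: "\<And>j. j \<in> J ==> v j \<in> carrier (X j)"
    and sep: "\<And>j. j \<in> J ==> X j = X0 \<or> \<not> module_isomorphic R (X j) X0"
    and scal: "\<And>h. h \<in> LinearCombinations.module_hom R X0 X0 ==>
      \<exists>c. \<forall>m\<in>carrier X0. h m = cscale R X0 c m"
    and add: "\<And>m n. m \<in> carrier X0 ==> n \<in> carrier X0 ==> l (m \<oplus>\<^bsub>X0\<^esub> n) = l m + l n"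
    and scale: "\<And>c m. m \<in> carrier X0 ==> l (cscale R X0 c m) = c * l m"
    and lv: "\<And>j. j \<in> J ==> X j = X0 ==> l (v j) = (0::complex)"
    and v0: "v0 \<in> carrier X0"
    and kill: "\<And>b. b \<in> carrier R ==> (\<And>j. j \<in> J ==> b \<odot>\<^bsub>X j\<^esub> v j = \<zero>\<^bsub>X j\<^esub>) ==> b \<odot>\<^bsub>X0\<^esub> v0 = \<zero>\<^bsub>X0\<^esub>"
  shows "l v0 = 0"
  using \<open>finite J\<close> irr(1) v sep lv v0 kill
proof (induction J arbitrary: v0 rule: finite_induct)
  interpret X0: complex_left_module R X0
    using alg irreducible_left_module[OF irr(2)] by (simp add: complex_left_module_def)
  case empty
  have "v0 = \<zero>\<^bsub>X0\<^esub>"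
    using empty.prems(6)[of "\<one>\<^bsub>R\<^esub>"] empty.prems(5) X0.smult_one by simp
  then show ?case
    using scale[of "\<zero>\<^bsub>X0\<^esub>" 0] by simp
next
  interpret X0: complex_left_module R X0
    using alg irreducible_left_module[OF irr(2)] by (simp add: complex_left_module_def)
  case (insert i J)
  interpret Xi: complex_left_module R "X i"
    using alg irreducible_left_module[OF insert.prems(1)[of i]] by (simp add: complex_left_module_def)
  have Xj: "left_module R (X j)" if "j \<in> J" for j
    using insert.prems(1)[of j] that irreducible_left_module by auto
  have vi: "v i \<in> carrier (X i)" using insert.prems(2) by simp
  have v0: "v0 \<in> carrier X0" by (rule insert.prems(5))
  \<comment> \<open>The elements killing the vectors of the smaller family form a left ideal. The
    induction hypothesis says that \<open>l\<close> vanishes on every vector of \<open>X0\<close>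
    killed by it.\<close>
  define L where "L = {b \<in> carrier R. \<forall>j\<in>J. b \<odot>\<^bsub>X j\<^esub> v j = \<zero>\<^bsub>X j\<^esub>}"
  have LR: "b \<in> carrier R" if "b \<in> L" for b using that by (simp add: L_def)
  have IH: "l w = 0" if "w \<in> carrier X0" "\<And>b. b \<in> L ==> b \<odot>\<^bsub>X0\<^esub> w = \<zero>\<^bsub>X0\<^esub>" for w
    by (rule insert.IH) (use insert.prems that in \<open>auto simp: L_def\<close>)
  have L0: "\<zero>\<^bsub>R\<^esub> \<in> L"
    using Xj insert.prems(2) by (auto simp: L_def left_module.smult_zero_left)
  have Ladd: "a \<oplus>\<^bsub>R\<^esub> b \<in> L" if "a \<in> L" "b \<in> L" for a b
  proof -
    have "(a \<oplus>\<^bsub>R\<^esub> b) \<odot>\<^bsub>X j\<^esub> v j = \<zero>\<^bsub>X j\<^esub>" if "j \<in> J" for j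
    proof -
      interpret Xj: left_module R "X j" by (rule Xj[OF that])
      show ?thesis
        using \<open>a \<in> L\<close> \<open>b \<in> L\<close> that insert.prems(2)[of j] Xj.smult_l_distr[of a b "v j"] by (simp add: L_def)
    qed
    then show ?thesis using that by (auto simp: L_def)
  qed
  have Lmult: "a \<otimes>\<^bsub>R\<^esub> b \<in> L" if "a \<in> carrier R" "b \<in> L" for a b
  proof -
    have "(a \<otimes>\<^bsub>R\<^esub> b) \<odot>\<^bsub>X j\<^esub> v j = \<zero>\<^bsub>X j\<^esub>" if "j \<in> J" for j
    proof -
      interpret Xj: left_module R "X j" by (rule Xj[OF that])
      show ?thesis
        using \<open>a \<in> carrier R\<close> \<open>b \<in> L\<close> that insert.prems(2)[of j] Xj.smult_assoc[of a b "v j"]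
        by (simp add: L_def)
    qed
    then show ?thesis using that by (auto simp: L_def)
  qed
  show ?case
  proof (cases "\<exists>b\<in>L. b \<odot>\<^bsub>X i\<^esub> v i \<noteq> \<zero>\<^bsub>X i\<^esub>")
    \<comment> \<open>\<open>L\<close> already kills \<open>v i\<close>, so it kills
      \<open>v0\<close> by assumption and the smaller family suffices.\<close>
    case False
    show ?thesis
    proof (rule IH[OF v0])
      fix b assume b: "b \<in> L"
      show "b \<odot>\<^bsub>X0\<^esub> v0 = \<zero>\<^bsub>X0\<^esub>"
        by (rule insert.prems(6)) (use b False in \<open>auto simp: L_def\<close>)
    qed
  next
    case True
    then obtain b where b: "b \<in> L" "b \<odot>\<^bsub>X i\<^esub> v i \<noteq> \<zero>\<^bsub>X i\<^esub>" by auto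
    have Lv: "\<exists>y\<in>L. y \<odot>\<^bsub>X i\<^esub> v i = n" if "n \<in> carrier (X i)" for n
      by (rule irreducible_ideal_transitive[OF insert.prems(1)[of i] _ L0 Ladd Lmult b(1) vi b(2) that])
        (auto simp: LR)
    \<comment> \<open>Since \<open>L\<close> moves \<open>v i\<close> onto all of
      \<open>X i\<close>, sending \<open>b \<odot> v i\<close> to \<open>b \<odot> v0\<close> for
      \<open>b\<close> in \<open>L\<close> defines a homomorphism from \<open>X i\<close> to
      \<open>X0\<close>. It is well defined because the difference of two elements agreeing at
      \<open>v i\<close> kills the whole enlarged family.\<close>
    have wd: "a \<odot>\<^bsub>X0\<^esub> v0 = b \<odot>\<^bsub>X0\<^esub> v0"
      if ab: "a \<in> L" "b \<in> L" "a \<odot>\<^bsub>X i\<^esub> v i = b \<odot>\<^bsub>X i\<^esub> v i" for a b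
    proof -
      define d where "d = a \<oplus>\<^bsub>R\<^esub> (\<ominus>\<^bsub>R\<^esub> \<one>\<^bsub>R\<^esub>) \<otimes>\<^bsub>R\<^esub> b"
      have ab': "a \<in> carrier R" "b \<in> carrier R" using ab LR by auto
      have d: "d \<in> L" unfolding d_def by (intro Ladd Lmult ab) simp
      have d2: "d = a \<oplus>\<^bsub>R\<^esub> \<ominus>\<^bsub>R\<^esub> b"
        using ab' by (simp add: d_def X0.l_minus)
      have "d \<odot>\<^bsub>X0\<^esub> v0 = \<zero>\<^bsub>X0\<^esub>"
      proof (rule insert.prems(6))
        show "d \<in> carrier R" by (rule LR[OF d])
        fix j assume "j \<in> insert i J"
        moreover have "d \<odot>\<^bsub>X i\<^esub> v i = \<zero>\<^bsub>X i\<^esub>"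
          unfolding d2 using ab ab' vi
          by (simp add: Xi.smult_l_distr Xi.smult_minus_left Xi.smult_closed Xi.M.r_neg)
        ultimately show "d \<odot>\<^bsub>X j\<^esub> v j = \<zero>\<^bsub>X j\<^esub>" using d by (auto simp: L_def)
      qed
      then have "a \<odot>\<^bsub>X0\<^esub> v0 \<oplus>\<^bsub>X0\<^esub> \<ominus>\<^bsub>X0\<^esub> (b \<odot>\<^bsub>X0\<^esub> v0) = \<zero>\<^bsub>X0\<^esub>"
        unfolding d2 using ab' v0 by (simp add: X0.smult_l_distr X0.smult_minus_left)
      then show ?thesis
        using ab' v0 by (metis X0.M.a_inv_closed X0.M.minus_equality X0.M.minus_minus X0.smult_closed)
    qed
    define pick where "pick n = (SOME y. y \<in> L \<and> y \<odot>\<^bsub>X i\<^esub> v i = n)" for n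
    have pick: "pick n \<in> L" "pick n \<odot>\<^bsub>X i\<^esub> v i = n" if "n \<in> carrier (X i)" for n
      using someI_ex[of "\<lambda>y. y \<in> L \<and> y \<odot>\<^bsub>X i\<^esub> v i = n"] Lv[OF that] unfolding pick_def by blast+
    define h where "h n = pick n \<odot>\<^bsub>X0\<^esub> v0" for n
    have hb: "h (b \<odot>\<^bsub>X i\<^esub> v i) = b \<odot>\<^bsub>X0\<^esub> v0" if "b \<in> L" for b
      unfolding h_def using that pick vi LR[OF that] by (intro wd) (auto simp: Xi.smult_closed)
    have hom: "h \<in> LinearCombinations.module_hom R (X i) X0"
    proof (rule module_homI)
      fix m assume m: "m \<in> carrier (X i)"
      show "h m \<in> carrier X0" using pick(1)[OF m] v0 LR by (simp add: h_def X0.smult_closed)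
    next
      fix m n assume mn: "m \<in> carrier (X i)" "n \<in> carrier (X i)"
      note p = pick(1)[OF mn(1)] pick(1)[OF mn(2)]
      have "(pick m \<oplus>\<^bsub>R\<^esub> pick n) \<odot>\<^bsub>X i\<^esub> v i = m \<oplus>\<^bsub>X i\<^esub> n"
        using mn pick(2) LR[OF p(1)] LR[OF p(2)] vi by (simp add: Xi.smult_l_distr)
      then have "h (m \<oplus>\<^bsub>X i\<^esub> n) = (pick m \<oplus>\<^bsub>R\<^esub> pick n) \<odot>\<^bsub>X0\<^esub> v0"
        using hb[OF Ladd[OF p]] by simp
      then show "h (m \<oplus>\<^bsub>X i\<^esub> n) = h m \<oplus>\<^bsub>X0\<^esub> h n"
        using LR[OF p(1)] LR[OF p(2)] v0 by (simp add: h_def X0.smult_l_distr)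
    next
      fix r m assume rm: "r \<in> carrier R" "m \<in> carrier (X i)"
      note p = pick(1)[OF rm(2)]
      have "(r \<otimes>\<^bsub>R\<^esub> pick m) \<odot>\<^bsub>X i\<^esub> v i = r \<odot>\<^bsub>X i\<^esub> m"
        using rm pick(2) LR[OF p] vi by (simp add: Xi.smult_assoc)
      then have "h (r \<odot>\<^bsub>X i\<^esub> m) = (r \<otimes>\<^bsub>R\<^esub> pick m) \<odot>\<^bsub>X0\<^esub> v0"
        using hb[OF Lmult[OF rm(1) p]] by simp
      then show "h (r \<odot>\<^bsub>X i\<^esub> m) = r \<odot>\<^bsub>X0\<^esub> h m"
        using LR[OF p] rm v0 by (simp add: h_def X0.smult_assoc)
    qed
    show ?thesis
    proof (cases "X i = X0")
      \<comment> \<open>Non-isomorphic modules: the homomorphism vanishes by Schur's lemma, so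
        \<open>L\<close> kills \<open>v0\<close>.\<close>
      case iso: False
      have h0: "h m = \<zero>\<^bsub>X0\<^esub>" if "m \<in> carrier (X i)" for m
      proof (rule ccontr)
        assume "h m \<noteq> \<zero>\<^bsub>X0\<^esub>"
        then have "module_isomorphic R (X i) X0"
          using schur[OF insert.prems(1)[of i] irr(2) hom that] hom
          by (auto simp: module_isomorphic_def)
        then show False using insert.prems(3)[of i] iso by auto
      qed
      show ?thesis
      proof (rule IH[OF v0])
        fix b assume "b \<in> L"
        then show "b \<odot>\<^bsub>X0\<^esub> v0 = \<zero>\<^bsub>X0\<^esub>"
          using hb[of b] h0[of "b \<odot>\<^bsub>X i\<^esub> v i"] vi LR by (simp add: Xi.smult_closed)
      qed
    next
      case same: True
      obtain c where c: "\<And>m. m \<in> carrier X0 ==> h m = cscale R X0 c m"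
        using scal hom unfolding same by blast
      have vi0: "v i \<in> carrier X0" using vi same by simp
      \<comment> \<open>The homomorphism is a scalar \<open>c\<close>, so \<open>L\<close> kills
        \<open>v0 - c v i\<close>. By induction \<open>l\<close> vanishes there, and it vanishes at
        \<open>v i\<close> by assumption.\<close>
      define w where "w = v0 \<oplus>\<^bsub>X0\<^esub> cscale R X0 (- c) (v i)"
      have "l w = 0"
      proof (rule IH)
        show "w \<in> carrier X0" using v0 vi0 by (simp add: w_def)
        fix b assume b: "b \<in> L"
        note bR = LR[OF b]
        have "b \<odot>\<^bsub>X0\<^esub> v0 = cscale R X0 c (b \<odot>\<^bsub>X0\<^esub> v i)"
          using hb[OF b] c[of "b \<odot>\<^bsub>X0\<^esub> v i"] vi0 bR same by (simp add: X0.smult_closed)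
        then have "b \<odot>\<^bsub>X0\<^esub> w = cscale R X0 c (b \<odot>\<^bsub>X0\<^esub> v i) \<oplus>\<^bsub>X0\<^esub> cscale R X0 (- c) (b \<odot>\<^bsub>X0\<^esub> v i)"
          using bR v0 vi0 by (simp add: w_def X0.smult_r_distr X0.smult_cscale)
        also have "\<dots> = \<zero>\<^bsub>X0\<^esub>"
          using X0.cscale_add_left[of "b \<odot>\<^bsub>X0\<^esub> v i" c "- c"] bR vi0 by (simp add: X0.smult_closed)
        finally show "b \<odot>\<^bsub>X0\<^esub> w = \<zero>\<^bsub>X0\<^esub>" .
      qed
      moreover have "l w = l v0 + - c * l (v i)"
        using v0 vi0 by (simp add: w_def add scale)
      ultimately show ?thesis
        using insert.prems(4)[of i] same by simp
    qed
  qed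
qed


text \<open>Built from elements that send one basis vector to its target and kill all the others;
  their sum over all basis vectors does everything at once.\<close>

lemma density:
  assumes alg: "complex_algebra R" and "finite J"
    and irr: "\<And>j. j \<in> J ==> irreducible_module R (X j)"
    and sep: "\<And>j k. j \<in> J ==> k \<in> J ==> j \<noteq> k ==> \<not> module_isomorphic R (X j) (X k)"
    and co: "\<And>j. j \<in> J ==> coord_system R (X j) (I j) (b j) (\<kappa> j)"
    and z: "\<And>j i. j \<in> J ==> i \<in> I j ==> z j i \<in> carrier (X j)"
  shows "\<exists>a\<in>carrier R. \<forall>j\<in>J. \<forall>i\<in>I j. a \<odot>\<^bsub>X j\<^esub> b j i = z j i"
proof -
  interpret complex_algebra R by fact
  define K where "K = Sigma J I"
  have fin: "finite K"
    unfolding K_def using \<open>finite J\<close> coord_systemD(1)[OF co] by (intro finite_SigmaI) auto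
  have lm: "complex_left_module R (X j)" if "j \<in> J" for j
    using alg irreducible_left_module[OF irr[OF that]] by (simp add: complex_left_module_def)
  have bX: "b j i \<in> carrier (X j)" if "j \<in> J" "i \<in> I j" for j i
    using coord_systemD(2)[OF co] that by auto
  have ex: "\<exists>a\<in>carrier R. a \<odot>\<^bsub>X j\<^esub> b j i = z j i \<and>
      (\<forall>k\<in>J. \<forall>l\<in>I k. (k, l) \<noteq> (j, i) \<longrightarrow> a \<odot>\<^bsub>X k\<^esub> b k l = \<zero>\<^bsub>X k\<^esub>)"
    if j: "j \<in> J" and i: "i \<in> I j" for j i
  proof -
    define L where
      "L = {a \<in> carrier R. \<forall>k\<in>J. \<forall>l\<in>I k. (k, l) \<noteq> (j, i) \<longrightarrow> a \<odot>\<^bsub>X k\<^esub> b k l = \<zero>\<^bsub>X k\<^esub>}"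
    have "\<exists>a\<in>L. a \<odot>\<^bsub>X j\<^esub> b j i \<noteq> \<zero>\<^bsub>X j\<^esub>"
    proof (rule ccontr)
      assume none: "\<not> ?thesis"
      \<comment> \<open>If no element of \<open>L\<close> moved \<open>b j i\<close>, then
        \<open>density_functional\<close> would apply to the functional dual to
        \<open>b j i\<close>: it vanishes on the other basis vectors of \<open>X j\<close>, so it
        would vanish at \<open>b j i\<close>, where it is one.\<close>
      have "\<kappa> j i (b j i) = 0"
      proof (rule density_functional[where J = "K - {(j, i)}" and X = "\<lambda>(k, l). X k"
            and v = "\<lambda>(k, l). b k l" and l = "\<kappa> j i" and ?X0.0 = "X j", OF alg])
        show "\<exists>c. \<forall>m\<in>carrier (X j). h m = cscale R (X j) c m"
          if "h \<in> LinearCombinations.module_hom R (X j) (X j)" for h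
          using schur_scalar[OF alg irr[OF j] co[OF j] that] .
        fix p assume p: "p \<in> K - {(j, i)}"
        then obtain k l where kl: "p = (k, l)" "k \<in> J" "l \<in> I k" "(k, l) \<noteq> (j, i)"
          by (auto simp: K_def)
        show "(case p of (k, l) \<Rightarrow> X k) = X j \<or> \<not> module_isomorphic R (case p of (k, l) \<Rightarrow> X k) (X j)"
          using kl sep[OF kl(2) j] by auto
        assume "(case p of (k, l) \<Rightarrow> X k) = X j"
        then have "k = j" using sep[OF kl(2) j] kl module_isomorphic_refl[of R "X j"] by auto
        then show "\<kappa> j i (case p of (k, l) \<Rightarrow> b k l) = 0"
          using kl coord_systemD(5)[OF co[OF j] i, of l] by auto
      next
        fix a
        assume a: "a \<in> carrier R" and k: "\<And>p. p \<in> K - {(j, i)} ==>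
          a \<odot>\<^bsub>case p of (k, l) \<Rightarrow> X k\<^esub> (case p of (k, l) \<Rightarrow> b k l) = \<zero>\<^bsub>case p of (k, l) \<Rightarrow> X k\<^esub>"
        have "a \<in> L"
          unfolding L_def using a k[of "(_, _)"] by (auto simp: K_def)
        then show "a \<odot>\<^bsub>X j\<^esub> b j i = \<zero>\<^bsub>X j\<^esub>" using none by auto
      qed (use fin irr j i bX coord_systemD(3,4)[OF co[OF j] i] in \<open>auto simp: K_def\<close>)
      then show False using coord_systemD(5)[OF co[OF j] i i] by simp
    qed
    then obtain x where x: "x \<in> L" "x \<odot>\<^bsub>X j\<^esub> b j i \<noteq> \<zero>\<^bsub>X j\<^esub>" by auto
    \<comment> \<open>One nonzero value suffices: by irreducibility the left ideal \<open>L\<close>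
      then moves \<open>b j i\<close> onto every vector.\<close>
    have "\<exists>y\<in>L. y \<odot>\<^bsub>X j\<^esub> b j i = z j i"
    proof (rule irreducible_ideal_transitive[OF irr[OF j] _ _ _ _ x(1) bX[OF j i] x(2) z[OF j i]])
      show "L \<subseteq> carrier R" by (auto simp: L_def)
      show "\<zero>\<^bsub>R\<^esub> \<in> L"
        using lm bX by (auto simp: L_def complex_left_module_def left_module.smult_zero_left)
      show "x \<oplus>\<^bsub>R\<^esub> y \<in> L" if "x \<in> L" "y \<in> L" for x y
      proof -
        have "(x \<oplus>\<^bsub>R\<^esub> y) \<odot>\<^bsub>X k\<^esub> b k l = \<zero>\<^bsub>X k\<^esub>" if kl: "k \<in> J" "l \<in> I k" "(k, l) \<noteq> (j, i)" for k l
        proof -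
          interpret Xk: complex_left_module R "X k" by (rule lm[OF kl(1)])
          show ?thesis
            using \<open>x \<in> L\<close> \<open>y \<in> L\<close> kl bX[OF kl(1,2)] Xk.smult_l_distr[of x y "b k l"] by (simp add: L_def)
        qed
        then show ?thesis using that by (auto simp: L_def)
      qed
      show "a \<otimes>\<^bsub>R\<^esub> x \<in> L" if "a \<in> carrier R" "x \<in> L" for a x
      proof -
        have "(a \<otimes>\<^bsub>R\<^esub> x) \<odot>\<^bsub>X k\<^esub> b k l = \<zero>\<^bsub>X k\<^esub>" if kl: "k \<in> J" "l \<in> I k" "(k, l) \<noteq> (j, i)" for k l
        proof -
          interpret Xk: complex_left_module R "X k" by (rule lm[OF kl(1)])
          show ?thesis
            using \<open>a \<in> carrier R\<close> \<open>x \<in> L\<close> kl bX[OF kl(1,2)] Xk.smult_assoc[of a x "b k l"] by (simp add: L_def)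
        qed
        then show ?thesis using that by (auto simp: L_def)
      qed
    qed
    then show ?thesis by (auto simp: L_def)
  qed
  define e where "e p = (SOME a. a \<in> carrier R \<and> (case p of (j, i) \<Rightarrow> a \<odot>\<^bsub>X j\<^esub> b j i = z j i \<and>
      (\<forall>k\<in>J. \<forall>l\<in>I k. (k, l) \<noteq> (j, i) \<longrightarrow> a \<odot>\<^bsub>X k\<^esub> b k l = \<zero>\<^bsub>X k\<^esub>)))" for p
  have e: "e (j, i) \<in> carrier R" "e (j, i) \<odot>\<^bsub>X j\<^esub> b j i = z j i"
    "\<And>k l. k \<in> J ==> l \<in> I k ==> (k, l) \<noteq> (j, i) ==> e (j, i) \<odot>\<^bsub>X k\<^esub> b k l = \<zero>\<^bsub>X k\<^esub>"
    if "j \<in> J" "i \<in> I j" for j i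
    using someI_ex[of "\<lambda>a. a \<in> carrier R \<and> (case (j, i) of (j, i) \<Rightarrow> a \<odot>\<^bsub>X j\<^esub> b j i = z j i \<and>
      (\<forall>k\<in>J. \<forall>l\<in>I k. (k, l) \<noteq> (j, i) \<longrightarrow> a \<odot>\<^bsub>X k\<^esub> b k l = \<zero>\<^bsub>X k\<^esub>))"] ex[OF that]
    unfolding e_def[symmetric] by auto
  have eR: "e p \<in> carrier R" if "p \<in> K" for p
    using e(1) that by (auto simp: K_def)
  show ?thesis
  proof (intro bexI ballI)
    show "finsum R e K \<in> carrier R" using eR by (intro finsum_closed) auto
    fix j i assume j: "j \<in> J" and i: "i \<in> I j"
    interpret Xj: complex_left_module R "X j" by (rule lm[OF j])
    have "finsum R e K \<odot>\<^bsub>X j\<^esub> b j i = finsum (X j) (\<lambda>p. e p \<odot>\<^bsub>X j\<^esub> b j i) K"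
      using eR bX[OF j i] by (rule Xj.smult_finsum_left)
    also have "\<dots> = e (j, i) \<odot>\<^bsub>X j\<^esub> b j i"
    proof (rule finsum_single[OF Xj.M.abelian_group_axioms fin])
      show "(j, i) \<in> K" using j i by (simp add: K_def)
      show "e (j, i) \<odot>\<^bsub>X j\<^esub> b j i \<in> carrier (X j)"
        using e(1)[OF j i] bX[OF j i] by (rule Xj.smult_closed)
      fix p assume "p \<in> K" "p \<noteq> (j, i)"
      then show "e p \<odot>\<^bsub>X j\<^esub> b j i = \<zero>\<^bsub>X j\<^esub>"
        using e(3)[OF _ _ j i] by (cases p) (auto simp: K_def)
    qed
    finally show "finsum R e K \<odot>\<^bsub>X j\<^esub> b j i = z j i" using e(2)[OF j i] by simp
  qed
qed

section \<open>Twisted group algebras of finite groups\<close>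

lemma TGA_simps [simp]:
  "carrier (twisted_group_algebra G \<alpha>) = {f. \<forall>x. x \<notin> carrier G \<longrightarrow> f x = 0}"
  "\<zero>\<^bsub>twisted_group_algebra G \<alpha>\<^esub> = (\<lambda>x. 0)"
  "f \<oplus>\<^bsub>twisted_group_algebra G \<alpha>\<^esub> h = (\<lambda>x. f x + h x)"
  "c \<odot>\<^bsub>twisted_group_algebra G \<alpha>\<^esub> f = (\<lambda>x. c * f x)"
  by (simp_all add: twisted_group_algebra_def)

lemma TGA_one: "\<one>\<^bsub>twisted_group_algebra G \<alpha>\<^esub> =
    (\<lambda>x. if x = \<one>\<^bsub>G\<^esub> then inverse (\<alpha> \<one>\<^bsub>G\<^esub> \<one>\<^bsub>G\<^esub>) else 0)"
  by (simp add: twisted_group_algebra_def)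

lemma sum_rotate3:
  "(\<Sum>y\<in>Y. \<Sum>m\<in>M. \<Sum>k\<in>K. F y m k) = (\<Sum>m\<in>M. \<Sum>k\<in>K. \<Sum>y\<in>Y. F y m k)"
proof -
  have "(\<Sum>y\<in>Y. \<Sum>m\<in>M. \<Sum>k\<in>K. F y m k) = (\<Sum>m\<in>M. \<Sum>y\<in>Y. \<Sum>k\<in>K. F y m k)"
    by (rule sum.swap)
  also have "\<dots> = (\<Sum>m\<in>M. \<Sum>k\<in>K. \<Sum>y\<in>Y. F y m k)"
    by (rule sum.cong[OF refl], rule sum.swap)
  finally show ?thesis .
qed

locale twisted = group G for G :: "('g, 'x) monoid_scheme" (structure) +
  fixes \<alpha> :: "'g \<Rightarrow> 'g \<Rightarrow> complex"
  assumes fin: "finite (carrier G)" and cocycle: "\<alpha> \<in> cocycles2 G"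
begin

abbreviation A where "A \<equiv> twisted_group_algebra G \<alpha>"

lemma \<alpha>_nonzero [simp]: "g \<in> carrier G ==> h \<in> carrier G ==> \<alpha> g h \<noteq> 0"
  using cocycle unfolding cocycles2_def by blast

lemma \<alpha>_cocycle: "g \<in> carrier G ==> h \<in> carrier G ==> k \<in> carrier G ==>
    \<alpha> g h * \<alpha> (g \<otimes> h) k = \<alpha> g (h \<otimes> k) * \<alpha> h k"
  using cocycle unfolding cocycles2_def by blast

text \<open>A cocycle that is not normalised takes the constant value
  \<open>\<alpha> \<one> \<one>\<close> on pairs with a neutral entry; this constant is the source
  of the extra factors in the unit and in the inverses.\<close>

lemma \<alpha>_one_left: "g \<in> carrier G ==> \<alpha> \<one> g = \<alpha> \<one> \<one>"
  using \<alpha>_cocycle[of \<one> \<one> g] by simp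

lemma \<alpha>_one_right: "g \<in> carrier G ==> \<alpha> g \<one> = \<alpha> \<one> \<one>"
  using \<alpha>_cocycle[of g \<one> \<one>] by simp

lemma \<alpha>_inv: "g \<in> carrier G ==> \<alpha> g (inv g) = \<alpha> (inv g) g"
  using \<alpha>_cocycle[of g "inv g" g] \<alpha>_one_left[of g] \<alpha>_one_right[of g] by simp

lemma A_mult: "(f \<otimes>\<^bsub>A\<^esub> h) x =
    (\<Sum>g\<in>carrier G. \<Sum>k\<in>carrier G. if g \<otimes> k = x then f g * h k * \<alpha> g k else 0)"
proof -
  have "(f \<otimes>\<^bsub>A\<^esub> h) x =
      (\<Sum>(g, k) \<in> {p \<in> carrier G \<times> carrier G. case p of (g, k) \<Rightarrow> g \<otimes> k = x}. f g * h k * \<alpha> g k)"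
    by (simp add: twisted_group_algebra_def) (rule sum.cong, auto)
  also have "\<dots> = (\<Sum>(g, k) \<in> carrier G \<times> carrier G. if g \<otimes> k = x then f g * h k * \<alpha> g k else 0)"
    using fin by (subst sum.inter_filter) (auto intro: sum.cong)
  finally show ?thesis by (simp add: sum.cartesian_product)
qed

lemma A_mult_left: "(f \<otimes>\<^bsub>A\<^esub> h) x =
    (if x \<in> carrier G then \<Sum>g\<in>carrier G. f g * h (inv g \<otimes> x) * \<alpha> g (inv g \<otimes> x) else 0)"
proof -
  have "(\<Sum>k\<in>carrier G. if g \<otimes> k = x then f g * h k * \<alpha> g k else 0) =
      (if x \<in> carrier G then f g * h (inv g \<otimes> x) * \<alpha> g (inv g \<otimes> x) else 0)" if g: "g \<in> carrier G" for g
  proof (cases "x \<in> carrier G")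
    case True
    have "(\<Sum>k\<in>carrier G. if g \<otimes> k = x then f g * h k * \<alpha> g k else 0) =
        (\<Sum>k\<in>carrier G. if k = inv g \<otimes> x then f g * h k * \<alpha> g k else 0)"
      using g True by (intro sum.cong) (auto simp: inv_solve_left m_assoc[symmetric])
    then show ?thesis using g True fin by simp
  next
    case False
    then have "g \<otimes> k \<noteq> x" if "k \<in> carrier G" for k using g that by auto
    then show ?thesis using False by simp
  qed
  then show ?thesis by (simp add: A_mult)
qed

lemma A_assoc: "(f \<otimes>\<^bsub>A\<^esub> h) \<otimes>\<^bsub>A\<^esub> l = f \<otimes>\<^bsub>A\<^esub> (h \<otimes>\<^bsub>A\<^esub> l)"
proof
  fix x
  let ?S = "\<lambda>F. \<Sum>g\<in>carrier G. \<Sum>m\<in>carrier G. \<Sum>k\<in>carrier G. F g m k"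
  \<comment> \<open>The index \<open>y\<close> stands for the intermediate product
    \<open>g \<otimes> m\<close>; rotating the sums collapses it. In the expansion of the other side
    \<open>y\<close> is \<open>m \<otimes> k\<close>, and the cocycle identity matches the
    coefficients.\<close>
  have "((f \<otimes>\<^bsub>A\<^esub> h) \<otimes>\<^bsub>A\<^esub> l) x = (\<Sum>y\<in>carrier G. \<Sum>k\<in>carrier G. \<Sum>g\<in>carrier G. \<Sum>m\<in>carrier G.
      if y = g \<otimes> m then (if y \<otimes> k = x then f g * h m * l k * (\<alpha> g m * \<alpha> y k) else 0) else 0)"
    unfolding A_mult[of "f \<otimes>\<^bsub>A\<^esub> h"] unfolding A_mult[of f]
    by (intro sum.cong refl)
      (auto simp: sum_distrib_left sum_distrib_right mult_ac intro!: sum.cong sum.neutral)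
  also have "\<dots> = (\<Sum>y\<in>carrier G. \<Sum>g\<in>carrier G. \<Sum>m\<in>carrier G. \<Sum>k\<in>carrier G.
      if y = g \<otimes> m then (if y \<otimes> k = x then f g * h m * l k * (\<alpha> g m * \<alpha> y k) else 0) else 0)"
    by (rule sum.cong[OF refl], rule sum_rotate3)
  also have "\<dots> = (\<Sum>g\<in>carrier G. \<Sum>y\<in>carrier G. \<Sum>m\<in>carrier G. \<Sum>k\<in>carrier G.
      if y = g \<otimes> m then (if y \<otimes> k = x then f g * h m * l k * (\<alpha> g m * \<alpha> y k) else 0) else 0)"
    by (rule sum.swap)
  also have "\<dots> = ?S (\<lambda>g m k. \<Sum>y\<in>carrier G.
      if y = g \<otimes> m then (if y \<otimes> k = x then f g * h m * l k * (\<alpha> g m * \<alpha> y k) else 0) else 0)"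
    by (rule sum.cong[OF refl], rule sum_rotate3)
  also have "\<dots> = ?S (\<lambda>g m k.
      if g \<otimes> m \<otimes> k = x then f g * h m * l k * (\<alpha> g m * \<alpha> (g \<otimes> m) k) else 0)"
    using fin by (intro sum.cong refl) simp
  finally have 1: "((f \<otimes>\<^bsub>A\<^esub> h) \<otimes>\<^bsub>A\<^esub> l) x = \<dots>" .
  have "(f \<otimes>\<^bsub>A\<^esub> (h \<otimes>\<^bsub>A\<^esub> l)) x = (\<Sum>g\<in>carrier G. \<Sum>y\<in>carrier G. \<Sum>m\<in>carrier G. \<Sum>k\<in>carrier G.
      if y = m \<otimes> k then (if g \<otimes> y = x then f g * h m * l k * (\<alpha> g y * \<alpha> m k) else 0) else 0)"
    unfolding A_mult[of f] unfolding A_mult[of h]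
    by (intro sum.cong refl)
      (auto simp: sum_distrib_left sum_distrib_right mult_ac intro!: sum.cong sum.neutral)
  also have "\<dots> = ?S (\<lambda>g m k. \<Sum>y\<in>carrier G.
      if y = m \<otimes> k then (if g \<otimes> y = x then f g * h m * l k * (\<alpha> g y * \<alpha> m k) else 0) else 0)"
    by (rule sum.cong[OF refl], rule sum_rotate3)
  also have "\<dots> = ?S (\<lambda>g m k.
      if g \<otimes> (m \<otimes> k) = x then f g * h m * l k * (\<alpha> g (m \<otimes> k) * \<alpha> m k) else 0)"
    using fin by (intro sum.cong refl) simp
  also have "\<dots> = ?S (\<lambda>g m k.
      if g \<otimes> m \<otimes> k = x then f g * h m * l k * (\<alpha> g m * \<alpha> (g \<otimes> m) k) else 0)"
    by (intro sum.cong refl) (simp add: m_assoc \<alpha>_cocycle)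
  finally show "((f \<otimes>\<^bsub>A\<^esub> h) \<otimes>\<^bsub>A\<^esub> l) x = (f \<otimes>\<^bsub>A\<^esub> (h \<otimes>\<^bsub>A\<^esub> l)) x"
    using 1 by simp
qed

lemma A_add_mult: "(\<lambda>x. f x + h x) \<otimes>\<^bsub>A\<^esub> l = (\<lambda>x. (f \<otimes>\<^bsub>A\<^esub> l) x + (h \<otimes>\<^bsub>A\<^esub> l) x)"
  by (auto simp: A_mult_left sum.distrib algebra_simps fun_eq_iff)

lemma A_mult_add: "l \<otimes>\<^bsub>A\<^esub> (\<lambda>x. f x + h x) = (\<lambda>x. (l \<otimes>\<^bsub>A\<^esub> f) x + (l \<otimes>\<^bsub>A\<^esub> h) x)"
  by (auto simp: A_mult_left sum.distrib algebra_simps fun_eq_iff)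

lemma A_scale_mult: "(\<lambda>x. c * f x) \<otimes>\<^bsub>A\<^esub> l = (\<lambda>x. c * (f \<otimes>\<^bsub>A\<^esub> l) x)"
  by (auto simp: A_mult_left sum_distrib_left algebra_simps fun_eq_iff)

lemma A_mult_scale: "l \<otimes>\<^bsub>A\<^esub> (\<lambda>x. c * f x) = (\<lambda>x. c * (l \<otimes>\<^bsub>A\<^esub> f) x)"
  by (auto simp: A_mult_left sum_distrib_left algebra_simps fun_eq_iff)

lemma basis_mult: "g \<in> carrier G ==> (basis_elt g \<otimes>\<^bsub>A\<^esub> f) x =
    (if x \<in> carrier G then f (inv g \<otimes> x) * \<alpha> g (inv g \<otimes> x) else 0)"
  using fin by (simp add: A_mult_left basis_elt_def if_distrib[of "\<lambda>t. t * _"] cong: if_cong)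

lemma basis_mult_basis:
  assumes "g \<in> carrier G" "h \<in> carrier G"
  shows "basis_elt g \<otimes>\<^bsub>A\<^esub> basis_elt h = (\<lambda>x. \<alpha> g h * basis_elt (g \<otimes> h) x)"
proof
  fix x show "(basis_elt g \<otimes>\<^bsub>A\<^esub> basis_elt h) x = \<alpha> g h * basis_elt (g \<otimes> h) x"
    unfolding basis_mult[OF assms(1)] using assms
    by (auto simp: basis_elt_def inv_solve_left m_assoc[symmetric])
qed

lemma A_one_basis: "\<one>\<^bsub>A\<^esub> = (\<lambda>x. inverse (\<alpha> \<one> \<one>) * basis_elt \<one> x)"
  by (auto simp: TGA_one basis_elt_def)

lemma A_one_mult:
  assumes "f \<in> carrier A" shows "\<one>\<^bsub>A\<^esub> \<otimes>\<^bsub>A\<^esub> f = f"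
proof
  fix x show "(\<one>\<^bsub>A\<^esub> \<otimes>\<^bsub>A\<^esub> f) x = f x"
    using assms \<alpha>_one_left[of x] by (cases "x \<in> carrier G") (auto simp: A_one_basis A_scale_mult basis_mult)
qed

lemma mult_basis: "g \<in> carrier G ==> (f \<otimes>\<^bsub>A\<^esub> basis_elt g) x =
    (if x \<in> carrier G then f (x \<otimes> inv g) * \<alpha> (x \<otimes> inv g) g else 0)"
proof (cases "x \<in> carrier G")
  assume g: "g \<in> carrier G"
  case True
  have "(f \<otimes>\<^bsub>A\<^esub> basis_elt g) x = (\<Sum>k\<in>carrier G. if k = x \<otimes> inv g then f k * \<alpha> k g else 0)"
  proof -
    have "f k * basis_elt g (inv k \<otimes> x) * \<alpha> k (inv k \<otimes> x) = (if k = x \<otimes> inv g then f k * \<alpha> k g else 0)"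
      if k: "k \<in> carrier G" for k
    proof (cases "k = x \<otimes> inv g")
      case kx: True
      then have "inv k \<otimes> x = g"
        using inv_solve_left[OF g k True] inv_solve_right[OF k True g] by metis
      then show ?thesis using kx by (simp add: basis_elt_def)
    next
      case False
      then have "inv k \<otimes> x \<noteq> g"
        using inv_solve_left[OF g k True] inv_solve_right[OF k True g] by metis
      then show ?thesis using False by (simp add: basis_elt_def)
    qed
    then show ?thesis
      unfolding A_mult_left using True by (simp cong: sum.cong)
  qed
  then show ?thesis using fin g True by simp
qed (simp add: A_mult_left)

lemma A_mult_one:
  assumes "f \<in> carrier A" shows "f \<otimes>\<^bsub>A\<^esub> \<one>\<^bsub>A\<^esub> = f"
proof
  fix x show "(f \<otimes>\<^bsub>A\<^esub> \<one>\<^bsub>A\<^esub>) x = f x"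
    using assms \<alpha>_one_right[of x] by (cases "x \<in> carrier G") (auto simp: A_one_basis A_mult_scale mult_basis)
qed

lemma abelian_group_A: "abelian_group A"
proof (rule abelian_groupI)
  show "\<exists>y\<in>carrier A. y \<oplus>\<^bsub>A\<^esub> f = \<zero>\<^bsub>A\<^esub>" if "f \<in> carrier A" for f
    by (rule bexI[of _ "\<lambda>x. - f x"]) (use that in auto)
qed (auto simp: add_ac)

sublocale A: ring A
proof (rule ringI[OF abelian_group_A])
  show "Group.monoid A"
  proof (rule monoidI)
    show "f \<otimes>\<^bsub>A\<^esub> h \<in> carrier A" for f h by (simp add: A_mult_left)
    show "\<one>\<^bsub>A\<^esub> \<in> carrier A" by (simp add: TGA_one)
  qed (use A_assoc A_one_mult A_mult_one in \<open>blast+\<close>)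
qed (auto simp: A_add_mult A_mult_add)

sublocale Alg: complex_algebra A
proof -
  have "Module.module class_ring A"
    using abelian_group_A class_field
    by (intro Module.moduleI) (auto simp: algebra_simps field_def domain_def)
  then show "complex_algebra A"
    using A.ring_axioms
    by (simp add: complex_algebra_def complex_algebra_axioms_def A_scale_mult A_mult_scale)
qed

lemma basis_elt_closed [simp]: "g \<in> carrier G ==> basis_elt g \<in> carrier A"
  by (auto simp: basis_elt_def)

lemma A_finsum: "finite I ==> (\<And>i. i \<in> I ==> f i \<in> carrier A) ==> finsum A f I = (\<lambda>x. \<Sum>i\<in>I. f i x)"
proof (induction I rule: finite_induct)
  case (insert i I)
  then have "finsum A f (insert i I) = f i \<oplus>\<^bsub>A\<^esub> finsum A f I"
    by (intro A.finsum_insert) auto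
  then show ?case using insert by simp
qed simp

lemma A_minus: "f \<in> carrier A ==> \<ominus>\<^bsub>A\<^esub> f = (\<lambda>x. - f x)"
  by (rule A.minus_equality) auto

lemma A_expand: "f \<in> carrier A ==> f = finsum A (\<lambda>g. f g \<odot>\<^bsub>A\<^esub> basis_elt g) (carrier G)"
  using fin by (subst A_finsum) (auto simp: basis_elt_def fun_eq_iff if_distrib[of "\<lambda>t. _ * t"] cong: if_cong)

text \<open>The inverse of \<open>basis_elt g\<close>. As the unit is
  \<open>basis_elt \<one>\<close> divided by \<open>\<alpha> \<one> \<one>\<close>, the product of
  \<open>basis_elt (inv g)\<close> and \<open>basis_elt g\<close> is
  \<open>\<alpha> (inv g) g * \<alpha> \<one> \<one>\<close> times the unit.\<close>

definition basis_inv :: "'g \<Rightarrow> 'g \<Rightarrow> complex" where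
  "basis_inv g = (\<lambda>x. inverse (\<alpha> (inv g) g * \<alpha> \<one> \<one>) * basis_elt (inv g) x)"

lemma basis_inv_closed [simp]: "g \<in> carrier G ==> basis_inv g \<in> carrier A"
  by (auto simp: basis_elt_def basis_inv_def)

lemma basis_inv_mult [simp]: "g \<in> carrier G ==> basis_inv g \<otimes>\<^bsub>A\<^esub> basis_elt g = \<one>\<^bsub>A\<^esub>"
  by (simp add: basis_inv_def A_scale_mult basis_mult_basis A_one_basis fun_eq_iff)

lemma mult_basis_inv [simp]: "g \<in> carrier G ==> basis_elt g \<otimes>\<^bsub>A\<^esub> basis_inv g = \<one>\<^bsub>A\<^esub>"
  by (simp add: basis_inv_def A_mult_scale basis_mult_basis A_one_basis \<alpha>_inv fun_eq_iff)

end

section \<open>Semisimplicity\<close>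

context twisted
begin

text \<open>The dimension of a subspace, read off from its independent subsets. Only strict
  monotonicity is used, to pick minimal left ideals and smallest annihilators.\<close>

definition space_rank :: "('g \<Rightarrow> complex) set \<Rightarrow> nat" where
  "space_rank U = Max (card ` {S. S \<subseteq> U \<and> \<not> Alg.lin_dep S})"

text \<open>An independent subset of \<open>U\<close> of largest size has its span inside
  \<open>U\<close>, so a vector of \<open>V\<close> outside \<open>U\<close> extends it.\<close>

lemma space_rank_less:
  assumes UV: "U \<subset> V" and VA: "V \<subseteq> carrier A" and zero: "\<zero>\<^bsub>A\<^esub> \<in> U"
    and add: "\<And>f h. f \<in> U ==> h \<in> U ==> f \<oplus>\<^bsub>A\<^esub> h \<in> U"
    and scale: "\<And>c f. f \<in> U ==> c \<odot>\<^bsub>A\<^esub> f \<in> U"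
  shows "space_rank U < space_rank V"
proof -
  interpret vs: vectorspace "class_ring :: complex ring" A
    using Alg.module_axioms class_field by (simp add: vectorspace_def)
  have UA: "U \<subseteq> carrier A" using UV VA by blast
  have sub: "LinearCombinations.submodule class_ring U A"
    by (rule LinearCombinations.submodule.intro[OF Alg.module_axioms UA add zero scale])
  let ?b = "basis_elt ` carrier G :: ('g \<Rightarrow> complex) set"
  have bA: "?b \<subseteq> carrier A" using basis_elt_closed by blast
  have gen: "Alg.span ?b = carrier A"
  proof (intro equalityI subsetI)
    fix f assume f: "f \<in> carrier A"
    have sb: "LinearCombinations.submodule class_ring (Alg.span ?b) A"
      by (rule Alg.span_is_submodule[OF bA])
    have "finsum A (\<lambda>g. f g \<odot>\<^bsub>A\<^esub> basis_elt g) I \<in> Alg.span ?b" if "finite I" "I \<subseteq> carrier G" for I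
      using that
    proof (induction I rule: finite_induct)
      case empty
      then show ?case using LinearCombinations.submodule.zero_closed[OF sb] by simp
    next
      case (insert g I)
      have "basis_elt g \<in> Alg.span ?b"
        using Alg.in_own_span[OF bA] insert.prems by blast
      then have "f g \<odot>\<^bsub>A\<^esub> basis_elt g \<in> Alg.span ?b"
        using LinearCombinations.submodule.smult_closed[OF sb, of "f g" "basis_elt g"] by (simp del: TGA_simps)
      moreover have "finsum A (\<lambda>g. f g \<odot>\<^bsub>A\<^esub> basis_elt g) (insert g I)
          = f g \<odot>\<^bsub>A\<^esub> basis_elt g \<oplus>\<^bsub>A\<^esub> finsum A (\<lambda>g. f g \<odot>\<^bsub>A\<^esub> basis_elt g) I"
        using insert.hyps insert.prems Alg.smult_closed_complex[OF basis_elt_closed]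
        by (intro A.finsum_insert) (auto simp del: TGA_simps)
      ultimately show ?case
        using LinearCombinations.submodule.m_closed[OF sb] insert.IH insert.prems by simp
    qed
    from this[OF fin order_refl] show "f \<in> Alg.span ?b" using A_expand[OF f] by simp
  qed (use Alg.span_is_subset2[OF bA] in blast)
  \<comment> \<open>The basis elements of the group span \<open>A\<close> and bound the size of
    independent sets, so the maxima in \<open>space_rank\<close> are attained.\<close>
  have bound: "card S \<le> card ?b \<and> finite S" if "S \<subseteq> carrier A" "\<not> Alg.lin_dep S" for S
  proof -
    have "vs.fin_dim" unfolding vs.fin_dim_def using gen bA fin by (intro exI[of _ ?b]) simp
    then have "finite S" using that vs.fin_dim_li_fin by blast
    then show ?thesis using vs.li_smaller_than_gen[of S ?b] that gen bA fin by simp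
  qed
  have finite_cards: "finite (card ` {S. S \<subseteq> X \<and> \<not> Alg.lin_dep S})" if "X \<subseteq> carrier A" for X
    by (rule finite_subset[of _ "{..card ?b}"]) (use bound that in blast)+
  have "\<not> Alg.lin_dep {}" unfolding Alg.lin_dep_def by blast
  then have "card ` {S. S \<subseteq> U \<and> \<not> Alg.lin_dep S} \<noteq> {}" by blast
  from Max_in[OF finite_cards[OF UA] this]
  obtain S where S: "S \<subseteq> U" "\<not> Alg.lin_dep S" "card S = space_rank U"
    unfolding space_rank_def by auto
  obtain f where f: "f \<in> V" "f \<notin> U" using UV by blast
  have SA: "S \<subseteq> carrier A" and fA: "f \<in> carrier A" and fS: "f \<notin> S"
    using S(1) UA f VA by blast+
  have "f \<notin> Alg.span S" using Alg.span_is_subset[OF S(1) sub] f(2) by blast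
  then have "\<not> Alg.lin_dep (S \<union> {f})" using vs.lin_dep_iff_in_span[OF SA S(2) fA fS] by blast
  moreover have "S \<union> {f} \<subseteq> V" using S(1) UV f(1) by blast
  ultimately have "card (S \<union> {f}) \<le> space_rank V"
    unfolding space_rank_def by (intro Max_ge[OF finite_cards[OF VA]]) blast
  then show ?thesis using bound[OF SA S(2)] fS S(3) by simp
qed

text \<open>
  The moduli \<open>|\<alpha> g h|\<^sup>2\<close> form the coboundary of \<open>weight\<close>. This makes the adjoint of a left
  multiplication for the weighted inner product a left multiplication again.
\<close>

definition weight :: "'g \<Rightarrow> real" where
  "weight g = (\<Prod>k\<in>carrier G. cmod (\<alpha> g k)) powr (2 / card (carrier G))"

lemma weight_pos: "g \<in> carrier G ==> weight g > 0"
  by (simp add: weight_def prod_zero_iff fin)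

text \<open>Taking absolute values in the cocycle identity and multiplying over all \<open>k\<close>
  gives \<open>P g * P h = cmod (\<alpha> g h) ^ n * P (g \<otimes> h)\<close>, since translation by
  \<open>h\<close> permutes the group. The exponent \<open>2 / n\<close> extracts the
  \<open>n\<close>-th root and squares it.\<close>

lemma weight_mult:
  assumes g: "g \<in> carrier G" and h: "h \<in> carrier G"
  shows "weight g * weight h = (cmod (\<alpha> g h))\<^sup>2 * weight (g \<otimes> h)"
proof -
  define n where "n = card (carrier G)"
  define P where "P g = (\<Prod>k\<in>carrier G. cmod (\<alpha> g k))" for g
  have n: "n > 0" unfolding n_def using fin by (auto simp: card_gt_0_iff)
  have pos: "P g \<ge> 0" for g unfolding P_def by (simp add: prod_nonneg)
  have "cmod (\<alpha> g h) ^ n * P (g \<otimes> h) = (\<Prod>k\<in>carrier G. cmod (\<alpha> g h * \<alpha> (g \<otimes> h) k))"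
    by (simp add: P_def n_def norm_mult prod.distrib)
  also have "\<dots> = (\<Prod>k\<in>carrier G. cmod (\<alpha> g (h \<otimes> k) * \<alpha> h k))"
    using g h by (intro prod.cong) (simp_all add: \<alpha>_cocycle)
  also have "\<dots> = (\<Prod>k\<in>carrier G. cmod (\<alpha> g (h \<otimes> k))) * P h"
    by (simp add: P_def norm_mult prod.distrib)
  also have "(\<Prod>k\<in>carrier G. cmod (\<alpha> g (h \<otimes> k))) = P g"
    unfolding P_def
    by (rule prod.reindex_bij_witness[of _ "\<lambda>k. inv h \<otimes> k" "\<lambda>k. h \<otimes> k"])
      (use h in \<open>auto simp: m_assoc[symmetric]\<close>)
  finally have "P g * P h = cmod (\<alpha> g h) ^ n * P (g \<otimes> h)" by simp
  then have "P g powr (2 / n) * P h powr (2 / n) = (cmod (\<alpha> g h) ^ n) powr (2 / n) * P (g \<otimes> h) powr (2 / n)"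
    using pos by (simp add: powr_mult[symmetric])
  also have "(cmod (\<alpha> g h) ^ n) powr (2 / n) = (cmod (\<alpha> g h))\<^sup>2"
  proof -
    have "(cmod (\<alpha> g h) ^ n) powr (2 / n) = (cmod (\<alpha> g h) powr n) powr (2 / n)"
      using g h n by (simp add: powr_realpow)
    also have "\<dots> = cmod (\<alpha> g h) powr 2"
      using n by (simp add: powr_powr)
    finally show ?thesis using g h by simp
  qed
  finally show ?thesis by (simp add: weight_def P_def n_def)
qed

section \<open>The weighted inner product and its adjoints\<close>

definition form :: "('g \<Rightarrow> complex) \<Rightarrow> ('g \<Rightarrow> complex) \<Rightarrow> complex" where
  "form x y = (\<Sum>g\<in>carrier G. of_real (weight g) * cnj (x g) * y g)"

text \<open>Sends a combination of the basis elements with coefficients \<open>a g\<close> to the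
  combination of their inverses with coefficients \<open>cnj (a g)\<close> times
  \<open>weight g\<close>; the denominator is that of \<open>basis_inv\<close>. For a unimodular
  cocycle this is the usual star operation.\<close>

definition adj :: "('g \<Rightarrow> complex) \<Rightarrow> 'g \<Rightarrow> complex" where
  "adj a h = (if h \<in> carrier G
    then cnj (a (inv h)) * (of_real (weight (inv h)) / (\<alpha> h (inv h) * \<alpha> \<one> \<one>)) else 0)"

lemma adj_closed [simp]: "adj a \<in> carrier A"
  by (simp add: adj_def)

lemma form_definite:
  assumes "x \<in> carrier A" "form x x = 0" shows "x = \<zero>\<^bsub>A\<^esub>"
proof -
  have "form x x = of_real (\<Sum>g\<in>carrier G. weight g * (cmod (x g))\<^sup>2)"
    unfolding form_def of_real_sum
    by (rule sum.cong) (simp_all add: complex_norm_square mult_ac del: of_real_power)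
  then have "(\<Sum>g\<in>carrier G. weight g * (cmod (x g))\<^sup>2) = 0"
    using assms(2) by (metis of_real_eq_0_iff)
  then have "\<forall>g\<in>carrier G. weight g * (cmod (x g))\<^sup>2 = 0"
    using fin by (subst (asm) sum_nonneg_eq_0_iff) (auto simp: weight_pos less_imp_le)
  then have "x g = 0" if "g \<in> carrier G" for g
    using that weight_pos[OF that] by auto
  then show ?thesis using assms(1) by auto
qed

text \<open>Both sides expand over pairs of group elements, with \<open>z = g \<otimes> h\<close> on
  the left; the coefficients agree by \<open>weight_mult\<close> and the cocycle identity for
  \<open>inv g\<close>, \<open>g\<close>, \<open>h\<close>.\<close>

lemma form_adj:
  assumes "a \<in> carrier A" "x \<in> carrier A" "y \<in> carrier A"
  shows "form (a \<otimes>\<^bsub>A\<^esub> x) y = form x (adj a \<otimes>\<^bsub>A\<^esub> y)"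
proof -
  have "form (a \<otimes>\<^bsub>A\<^esub> x) y = (\<Sum>z\<in>carrier G. \<Sum>g\<in>carrier G.
      of_real (weight z) * cnj (a g * x (inv g \<otimes> z) * \<alpha> g (inv g \<otimes> z)) * y z)"
    unfolding form_def
    by (intro sum.cong refl) (simp add: A_mult_left sum_distrib_left sum_distrib_right cnj_sum)
  also have "\<dots> = (\<Sum>g\<in>carrier G. \<Sum>z\<in>carrier G.
      of_real (weight z) * cnj (a g * x (inv g \<otimes> z) * \<alpha> g (inv g \<otimes> z)) * y z)"
    by (rule sum.swap)
  also have "\<dots> = (\<Sum>g\<in>carrier G. \<Sum>h\<in>carrier G.
      of_real (weight h) * cnj (x h) * (adj a (inv g) * y (g \<otimes> h) * \<alpha> (inv g) (g \<otimes> h)))"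
  proof (rule sum.cong[OF refl])
    fix g assume g: "g \<in> carrier G"
    have "(\<Sum>z\<in>carrier G. of_real (weight z) * cnj (a g * x (inv g \<otimes> z) * \<alpha> g (inv g \<otimes> z)) * y z)
        = (\<Sum>h\<in>carrier G. of_real (weight (g \<otimes> h)) * cnj (a g * x h * \<alpha> g h) * y (g \<otimes> h))"
      by (rule sum.reindex_bij_witness[of _ "\<lambda>h. g \<otimes> h" "\<lambda>z. inv g \<otimes> z"])
        (use g in \<open>auto simp: m_assoc[symmetric]\<close>)
    also have "\<dots> = (\<Sum>h\<in>carrier G.
        of_real (weight h) * cnj (x h) * (adj a (inv g) * y (g \<otimes> h) * \<alpha> (inv g) (g \<otimes> h)))"
    proof (rule sum.cong[OF refl])
      fix h assume h: "h \<in> carrier G"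
      have co: "\<alpha> (inv g) g * \<alpha> \<one> \<one> = \<alpha> (inv g) (g \<otimes> h) * \<alpha> g h"
        using \<alpha>_cocycle[of "inv g" g h] g h \<alpha>_one_left[OF h] by simp
      have nz: "\<alpha> (inv g) g * \<alpha> \<one> \<one> \<noteq> 0" "\<alpha> g h \<noteq> 0" using g h by simp_all
      \<comment> \<open>\<open>weight_mult\<close> trades the conjugate of
        \<open>\<alpha> g h\<close> for its inverse, which the identity \<open>co\<close> turns into
        the factor \<open>\<alpha> (inv g) (g \<otimes> h)\<close> of the other side.\<close>
      have "of_real (weight (g \<otimes> h)) * (cnj (\<alpha> g h) * \<alpha> g h)
          = (of_real ((cmod (\<alpha> g h))\<^sup>2 * weight (g \<otimes> h)) :: complex)"
        by (simp add: complex_norm_square mult_ac del: of_real_power)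
      also have "\<dots> = of_real (weight g) * of_real (weight h)"
        unfolding weight_mult[OF g h, symmetric] by simp
      finally have "of_real (weight (g \<otimes> h)) * cnj (\<alpha> g h) * \<alpha> g h
          = (of_real (weight g) * of_real (weight h) :: complex)"
        by (simp add: mult_ac)
      then have "of_real (weight (g \<otimes> h)) * cnj (\<alpha> g h) =
          of_real (weight g) * of_real (weight h) / \<alpha> g h"
        using nz by (simp add: field_simps)
      also have "\<dots> = of_real (weight h) * (of_real (weight g) / (\<alpha> (inv g) g * \<alpha> \<one> \<one>)) *
          \<alpha> (inv g) (g \<otimes> h)"
        using nz unfolding co by (simp add: field_simps)
      finally have w: "of_real (weight (g \<otimes> h)) * cnj (\<alpha> g h) = of_real (weight h) *
          (of_real (weight g) / (\<alpha> (inv g) g * \<alpha> \<one> \<one>)) * \<alpha> (inv g) (g \<otimes> h)" .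
      have "of_real (weight (g \<otimes> h)) * cnj (a g * x h * \<alpha> g h) * y (g \<otimes> h) =
          (of_real (weight (g \<otimes> h)) * cnj (\<alpha> g h)) * cnj (a g) * cnj (x h) * y (g \<otimes> h)"
        by (simp add: mult_ac)
      also have "\<dots> = of_real (weight h) * cnj (x h) * (adj a (inv g) * y (g \<otimes> h) * \<alpha> (inv g) (g \<otimes> h))"
        unfolding w using g by (simp add: adj_def mult_ac)
      finally show "of_real (weight (g \<otimes> h)) * cnj (a g * x h * \<alpha> g h) * y (g \<otimes> h) =
          of_real (weight h) * cnj (x h) * (adj a (inv g) * y (g \<otimes> h) * \<alpha> (inv g) (g \<otimes> h))" .
    qed
    finally show "(\<Sum>z\<in>carrier G. of_real (weight z) * cnj (a g * x (inv g \<otimes> z) * \<alpha> g (inv g \<otimes> z)) * y z)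
        = (\<Sum>h\<in>carrier G.
        of_real (weight h) * cnj (x h) * (adj a (inv g) * y (g \<otimes> h) * \<alpha> (inv g) (g \<otimes> h)))" .
  qed
  also have "\<dots> = (\<Sum>h\<in>carrier G. \<Sum>g\<in>carrier G.
      of_real (weight h) * cnj (x h) * (adj a (inv g) * y (g \<otimes> h) * \<alpha> (inv g) (g \<otimes> h)))"
    by (rule sum.swap)
  also have "\<dots> = (\<Sum>h\<in>carrier G. of_real (weight h) * cnj (x h) * (adj a \<otimes>\<^bsub>A\<^esub> y) h)"
  proof (rule sum.cong[OF refl])
    fix h assume h: "h \<in> carrier G"
    have "(\<Sum>g\<in>carrier G. adj a (inv g) * y (g \<otimes> h) * \<alpha> (inv g) (g \<otimes> h)) = (adj a \<otimes>\<^bsub>A\<^esub> y) h"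
      using h by (simp add: A_mult_left)
        (rule sum.reindex_bij_witness[of _ "\<lambda>g. inv g" "\<lambda>g. inv g"], auto)
    then show "(\<Sum>g\<in>carrier G.
        of_real (weight h) * cnj (x h) * (adj a (inv g) * y (g \<otimes> h) * \<alpha> (inv g) (g \<otimes> h)))
        = of_real (weight h) * cnj (x h) * (adj a \<otimes>\<^bsub>A\<^esub> y) h"
      by (simp add: sum_distrib_left[symmetric])
  qed
  finally show ?thesis by (simp add: form_def)
qed

section \<open>Left ideals and the vanishing of the radical\<close>

definition left_ideal :: "('g \<Rightarrow> complex) set \<Rightarrow> bool" where
  "left_ideal L \<longleftrightarrow> L \<subseteq> carrier A \<and> \<zero>\<^bsub>A\<^esub> \<in> L \<and> (\<forall>x\<in>L. \<forall>y\<in>L. x \<oplus>\<^bsub>A\<^esub> y \<in> L) \<and>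
     (\<forall>a\<in>carrier A. \<forall>x\<in>L. a \<otimes>\<^bsub>A\<^esub> x \<in> L)"

lemma left_ideal_scale:
  assumes "left_ideal L" "x \<in> L" shows "c \<odot>\<^bsub>A\<^esub> x \<in> L"
proof -
  have "x \<in> carrier A" using assms by (auto simp: left_ideal_def)
  then have "c \<odot>\<^bsub>A\<^esub> x = (c \<odot>\<^bsub>A\<^esub> \<one>\<^bsub>A\<^esub>) \<otimes>\<^bsub>A\<^esub> x"
    by (rule Alg.scalar_mult_left[symmetric])
  moreover have "c \<odot>\<^bsub>A\<^esub> \<one>\<^bsub>A\<^esub> \<in> carrier A" by (rule Alg.scalar_closed)
  ultimately show ?thesis using assms unfolding left_ideal_def by metis
qed

text \<open>A left ideal seen as a module. Its elements have the type of the ring elements, as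
  \<open>Irr\<close> demands of its representatives.\<close>

definition ideal_module :: "('g \<Rightarrow> complex) set \<Rightarrow> ('g \<Rightarrow> complex, 'g \<Rightarrow> complex) module" where
  "ideal_module L = \<lparr>carrier = L, monoid.mult = undefined, one = undefined, ring.zero = \<zero>\<^bsub>A\<^esub>,
     add = add A, Module.module.smult = monoid.mult A\<rparr>"

lemma ideal_module_simps [simp]:
  "carrier (ideal_module L) = L" "\<zero>\<^bsub>ideal_module L\<^esub> = \<zero>\<^bsub>A\<^esub>"
  "x \<oplus>\<^bsub>ideal_module L\<^esub> y = x \<oplus>\<^bsub>A\<^esub> y" "a \<odot>\<^bsub>ideal_module L\<^esub> x = a \<otimes>\<^bsub>A\<^esub> x"
  by (simp_all add: ideal_module_def)

lemma left_module_ideal_module: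
  assumes "left_ideal L" shows "left_module A (ideal_module L)"
proof -
  have L: "x \<in> carrier A" if "x \<in> L" for x using assms that by (auto simp: left_ideal_def)
  note l = assms[unfolded left_ideal_def]
  have "abelian_group (ideal_module L)"
  proof (rule abelian_groupI)
    fix x assume x: "x \<in> carrier (ideal_module L)"
    show "\<exists>y\<in>carrier (ideal_module L). y \<oplus>\<^bsub>ideal_module L\<^esub> x = \<zero>\<^bsub>ideal_module L\<^esub>"
      by (rule bexI[of _ "(- 1) \<odot>\<^bsub>A\<^esub> x"]) (use left_ideal_scale[OF assms, of x "- 1"] x in auto)
  qed (use l in \<open>auto simp: add_ac\<close>)
  then show ?thesis
    unfolding left_module_def left_module_axioms_def using A.ring_axioms l
    by (auto simp: A.l_distr A.r_distr A.m_assoc L simp del: TGA_simps)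
qed

text \<open>The Jacobson radical is zero. A minimal left ideal inside the common annihilator
  \<open>J\<close> of the irreducible modules would itself be irreducible, hence killed by
  \<open>J\<close>; the positive definite form excludes this.\<close>

lemma irreducible_faithful:
  assumes "b \<in> carrier A" "b \<noteq> \<zero>\<^bsub>A\<^esub>"
  shows "\<exists>M :: ('g \<Rightarrow> complex, 'g \<Rightarrow> complex) module.
    irreducible_module A M \<and> (\<exists>m\<in>carrier M. b \<odot>\<^bsub>M\<^esub> m \<noteq> \<zero>\<^bsub>M\<^esub>)"
proof (rule ccontr)
  assume none: "\<not> ?thesis"
  define J where "J = {a \<in> carrier A. \<forall>M :: ('g \<Rightarrow> complex, 'g \<Rightarrow> complex) module.
    irreducible_module A M \<longrightarrow> (\<forall>m\<in>carrier M. a \<odot>\<^bsub>M\<^esub> m = \<zero>\<^bsub>M\<^esub>)}"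
  have JA: "J \<subseteq> carrier A" by (auto simp: J_def)
  have bJ: "b \<in> J" using none assms by (auto simp: J_def)
  have J0: "a \<odot>\<^bsub>M\<^esub> m = \<zero>\<^bsub>M\<^esub>" if "a \<in> J" "irreducible_module A M" "m \<in> carrier M"
    for a m and M :: "('g \<Rightarrow> complex, 'g \<Rightarrow> complex) module"
    using that by (auto simp: J_def)
  have lm: "left_module A M" if "irreducible_module A M"
    for M :: "('g \<Rightarrow> complex, 'g \<Rightarrow> complex) module"
    using that by (rule irreducible_left_module)
  have JI: "left_ideal J"
    unfolding left_ideal_def
  proof (intro conjI ballI)
    show "J \<subseteq> carrier A" by (rule JA)
    show "\<zero>\<^bsub>A\<^esub> \<in> J"
      unfolding J_def using left_module.smult_zero_left[OF lm] A.zero_closed by blast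
    fix x y assume x: "x \<in> J" and y: "y \<in> J"
    have "x \<in> carrier A" "y \<in> carrier A" using x y JA by auto
    moreover have "(x \<oplus>\<^bsub>A\<^esub> y) \<odot>\<^bsub>M\<^esub> m = \<zero>\<^bsub>M\<^esub>" if M: "irreducible_module A M" "m \<in> carrier M"
      for m and M :: "('g \<Rightarrow> complex, 'g \<Rightarrow> complex) module"
    proof -
      interpret M: left_module A M by (rule lm[OF M(1)])
      show ?thesis
        using M.smult_l_distr[OF calculation M(2)] J0[OF x M] J0[OF y M] by simp
    qed
    ultimately show "x \<oplus>\<^bsub>A\<^esub> y \<in> J"
      unfolding J_def using A.a_closed by blast
  next
    fix a x assume a: "a \<in> carrier A" and x: "x \<in> J"
    have "x \<in> carrier A" using x JA by auto
    then show "a \<otimes>\<^bsub>A\<^esub> x \<in> J"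
      unfolding J_def using a J0[OF x] left_module.smult_assoc[OF lm, of _ a x]
        left_module.smult_zero_right[OF lm, of _ a]
      by (auto simp del: TGA_simps)
  qed
  have JR: "x \<otimes>\<^bsub>A\<^esub> a \<in> J" if x: "x \<in> J" and a: "a \<in> carrier A" for a x
  proof -
    have "x \<in> carrier A" using x JA by auto
    then show ?thesis
      unfolding J_def using a J0[OF x] left_module.smult_assoc[OF lm, of _ x a]
        left_module.smult_closed[OF lm, of _ a]
      by (auto simp del: TGA_simps)
  qed
  \<comment> \<open>A nonzero left ideal inside \<open>J\<close> of least rank is minimal: a proper
    nonzero left ideal in it would have smaller rank.\<close>
  let ?P = "\<lambda>L. left_ideal L \<and> L \<subseteq> J \<and> L \<noteq> {\<zero>\<^bsub>A\<^esub>}"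
  have "?P J" using JI bJ assms by auto
  then obtain L where L: "?P L" and min: "\<And>L'. ?P L' ==> space_rank L \<le> space_rank L'"
    using ex_has_least_nat[of ?P J space_rank] by blast
  have LI: "left_ideal L" and LJ: "L \<subseteq> J" using L by auto
  have LA: "L \<subseteq> carrier A" using LJ JA by auto
  have irr: "irreducible_module A (ideal_module L)"
    unfolding irreducible_module_def
  proof (intro conjI allI impI)
    show "left_module A (ideal_module L)" by (rule left_module_ideal_module[OF LI])
    show "carrier (ideal_module L) \<noteq> {\<zero>\<^bsub>ideal_module L\<^esub>}" using L by simp
    fix H assume H: "Module.submodule H A (ideal_module L)"
    note h = submodD[OF H, unfolded ideal_module_simps]
    have HI: "left_ideal H"
      unfolding left_ideal_def using h LA by blast
    show "H = {\<zero>\<^bsub>ideal_module L\<^esub>} \<or> H = carrier (ideal_module L)"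
    proof (rule ccontr)
      assume c: "\<not> ?thesis"
      then have "H \<subset> L" "H \<noteq> {\<zero>\<^bsub>A\<^esub>}" using h(1) by auto
      then have "space_rank H < space_rank L"
        using LA HI left_ideal_scale[OF HI] by (intro space_rank_less) (auto simp: left_ideal_def)
      moreover have "space_rank L \<le> space_rank H"
        using min[of H] HI \<open>H \<subset> L\<close> \<open>H \<noteq> {\<zero>\<^bsub>A\<^esub>}\<close> LJ by auto
      ultimately show False by simp
    qed
  qed
  \<comment> \<open>\<open>L\<close> is now one of the irreducible modules that \<open>J\<close>
    annihilates.\<close>
  have kill: "x \<otimes>\<^bsub>A\<^esub> y = \<zero>\<^bsub>A\<^esub>" if "x \<in> J" "y \<in> L" for x y
    using J0[OF that(1) irr] that(2) by simp
  obtain x where x: "x \<in> L" "x \<noteq> \<zero>\<^bsub>A\<^esub>"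
    using L LI by (auto simp: left_ideal_def)
  have xA: "x \<in> carrier A" using x LA by auto
  \<comment> \<open>The value \<open>form t t\<close> equals \<open>form (x t) x\<close>, and
    \<open>x t\<close> vanishes as \<open>x\<close> lies in \<open>J\<close> and \<open>t\<close> in
    \<open>L\<close>. So \<open>t\<close> is zero, and then \<open>form x x\<close>, which moving
    \<open>x\<close> across turns into the form of the unit and \<open>t\<close>, is zero as
    well.\<close>
  define t where "t = adj x \<otimes>\<^bsub>A\<^esub> x"
  have tL: "t \<in> L" using LI x adj_closed unfolding left_ideal_def t_def by blast
  have tA: "t \<in> carrier A" using tL LA by auto
  have "form t t = form t (adj x \<otimes>\<^bsub>A\<^esub> x)" by (simp add: t_def)
  also have "\<dots> = form (x \<otimes>\<^bsub>A\<^esub> t) x" by (rule form_adj[OF xA tA xA, symmetric])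
  also have "x \<otimes>\<^bsub>A\<^esub> t = \<zero>\<^bsub>A\<^esub>" using kill[of x t] x LJ tL by auto
  finally have "form t t = 0" by (simp add: form_def)
  then have t0: "t = \<zero>\<^bsub>A\<^esub>" by (rule form_definite[OF tA])
  have "form x x = form (x \<otimes>\<^bsub>A\<^esub> \<one>\<^bsub>A\<^esub>) x" using A.r_one[OF xA] by simp
  also have "\<dots> = form \<one>\<^bsub>A\<^esub> (adj x \<otimes>\<^bsub>A\<^esub> x)" by (rule form_adj[OF xA A.one_closed xA])
  also have "\<dots> = 0" using t0 by (simp add: form_def t_def)
  finally have "x = \<zero>\<^bsub>A\<^esub>" by (rule form_definite[OF xA])
  then show False using x by simp
qed

end

section \<open>Central idempotents\<close>

lemma (in complex_left_module) coord_agree: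
  assumes co: "coord_system R M I b \<kappa>" and a: "a \<in> carrier R" "a' \<in> carrier R"
    and eq: "\<And>i. i \<in> I ==> a \<odot>\<^bsub>M\<^esub> b i = a' \<odot>\<^bsub>M\<^esub> b i" and m: "m \<in> carrier M"
  shows "a \<odot>\<^bsub>M\<^esub> m = a' \<odot>\<^bsub>M\<^esub> m"
proof -
  note c = coord_systemD[OF co]
  have x: "x \<odot>\<^bsub>M\<^esub> m = finsum M (\<lambda>i. cscale R M (\<kappa> i m) (x \<odot>\<^bsub>M\<^esub> b i)) I" if "x \<in> carrier R" for x
  proof -
    have "x \<odot>\<^bsub>M\<^esub> m = x \<odot>\<^bsub>M\<^esub> finsum M (\<lambda>i. cscale R M (\<kappa> i m) (b i)) I"
      using c(6)[OF m] by simp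
    also have "\<dots> = finsum M (\<lambda>i. x \<odot>\<^bsub>M\<^esub> cscale R M (\<kappa> i m) (b i)) I"
      by (rule smult_finsum_right) (use c(2) that in auto)
    also have "\<dots> = finsum M (\<lambda>i. cscale R M (\<kappa> i m) (x \<odot>\<^bsub>M\<^esub> b i)) I"
      by (rule M.finsum_cong') (use c(2) that in \<open>auto simp: smult_cscale smult_closed\<close>)
    finally show ?thesis .
  qed
  have "finsum M (\<lambda>i. cscale R M (\<kappa> i m) (a \<odot>\<^bsub>M\<^esub> b i)) I =
      finsum M (\<lambda>i. cscale R M (\<kappa> i m) (a' \<odot>\<^bsub>M\<^esub> b i)) I"
    by (rule M.finsum_cong') (use c(2) a eq in \<open>auto simp: smult_closed\<close>)
  then show ?thesis using x a by simp
qed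

lemma isomorphic_agree:
  assumes iso: "module_isomorphic R M M'" and lm: "left_module R M"
    and a: "a \<in> carrier R" "a' \<in> carrier R"
    and eq: "\<And>m. m \<in> carrier M ==> a \<odot>\<^bsub>M\<^esub> m = a' \<odot>\<^bsub>M\<^esub> m" and m: "m \<in> carrier M'"
  shows "a \<odot>\<^bsub>M'\<^esub> m = a' \<odot>\<^bsub>M'\<^esub> m"
proof -
  obtain f where f: "f \<in> LinearCombinations.module_hom R M M'" "bij_betw f (carrier M) (carrier M')"
    using iso by (auto simp: module_isomorphic_def)
  then obtain n where n: "n \<in> carrier M" "m = f n"
    using m by (auto simp: bij_betw_def)
  show ?thesis
    using module_homD(3)[OF f(1) a(1) n(1)] module_homD(3)[OF f(1) a(2) n(1)] eq[OF n(1)] n(2) by simp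
qed

lemma isomorphic_agree_zero:
  assumes iso: "module_isomorphic R M M'" and lm: "left_module R M" "left_module R M'"
    and a: "a \<in> carrier R" and eq: "\<And>m. m \<in> carrier M ==> a \<odot>\<^bsub>M\<^esub> m = \<zero>\<^bsub>M\<^esub>"
    and m: "m \<in> carrier M'"
  shows "a \<odot>\<^bsub>M'\<^esub> m = \<zero>\<^bsub>M'\<^esub>"
proof -
  interpret M: left_module R M by fact
  interpret M': left_module R M' by fact
  show ?thesis
    using isomorphic_agree[OF iso lm(1) a M.R.zero_closed _ m] eq m by simp
qed

lemma finsum_mem:
  assumes "abelian_group M" "H \<subseteq> carrier M" "\<zero>\<^bsub>M\<^esub> \<in> H" "\<And>m n. m \<in> H ==> n \<in> H ==> m \<oplus>\<^bsub>M\<^esub> n \<in> H"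
    and "\<And>i. i \<in> I ==> x i \<in> H"
  shows "finsum M x I \<in> H"
proof -
  interpret M: abelian_group M by fact
  show ?thesis
    using assms(5)
  proof (induction I rule: infinite_finite_induct)
    case (insert i I)
    have "x i \<in> carrier M" "x \<in> I \<rightarrow> carrier M" using insert.prems assms(2) by auto
    then show ?case using insert assms(4) by (simp add: M.finsum_insert)
  qed (use assms(3) in auto)
qed

lemma module_type_self: "irreducible_module R M ==> M \<in> module_type R M"
  by (simp add: module_type_def module_isomorphic_refl)

lemma module_type_in_Irr: "irreducible_module R M ==> module_type R M \<in> Irr R"
  by (auto simp: Irr_def)

lemma Irr_member:
  assumes "c \<in> Irr R" "M \<in> c" shows "irreducible_module R M" "module_type R M = c"
proof -
  obtain M' where M': "irreducible_module R M'" "c = module_type R M'"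
    using assms(1) by (auto simp: Irr_def)
  then show i: "irreducible_module R M" using assms(2) by (auto simp: module_type_def)
  show "module_type R M = c"
    using M' assms(2) i module_type_eq_iff[OF M'(1) i] by (auto simp: module_type_def)
qed

context twisted
begin

section \<open>Finiteness of the set of isomorphism types\<close>

lemma complex_left_module_A: "left_module A M ==> complex_left_module A M"
  by (simp add: complex_left_module_def Alg.complex_algebra_axioms)

text \<open>The images of any nonzero \<open>m\<close> under the finitely many basis elements span
  \<open>M\<close>, because \<open>m\<close> generates \<open>M\<close>.\<close>

lemma irreducible_coord_system:
  fixes M :: "('g \<Rightarrow> complex, 'm) module"
  assumes irr: "irreducible_module A M"
  shows "\<exists>\<beta> \<kappa>. coord_system A M \<beta> (\<lambda>x. x) \<kappa> \<and> card \<beta> = complex_dim A M"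
proof -
  interpret complex_left_module A M
    using irr by (intro complex_left_module_A irreducible_left_module)
  obtain m where m: "m \<in> carrier M" "m \<noteq> \<zero>\<^bsub>M\<^esub>"
    using irreducible_nonzero[OF irr] by auto
  show ?thesis
  proof (rule coord_system_exists[of "(\<lambda>g. basis_elt g \<odot>\<^bsub>M\<^esub> m) ` carrier G"])
    show "finite ((\<lambda>g. basis_elt g \<odot>\<^bsub>M\<^esub> m) ` carrier G)" using fin by simp
    show "(\<lambda>g. basis_elt g \<odot>\<^bsub>M\<^esub> m) ` carrier G \<subseteq> carrier M"
      using m basis_elt_closed by (auto intro!: smult_closed simp del: TGA_simps)
    fix H assume H: "H \<subseteq> carrier M" "(\<lambda>g. basis_elt g \<odot>\<^bsub>M\<^esub> m) ` carrier G \<subseteq> H" "\<zero>\<^bsub>M\<^esub> \<in> H"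
      "\<And>m n. m \<in> H ==> n \<in> H ==> m \<oplus>\<^bsub>M\<^esub> n \<in> H" "\<And>c m. m \<in> H ==> cscale A M c m \<in> H"
    have "n \<in> H" if n: "n \<in> carrier M" for n
    proof -
      obtain a where a: "a \<in> carrier A" "a \<odot>\<^bsub>M\<^esub> m = n"
        using irreducible_transitive[OF irr m n] by auto
      have "n = finsum A (\<lambda>g. a g \<odot>\<^bsub>A\<^esub> basis_elt g) (carrier G) \<odot>\<^bsub>M\<^esub> m"
        using A_expand[OF a(1)] a(2) by metis
      also have "\<dots> = finsum M (\<lambda>g. (a g \<odot>\<^bsub>A\<^esub> basis_elt g) \<odot>\<^bsub>M\<^esub> m) (carrier G)"
        by (rule smult_finsum_left[OF _ m(1)]) (intro Alg.smult_closed_complex basis_elt_closed)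
      also have "\<dots> \<in> H"
      proof (rule finsum_mem[OF M.abelian_group_axioms H(1,3,4)])
        fix g assume g: "g \<in> carrier G"
        have "(a g \<odot>\<^bsub>A\<^esub> basis_elt g) \<odot>\<^bsub>M\<^esub> m = cscale A M (a g) (basis_elt g \<odot>\<^bsub>M\<^esub> m)"
          by (rule smult_smult[OF basis_elt_closed[OF g] m(1)])
        then show "(a g \<odot>\<^bsub>A\<^esub> basis_elt g) \<odot>\<^bsub>M\<^esub> m \<in> H" using H(2,5) g by auto
      qed
      finally show ?thesis .
    qed
    then show "H = carrier M" using H(1) by auto
  qed
qed

text \<open>At this point the types are not known to be finite in number. A finite family whose
  annihilator has least rank is faithful, since an element surviving in the annihilator could be
  removed by adding one irreducible module on which it acts nontrivially.\<close>

lemma finite_faithful_family: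
  "\<exists>F :: ('g \<Rightarrow> complex, 'g \<Rightarrow> complex) module set. finite F \<and> (\<forall>M\<in>F. irreducible_module A M) \<and>
     (\<forall>b\<in>carrier A. (\<forall>M\<in>F. \<forall>m\<in>carrier M. b \<odot>\<^bsub>M\<^esub> m = \<zero>\<^bsub>M\<^esub>) \<longrightarrow> b = \<zero>\<^bsub>A\<^esub>)"
proof -
  define ann where "ann F = {b \<in> carrier A. \<forall>M\<in>F. \<forall>m\<in>carrier M. b \<odot>\<^bsub>M\<^esub> m = \<zero>\<^bsub>M\<^esub>}"
    for F :: "('g \<Rightarrow> complex, 'g \<Rightarrow> complex) module set"
  have ann0: "f \<odot>\<^bsub>N\<^esub> n = \<zero>\<^bsub>N\<^esub>" if "f \<in> ann F" "N \<in> F" "n \<in> carrier N" for f F N n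
    using that by (auto simp: ann_def)
  let ?P = "\<lambda>F :: ('g \<Rightarrow> complex, 'g \<Rightarrow> complex) module set. finite F \<and> (\<forall>M\<in>F. irreducible_module A M)"
  have "?P {}" by simp
  then obtain F where F: "?P F" and min: "\<And>F'. ?P F' ==> space_rank (ann F) \<le> space_rank (ann F')"
    using ex_has_least_nat[of ?P "{}" "\<lambda>F. space_rank (ann F)"] by blast
  have "b = \<zero>\<^bsub>A\<^esub>" if b: "b \<in> ann F" for b
  proof (rule ccontr)
    assume "b \<noteq> \<zero>\<^bsub>A\<^esub>"
    then obtain M :: "('g \<Rightarrow> complex, 'g \<Rightarrow> complex) module" and m
      where M: "irreducible_module A M" "m \<in> carrier M" "b \<odot>\<^bsub>M\<^esub> m \<noteq> \<zero>\<^bsub>M\<^esub>"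
      using irreducible_faithful[of b] b by (auto simp: ann_def simp del: TGA_simps)
    have P: "?P (insert M F)" using F M by auto
    have lm: "complex_left_module A N" if "N \<in> insert M F" for N
      using P that by (auto intro: complex_left_module_A irreducible_left_module)
    have "space_rank (ann (insert M F)) < space_rank (ann F)"
    proof (rule space_rank_less)
      have "b \<notin> ann (insert M F)" using M by (auto simp: ann_def)
      then show "ann (insert M F) \<subset> ann F" using b by (auto simp: ann_def simp del: TGA_simps)
      show "ann F \<subseteq> carrier A" by (auto simp: ann_def simp del: TGA_simps)
      show "\<zero>\<^bsub>A\<^esub> \<in> ann (insert M F)"
      proof -
        have "\<zero>\<^bsub>A\<^esub> \<odot>\<^bsub>N\<^esub> n = \<zero>\<^bsub>N\<^esub>" if N: "N \<in> insert M F" "n \<in> carrier N" for N n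
        proof -
          interpret N: complex_left_module A N by (rule lm[OF N(1)])
          show ?thesis by (rule N.smult_zero_left[OF N(2)])
        qed
        then show ?thesis unfolding ann_def using A.zero_closed by blast
      qed
      show "f \<oplus>\<^bsub>A\<^esub> h \<in> ann (insert M F)" if fh: "f \<in> ann (insert M F)" "h \<in> ann (insert M F)" for f h
      proof -
        have "f \<in> carrier A" "h \<in> carrier A" using fh by (auto simp: ann_def simp del: TGA_simps)
        moreover have "(f \<oplus>\<^bsub>A\<^esub> h) \<odot>\<^bsub>N\<^esub> n = \<zero>\<^bsub>N\<^esub>" if N: "N \<in> insert M F" "n \<in> carrier N" for N n
        proof -
          interpret N: complex_left_module A N by (rule lm[OF N(1)])
          show ?thesis
            using N.smult_l_distr[OF calculation N(2)] ann0[OF fh(1) N] ann0[OF fh(2) N] by simp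
        qed
        ultimately show ?thesis unfolding ann_def using A.a_closed by blast
      qed
      show "c \<odot>\<^bsub>A\<^esub> f \<in> ann (insert M F)" if f: "f \<in> ann (insert M F)" for c f
      proof -
        have fA: "f \<in> carrier A" using f by (auto simp: ann_def simp del: TGA_simps)
        have "(c \<odot>\<^bsub>A\<^esub> f) \<odot>\<^bsub>N\<^esub> n = \<zero>\<^bsub>N\<^esub>" if N: "N \<in> insert M F" "n \<in> carrier N" for N n
        proof -
          interpret N: complex_left_module A N by (rule lm[OF N(1)])
          show ?thesis
            using N.smult_smult[OF fA N(2)] ann0[OF f N] by simp
        qed
        then show ?thesis unfolding ann_def using Alg.smult_closed_complex[OF fA] by blast
      qed
    qed
    then show False using min[OF P] by simp
  qed
  then show ?thesis
    using F by (intro exI[of _ F]) (auto simp: ann_def simp del: TGA_simps)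
qed

text \<open>A finite faithful family represents all types. For \<open>M\<close> isomorphic to none
  of its members, an element killing bases of all members is zero and so kills \<open>M\<close>; the
  density theorem then makes every coordinate functional vanish on \<open>M\<close>.\<close>

lemma finite_irreducible_representatives:
  "\<exists>F :: ('g \<Rightarrow> complex, 'g \<Rightarrow> complex) module set. finite F \<and> (\<forall>M\<in>F. irreducible_module A M) \<and>
     (\<forall>M :: ('g \<Rightarrow> complex, 'g \<Rightarrow> complex) module. irreducible_module A M \<longrightarrow>
       (\<exists>N\<in>F. module_isomorphic A N M))"
proof -
  obtain F :: "('g \<Rightarrow> complex, 'g \<Rightarrow> complex) module set"
    where F': "finite F" "\<forall>M\<in>F. irreducible_module A M"
      and faith': "\<forall>b\<in>carrier A. (\<forall>M\<in>F. \<forall>m\<in>carrier M. b \<odot>\<^bsub>M\<^esub> m = \<zero>\<^bsub>M\<^esub>) \<longrightarrow> b = \<zero>\<^bsub>A\<^esub>"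
    using finite_faithful_family by (elim exE conjE)
  note F = F'(1) F'(2)[THEN bspec]
  have faith: "b = \<zero>\<^bsub>A\<^esub>" if "b \<in> carrier A" "\<And>M m. M \<in> F ==> m \<in> carrier M ==> b \<odot>\<^bsub>M\<^esub> m = \<zero>\<^bsub>M\<^esub>" for b
    using faith'[THEN bspec, OF that(1)] that(2) by simp
  have "\<exists>\<beta> \<kappa>. coord_system A N \<beta> (\<lambda>x. x) \<kappa>" if "N \<in> F" for N
    using irreducible_coord_system[OF F(2)[OF that]] by (elim exE conjE) (intro exI)
  then obtain \<beta> \<kappa> where co: "\<And>N. N \<in> F ==> coord_system A N (\<beta> N) (\<lambda>x. x) (\<kappa> N)"
    by metis
  have "\<exists>N\<in>F. module_isomorphic A N M" if M: "irreducible_module A M"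
    for M :: "('g \<Rightarrow> complex, 'g \<Rightarrow> complex) module"
  proof (rule ccontr)
    assume none: "\<not> ?thesis"
    interpret M: complex_left_module A M
      using M by (intro complex_left_module_A irreducible_left_module)
    obtain v where v: "v \<in> carrier M" "v \<noteq> \<zero>\<^bsub>M\<^esub>" using irreducible_nonzero[OF M] by auto
    obtain \<gamma> \<mu> where coM: "coord_system A M \<gamma> (\<lambda>x. x) \<mu>"
      using irreducible_coord_system[OF M] by auto
    have "\<mu> i v = 0" if i: "i \<in> \<gamma>" for i
    proof (rule density_functional[where J = "Sigma F \<beta>" and X = fst and v = snd and l = "\<mu> i"
          and ?X0.0 = M, OF Alg.complex_algebra_axioms])
      show "finite (Sigma F \<beta>)"
        using F(1) coord_systemD(1)[OF co] by (intro finite_SigmaI) auto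
      show "\<exists>c. \<forall>m\<in>carrier M. h m = cscale A M c m"
        if "h \<in> LinearCombinations.module_hom A M M" for h
        using schur_scalar[OF Alg.complex_algebra_axioms M coM that] .
      fix j assume j: "j \<in> Sigma F \<beta>"
      show "fst j = M \<or> \<not> module_isomorphic A (fst j) M" using none j by auto
      show "\<mu> i (snd j) = 0" if "fst j = M"
        using none j that module_isomorphic_refl[of A M] by auto
      show "irreducible_module A (fst j)" using F(2) j by auto
      show "snd j \<in> carrier (fst j)" using coord_systemD(2)[OF co] j by auto
    next
      fix b assume b: "b \<in> carrier A" and k: "\<And>j. j \<in> Sigma F \<beta> ==> b \<odot>\<^bsub>fst j\<^esub> snd j = \<zero>\<^bsub>fst j\<^esub>"
      have "b = \<zero>\<^bsub>A\<^esub>"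
      proof (rule faith[OF b])
        fix N n assume N: "N \<in> F" "n \<in> carrier N"
        interpret N: complex_left_module A N
          using F(2)[OF N(1)] by (intro complex_left_module_A irreducible_left_module)
        have "b \<odot>\<^bsub>N\<^esub> n = \<zero>\<^bsub>A\<^esub> \<odot>\<^bsub>N\<^esub> n"
          by (rule N.coord_agree[OF co[OF N(1)] b A.zero_closed _ N(2)])
            (use k[of "(N, _)"] N coord_systemD(2)[OF co[OF N(1)]] in \<open>auto simp del: TGA_simps\<close>)
        then show "b \<odot>\<^bsub>N\<^esub> n = \<zero>\<^bsub>N\<^esub>" using N.smult_zero_left[OF N(2)] by simp
      qed
      then show "b \<odot>\<^bsub>M\<^esub> v = \<zero>\<^bsub>M\<^esub>" using M.smult_zero_left[OF v(1)] by simp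
    qed (use M v(1) coord_systemD(3,4)[OF coM i] in auto)
    then have "v = \<zero>\<^bsub>M\<^esub>"
      by (intro M.coord_eqI[OF coM]) (use v(1) M.coord_zero[OF coM] in auto)
    then show False using v by simp
  qed
  then show ?thesis using F by blast
qed

lemma finite_Irr: "finite (Irr A)"
proof -
  obtain F :: "('g \<Rightarrow> complex, 'g \<Rightarrow> complex) module set"
    where F: "finite F" "\<forall>M\<in>F. irreducible_module A M"
      and ex: "\<forall>M :: ('g \<Rightarrow> complex, 'g \<Rightarrow> complex) module.
        irreducible_module A M \<longrightarrow> (\<exists>N\<in>F. module_isomorphic A N M)"
    using finite_irreducible_representatives by (elim exE conjE)
  have "Irr A \<subseteq> module_type A ` F"
  proof
    fix c assume "c \<in> Irr A"
    then obtain M where M: "irreducible_module A M" "c = module_type A M" unfolding Irr_def by blast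
    obtain N where N: "N \<in> F" "module_isomorphic A N M" using ex[THEN spec, THEN mp, OF M(1)] by (elim bexE)
    then show "c \<in> module_type A ` F"
      using module_type_eq_iff[OF F(2)[THEN bspec, OF N(1)] M(1)] M(2) by (simp add: image_iff) metis
  qed
  then show ?thesis using F(1) finite_surj by blast
qed

section \<open>Representatives of the types, and idempotents of sets of types\<close>

definition rep :: "('g \<Rightarrow> complex, 'g \<Rightarrow> complex) module set \<Rightarrow> ('g \<Rightarrow> complex, 'g \<Rightarrow> complex) module"
  where "rep c = (SOME M. M \<in> c)"

lemma rep: assumes "c \<in> Irr A" shows "irreducible_module A (rep c)" "module_type A (rep c) = c"
proof -
  obtain M where M: "c = module_type A M" "irreducible_module A M"
    using assms unfolding Irr_def by blast
  have "M \<in> c" unfolding M(1) by (rule module_type_self[OF M(2)])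
  then have "rep c \<in> c" unfolding rep_def by (rule someI)
  then show "irreducible_module A (rep c)" "module_type A (rep c) = c"
    by (rule Irr_member[OF assms])+
qed

lemma rep_isomorphic:
  assumes "irreducible_module A M" shows "module_isomorphic A (rep (module_type A M)) M"
  using module_type_eq_iff[OF rep(1)[OF module_type_in_Irr[OF assms]] assms]
    rep(2)[OF module_type_in_Irr[OF assms]] by simp

definition rep_basis where
  "rep_basis = (SOME \<beta>. \<exists>\<kappa>. \<forall>c\<in>Irr A. coord_system A (rep c) (\<beta> c) (\<lambda>x. x) (\<kappa> c))"

definition rep_coord where
  "rep_coord = (SOME \<kappa>. \<forall>c\<in>Irr A. coord_system A (rep c) (rep_basis c) (\<lambda>x. x) (\<kappa> c))"

lemma rep_coord_system:
  assumes "c \<in> Irr A" shows "coord_system A (rep c) (rep_basis c) (\<lambda>x. x) (rep_coord c)"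
proof -
  have "\<exists>\<beta> \<kappa>. coord_system A (rep c) \<beta> (\<lambda>x. x) \<kappa>" if "c \<in> Irr A" for c
    using irreducible_coord_system[OF rep(1)[OF that]] by (elim exE conjE) (intro exI)
  then have "\<exists>\<beta> \<kappa>. \<forall>c\<in>Irr A. coord_system A (rep c) (\<beta> c) (\<lambda>x. x) (\<kappa> c)"
    by metis
  then have "\<exists>\<kappa>. \<forall>c\<in>Irr A. coord_system A (rep c) (rep_basis c) (\<lambda>x. x) (\<kappa> c)"
    unfolding rep_basis_def by (rule someI_ex)
  then have "\<forall>c\<in>Irr A. coord_system A (rep c) (rep_basis c) (\<lambda>x. x) (rep_coord c)"
    unfolding rep_coord_def by (rule someI_ex)
  then show ?thesis using assms by blast
qed

text \<open>Joint faithfulness, applied to the difference.\<close>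

lemma acts_eqI:
  assumes a: "a \<in> carrier A" "a' \<in> carrier A"
    and eq: "\<And>(M :: ('g \<Rightarrow> complex, 'g \<Rightarrow> complex) module) m.
      irreducible_module A M ==> m \<in> carrier M ==> a \<odot>\<^bsub>M\<^esub> m = a' \<odot>\<^bsub>M\<^esub> m"
  shows "a = a'"
proof (rule ccontr)
  assume ne: "a \<noteq> a'"
  define d where "d = a \<oplus>\<^bsub>A\<^esub> \<ominus>\<^bsub>A\<^esub> a'"
  have d: "d \<in> carrier A" unfolding d_def using a by (intro A.a_closed A.a_inv_closed)
  have d0: "d \<noteq> \<zero>\<^bsub>A\<^esub>"
    unfolding d_def using ne a by (metis A.a_inv_closed A.minus_equality A.minus_minus)
  obtain M :: "('g \<Rightarrow> complex, 'g \<Rightarrow> complex) module" and m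
    where M: "irreducible_module A M" "m \<in> carrier M" "d \<odot>\<^bsub>M\<^esub> m \<noteq> \<zero>\<^bsub>M\<^esub>"
    using irreducible_faithful[OF d d0] by (elim exE conjE bexE)
  interpret M: left_module A M using M(1) by (rule irreducible_left_module)
  have "d \<odot>\<^bsub>M\<^esub> m = a \<odot>\<^bsub>M\<^esub> m \<oplus>\<^bsub>M\<^esub> \<ominus>\<^bsub>M\<^esub> (a' \<odot>\<^bsub>M\<^esub> m)"
    unfolding d_def using M.smult_l_distr[OF a(1) A.a_inv_closed[OF a(2)] M(2)]
      M.smult_minus_left[OF a(2) M(2)] by simp
  then show False
    using M(3) eq[OF M(1,2)] M.smult_closed[OF a(2) M(2)] by (simp add: M.M.r_neg)
qed

lemma rep_eqI:
  assumes a: "a \<in> carrier A" "a' \<in> carrier A"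
    and eq: "\<And>c i. c \<in> Irr A ==> i \<in> rep_basis c ==> a \<odot>\<^bsub>rep c\<^esub> i = a' \<odot>\<^bsub>rep c\<^esub> i"
  shows "a = a'"
proof (rule acts_eqI[OF a])
  fix M :: "('g \<Rightarrow> complex, 'g \<Rightarrow> complex) module" and m
  assume M: "irreducible_module A M" "m \<in> carrier M"
  note c = module_type_in_Irr[OF M(1)]
  interpret N: complex_left_module A "rep (module_type A M)"
    using rep(1)[OF c] by (intro complex_left_module_A irreducible_left_module)
  show "a \<odot>\<^bsub>M\<^esub> m = a' \<odot>\<^bsub>M\<^esub> m"
  proof (rule isomorphic_agree[OF rep_isomorphic[OF M(1)] N.left_module_axioms a _ M(2)])
    fix n assume n: "n \<in> carrier (rep (module_type A M))"
    show "a \<odot>\<^bsub>rep (module_type A M)\<^esub> n = a' \<odot>\<^bsub>rep (module_type A M)\<^esub> n"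
      by (rule N.coord_agree[OF rep_coord_system[OF c] a eq[OF c] n])
  qed
qed

text \<open>Together with \<open>rep_eqI\<close> this is the Wedderburn decomposition in elementary
  terms: an element of \<open>A\<close> amounts to an arbitrary choice of values on the bases of the
  representatives.\<close>

lemma rep_density:
  assumes "\<And>c i. c \<in> Irr A ==> i \<in> rep_basis c ==> z c i \<in> carrier (rep c)"
  shows "\<exists>a\<in>carrier A. \<forall>c\<in>Irr A. \<forall>i\<in>rep_basis c. a \<odot>\<^bsub>rep c\<^esub> i = z c i"
proof (rule density[OF Alg.complex_algebra_axioms finite_Irr rep(1) _ rep_coord_system assms])
  fix c d assume "c \<in> Irr A" "d \<in> Irr A" "c \<noteq> d"
  then show "\<not> module_isomorphic A (rep c) (rep d)"
    using module_type_eq_iff[OF rep(1) rep(1), of c d] rep(2)[of c] rep(2)[of d] by simp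
qed

text \<open>Specified by its action alone. Uniqueness, in the form of \<open>idem_eqI\<close>, makes
  every identity between such elements a comparison of actions.\<close>

definition idem :: "('g \<Rightarrow> complex, 'g \<Rightarrow> complex) module set set \<Rightarrow> 'g \<Rightarrow> complex" where
  "idem Q = (SOME e. e \<in> carrier A \<and> (\<forall>M m. irreducible_module A M \<longrightarrow> m \<in> carrier M \<longrightarrow>
     e \<odot>\<^bsub>M\<^esub> m = (if module_type A M \<in> Q then m else \<zero>\<^bsub>M\<^esub>)))"

lemma idem_exists:
  "\<exists>e. e \<in> carrier A \<and> (\<forall>(M :: ('g \<Rightarrow> complex, 'g \<Rightarrow> complex) module) m.
     irreducible_module A M \<longrightarrow> m \<in> carrier M \<longrightarrow>
     e \<odot>\<^bsub>M\<^esub> m = (if module_type A M \<in> Q then m else \<zero>\<^bsub>M\<^esub>))"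
proof -
  have lm: "complex_left_module A (rep c)" if "c \<in> Irr A" for c
    using rep(1)[OF that] by (intro complex_left_module_A irreducible_left_module)
  obtain e where e: "e \<in> carrier A"
    "\<And>c i. c \<in> Irr A ==> i \<in> rep_basis c ==> e \<odot>\<^bsub>rep c\<^esub> i = (if c \<in> Q then i else \<zero>\<^bsub>rep c\<^esub>)"
  proof -
    have "\<exists>a\<in>carrier A. \<forall>c\<in>Irr A. \<forall>i\<in>rep_basis c.
        a \<odot>\<^bsub>rep c\<^esub> i = (if c \<in> Q then i else \<zero>\<^bsub>rep c\<^esub>)"
    proof (rule rep_density)
      fix c i assume ci: "c \<in> Irr A" "i \<in> rep_basis c"
      interpret complex_left_module A "rep c" by (rule lm[OF ci(1)])
      show "(if c \<in> Q then i else \<zero>\<^bsub>rep c\<^esub>) \<in> carrier (rep c)"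
        using coord_systemD(2)[OF rep_coord_system[OF ci(1)] ci(2)] by simp
    qed
    then show ?thesis using that by metis
  qed
  have "e \<odot>\<^bsub>M\<^esub> m = (if module_type A M \<in> Q then m else \<zero>\<^bsub>M\<^esub>)"
    if M: "irreducible_module A M" "m \<in> carrier M" for M :: "('g \<Rightarrow> complex, 'g \<Rightarrow> complex) module" and m
  proof -
    note c = module_type_in_Irr[OF M(1)]
    let ?c = "module_type A M"
    interpret N: complex_left_module A "rep ?c" by (rule lm[OF c])
    interpret M: left_module A M using M(1) by (rule irreducible_left_module)
    \<comment> \<open>Comparing with the unit or the zero of \<open>A\<close>, instead of with
      \<open>m\<close> or the zero vector, lets the agreement on the representative be carried to
      \<open>M\<close> by \<open>isomorphic_agree\<close>.\<close>
    define u where "u = (if ?c \<in> Q then \<one>\<^bsub>A\<^esub> else \<zero>\<^bsub>A\<^esub>)"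
    have u: "u \<in> carrier A" unfolding u_def using A.one_closed A.zero_closed by (simp del: TGA_simps)
    have "e \<odot>\<^bsub>M\<^esub> m = u \<odot>\<^bsub>M\<^esub> m"
    proof (rule isomorphic_agree[OF rep_isomorphic[OF M(1)] N.left_module_axioms e(1) u _ M(2)])
      fix n assume n: "n \<in> carrier (rep ?c)"
      show "e \<odot>\<^bsub>rep ?c\<^esub> n = u \<odot>\<^bsub>rep ?c\<^esub> n"
      proof (rule N.coord_agree[OF rep_coord_system[OF c] e(1) u _ n])
        fix i assume i: "i \<in> rep_basis ?c"
        have iN: "i \<in> carrier (rep ?c)" using coord_systemD(2)[OF rep_coord_system[OF c] i] .
        show "e \<odot>\<^bsub>rep ?c\<^esub> i = u \<odot>\<^bsub>rep ?c\<^esub> i"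
          using e(2)[OF c i] N.smult_one[OF iN] N.smult_zero_left[OF iN] by (simp add: u_def del: TGA_simps)
      qed
    qed
    then show ?thesis
      using M.smult_one[OF M(2)] M.smult_zero_left[OF M(2)] by (simp add: u_def del: TGA_simps)
  qed
  then show ?thesis using e(1) by blast
qed

lemma idem_closed: "idem Q \<in> carrier A"
  using someI_ex[OF idem_exists[of Q]] unfolding idem_def[symmetric] by (rule conjunct1)

lemma idem_acts: "irreducible_module A M ==> m \<in> carrier M ==>
    idem Q \<odot>\<^bsub>M\<^esub> m = (if module_type A M \<in> Q then m else \<zero>\<^bsub>M\<^esub>)"
  using someI_ex[OF idem_exists[of Q]] unfolding idem_def[symmetric] by simp

lemma idem_eqI:
  assumes "e \<in> carrier A" "\<And>M m. irreducible_module A M ==> m \<in> carrier M ==>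
    e \<odot>\<^bsub>M\<^esub> m = (if module_type A M \<in> Q then m else \<zero>\<^bsub>M\<^esub>)"
  shows "e = idem Q"
proof (rule acts_eqI[OF assms(1) idem_closed])
  fix M :: "('g \<Rightarrow> complex, 'g \<Rightarrow> complex) module" and m
  assume M: "irreducible_module A M" "m \<in> carrier M"
  show "e \<odot>\<^bsub>M\<^esub> m = idem Q \<odot>\<^bsub>M\<^esub> m"
    using assms(2)[OF M] idem_acts[OF M] by simp
qed

lemma idem_mult: "idem Q \<otimes>\<^bsub>A\<^esub> idem P = idem (Q \<inter> P)"
proof (rule idem_eqI)
  show "idem Q \<otimes>\<^bsub>A\<^esub> idem P \<in> carrier A" using idem_closed A.m_closed by blast
  fix M :: "('g \<Rightarrow> complex, 'g \<Rightarrow> complex) module" and m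
  assume M: "irreducible_module A M" "m \<in> carrier M"
  interpret M: left_module A M using M(1) by (rule irreducible_left_module)
  show "(idem Q \<otimes>\<^bsub>A\<^esub> idem P) \<odot>\<^bsub>M\<^esub> m = (if module_type A M \<in> Q \<inter> P then m else \<zero>\<^bsub>M\<^esub>)"
    using M.smult_assoc[OF idem_closed idem_closed M(2)] idem_acts[OF M]
      M.smult_zero_right[OF idem_closed] by simp
qed

lemma idem_add:
  assumes "Q \<inter> P = {}" shows "idem Q \<oplus>\<^bsub>A\<^esub> idem P = idem (Q \<union> P)"
proof (rule idem_eqI)
  show "idem Q \<oplus>\<^bsub>A\<^esub> idem P \<in> carrier A" using idem_closed A.a_closed by blast
  fix M :: "('g \<Rightarrow> complex, 'g \<Rightarrow> complex) module" and m
  assume M: "irreducible_module A M" "m \<in> carrier M"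
  interpret M: left_module A M using M(1) by (rule irreducible_left_module)
  show "(idem Q \<oplus>\<^bsub>A\<^esub> idem P) \<odot>\<^bsub>M\<^esub> m = (if module_type A M \<in> Q \<union> P then m else \<zero>\<^bsub>M\<^esub>)"
    using M.smult_l_distr[OF idem_closed idem_closed M(2)] idem_acts[OF M] assms M(2) by auto
qed

lemma idem_empty: "idem {} = \<zero>\<^bsub>A\<^esub>"
proof (rule idem_eqI[symmetric])
  show "\<zero>\<^bsub>A\<^esub> \<in> carrier A" by (rule A.zero_closed)
  fix M :: "('g \<Rightarrow> complex, 'g \<Rightarrow> complex) module" and m
  assume M: "irreducible_module A M" "m \<in> carrier M"
  interpret M: left_module A M using M(1) by (rule irreducible_left_module)
  show "\<zero>\<^bsub>A\<^esub> \<odot>\<^bsub>M\<^esub> m = (if module_type A M \<in> {} then m else \<zero>\<^bsub>M\<^esub>)"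
    using M.smult_zero_left[OF M(2)] by simp
qed

lemma idem_all: "idem (Irr A) = \<one>\<^bsub>A\<^esub>"
proof (rule idem_eqI[symmetric])
  show "\<one>\<^bsub>A\<^esub> \<in> carrier A" by (rule A.one_closed)
  fix M :: "('g \<Rightarrow> complex, 'g \<Rightarrow> complex) module" and m
  assume M: "irreducible_module A M" "m \<in> carrier M"
  interpret M: left_module A M using M(1) by (rule irreducible_left_module)
  show "\<one>\<^bsub>A\<^esub> \<odot>\<^bsub>M\<^esub> m = (if module_type A M \<in> Irr A then m else \<zero>\<^bsub>M\<^esub>)"
    using M.smult_one[OF M(2)] module_type_in_Irr[OF M(1)] by simp
qed

lemma idem_finsum:
  assumes "finite S" "\<And>Q P. Q \<in> S ==> P \<in> S ==> Q \<noteq> P ==> Q \<inter> P = {}"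
  shows "finsum A idem S = idem (\<Union>S)"
  using assms
proof (induction S rule: finite_induct)
  case empty
  then show ?case using idem_empty by simp
next
  case (insert Q S)
  have "finsum A idem (insert Q S) = idem Q \<oplus>\<^bsub>A\<^esub> finsum A idem S"
    using insert(1,2) idem_closed by (intro A.finsum_insert) auto
  also have "\<dots> = idem Q \<oplus>\<^bsub>A\<^esub> idem (\<Union>S)"
    using insert by simp
  also have "\<dots> = idem (\<Union>(insert Q S))"
    using insert(2,4) by (subst idem_add) auto
  finally show ?case .
qed

text \<open>A matrix unit argument on the representative, where \<open>k\<close> moves some
  \<open>n\<close>. With \<open>q i\<close> sending the basis vector \<open>i\<close> to
  \<open>n\<close> and killing the others, and \<open>p i\<close> sending the image of
  \<open>n\<close> under \<open>k\<close> back to \<open>i\<close>, the sum of the products of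
  \<open>p i\<close>, \<open>k\<close> and \<open>q i\<close> is the identity on this type and zero
  on all others.\<close>

lemma ideal_contains_idem:
  assumes J: "J \<subseteq> carrier A" "\<zero>\<^bsub>A\<^esub> \<in> J" "\<And>x y. x \<in> J ==> y \<in> J ==> x \<oplus>\<^bsub>A\<^esub> y \<in> J"
      "\<And>a x. a \<in> carrier A ==> x \<in> J ==> a \<otimes>\<^bsub>A\<^esub> x \<in> J"
      "\<And>a x. a \<in> carrier A ==> x \<in> J ==> x \<otimes>\<^bsub>A\<^esub> a \<in> J"
    and M: "irreducible_module A M" and k: "k \<in> J" "m \<in> carrier M" "k \<odot>\<^bsub>M\<^esub> m \<noteq> \<zero>\<^bsub>M\<^esub>"
  shows "idem {module_type A M} \<in> J"
proof -
  define c where "c = module_type A M"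
  have c: "c \<in> Irr A" unfolding c_def by (rule module_type_in_Irr[OF M])
  let ?N = "rep c"
  have lm: "complex_left_module A (rep d)" if "d \<in> Irr A" for d
    using rep(1)[OF that] by (intro complex_left_module_A irreducible_left_module)
  interpret N: complex_left_module A ?N by (rule lm[OF c])
  have kA: "k \<in> carrier A" using k(1) J(1) by auto
  have "\<exists>n\<in>carrier ?N. k \<odot>\<^bsub>?N\<^esub> n \<noteq> \<zero>\<^bsub>?N\<^esub>"
    using isomorphic_agree_zero[OF rep_isomorphic[OF M, folded c_def] N.left_module_axioms
        irreducible_left_module[OF M] kA _ k(2)] k(3) by metis
  then obtain n where n: "n \<in> carrier ?N" "k \<odot>\<^bsub>?N\<^esub> n \<noteq> \<zero>\<^bsub>?N\<^esub>" by auto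
  note b = coord_systemD[OF rep_coord_system[OF c]]
  have "\<forall>i\<in>rep_basis c. \<exists>p\<in>carrier A. p \<odot>\<^bsub>?N\<^esub> (k \<odot>\<^bsub>?N\<^esub> n) = i"
    using irreducible_transitive[OF rep(1)[OF c] N.smult_closed[OF kA n(1)] n(2) b(2)] by simp
  then obtain p where p: "\<And>i. i \<in> rep_basis c ==> p i \<in> carrier A"
    "\<And>i. i \<in> rep_basis c ==> p i \<odot>\<^bsub>?N\<^esub> (k \<odot>\<^bsub>?N\<^esub> n) = i" by metis
  have "\<exists>q\<in>carrier A. \<forall>d\<in>Irr A. \<forall>l\<in>rep_basis d.
      q \<odot>\<^bsub>rep d\<^esub> l = (if d = c \<and> l = i then n else \<zero>\<^bsub>rep d\<^esub>)" for i
  proof (rule rep_density)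
    fix d l assume d: "d \<in> Irr A"
    interpret D: complex_left_module A "rep d" by (rule lm[OF d])
    show "(if d = c \<and> l = i then n else \<zero>\<^bsub>rep d\<^esub>) \<in> carrier (rep d)" using n by auto
  qed
  then obtain q where q: "\<And>i. q i \<in> carrier A"
    "\<And>i d l. d \<in> Irr A ==> l \<in> rep_basis d ==>
      q i \<odot>\<^bsub>rep d\<^esub> l = (if d = c \<and> l = i then n else \<zero>\<^bsub>rep d\<^esub>)" by metis
  define x where "x i = p i \<otimes>\<^bsub>A\<^esub> (k \<otimes>\<^bsub>A\<^esub> q i)" for i
  have xJ: "x i \<in> J" if "i \<in> rep_basis c" for i
    unfolding x_def using that p(1) q(1) k(1) J(4,5) by blast
  have xA: "x i \<in> carrier A" if "i \<in> rep_basis c" for i using xJ[OF that] J(1) by auto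
  have "finsum A x (rep_basis c) \<in> J"
    by (rule finsum_mem[OF A.is_abelian_group J(1,2,3) xJ])
  moreover have "finsum A x (rep_basis c) = idem {c}"
  proof (rule rep_eqI)
    show "finsum A x (rep_basis c) \<in> carrier A" using calculation J(1) by auto
    show "idem {c} \<in> carrier A" by (rule idem_closed)
    fix d l assume d: "d \<in> Irr A" and l: "l \<in> rep_basis d"
    interpret D: complex_left_module A "rep d" by (rule lm[OF d])
    have lD: "l \<in> carrier (rep d)" using coord_systemD(2)[OF rep_coord_system[OF d] l] .
    have xl: "x i \<odot>\<^bsub>rep d\<^esub> l = (if d = c \<and> l = i then l else \<zero>\<^bsub>rep d\<^esub>)" if i: "i \<in> rep_basis c" for i
    proof -
      have "x i \<odot>\<^bsub>rep d\<^esub> l = p i \<odot>\<^bsub>rep d\<^esub> (k \<odot>\<^bsub>rep d\<^esub> (q i \<odot>\<^bsub>rep d\<^esub> l))"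
        unfolding x_def using D.smult_assoc[OF p(1)[OF i] A.m_closed[OF kA q(1)] lD]
          D.smult_assoc[OF kA q(1) lD] by simp
      then show ?thesis
        using q(2)[OF d l] p(2)[OF i] D.smult_zero_right[OF kA] D.smult_zero_right[OF p(1)[OF i]] by auto
    qed
    have "finsum A x (rep_basis c) \<odot>\<^bsub>rep d\<^esub> l = finsum (rep d) (\<lambda>i. x i \<odot>\<^bsub>rep d\<^esub> l) (rep_basis c)"
      by (rule D.smult_finsum_left[OF xA lD])
    also have "\<dots> = (if d = c then l else \<zero>\<^bsub>rep d\<^esub>)"
    proof (cases "d = c")
      case True
      have "finsum (rep d) (\<lambda>i. x i \<odot>\<^bsub>rep d\<^esub> l) (rep_basis c) = x l \<odot>\<^bsub>rep d\<^esub> l"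
        by (rule finsum_single[OF D.M.abelian_group_axioms b(1)])
          (use True l lD xl in auto)
      then show ?thesis using True l xl by simp
    next
      case False
      have "finsum (rep d) (\<lambda>i. x i \<odot>\<^bsub>rep d\<^esub> l) (rep_basis c) = finsum (rep d) (\<lambda>i. \<zero>\<^bsub>rep d\<^esub>) (rep_basis c)"
        by (rule D.M.finsum_cong') (use False xl in auto)
      then show ?thesis using False by simp
    qed
    also have "\<dots> = idem {c} \<odot>\<^bsub>rep d\<^esub> l"
      using idem_acts[OF rep(1)[OF d] lD, of "{c}"] rep(2)[OF d] by simp
    finally show "finsum A x (rep_basis c) \<odot>\<^bsub>rep d\<^esub> l = idem {c} \<odot>\<^bsub>rep d\<^esub> l" .
  qed
  ultimately show ?thesis by (simp add: c_def)
qed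

end

section \<open>The grading by the quotient group and the action on irreducible modules\<close>

locale crossed = twisted G \<alpha> + N: normal N G for G (structure) and \<alpha> and N
begin

abbreviation \<Gamma> where "\<Gamma> \<equiv> G Mod N"
abbreviation B where "B \<equiv> twisted_subgroup_algebra G \<alpha> N"
abbreviation D where "D \<equiv> quotient_grading A twisted_grading"
abbreviation act where "act \<equiv> irr_action G \<alpha> N"
abbreviation mult_A (infixl "\<cdot>" 70) where "x \<cdot> y \<equiv> x \<otimes>\<^bsub>A\<^esub> y"
abbreviation mult_coset (infixl "\<star>" 70) where "C \<star> C' \<equiv> C \<otimes>\<^bsub>\<Gamma>\<^esub> C'"

lemma N_subset: "N \<subseteq> carrier G"
  by (rule N.subset)

lemma finite_N: "finite N"
  using N_subset fin by (rule finite_subset)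

sublocale B: twisted "G\<lparr>carrier := N\<rparr>" \<alpha>
proof (intro twisted.intro twisted_axioms.intro)
  show "group (G\<lparr>carrier := N\<rparr>)"
    by (rule N.subgroup_is_group) (rule is_group)
  show "finite (carrier (G\<lparr>carrier := N\<rparr>))" using finite_N by simp
  have "\<alpha> g h \<noteq> 0" if "g \<in> N" "h \<in> N" for g h
    using that N_subset by auto
  moreover have "\<alpha> g h * \<alpha> (g \<otimes> h) k = \<alpha> g (h \<otimes> k) * \<alpha> h k" if "g \<in> N" "h \<in> N" "k \<in> N" for g h k
    using that N_subset \<alpha>_cocycle[of g h k] by auto
  ultimately show "\<alpha> \<in> cocycles2 (G\<lparr>carrier := N\<rparr>)" unfolding cocycles2_def by simp
qed

lemma B_subset: "carrier B \<subseteq> carrier A"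
  using N_subset by auto

lemma BA: "b \<in> carrier B ==> b \<in> carrier A"
  using B_subset by (rule subsetD)

lemma B_mult:
  assumes "f \<in> carrier B" "h \<in> carrier B" shows "f \<otimes>\<^bsub>B\<^esub> h = f \<cdot> h"
proof
  fix x
  have "(f \<otimes>\<^bsub>B\<^esub> h) x = (\<Sum>g\<in>N. \<Sum>k\<in>N. if g \<otimes> k = x then f g * h k * \<alpha> g k else 0)"
    unfolding B.A_mult by simp
  also have "\<dots> = (\<Sum>g\<in>N. \<Sum>k\<in>carrier G. if g \<otimes> k = x then f g * h k * \<alpha> g k else 0)"
    by (rule sum.cong[OF refl], rule sum.mono_neutral_left)
      (use fin N_subset assms(2) in auto)
  also have "\<dots> = (\<Sum>g\<in>carrier G. \<Sum>k\<in>carrier G. if g \<otimes> k = x then f g * h k * \<alpha> g k else 0)"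
    by (rule sum.mono_neutral_left) (use fin N_subset assms(1) in \<open>auto intro!: sum.neutral\<close>)
  finally show "(f \<otimes>\<^bsub>B\<^esub> h) x = (f \<cdot> h) x" by (simp add: A_mult)
qed

lemma B_one: "\<one>\<^bsub>B\<^esub> = \<one>\<^bsub>A\<^esub>"
  by (simp add: TGA_one cong: if_cong)

lemma B_scalar: "c \<odot>\<^bsub>B\<^esub> b = c \<odot>\<^bsub>A\<^esub> b"
  by simp

lemma group_\<Gamma>: "group \<Gamma>"
  by (rule N.factorgroup_is_group)

sublocale \<Gamma>: group \<Gamma>
  by (rule group_\<Gamma>)

lemma one_\<Gamma>: "\<one>\<^bsub>\<Gamma>\<^esub> = N" by simp

lemma N_\<Gamma>: "N \<in> carrier \<Gamma>"
  using \<Gamma>.one_closed by simp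

lemma coset_\<Gamma>: "g \<in> carrier G ==> N #> g \<in> carrier \<Gamma>"
  unfolding carrier_FactGroup by blast

lemma coset_cases: assumes "C \<in> carrier \<Gamma>" obtains g where "g \<in> carrier G" "C = N #> g"
  using assms unfolding carrier_FactGroup by blast

lemma coset_self: "g \<in> carrier G ==> g \<in> N #> g"
  by (rule rcos_self[OF _ N.subgroup_axioms])

lemma coset_subset: "C \<in> carrier \<Gamma> ==> C \<subseteq> carrier G"
  by (elim coset_cases) (simp add: r_coset_subset_G N_subset)

lemma coset_eq: assumes "C \<in> carrier \<Gamma>" "g \<in> C" shows "C = N #> g"
proof -
  obtain h where h: "h \<in> carrier G" "C = N #> h" using assms(1) by (rule coset_cases)
  show ?thesis using repr_independence[of g N h] h assms(2) N.subgroup_axioms by simp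
qed

lemma coset_disjoint: "C \<in> carrier \<Gamma> ==> C' \<in> carrier \<Gamma> ==> x \<in> C ==> x \<in> C' ==> C = C'"
  using coset_eq[of C x] coset_eq[of C' x] by simp

lemma coset_ex: assumes "C \<in> carrier \<Gamma>" obtains g where "g \<in> C" "g \<in> carrier G"
proof -
  obtain h where h: "h \<in> carrier G" "C = N #> h" using assms(1) by (rule coset_cases)
  show ?thesis by (rule that[of h]) (use h coset_self in simp_all)
qed

lemma coset_mult: "C \<in> carrier \<Gamma> ==> C' \<in> carrier \<Gamma> ==> g \<in> C ==> h \<in> C' ==> g \<otimes> h \<in> C \<star> C'"
  unfolding mult_FactGroup set_mult_def by blast

lemma coset_inv: assumes "C \<in> carrier \<Gamma>" "g \<in> C" shows "inv g \<in> inv\<^bsub>\<Gamma>\<^esub> C"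
proof -
  have "inv\<^bsub>\<Gamma>\<^esub> C = (\<Union>h\<in>C. {inv h})"
    using N.inv_FactGroup[OF assms(1)] by (simp add: SET_INV_def)
  then show ?thesis using assms(2) by blast
qed

lemma finite_\<Gamma>: "finite (carrier \<Gamma>)"
  unfolding carrier_FactGroup using fin by simp

lemma finite_coset: "C \<in> carrier \<Gamma> ==> finite C"
  using coset_subset fin by (rule finite_subset)

section \<open>Homogeneous components and homogeneous units\<close>

lemma D_eq:
  assumes "C \<in> carrier \<Gamma>" shows "D C = {f. \<forall>x. x \<notin> C \<longrightarrow> f x = 0}"
proof (intro equalityI subsetI CollectI allI impI)
  fix f x assume f: "f \<in> D C" and x: "x \<notin> C"
  obtain F J where J: "f = finsum A F J" "finite J" "J \<subseteq> C" "F \<in> Pi J twisted_grading"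
    using f unfolding quotient_grading_def family_sum_def by blast
  have Fj: "\<exists>c. F j = (\<lambda>x. c * basis_elt j x)" if "j \<in> J" for j
    using Pi_mem[OF J(4) that] unfolding twisted_grading_def by blast
  have "F j \<in> carrier A" if "j \<in> J" for j
    using Fj[OF that] J(3) that coset_subset[OF assms] by (auto simp: basis_elt_def)
  then have "f x = (\<Sum>j\<in>J. F j x)"
    using A_finsum[OF J(2), of F] J(1) by simp
  also have "\<dots> = 0"
  proof (rule sum.neutral, rule ballI)
    fix j assume j: "j \<in> J"
    then have "x \<noteq> j" using x J(3) by auto
    then show "F j x = 0" using Fj[OF j] by (auto simp: basis_elt_def)
  qed
  finally show "f x = 0" .
next
  fix f :: "'a \<Rightarrow> complex" assume f: "f \<in> {f. \<forall>x. x \<notin> C \<longrightarrow> f x = 0}"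
  have CG: "g \<in> carrier G" if "g \<in> C" for g using that coset_subset[OF assms] by auto
  let ?F = "\<lambda>g x. f g * basis_elt g x"
  have "finsum A ?F C = (\<lambda>x. \<Sum>g\<in>C. f g * basis_elt g x)"
    by (rule A_finsum[OF finite_coset[OF assms]]) (use CG in \<open>auto simp: basis_elt_def\<close>)
  also have "\<dots> = f"
    using f finite_coset[OF assms]
    by (auto simp: basis_elt_def fun_eq_iff if_distrib[of "\<lambda>t. _ * t"] cong: if_cong)
  finally have "f = finsum A ?F C" by simp
  moreover have "?F \<in> Pi C twisted_grading"
    by (rule Pi_I) (unfold twisted_grading_def, rule rangeI)
  ultimately show "f \<in> D C"
    unfolding quotient_grading_def family_sum_def using finite_coset[OF assms] by blast
qed

lemma D_A: "C \<in> carrier \<Gamma> ==> a \<in> D C ==> a \<in> carrier A"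
  using coset_subset[of C] by (auto simp: D_eq)

lemma D_N: "D N = carrier B"
  using D_eq[OF N_\<Gamma>] by simp

lemma D_mult:
  assumes C: "C \<in> carrier \<Gamma>" "C' \<in> carrier \<Gamma>" and a: "a \<in> D C" "b \<in> D C'"
  shows "a \<cdot> b \<in> D (C \<star> C')"
proof -
  have "(a \<cdot> b) x = 0" if x: "x \<notin> C \<star> C'" for x
  proof -
    have "(if g \<otimes> k = x then a g * b k * \<alpha> g k else 0) = 0" for g k
      using a D_eq C coset_mult[OF C, of g k] x by (cases "g \<in> C"; cases "k \<in> C'") auto
    then show ?thesis unfolding A_mult by simp
  qed
  then show ?thesis using D_eq[OF \<Gamma>.m_closed[OF C]] by simp
qed

text \<open>Nonzero multiples of basis elements rather than the basis elements themselves, so that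
  products and inverses stay in such sets, of the product and the inverse degree. Results on
  conjugates then hold for every such choice of units.\<close>

definition hu :: "'a set \<Rightarrow> ('a \<Rightarrow> complex) set" where
  "hu C = {v. \<exists>g\<in>C. \<exists>c. c \<noteq> 0 \<and> v = c \<odot>\<^bsub>A\<^esub> basis_elt g}"

lemma hu_D: "C \<in> carrier \<Gamma> ==> v \<in> hu C ==> v \<in> D C"
  by (auto simp: D_eq hu_def basis_elt_def)

lemma hu_A: "C \<in> carrier \<Gamma> ==> v \<in> hu C ==> v \<in> carrier A"
  by (rule D_A[OF _ hu_D])

lemma basis_elt_hu: "g \<in> C ==> basis_elt g \<in> hu C"
  unfolding hu_def by (intro CollectI bexI[of _ g] exI[of _ 1]) auto

lemma one_hu: "\<one>\<^bsub>A\<^esub> \<in> hu N"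
  unfolding hu_def by (intro CollectI bexI[of _ "\<one>"] exI[of _ "inverse (\<alpha> \<one> \<one>)"]) (auto simp: A_one_basis)

lemma hu_mult:
  assumes C: "C \<in> carrier \<Gamma>" "C' \<in> carrier \<Gamma>" and v: "v \<in> hu C" "w \<in> hu C'"
  shows "v \<cdot> w \<in> hu (C \<star> C')"
proof -
  obtain g c where g: "g \<in> C" "c \<noteq> 0" "v = c \<odot>\<^bsub>A\<^esub> basis_elt g"
    using v(1) unfolding hu_def by (elim CollectE bexE exE conjE)
  obtain h d where h: "h \<in> C'" "d \<noteq> 0" "w = d \<odot>\<^bsub>A\<^esub> basis_elt h"
    using v(2) unfolding hu_def by (elim CollectE bexE exE conjE)
  have gh: "g \<in> carrier G" "h \<in> carrier G"
    using subsetD[OF coset_subset[OF C(1)] g(1)] subsetD[OF coset_subset[OF C(2)] h(1)] .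
  have "v \<cdot> w = (c * d * \<alpha> g h) \<odot>\<^bsub>A\<^esub> basis_elt (g \<otimes> h)"
    by (simp only: g(3) h(3) TGA_simps A_scale_mult A_mult_scale basis_mult_basis[OF gh] mult.assoc)
  then show ?thesis
    unfolding hu_def using coset_mult[OF C g(1) h(1)] g(2) h(2) \<alpha>_nonzero[OF gh]
    by (intro CollectI bexI[of _ "g \<otimes> h"] exI[of _ "c * d * \<alpha> g h"]) simp_all
qed

lemma hu_inverse_exists:
  assumes C: "C \<in> carrier \<Gamma>" and v: "v \<in> hu C"
  shows "\<exists>w\<in>hu (inv\<^bsub>\<Gamma>\<^esub> C). w \<cdot> v = \<one>\<^bsub>A\<^esub> \<and> v \<cdot> w = \<one>\<^bsub>A\<^esub>"
proof -
  obtain g c where g: "g \<in> C" "c \<noteq> 0" "v = c \<odot>\<^bsub>A\<^esub> basis_elt g"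
    using v unfolding hu_def by (elim CollectE bexE exE conjE)
  have gG: "g \<in> carrier G" by (rule subsetD[OF coset_subset[OF C] g(1)])
  define w where "w = inverse c \<odot>\<^bsub>A\<^esub> basis_inv g"
  have "w \<in> hu (inv\<^bsub>\<Gamma>\<^esub> C)"
    unfolding hu_def
  proof (intro CollectI bexI exI conjI)
    show "inv g \<in> inv\<^bsub>\<Gamma>\<^esub> C" by (rule coset_inv[OF C g(1)])
    show "inverse c * inverse (\<alpha> (inv g) g * \<alpha> \<one> \<one>) \<noteq> 0" using g(2) gG by simp
    show "w = (inverse c * inverse (\<alpha> (inv g) g * \<alpha> \<one> \<one>)) \<odot>\<^bsub>A\<^esub> basis_elt (inv g)"
      by (simp only: w_def basis_inv_def TGA_simps mult.assoc)
  qed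
  moreover have "w \<cdot> v = \<one>\<^bsub>A\<^esub>"
  proof -
    have "w \<cdot> v = (\<lambda>x. (inverse c * c) * \<one>\<^bsub>A\<^esub> x)"
      by (simp only: w_def g(3) TGA_simps A_scale_mult A_mult_scale basis_inv_mult[OF gG] mult.assoc)
    then show ?thesis using g(2) by simp
  qed
  moreover have "v \<cdot> w = \<one>\<^bsub>A\<^esub>"
  proof -
    have "v \<cdot> w = (\<lambda>x. (c * inverse c) * \<one>\<^bsub>A\<^esub> x)"
      by (simp only: w_def g(3) TGA_simps A_scale_mult A_mult_scale mult_basis_inv[OF gG] mult.assoc)
    then show ?thesis using g(2) by simp
  qed
  ultimately show ?thesis by blast
qed

lemma hu_Units: assumes C: "C \<in> carrier \<Gamma>" and v: "v \<in> hu C" shows "v \<in> Units A"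
proof -
  obtain w where w: "w \<in> hu (inv\<^bsub>\<Gamma>\<^esub> C)" "w \<cdot> v = \<one>\<^bsub>A\<^esub>" "v \<cdot> w = \<one>\<^bsub>A\<^esub>"
    using hu_inverse_exists[OF assms] by (elim bexE conjE)
  show ?thesis
    unfolding Units_def using hu_A[OF assms] hu_A[OF \<Gamma>.inv_closed[OF C] w(1)] w(2,3)
    by (intro CollectI conjI bexI[of _ w])
qed

lemma hu_inv: assumes C: "C \<in> carrier \<Gamma>" and v: "v \<in> hu C" shows "inv\<^bsub>A\<^esub> v \<in> hu (inv\<^bsub>\<Gamma>\<^esub> C)"
proof -
  obtain w where w: "w \<in> hu (inv\<^bsub>\<Gamma>\<^esub> C)" "w \<cdot> v = \<one>\<^bsub>A\<^esub>" "v \<cdot> w = \<one>\<^bsub>A\<^esub>"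
    using hu_inverse_exists[OF assms] by (elim bexE conjE)
  have wA: "w \<in> carrier A" using hu_A[OF \<Gamma>.inv_closed[OF C] w(1)] .
  have "inv\<^bsub>A\<^esub> v = w"
    using A.inv_unique'[OF hu_A[OF assms] wA w(3,2)] by simp
  then show ?thesis using w(1) by simp
qed

lemma hu_inv_A: "C \<in> carrier \<Gamma> ==> v \<in> hu C ==> inv\<^bsub>A\<^esub> v \<in> carrier A"
  using hu_Units by (rule A.Units_inv_closed)

lemma hu_l_inv: "C \<in> carrier \<Gamma> ==> v \<in> hu C ==> inv\<^bsub>A\<^esub> v \<cdot> v = \<one>\<^bsub>A\<^esub>"
  using hu_Units by (rule A.Units_l_inv)

lemma hu_r_inv: "C \<in> carrier \<Gamma> ==> v \<in> hu C ==> v \<cdot> inv\<^bsub>A\<^esub> v = \<one>\<^bsub>A\<^esub>"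
  using hu_Units by (rule A.Units_r_inv)

lemma hu_l_cancel: "C \<in> carrier \<Gamma> ==> v \<in> hu C ==> a \<in> carrier A ==> inv\<^bsub>A\<^esub> v \<cdot> (v \<cdot> a) = a"
  using A.m_assoc[OF hu_inv_A hu_A, of C v C v a] by (simp add: hu_l_inv A.l_one del: TGA_simps)

lemma hu_r_cancel: "C \<in> carrier \<Gamma> ==> v \<in> hu C ==> a \<in> carrier A ==> v \<cdot> (inv\<^bsub>A\<^esub> v \<cdot> a) = a"
  using A.m_assoc[OF hu_A hu_inv_A, of C v C v a] by (simp add: hu_r_inv A.l_one del: TGA_simps)

lemma hu_inv_mult:
  assumes C: "C \<in> carrier \<Gamma>" "C' \<in> carrier \<Gamma>" and v: "v \<in> hu C" "w \<in> hu C'"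
  shows "inv\<^bsub>A\<^esub> (v \<cdot> w) = inv\<^bsub>A\<^esub> w \<cdot> inv\<^bsub>A\<^esub> v"
proof -
  note c = hu_A[OF C(1) v(1)] hu_A[OF C(2) v(2)] hu_inv_A[OF C(1) v(1)] hu_inv_A[OF C(2) v(2)]
  have "(v \<cdot> w) \<cdot> (inv\<^bsub>A\<^esub> w \<cdot> inv\<^bsub>A\<^esub> v) = \<one>\<^bsub>A\<^esub>"
    using c hu_r_cancel[OF C(2) v(2) c(3)] hu_r_inv[OF C(1) v(1)]
    by (simp add: A.m_assoc A.m_closed del: TGA_simps)
  moreover have "(inv\<^bsub>A\<^esub> w \<cdot> inv\<^bsub>A\<^esub> v) \<cdot> (v \<cdot> w) = \<one>\<^bsub>A\<^esub>"
    using c hu_l_cancel[OF C(1) v(1) c(2)] hu_l_inv[OF C(2) v(2)]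
    by (simp add: A.m_assoc A.m_closed del: TGA_simps)
  ultimately show ?thesis
    using A.inv_unique'[OF A.m_closed[OF c(1,2)] A.m_closed[OF c(4,3)]] by simp
qed

lemma conj_B:
  assumes C: "C \<in> carrier \<Gamma>" and v: "v \<in> hu C" and b: "b \<in> carrier B"
  shows "inv\<^bsub>A\<^esub> v \<cdot> b \<cdot> v \<in> carrier B" "v \<cdot> b \<cdot> inv\<^bsub>A\<^esub> v \<in> carrier B"
proof -
  note Ci = \<Gamma>.inv_closed[OF C]
  have vD: "v \<in> D C" and viD: "inv\<^bsub>A\<^esub> v \<in> D (inv\<^bsub>\<Gamma>\<^esub> C)" and bD: "b \<in> D N"
    using hu_D[OF C v] hu_D[OF Ci hu_inv[OF C v]] b D_N by simp_all
  have e1: "inv\<^bsub>\<Gamma>\<^esub> C \<star> N \<star> C = N"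
    using \<Gamma>.r_one[OF Ci] \<Gamma>.l_inv[OF C] unfolding one_\<Gamma> by simp
  have e2: "C \<star> N \<star> inv\<^bsub>\<Gamma>\<^esub> C = N"
    using \<Gamma>.r_one[OF C] \<Gamma>.r_inv[OF C] unfolding one_\<Gamma> by simp
  show "inv\<^bsub>A\<^esub> v \<cdot> b \<cdot> v \<in> carrier B"
    using D_mult[OF \<Gamma>.m_closed[OF Ci N_\<Gamma>] C D_mult[OF Ci N_\<Gamma> viD bD] vD] unfolding e1 D_N .
  show "v \<cdot> b \<cdot> inv\<^bsub>A\<^esub> v \<in> carrier B"
    using D_mult[OF \<Gamma>.m_closed[OF C N_\<Gamma>] Ci D_mult[OF C N_\<Gamma> vD bD] viD] unfolding e2 D_N .
qed

text \<open>A component of the quotient grading is \<open>v\<close> times \<open>B\<close> for any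
  homogeneous unit \<open>v\<close> of its degree; this is the step that moves its elements into
  \<open>B\<close>.\<close>

lemma D_shift:
  assumes C: "C \<in> carrier \<Gamma>" and v: "v \<in> hu C" and a: "a \<in> D C"
  shows "inv\<^bsub>A\<^esub> v \<cdot> a \<in> carrier B"
  using D_mult[OF \<Gamma>.inv_closed[OF C] C hu_D[OF \<Gamma>.inv_closed[OF C] hu_inv[OF C v]] a]
    \<Gamma>.l_inv[OF C] D_N by simp

section \<open>Conjugate modules\<close>

abbreviation cj :: "('a \<Rightarrow> complex) \<Rightarrow> ('a \<Rightarrow> complex, 'm) module \<Rightarrow> ('a \<Rightarrow> complex, 'm) module" where
  "cj v M \<equiv> conjugate_module A v M"

lemma cj_simps [simp]:
  "carrier (cj v M) = carrier M" "x \<oplus>\<^bsub>cj v M\<^esub> y = x \<oplus>\<^bsub>M\<^esub> y" "\<zero>\<^bsub>cj v M\<^esub> = \<zero>\<^bsub>M\<^esub>"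
  "a \<odot>\<^bsub>cj v M\<^esub> m = (inv\<^bsub>A\<^esub> v \<cdot> a \<cdot> v) \<odot>\<^bsub>M\<^esub> m"
  by (simp_all add: conjugate_module_def)

lemma left_module_cj:
  assumes lm: "left_module B M" and C: "C \<in> carrier \<Gamma>" and v: "v \<in> hu C"
  shows "left_module B (cj v M)"
proof -
  interpret M: left_module B M by (rule lm)
  note vA = hu_A[OF C v] and viA = hu_inv_A[OF C v]
  have "abelian_group (cj v M)"
  proof (rule abelian_groupI)
    fix x assume "x \<in> carrier (cj v M)"
    then show "\<exists>y\<in>carrier (cj v M). y \<oplus>\<^bsub>cj v M\<^esub> x = \<zero>\<^bsub>cj v M\<^esub>"
      by (intro bexI[of _ "\<ominus>\<^bsub>M\<^esub> x"]) (simp_all add: M.M.l_neg)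
  qed (auto simp: M.M.a_assoc intro: M.M.a_comm)
  moreover have "left_module_axioms B (cj v M)"
  proof (rule left_module_axioms.intro)
    fix a m assume "a \<in> carrier B" "m \<in> carrier (cj v M)"
    then show "a \<odot>\<^bsub>cj v M\<^esub> m \<in> carrier (cj v M)"
      using M.smult_closed[OF conj_B(1)[OF C v]] by simp
  next
    fix a b m assume ab: "a \<in> carrier B" "b \<in> carrier B" and m: "m \<in> carrier (cj v M)"
    have "inv\<^bsub>A\<^esub> v \<cdot> (a \<oplus>\<^bsub>B\<^esub> b) \<cdot> v =
        (inv\<^bsub>A\<^esub> v \<cdot> a \<cdot> v) \<oplus>\<^bsub>B\<^esub> (inv\<^bsub>A\<^esub> v \<cdot> b \<cdot> v)"
      by (simp add: A_mult_add A_add_mult)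
    then show "(a \<oplus>\<^bsub>B\<^esub> b) \<odot>\<^bsub>cj v M\<^esub> m = a \<odot>\<^bsub>cj v M\<^esub> m \<oplus>\<^bsub>cj v M\<^esub> b \<odot>\<^bsub>cj v M\<^esub> m"
      using M.smult_l_distr[OF conj_B(1)[OF C v ab(1)] conj_B(1)[OF C v ab(2)]] m
      by (simp del: TGA_simps)
  next
    fix a m n assume "a \<in> carrier B" "m \<in> carrier (cj v M)" "n \<in> carrier (cj v M)"
    then show "a \<odot>\<^bsub>cj v M\<^esub> (m \<oplus>\<^bsub>cj v M\<^esub> n) = a \<odot>\<^bsub>cj v M\<^esub> m \<oplus>\<^bsub>cj v M\<^esub> a \<odot>\<^bsub>cj v M\<^esub> n"
      using M.smult_r_distr[OF conj_B(1)[OF C v]] by simp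
  next
    fix a b m assume ab: "a \<in> carrier B" "b \<in> carrier B" and m: "m \<in> carrier (cj v M)"
    note abA = BA[OF ab(1)] BA[OF ab(2)]
    have "inv\<^bsub>A\<^esub> v \<cdot> (a \<otimes>\<^bsub>B\<^esub> b) \<cdot> v =
        (inv\<^bsub>A\<^esub> v \<cdot> a \<cdot> v) \<otimes>\<^bsub>B\<^esub> (inv\<^bsub>A\<^esub> v \<cdot> b \<cdot> v)"
      unfolding B_mult[OF ab] B_mult[OF conj_B(1)[OF C v ab(1)] conj_B(1)[OF C v ab(2)]]
      using vA viA abA hu_r_cancel[OF C v]
      by (simp add: A.m_assoc A.m_closed del: TGA_simps)
    then show "(a \<otimes>\<^bsub>B\<^esub> b) \<odot>\<^bsub>cj v M\<^esub> m = a \<odot>\<^bsub>cj v M\<^esub> (b \<odot>\<^bsub>cj v M\<^esub> m)"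
      using M.smult_assoc[OF conj_B(1)[OF C v ab(1)] conj_B(1)[OF C v ab(2)]] m
      by (simp del: TGA_simps)
  next
    fix m assume "m \<in> carrier (cj v M)"
    then show "\<one>\<^bsub>B\<^esub> \<odot>\<^bsub>cj v M\<^esub> m = m"
      using M.smult_one hu_l_inv[OF C v] A.r_one[OF viA] by (simp add: B_one del: TGA_simps)
  qed
  ultimately show ?thesis
    using B.A.ring_axioms by (simp add: left_module_def)
qed

lemma conj_conj:
  assumes C: "C \<in> carrier \<Gamma>" and v: "v \<in> hu C" and b: "b \<in> carrier A"
  shows "inv\<^bsub>A\<^esub> v \<cdot> (v \<cdot> b \<cdot> inv\<^bsub>A\<^esub> v) \<cdot> v = b"
  using hu_A[OF C v] hu_inv_A[OF C v] b hu_l_cancel[OF C v] hu_l_inv[OF C v]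
  by (simp add: A.m_assoc A.m_closed A.r_one del: TGA_simps)

text \<open>Conjugation by \<open>v\<close> is a bijection of \<open>B\<close>, so \<open>M\<close>
  and its conjugate have the same submodules.\<close>

lemma irreducible_cj:
  assumes irr: "irreducible_module B M" and C: "C \<in> carrier \<Gamma>" and v: "v \<in> hu C"
  shows "irreducible_module B (cj v M)"
proof -
  interpret M: left_module B M using irr by (rule irreducible_left_module)
  show ?thesis
    unfolding irreducible_module_def
  proof (intro conjI allI impI)
    show "left_module B (cj v M)" by (rule left_module_cj[OF M.left_module_axioms C v])
    show "carrier (cj v M) \<noteq> {\<zero>\<^bsub>cj v M\<^esub>}" using irr by (simp add: irreducible_module_def)
    fix H assume H: "Module.submodule H B (cj v M)"
    note h = submodD[OF H, unfolded cj_simps]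
    have "Module.submodule H B M"
    proof (rule M.submodI)
      fix b m assume b: "b \<in> carrier B" and m: "m \<in> H"
      have "(inv\<^bsub>A\<^esub> v \<cdot> (v \<cdot> b \<cdot> inv\<^bsub>A\<^esub> v) \<cdot> v) \<odot>\<^bsub>M\<^esub> m \<in> H"
        by (rule h(4)[OF conj_B(2)[OF C v b] m])
      then show "b \<odot>\<^bsub>M\<^esub> m \<in> H" unfolding conj_conj[OF C v BA[OF b]] .
    qed (use h in blast)+
    then show "H = {\<zero>\<^bsub>cj v M\<^esub>} \<or> H = carrier (cj v M)"
      using irr by (simp add: irreducible_module_def)
  qed
qed

lemma cj_isomorphic:
  assumes iso: "module_isomorphic B M M'" and C: "C \<in> carrier \<Gamma>" and v: "v \<in> hu C"
  shows "module_isomorphic B (cj v M) (cj v M')"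
proof -
  obtain f where f: "f \<in> LinearCombinations.module_hom B M M'" "bij_betw f (carrier M) (carrier M')"
    using iso unfolding module_isomorphic_def by blast
  have "f \<in> LinearCombinations.module_hom B (cj v M) (cj v M')"
    by (rule module_homI) (use module_homD[OF f(1)] conj_B(1)[OF C v] in simp_all)
  then show ?thesis using f(2) unfolding module_isomorphic_def by auto
qed

text \<open>The identity map is an isomorphism; the order of the two conjugations is what makes the
  action on types a left action.\<close>

lemma cj_cj:
  assumes lm: "left_module B M"
    and C: "C \<in> carrier \<Gamma>" "C' \<in> carrier \<Gamma>" and v: "v \<in> hu C" "w \<in> hu C'"
  shows "module_isomorphic B (cj (v \<cdot> w) M) (cj v (cj w M))"
proof -
  have "(\<lambda>m. m) \<in> LinearCombinations.module_hom B (cj (v \<cdot> w) M) (cj v (cj w M))"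
  proof (rule module_homI)
    fix b m assume b: "b \<in> carrier B"
    have "inv\<^bsub>A\<^esub> (v \<cdot> w) \<cdot> b \<cdot> (v \<cdot> w) =
        inv\<^bsub>A\<^esub> w \<cdot> (inv\<^bsub>A\<^esub> v \<cdot> b \<cdot> v) \<cdot> w"
      unfolding hu_inv_mult[OF C v]
      using hu_A[OF C(1) v(1)] hu_A[OF C(2) v(2)] hu_inv_A[OF C(1) v(1)] hu_inv_A[OF C(2) v(2)] BA[OF b]
      by (simp add: A.m_assoc A.m_closed del: TGA_simps)
    then show "b \<odot>\<^bsub>cj (v \<cdot> w) M\<^esub> m = b \<odot>\<^bsub>cj v (cj w M)\<^esub> m"
      by simp
  qed simp_all
  then show ?thesis unfolding module_isomorphic_def
    by (intro bexI[of _ "\<lambda>m. m"]) (simp_all add: bij_betw_def inj_on_def)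
qed

text \<open>A unit of degree \<open>N\<close> lies in \<open>B\<close>, and its own action on
  \<open>M\<close> is the isomorphism.\<close>

lemma cj_inner:
  assumes lm: "left_module B M" and w: "w \<in> hu N"
  shows "module_isomorphic B (cj w M) M"
proof -
  interpret M: left_module B M by (rule lm)
  note wA = hu_A[OF N_\<Gamma> w] and wiA = hu_inv_A[OF N_\<Gamma> w]
  have wB: "w \<in> carrier B" using hu_D[OF N_\<Gamma> w] D_N by simp
  have wiB: "inv\<^bsub>A\<^esub> w \<in> carrier B"
    using hu_D[OF N_\<Gamma>] hu_inv[OF N_\<Gamma> w] D_N \<Gamma>.inv_one by simp
  have c1: "w \<odot>\<^bsub>M\<^esub> (inv\<^bsub>A\<^esub> w \<odot>\<^bsub>M\<^esub> m) = m" if "m \<in> carrier M" for m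
    using M.smult_assoc[OF wB wiB that] M.smult_one[OF that] hu_r_inv[OF N_\<Gamma> w]
    by (simp add: B_mult[OF wB wiB] B_one del: TGA_simps)
  have c2: "inv\<^bsub>A\<^esub> w \<odot>\<^bsub>M\<^esub> (w \<odot>\<^bsub>M\<^esub> m) = m" if "m \<in> carrier M" for m
    using M.smult_assoc[OF wiB wB that] M.smult_one[OF that] hu_l_inv[OF N_\<Gamma> w]
    by (simp add: B_mult[OF wiB wB] B_one del: TGA_simps)
  have "(\<lambda>m. w \<odot>\<^bsub>M\<^esub> m) \<in> LinearCombinations.module_hom B (cj w M) M"
  proof (rule module_homI)
    fix b m assume b: "b \<in> carrier B" and m: "m \<in> carrier (cj w M)"
    have "w \<odot>\<^bsub>M\<^esub> (b \<odot>\<^bsub>cj w M\<^esub> m) = (w \<otimes>\<^bsub>B\<^esub> (inv\<^bsub>A\<^esub> w \<cdot> b \<cdot> w)) \<odot>\<^bsub>M\<^esub> m"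
      using M.smult_assoc[OF wB conj_B(1)[OF N_\<Gamma> w b]] m by simp
    also have "w \<otimes>\<^bsub>B\<^esub> (inv\<^bsub>A\<^esub> w \<cdot> b \<cdot> w) = b \<otimes>\<^bsub>B\<^esub> w"
      unfolding B_mult[OF wB conj_B(1)[OF N_\<Gamma> w b]] B_mult[OF b wB]
      using wA wiA BA[OF b] hu_r_cancel[OF N_\<Gamma> w] by (simp add: A.m_assoc A.m_closed del: TGA_simps)
    also have "(b \<otimes>\<^bsub>B\<^esub> w) \<odot>\<^bsub>M\<^esub> m = b \<odot>\<^bsub>M\<^esub> (w \<odot>\<^bsub>M\<^esub> m)"
      using M.smult_assoc[OF b wB] m by simp
    finally show "w \<odot>\<^bsub>M\<^esub> (b \<odot>\<^bsub>cj w M\<^esub> m) = b \<odot>\<^bsub>M\<^esub> (w \<odot>\<^bsub>M\<^esub> m)" .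
  qed (use M.smult_closed[OF wB] M.smult_r_distr[OF wB] in simp_all)
  moreover have "bij_betw (\<lambda>m. w \<odot>\<^bsub>M\<^esub> m) (carrier (cj w M)) (carrier M)"
    by (rule bij_betwI[of _ _ _ "\<lambda>m. inv\<^bsub>A\<^esub> w \<odot>\<^bsub>M\<^esub> m"])
      (use M.smult_closed[OF wB] M.smult_closed[OF wiB] c1 c2 in auto)
  ultimately show ?thesis unfolding module_isomorphic_def by blast
qed

text \<open>Two units of the same degree differ by a unit of degree \<open>N\<close> on the right,
  to which \<open>cj_inner\<close> applies.\<close>

lemma cj_same:
  assumes lm: "left_module B M" and C: "C \<in> carrier \<Gamma>" and v: "v \<in> hu C" "w \<in> hu C"
  shows "module_isomorphic B (cj v M) (cj w M)"
proof -
  define x where "x = inv\<^bsub>A\<^esub> v \<cdot> w"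
  have x: "x \<in> hu N"
    using hu_mult[OF \<Gamma>.inv_closed[OF C] C hu_inv[OF C v(1)] v(2)] \<Gamma>.l_inv[OF C] by (simp add: x_def)
  have w: "w = v \<cdot> x"
    unfolding x_def using hu_r_cancel[OF C v(1) hu_A[OF C v(2)]] by simp
  have "module_isomorphic B (cj w M) (cj v (cj x M))"
    unfolding w by (rule cj_cj[OF lm C N_\<Gamma> v(1) x])
  moreover have "module_isomorphic B (cj v (cj x M)) (cj v M)"
    by (rule cj_isomorphic[OF cj_inner[OF lm x] C v(1)])
  ultimately have "module_isomorphic B (cj w M) (cj v M)"
    by (rule module_isomorphic_trans)
  then show ?thesis
    by (rule module_isomorphic_sym[OF left_module_cj[OF lm C v(2)]])
qed

text \<open>All members of the union in \<open>irr_action\<close> coincide, so the action can be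
  computed with one module and one homogeneous unit, possibly a multiple of a basis element.\<close>

lemma act_module_type:
  assumes irr: "irreducible_module B M" and C: "C \<in> carrier \<Gamma>" and v: "v \<in> hu C"
  shows "act C (module_type B M) = module_type B (cj v M)"
proof -
  have eq: "module_type B (cj (basis_elt g) M') = module_type B (cj v M)"
    if g: "g \<in> C" and M': "M' \<in> module_type B M" for g M'
  proof -
    have irr': "irreducible_module B M'" and iso: "module_isomorphic B M M'"
      using M' by (auto simp: module_type_def)
    note bg = basis_elt_hu[OF g]
    have "module_isomorphic B (cj v M) (cj (basis_elt g) M)"
      by (rule cj_same[OF irreducible_left_module[OF irr] C v bg])
    then have "module_isomorphic B (cj v M) (cj (basis_elt g) M')"
      by (rule module_isomorphic_trans[OF _ cj_isomorphic[OF iso C bg]])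
    then show ?thesis
      using module_type_eq_iff[OF irreducible_cj[OF irr C v] irreducible_cj[OF irr' C bg]] by simp
  qed
  obtain g where g: "g \<in> C" using C by (rule coset_ex)
  have "module_type B (cj v M) \<subseteq> act C (module_type B M)"
    unfolding irr_action_def using eq[OF g module_type_self[OF irr]] g module_type_self[OF irr] by blast
  moreover have "act C (module_type B M) \<subseteq> module_type B (cj v M)"
    unfolding irr_action_def using eq by blast
  ultimately show ?thesis by blast
qed

lemma Irr_cases: assumes "c \<in> Irr B" obtains M where "irreducible_module B M" "c = module_type B M"
  using assms unfolding Irr_def by blast

lemma hu_ex: assumes "C \<in> carrier \<Gamma>" obtains v where "v \<in> hu C"
  using assms basis_elt_hu by (elim coset_ex) blast

lemma act_closed: assumes "c \<in> Irr B" "C \<in> carrier \<Gamma>" shows "act C c \<in> Irr B"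
proof -
  obtain M where M: "irreducible_module B M" "c = module_type B M" using assms(1) by (rule Irr_cases)
  obtain v where v: "v \<in> hu C" using assms(2) by (rule hu_ex)
  show ?thesis
    unfolding M(2) act_module_type[OF M(1) assms(2) v]
    by (rule module_type_in_Irr[OF irreducible_cj[OF M(1) assms(2) v]])
qed

lemma act_one: assumes "c \<in> Irr B" shows "act N c = c"
proof -
  obtain M where M: "irreducible_module B M" "c = module_type B M" using assms(1) by (rule Irr_cases)
  show ?thesis
    unfolding M(2) act_module_type[OF M(1) N_\<Gamma> one_hu]
    using module_type_eq_iff[OF irreducible_cj[OF M(1) N_\<Gamma> one_hu] M(1)]
      cj_inner[OF irreducible_left_module[OF M(1)] one_hu] by simp
qed

lemma act_mult:
  assumes "c \<in> Irr B" and C: "C \<in> carrier \<Gamma>" "C' \<in> carrier \<Gamma>"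
  shows "act (C \<star> C') c = act C (act C' c)"
proof -
  obtain M where M: "irreducible_module B M" "c = module_type B M" using assms(1) by (rule Irr_cases)
  obtain v where v: "v \<in> hu C" using C(1) by (rule hu_ex)
  obtain w where w: "w \<in> hu C'" using C(2) by (rule hu_ex)
  note vw = hu_mult[OF C v w] and CC = \<Gamma>.m_closed[OF C] and irr = irreducible_cj[OF M(1) C(2) w]
  show ?thesis
    unfolding M(2) act_module_type[OF M(1) CC vw] act_module_type[OF M(1) C(2) w]
      act_module_type[OF irr C(1) v]
    using module_type_eq_iff[OF irreducible_cj[OF M(1) CC vw] irreducible_cj[OF irr C(1) v]]
      cj_cj[OF irreducible_left_module[OF M(1)] C v w] by simp
qed

lemma act_inv_eq:
  assumes "c \<in> Irr B" "C \<in> carrier \<Gamma>" shows "act (inv\<^bsub>\<Gamma>\<^esub> C) (act C c) = c"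
  using act_mult[OF assms(1) \<Gamma>.inv_closed[OF assms(2)] assms(2)] \<Gamma>.l_inv[OF assms(2)] act_one[OF assms(1)]
  by simp

section \<open>Orbits of the action\<close>

abbreviation orb where "orb c \<equiv> orbit \<Gamma> act c"

lemma orb_def: "orb c = {act C c | C. C \<in> carrier \<Gamma>}"
  by (simp add: orbit_def)

lemma orb_self: "c \<in> Irr B ==> c \<in> orb c"
  unfolding orb_def using act_one[of c] N_\<Gamma> by (intro CollectI exI[of _ N]) simp

lemma orb_subset: "c \<in> Irr B ==> orb c \<subseteq> Irr B"
  unfolding orb_def using act_closed by blast

lemma orb_act: assumes "c \<in> Irr B" "C \<in> carrier \<Gamma>" "d \<in> orb c" shows "act C d \<in> orb c"
proof -
  obtain C' where C': "C' \<in> carrier \<Gamma>" "d = act C' c" using assms(3) unfolding orb_def by blast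
  show ?thesis
    unfolding orb_def C'(2) using act_mult[OF assms(1,2) C'(1)] \<Gamma>.m_closed[OF assms(2) C'(1)] by blast
qed

lemma orb_eq: assumes "c \<in> Irr B" "d \<in> orb c" shows "orb d = orb c"
proof -
  obtain C where C: "C \<in> carrier \<Gamma>" "d = act C c" using assms(2) unfolding orb_def by blast
  have d: "d \<in> Irr B" unfolding C(2) by (rule act_closed[OF assms(1) C(1)])
  have c: "c \<in> orb d"
    unfolding orb_def C(2) using act_inv_eq[OF assms(1) C(1)] \<Gamma>.inv_closed[OF C(1)]
    by (intro CollectI exI[of _ "inv\<^bsub>\<Gamma>\<^esub> C"]) simp
  have "orb d \<subseteq> orb c"
  proof
    fix x assume "x \<in> orb d"
    then obtain X where "X \<in> carrier \<Gamma>" "x = act X d" unfolding orb_def by blast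
    then show "x \<in> orb c" using orb_act[OF assms(1) _ assms(2)] by simp
  qed
  moreover have "orb c \<subseteq> orb d"
  proof
    fix x assume "x \<in> orb c"
    then obtain X where "X \<in> carrier \<Gamma>" "x = act X c" unfolding orb_def by blast
    then show "x \<in> orb d" using orb_act[OF d _ c] by simp
  qed
  ultimately show ?thesis by blast
qed

lemma orb_act_iff:
  assumes "c \<in> Irr B" "C \<in> carrier \<Gamma>" "d \<in> Irr B" shows "act C d \<in> orb c \<longleftrightarrow> d \<in> orb c"
  using orb_act[OF assms(1) \<Gamma>.inv_closed[OF assms(2)], of "act C d"] act_inv_eq[OF assms(3,2)]
    orb_act[OF assms(1,2), of d] by auto

lemma orbits_eq: "orbits \<Gamma> (Irr B) act = orb ` Irr B"
  unfolding orbits_def by blast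

lemma orbits_disjoint:
  assumes "O1 \<in> orbits \<Gamma> (Irr B) act" "O2 \<in> orbits \<Gamma> (Irr B) act" "O1 \<noteq> O2"
  shows "O1 \<inter> O2 = {}"
proof -
  obtain c d where c: "c \<in> Irr B" "O1 = orb c" and d: "d \<in> Irr B" "O2 = orb d"
    using assms(1,2) unfolding orbits_eq by blast
  have "False" if "x \<in> orb c" "x \<in> orb d" for x
    using orb_eq[OF c(1) that(1)] orb_eq[OF d(1) that(2)] c(2) d(2) assms(3) by simp
  then show ?thesis using c d by blast
qed

lemma orbits_Union: "\<Union> (orbits \<Gamma> (Irr B) act) = Irr B"
  unfolding orbits_eq using orb_self orb_subset by blast

end

section \<open>The graded-simple summands\<close>

lemma ideal_algebra_simps [simp]:
  "carrier (ideal_algebra A I) = I" "\<zero>\<^bsub>ideal_algebra A I\<^esub> = \<zero>\<^bsub>A\<^esub>"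
  "x \<oplus>\<^bsub>ideal_algebra A I\<^esub> y = x \<oplus>\<^bsub>A\<^esub> y" "x \<otimes>\<^bsub>ideal_algebra A I\<^esub> y = x \<otimes>\<^bsub>A\<^esub> y"
  "c \<odot>\<^bsub>ideal_algebra A I\<^esub> x = c \<odot>\<^bsub>A\<^esub> x"
  by (simp_all add: ideal_algebra_def)

lemma finsum_ideal_algebra:
  assumes "abelian_group A" "abelian_group (ideal_algebra A I)" "I \<subseteq> carrier A"
    and "\<And>j. j \<in> J ==> f j \<in> I"
  shows "finsum (ideal_algebra A I) f J = finsum A f J"
  using assms(4)
proof (induction J rule: infinite_finite_induct)
  interpret A: abelian_group A by fact
  interpret I: abelian_group "ideal_algebra A I" by fact
  case (insert j J)
  have "f \<in> J \<rightarrow> I" "f j \<in> I" "f \<in> J \<rightarrow> carrier A" "f j \<in> carrier A" using insert.prems assms(3) by auto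
  then show ?case using insert by (simp add: A.finsum_insert I.finsum_insert)
next
  interpret A: abelian_group A by fact
  interpret I: abelian_group "ideal_algebra A I" by fact
  case (infinite J)
  then show ?case by simp
next
  interpret A: abelian_group A by fact
  interpret I: abelian_group "ideal_algebra A I" by fact
  case empty
  then show ?case by simp
qed

lemma internal_direct_sum_ideal_algebra:
  assumes "abelian_group A" "abelian_group (ideal_algebra A I)" "I \<subseteq> carrier A"
    and "\<And>k. k \<in> K ==> E k \<subseteq> I"
  shows "internal_direct_sum (ideal_algebra A I) X K E \<longleftrightarrow> internal_direct_sum A X K E"
proof -
  have eq: "finsum (ideal_algebra A I) f J = finsum A f J" if "J \<subseteq> K" "f \<in> Pi J E" for f J
    by (rule finsum_ideal_algebra[OF assms(1-3)]) (use that assms(4) in blast)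
  have "family_sum (ideal_algebra A I) K E = family_sum A K E"
    unfolding family_sum_def using eq by (intro Collect_cong) metis
  moreover have "(\<forall>J f. finite J \<and> J \<subseteq> K \<and> f \<in> Pi J E \<and> finsum (ideal_algebra A I) f J = \<zero>\<^bsub>A\<^esub>
      \<longrightarrow> (\<forall>j\<in>J. f j = \<zero>\<^bsub>A\<^esub>)) \<longleftrightarrow> (\<forall>J f. finite J \<and> J \<subseteq> K \<and> f \<in> Pi J E \<and> finsum A f J = \<zero>\<^bsub>A\<^esub>
      \<longrightarrow> (\<forall>j\<in>J. f j = \<zero>\<^bsub>A\<^esub>))"
    using eq by metis
  ultimately show ?thesis by (simp add: internal_direct_sum_def)
qed

section \<open>Projections onto the homogeneous components\<close>

context crossed
begin

definition restr :: "'a set \<Rightarrow> ('a \<Rightarrow> complex) \<Rightarrow> 'a \<Rightarrow> complex" where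
  "restr C f = (\<lambda>x. if x \<in> C then f x else 0)"

lemma restr_D: "C \<in> carrier \<Gamma> ==> restr C f \<in> D C"
  by (simp add: D_eq restr_def)

lemma restr_A: "C \<in> carrier \<Gamma> ==> restr C f \<in> carrier A"
  by (rule D_A[OF _ restr_D])

lemma restr_eq: "C \<in> carrier \<Gamma> ==> f \<in> D C ==> restr C f = f"
  by (auto simp: D_eq restr_def)

lemma restr_eq_zero: "C \<in> carrier \<Gamma> ==> C' \<in> carrier \<Gamma> ==> C \<noteq> C' ==> f \<in> D C ==> restr C' f = \<zero>\<^bsub>A\<^esub>"
  using coset_disjoint[of C C'] by (auto simp: D_eq restr_def fun_eq_iff)

lemma restr_add: "restr C (f \<oplus>\<^bsub>A\<^esub> h) = restr C f \<oplus>\<^bsub>A\<^esub> restr C h"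
  by (auto simp: restr_def)

lemma sum_cosets:
  assumes "C \<in> carrier \<Gamma>" "x \<in> C"
  shows "(\<Sum>C'\<in>carrier \<Gamma>. if x \<in> C' then h C' else (0::complex)) = h C"
proof -
  have "(\<Sum>C'\<in>carrier \<Gamma>. if x \<in> C' then h C' else 0) = (\<Sum>C'\<in>carrier \<Gamma>. if C' = C then h C' else 0)"
    by (rule sum.cong[OF refl]) (use coset_disjoint[OF assms(1)] assms(2) in auto)
  then show ?thesis using finite_\<Gamma> assms(1) by simp
qed

lemma restr_decompose:
  assumes "a \<in> carrier A" shows "a = finsum A (\<lambda>C. restr C a) (carrier \<Gamma>)"
proof
  fix x
  have "finsum A (\<lambda>C. restr C a) (carrier \<Gamma>) x = (\<Sum>C\<in>carrier \<Gamma>. if x \<in> C then a x else 0)"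
    using A_finsum[OF finite_\<Gamma> restr_A, of "\<lambda>C. C" "\<lambda>_. a"] by (simp add: restr_def)
  also have "\<dots> = a x"
  proof (cases "x \<in> carrier G")
    case True
    show ?thesis
      by (rule sum_cosets[OF coset_\<Gamma>[OF True] coset_self[OF True]])
  next
    case False
    then show ?thesis using assms by simp
  qed
  finally show "a x = finsum A (\<lambda>C. restr C a) (carrier \<Gamma>) x" by simp
qed

lemma D_independent:
  assumes J: "finite J" "J \<subseteq> carrier \<Gamma>" and f: "f \<in> Pi J D" and z: "finsum A f J = \<zero>\<^bsub>A\<^esub>" and j: "j \<in> J"
  shows "f j = \<zero>\<^bsub>A\<^esub>"
proof -
  have fD: "f i \<in> D i" if "i \<in> J" for i using Pi_mem[OF f that] .
  have iG: "i \<in> carrier \<Gamma>" if "i \<in> J" for i using that J(2) by (rule subsetD[rotated])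
  have fs: "finsum A f J = (\<lambda>x. \<Sum>i\<in>J. f i x)"
    by (rule A_finsum[OF J(1)]) (rule D_A[OF iG fD])
  have "f j x = 0" for x
  proof (cases "x \<in> j")
    case True
    have "f i x = 0" if "i \<in> J" "i \<noteq> j" for i
    proof -
      have "x \<notin> i" using coset_disjoint[OF iG[OF that(1)] iG[OF j]] True that(2) by blast
      then show ?thesis using fD[OF that(1)] D_eq[OF iG[OF that(1)]] by simp
    qed
    then have "(\<Sum>i\<in>J. f i x) = (\<Sum>i\<in>J. if i = j then f j x else 0)"
      by (intro sum.cong) auto
    also have "\<dots> = f j x" using J(1) j by simp
    finally show ?thesis using fs z by (simp add: fun_eq_iff)
  next
    case False
    then show ?thesis using fD[OF j] D_eq[OF iG[OF j]] by simp
  qed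
  then show ?thesis by auto
qed

text \<open>Stability under the projections \<open>restr\<close> is the practical form of being
  graded: an element is the sum of its projections.\<close>

lemma internal_direct_sum_restr:
  assumes I: "I \<subseteq> carrier A" "\<zero>\<^bsub>A\<^esub> \<in> I" "\<And>x y. x \<in> I ==> y \<in> I ==> x \<oplus>\<^bsub>A\<^esub> y \<in> I"
    and r: "\<And>C x. C \<in> carrier \<Gamma> ==> x \<in> I ==> restr C x \<in> I"
  shows "internal_direct_sum A I (carrier \<Gamma>) (\<lambda>C. I \<inter> D C)"
  unfolding internal_direct_sum_def
proof (intro conjI allI impI ballI)
  show "I = family_sum A (carrier \<Gamma>) (\<lambda>C. I \<inter> D C)"
  proof (intro equalityI subsetI)
    fix a assume a: "a \<in> I"
    have "a = finsum A (\<lambda>C. restr C a) (carrier \<Gamma>)"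
      by (rule restr_decompose[OF subsetD[OF I(1) a]])
    moreover have "(\<lambda>C. restr C a) \<in> Pi (carrier \<Gamma>) (\<lambda>C. I \<inter> D C)"
      by (intro Pi_I IntI r[OF _ a] restr_D)
    ultimately show "a \<in> family_sum A (carrier \<Gamma>) (\<lambda>C. I \<inter> D C)"
      unfolding family_sum_def using finite_\<Gamma> by blast
  next
    fix a assume "a \<in> family_sum A (carrier \<Gamma>) (\<lambda>C. I \<inter> D C)"
    then obtain f J where f: "a = finsum A f J" "f \<in> Pi J (\<lambda>C. I \<inter> D C)"
      unfolding family_sum_def by blast
    have fI: "f j \<in> I" if "j \<in> J" for j using Pi_mem[OF f(2) that] by simp
    show "a \<in> I"
      unfolding f(1) by (rule finsum_mem[OF abelian_group_A I fI])
  qed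
next
  fix J f j
  assume h: "finite J \<and> J \<subseteq> carrier \<Gamma> \<and> f \<in> Pi J (\<lambda>C. I \<inter> D C) \<and> finsum A f J = \<zero>\<^bsub>A\<^esub>" and j: "j \<in> J"
  then have "f \<in> Pi J D" by auto
  then show "f j = \<zero>\<^bsub>A\<^esub>" using D_independent[of J f j] h j by blast
qed

text \<open>Factors from \<open>B\<close> have degree \<open>N\<close>: a product
  \<open>g \<otimes> k\<close> with \<open>k\<close> in \<open>N\<close> lies in \<open>C\<close>
  only if \<open>g\<close> does.\<close>

lemma restr_mult_right:
  assumes C: "C \<in> carrier \<Gamma>" and a: "a \<in> carrier A" and b: "b \<in> carrier B"
  shows "restr C (a \<cdot> b) = restr C a \<cdot> b"
proof
  fix x
  show "restr C (a \<cdot> b) x = (restr C a \<cdot> b) x"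
  proof (cases "x \<in> C")
    case True
    have "(if g \<otimes> k = x then a g * b k * \<alpha> g k else 0) =
        (if g \<otimes> k = x then restr C a g * b k * \<alpha> g k else 0)"
      if g: "g \<in> carrier G" and k: "k \<in> carrier G" for g k
    proof (cases "g \<otimes> k = x \<and> k \<in> N")
      case gk: True
      have "x \<in> (N #> g) \<star> N"
        using coset_mult[OF coset_\<Gamma>[OF g] N_\<Gamma> coset_self[OF g], of k] gk by simp
      then have "x \<in> N #> g"
        using \<Gamma>.r_one[OF coset_\<Gamma>[OF g]] by simp
      then have "g \<in> C"
        using coset_disjoint[OF C coset_\<Gamma>[OF g] True] coset_self[OF g] by simp
      then show ?thesis by (simp add: restr_def)
    next
      case False
      then show ?thesis using b by auto
    qed
    then show ?thesis
      using True by (simp add: restr_def[of C "a \<cdot> b"] A_mult)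
  next
    case False
    have "restr C a \<cdot> b \<in> D (C \<star> N)"
      by (rule D_mult[OF C N_\<Gamma> restr_D[OF C]]) (use b D_N in simp)
    then have "restr C a \<cdot> b \<in> D C"
      using \<Gamma>.r_one[OF C] by simp
    then show ?thesis using False D_eq[OF C] by (simp add: restr_def)
  qed
qed

text \<open>For an idempotent \<open>e\<close> this is the left ideal generated by \<open>e\<close>,
  written as fixed points so that membership is an equation.\<close>

definition sm :: "('a \<Rightarrow> complex) \<Rightarrow> ('a \<Rightarrow> complex) set" where
  "sm e = {a \<in> carrier A. a \<cdot> e = a}"

lemma sm_A: "sm e \<subseteq> carrier A"
  unfolding sm_def by blast

lemma sm_iff: "a \<in> sm e \<longleftrightarrow> a \<in> carrier A \<and> a \<cdot> e = a"
  unfolding sm_def by blast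

lemma sm_zero: "e \<in> carrier A ==> \<zero>\<^bsub>A\<^esub> \<in> sm e"
  unfolding sm_iff by (intro conjI A.zero_closed A.l_null)

lemma sm_add: "e \<in> carrier A ==> x \<in> sm e ==> y \<in> sm e ==> x \<oplus>\<^bsub>A\<^esub> y \<in> sm e"
  unfolding sm_iff using A.l_distr[of x y e] A.a_closed[of x y] by (simp del: TGA_simps)

lemma sm_scale: "e \<in> carrier A ==> x \<in> sm e ==> c \<odot>\<^bsub>A\<^esub> x \<in> sm e"
  unfolding sm_iff using Alg.smult_mult_left[of x e c] Alg.smult_closed_complex[of x c] by (simp del: TGA_simps)

lemma sm_l: "e \<in> carrier A ==> a \<in> carrier A ==> x \<in> sm e ==> a \<cdot> x \<in> sm e"
  unfolding sm_iff using A.m_assoc[of a x e] A.m_closed[of a x] by (simp del: TGA_simps)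

end

text \<open>Centrality makes \<open>sm e\<close> a two-sided ideal with unit \<open>e\<close>;
  membership of \<open>e\<close> in \<open>B\<close>, the component of the neutral degree, makes it
  graded.\<close>

locale central_idem = crossed +
  fixes e
  assumes eB: "e \<in> carrier B" and ee: "e \<cdot> e = e"
    and central: "\<And>a. a \<in> carrier A ==> a \<cdot> e = e \<cdot> a"
begin

lemma eA: "e \<in> carrier A" by (rule BA[OF eB])

abbreviation S where "S \<equiv> sm e"
abbreviation SA where "SA \<equiv> ideal_algebra A S"

lemma S_A: "x \<in> S ==> x \<in> carrier A"
  using sm_A by (rule subsetD)

lemma e_S: "e \<in> S"
  unfolding sm_iff using eA ee by blast

lemma S_e: "x \<in> S ==> x \<cdot> e = x"
  unfolding sm_iff by blast

lemma e_S_left: "x \<in> S ==> e \<cdot> x = x"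
  using central[OF S_A] S_e by simp

lemma sm_r: "a \<in> carrier A ==> x \<in> S ==> x \<cdot> a \<in> S"
  unfolding sm_iff[of "x \<cdot> a"]
  using A.m_closed[OF S_A, of x a] A.m_assoc[OF S_A eA, of x a] A.m_assoc[OF S_A _ eA, of x a]
    central[of a] S_e[of x] by simp

lemma mult_e_S: "a \<in> carrier A ==> a \<cdot> e \<in> S"
  by (rule sm_l[OF eA _ e_S])

lemma SA_one: "\<one>\<^bsub>SA\<^esub> = e"
proof -
  have "\<one>\<^bsub>SA\<^esub> = (THE e. e \<in> S \<and> (\<forall>x\<in>S. e \<cdot> x = x \<and> x \<cdot> e = x))"
    by (simp add: ideal_algebra_def)
  also have "\<dots> = e"
  proof (rule the_equality)
    show "e \<in> S \<and> (\<forall>x\<in>S. e \<cdot> x = x \<and> x \<cdot> e = x)"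
      using e_S S_e e_S_left by blast
    fix e' assume "e' \<in> S \<and> (\<forall>x\<in>S. e' \<cdot> x = x \<and> x \<cdot> e' = x)"
    then show "e' = e" using e_S S_e[of e'] by metis
  qed
  finally show ?thesis .
qed

lemma abelian_group_SA: "abelian_group SA"
proof (rule abelian_groupI)
  fix x assume x: "x \<in> carrier SA"
  show "\<exists>y\<in>carrier SA. y \<oplus>\<^bsub>SA\<^esub> x = \<zero>\<^bsub>SA\<^esub>"
    by (rule bexI[of _ "(- 1) \<odot>\<^bsub>A\<^esub> x"]) (use sm_scale[OF eA, of x "- 1"] x in auto)
qed (use sm_add[OF eA] sm_zero[OF eA] in \<open>auto simp: add_ac\<close>)

lemma complex_algebra_SA: "complex_algebra SA"
proof -
  have "Group.monoid SA"
  proof (rule monoidI)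
    fix x y z assume "x \<in> carrier SA" "y \<in> carrier SA" "z \<in> carrier SA"
    then show "x \<otimes>\<^bsub>SA\<^esub> y \<otimes>\<^bsub>SA\<^esub> z = x \<otimes>\<^bsub>SA\<^esub> (y \<otimes>\<^bsub>SA\<^esub> z)"
      using A.m_assoc[OF S_A S_A S_A] by simp
  qed (use sm_l[OF eA S_A] e_S SA_one S_e e_S_left in simp_all)
  then have ring: "ring SA"
    using abelian_group_SA
  proof (intro ringI)
    fix x y z assume "x \<in> carrier SA" "y \<in> carrier SA" "z \<in> carrier SA"
    then have c: "x \<in> carrier A" "y \<in> carrier A" "z \<in> carrier A" using S_A by simp_all
    show "(x \<oplus>\<^bsub>SA\<^esub> y) \<otimes>\<^bsub>SA\<^esub> z = x \<otimes>\<^bsub>SA\<^esub> z \<oplus>\<^bsub>SA\<^esub> y \<otimes>\<^bsub>SA\<^esub> z"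
      "z \<otimes>\<^bsub>SA\<^esub> (x \<oplus>\<^bsub>SA\<^esub> y) = z \<otimes>\<^bsub>SA\<^esub> x \<oplus>\<^bsub>SA\<^esub> z \<otimes>\<^bsub>SA\<^esub> y"
      using A.l_distr[OF c] A.r_distr[OF c] by (simp_all del: TGA_simps)
  qed
  have "Module.module class_ring SA"
  proof (rule Module.moduleI)
    show "cring (class_ring :: complex ring)" by (rule domain.axioms(1)[OF field.axioms(1)[OF class_field]])
    show "abelian_group SA" by (rule abelian_group_SA)
    fix a b :: complex and x y
    assume x: "x \<in> carrier SA"
    then have xS: "x \<in> S" by simp
    show "a \<odot>\<^bsub>SA\<^esub> x \<in> carrier SA" using sm_scale[OF eA xS] by (simp del: TGA_simps)
    show "(a \<oplus>\<^bsub>class_ring\<^esub> b) \<odot>\<^bsub>SA\<^esub> x = a \<odot>\<^bsub>SA\<^esub> x \<oplus>\<^bsub>SA\<^esub> b \<odot>\<^bsub>SA\<^esub> x"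
      by (simp add: distrib_right)
    show "(a \<otimes>\<^bsub>class_ring\<^esub> b) \<odot>\<^bsub>SA\<^esub> x = a \<odot>\<^bsub>SA\<^esub> (b \<odot>\<^bsub>SA\<^esub> x)"
      by (simp add: mult.assoc)
    show "\<one>\<^bsub>class_ring\<^esub> \<odot>\<^bsub>SA\<^esub> x = x" by simp
    show "a \<odot>\<^bsub>SA\<^esub> (x \<oplus>\<^bsub>SA\<^esub> y) = a \<odot>\<^bsub>SA\<^esub> x \<oplus>\<^bsub>SA\<^esub> a \<odot>\<^bsub>SA\<^esub> y"
      by (simp add: distrib_left)
  qed
  moreover have "(c \<odot>\<^bsub>SA\<^esub> x) \<otimes>\<^bsub>SA\<^esub> y = c \<odot>\<^bsub>SA\<^esub> (x \<otimes>\<^bsub>SA\<^esub> y)"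
    "x \<otimes>\<^bsub>SA\<^esub> (c \<odot>\<^bsub>SA\<^esub> y) = c \<odot>\<^bsub>SA\<^esub> (x \<otimes>\<^bsub>SA\<^esub> y)"
    if "x \<in> carrier SA" "y \<in> carrier SA" for x y c
    using Alg.smult_mult_left[OF S_A S_A, of x y c] Alg.smult_mult_right[OF S_A S_A, of x y c] that
    by (simp_all del: TGA_simps)
  ultimately show ?thesis
    using ring by (simp add: complex_algebra_def complex_algebra_axioms_def del: ideal_algebra_simps)
qed

lemma S_restr: "C \<in> carrier \<Gamma> ==> x \<in> S ==> restr C x \<in> S"
  unfolding sm_iff[of "restr C x"]
  using restr_A[of C x] restr_mult_right[OF _ S_A eB, of C x] S_e[of x] by simp

lemma S_direct_sum: "internal_direct_sum A S (carrier \<Gamma>) (\<lambda>C. S \<inter> D C)"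
  by (rule internal_direct_sum_restr[OF sm_A sm_zero[OF eA] sm_add[OF eA] S_restr])

lemma S_ideal: "ideal S A"
proof (rule idealI[OF A.ring_axioms])
  show "subgroup S (add_monoid A)"
  proof (rule A.add.subgroupI)
    show "S \<subseteq> carrier A" by (rule sm_A)
    show "S \<noteq> {}" using e_S by blast
    fix x assume x: "x \<in> S"
    have "\<ominus>\<^bsub>A\<^esub> x = (- 1) \<odot>\<^bsub>A\<^esub> x" using A_minus[OF S_A[OF x]] by simp
    then show "\<ominus>\<^bsub>A\<^esub> x \<in> S" using sm_scale[OF eA x, of "- 1"] by (simp del: TGA_simps)
  qed (rule sm_add[OF eA])
qed (use sm_l[OF eA] sm_r in blast)+

lemma S_graded_ideal: "graded_ideal \<Gamma> A D S"
  unfolding graded_ideal_def using S_ideal S_direct_sum by blast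

lemma S_graded_algebra: "graded_algebra \<Gamma> SA (\<lambda>C. S \<inter> D C)"
  unfolding graded_algebra_def
proof (intro conjI ballI)
  interpret SA: complex_algebra SA by (rule complex_algebra_SA)
  show "group \<Gamma>" by (rule group_\<Gamma>)
  show "complex_algebra SA" by (rule complex_algebra_SA)
  show "internal_direct_sum SA (carrier SA) (carrier \<Gamma>) (\<lambda>C. S \<inter> D C)"
    using internal_direct_sum_ideal_algebra[OF abelian_group_A abelian_group_SA sm_A, of "carrier \<Gamma>" "\<lambda>C. S \<inter> D C" S]
      S_direct_sum by simp
  fix C assume C: "C \<in> carrier \<Gamma>"
  show "Module.submodule (S \<inter> D C) class_ring SA"
  proof (rule SA.submoduleI)
    show "S \<inter> D C \<subseteq> carrier SA" by simp
    show "\<zero>\<^bsub>SA\<^esub> \<in> S \<inter> D C" using sm_zero[OF eA] D_eq[OF C] by simp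
    fix x assume x: "x \<in> S \<inter> D C"
    have "\<ominus>\<^bsub>SA\<^esub> x = (- 1) \<odot>\<^bsub>A\<^esub> x"
    proof (rule SA.minus_equality)
      show "(- 1) \<odot>\<^bsub>A\<^esub> x \<oplus>\<^bsub>SA\<^esub> x = \<zero>\<^bsub>SA\<^esub>" by simp
      show "x \<in> carrier SA" using x by simp
      show "(- 1) \<odot>\<^bsub>A\<^esub> x \<in> carrier SA" using sm_scale[OF eA, of x "- 1"] x by simp
    qed
    then show "\<ominus>\<^bsub>SA\<^esub> x \<in> S \<inter> D C"
      using sm_scale[OF eA, of x "- 1"] x D_eq[OF C] by simp
  next
    fix x y assume "x \<in> S \<inter> D C" "y \<in> S \<inter> D C"
    then show "x \<oplus>\<^bsub>SA\<^esub> y \<in> S \<inter> D C" using sm_add[OF eA, of x y] D_eq[OF C] by simp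
  next
    fix c x assume "x \<in> S \<inter> D C"
    then show "c \<odot>\<^bsub>SA\<^esub> x \<in> S \<inter> D C" using sm_scale[OF eA, of x c] D_eq[OF C] by simp
  qed
next
  fix C C' x y assume C: "C \<in> carrier \<Gamma>" "C' \<in> carrier \<Gamma>" and x: "x \<in> S \<inter> D C" and y: "y \<in> S \<inter> D C'"
  have "x \<cdot> y \<in> D (C \<star> C')" by (rule D_mult[OF C]) (use x y in blast)+
  moreover have "x \<cdot> y \<in> S" by (rule sm_l[OF eA]) (use x y S_A in blast)+
  ultimately show "x \<otimes>\<^bsub>SA\<^esub> y \<in> S \<inter> D (C \<star> C')" by simp
qed

end

section \<open>Orbit idempotents and graded ideals\<close>

context crossed
begin

text \<open>Conjugated by a basis element, the idempotent acts on \<open>M\<close> as it did on a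
  conjugate of \<open>M\<close>. By invariance of \<open>Q\<close> it is unchanged, so it commutes
  with all basis elements, and these span \<open>A\<close>.\<close>

lemma idem_invariant_central:
  assumes inv: "\<And>C c. C \<in> carrier \<Gamma> ==> c \<in> Irr B ==> act C c \<in> Q \<longleftrightarrow> c \<in> Q"
    and a: "a \<in> carrier A"
  shows "a \<cdot> B.idem Q = B.idem Q \<cdot> a"
proof -
  define e where "e = B.idem Q"
  have eB: "e \<in> carrier B" unfolding e_def by (rule B.idem_closed)
  have eA: "e \<in> carrier A" by (rule BA[OF eB])
  let ?H = "{a \<in> carrier A. a \<cdot> e = e \<cdot> a}"
  have u: "basis_elt g \<cdot> e = e \<cdot> basis_elt g" if g: "g \<in> carrier G" for g
  proof -
    let ?u = "basis_elt g :: 'a \<Rightarrow> complex" and ?C = "N #> g"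
    note C = coset_\<Gamma>[OF g] and v = basis_elt_hu[OF coset_self[OF g]]
    have "inv\<^bsub>A\<^esub> ?u \<cdot> e \<cdot> ?u = e"
      unfolding e_def
    proof (rule B.idem_eqI)
      show "inv\<^bsub>A\<^esub> ?u \<cdot> B.idem Q \<cdot> ?u \<in> carrier B"
        by (rule conj_B(1)[OF C v B.idem_closed])
      fix M :: "('a \<Rightarrow> complex, 'a \<Rightarrow> complex) module" and m
      assume M: "irreducible_module B M" "m \<in> carrier M"
      have "(inv\<^bsub>A\<^esub> ?u \<cdot> B.idem Q \<cdot> ?u) \<odot>\<^bsub>M\<^esub> m = B.idem Q \<odot>\<^bsub>cj ?u M\<^esub> m" by simp
      also have "\<dots> = (if module_type B (cj ?u M) \<in> Q then m else \<zero>\<^bsub>M\<^esub>)"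
        using B.idem_acts[OF irreducible_cj[OF M(1) C v], of m Q] M(2) by simp
      also have "module_type B (cj ?u M) \<in> Q \<longleftrightarrow> module_type B M \<in> Q"
        using inv[OF C module_type_in_Irr[OF M(1)]] act_module_type[OF M(1) C v] by simp
      finally show "(inv\<^bsub>A\<^esub> ?u \<cdot> B.idem Q \<cdot> ?u) \<odot>\<^bsub>M\<^esub> m =
          (if module_type B M \<in> Q then m else \<zero>\<^bsub>M\<^esub>)" .
    qed
    then have "?u \<cdot> e = ?u \<cdot> (inv\<^bsub>A\<^esub> ?u \<cdot> (e \<cdot> ?u))"
      using A.m_assoc[OF hu_inv_A[OF C v] eA hu_A[OF C v]] by simp
    then show ?thesis
      using hu_r_cancel[OF C v A.m_closed[OF eA hu_A[OF C v]]] by simp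
  qed
  have "finsum A (\<lambda>g. a g \<odot>\<^bsub>A\<^esub> basis_elt g) (carrier G) \<in> ?H"
  proof (rule finsum_mem[OF abelian_group_A])
    show "?H \<subseteq> carrier A" by blast
    show "\<zero>\<^bsub>A\<^esub> \<in> ?H" using A.zero_closed A.l_null[OF eA] A.r_null[OF eA] by (simp del: TGA_simps)
    show "m \<oplus>\<^bsub>A\<^esub> n \<in> ?H" if "m \<in> ?H" "n \<in> ?H" for m n
      using that A.l_distr[of m n e] A.r_distr[of m n e] A.a_closed[of m n] eA by (simp del: TGA_simps)
    fix g assume g: "g \<in> carrier G"
    show "a g \<odot>\<^bsub>A\<^esub> basis_elt g \<in> ?H"
      using Alg.smult_mult_left[OF basis_elt_closed[OF g] eA, of "a g"]
        Alg.smult_mult_right[OF eA basis_elt_closed[OF g], of "a g"] u[OF g]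
        Alg.smult_closed_complex[OF basis_elt_closed[OF g], of "a g"] by (simp del: TGA_simps)
  qed
  then show ?thesis using A_expand[OF a] unfolding e_def by simp
qed

lemma central_idem_orb:
  assumes c: "c \<in> Irr B" shows "central_idem G \<alpha> N (B.idem (orb c))"
proof (intro central_idem.intro central_idem_axioms.intro)
  show "crossed G \<alpha> N" by (rule crossed_axioms)
  show "B.idem (orb c) \<in> carrier B" by (rule B.idem_closed)
  show "B.idem (orb c) \<cdot> B.idem (orb c) = B.idem (orb c)"
    using B.idem_mult[of "orb c" "orb c"] B_mult[OF B.idem_closed B.idem_closed, of "orb c" "orb c"] by simp
  fix a assume "a \<in> carrier A"
  then show "a \<cdot> B.idem (orb c) = B.idem (orb c) \<cdot> a"
    by (intro idem_invariant_central orb_act_iff[OF c])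
qed

lemma orb_cases: assumes "d \<in> orb c" obtains C where "C \<in> carrier \<Gamma>" "d = act C c"
  using assms unfolding orb_def by blast

text \<open>Homogeneous elements can be shifted by units into \<open>B\<close>, where ideals contain
  idempotents of types; conjugation by units then collects the idempotents of a whole orbit.\<close>

lemma graded_ideal_contains_idem:
  assumes K: "K \<subseteq> carrier A" "\<zero>\<^bsub>A\<^esub> \<in> K" "\<And>x y. x \<in> K ==> y \<in> K ==> x \<oplus>\<^bsub>A\<^esub> y \<in> K"
      "\<And>a x. a \<in> carrier A ==> x \<in> K ==> a \<cdot> x \<in> K"
      "\<And>a x. a \<in> carrier A ==> x \<in> K ==> x \<cdot> a \<in> K"
    and gr: "internal_direct_sum A K (carrier \<Gamma>) (\<lambda>C. K \<inter> D C)" and ne: "K \<noteq> {\<zero>\<^bsub>A\<^esub>}"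
  shows "\<exists>c\<in>Irr B. B.idem (orb c) \<in> K"
proof -
  obtain x where x: "x \<in> K" "x \<noteq> \<zero>\<^bsub>A\<^esub>" using ne K(2) by blast
  obtain f J where f: "x = finsum A f J" "J \<subseteq> carrier \<Gamma>" "f \<in> Pi J (\<lambda>C. K \<inter> D C)"
    using gr x(1) unfolding internal_direct_sum_def family_sum_def by blast
  have "\<exists>C\<in>J. f C \<noteq> \<zero>\<^bsub>A\<^esub>"
  proof (rule ccontr)
    assume "\<not> ?thesis"
    then have "x = finsum A (\<lambda>_. \<zero>\<^bsub>A\<^esub>) J"
      unfolding f(1) by (intro A.finsum_cong') (simp_all del: TGA_simps)
    then show False using x(2) by simp
  qed
  then obtain C where CJ: "C \<in> J" and fC: "f C \<noteq> \<zero>\<^bsub>A\<^esub>" by blast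
  have C: "C \<in> carrier \<Gamma>" by (rule subsetD[OF f(2) CJ])
  have fCK: "f C \<in> K" and fCD: "f C \<in> D C" using Pi_mem[OF f(3) CJ] by simp_all
  obtain v where v: "v \<in> hu C" using C by (rule hu_ex)
  \<comment> \<open>The shift stays in \<open>K\<close>, which absorbs multiplication from the left,
    and is nonzero because \<open>v\<close> is invertible.\<close>
  define y where "y = inv\<^bsub>A\<^esub> v \<cdot> f C"
  have yK: "y \<in> K" unfolding y_def by (rule K(4)[OF hu_inv_A[OF C v] fCK])
  have yB: "y \<in> carrier B" unfolding y_def by (rule D_shift[OF C v fCD])
  have y0: "y \<noteq> \<zero>\<^bsub>B\<^esub>"
  proof
    assume "y = \<zero>\<^bsub>B\<^esub>"
    then have "v \<cdot> y = \<zero>\<^bsub>A\<^esub>" using A.r_null[OF hu_A[OF C v]] by simp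
    then show False using hu_r_cancel[OF C v D_A[OF C fCD]] fC by (simp add: y_def del: TGA_simps)
  qed
  obtain M :: "('a \<Rightarrow> complex, 'a \<Rightarrow> complex) module" and m
    where M: "irreducible_module B M" "m \<in> carrier M" "y \<odot>\<^bsub>M\<^esub> m \<noteq> \<zero>\<^bsub>M\<^esub>"
    using B.irreducible_faithful[OF yB y0] by (elim exE conjE bexE)
  define c where "c = module_type B M"
  have c: "c \<in> Irr B" unfolding c_def by (rule module_type_in_Irr[OF M(1)])
  let ?J = "K \<inter> carrier B"
  have J: "?J \<subseteq> carrier B" "\<zero>\<^bsub>B\<^esub> \<in> ?J" "\<And>x y. x \<in> ?J ==> y \<in> ?J ==> x \<oplus>\<^bsub>B\<^esub> y \<in> ?J"
  proof -
    show "?J \<subseteq> carrier B" by (rule Int_lower2)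
    show "\<zero>\<^bsub>B\<^esub> \<in> ?J" using K(2) B.A.zero_closed by simp
    show "x \<oplus>\<^bsub>B\<^esub> y \<in> ?J" if "x \<in> ?J" "y \<in> ?J" for x y
      using K(3)[of x y] B.A.a_closed[of x y] that by simp
  qed
  have Jl: "a \<otimes>\<^bsub>B\<^esub> x \<in> ?J" if "a \<in> carrier B" "x \<in> ?J" for a x
    using K(4)[OF BA[OF that(1)], of x] B.A.m_closed[OF that(1), of x] that B_mult[of a x] by simp
  have Jr: "x \<otimes>\<^bsub>B\<^esub> a \<in> ?J" if "a \<in> carrier B" "x \<in> ?J" for a x
    using K(5)[OF BA[OF that(1)], of x] B.A.m_closed[OF _ that(1), of x] that B_mult[of x a] by simp
  have idc: "B.idem {d} \<in> ?J" if d: "d \<in> orb c" for d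
  proof -
    obtain C' where C': "C' \<in> carrier \<Gamma>" "d = act C' c" using d by (rule orb_cases)
    obtain w where w: "w \<in> hu C'" using C'(1) by (rule hu_ex)
    \<comment> \<open>The conjugate of \<open>y\<close> by \<open>w\<close> lies in \<open>K\<close>
      and in \<open>B\<close> and acts on the conjugate of \<open>M\<close> as \<open>y\<close> acts
      on \<open>M\<close>, so \<open>K\<close> contains the idempotent of that type too.\<close>
    define z where "z = w \<cdot> y \<cdot> inv\<^bsub>A\<^esub> w"
    have "z \<in> K" unfolding z_def by (rule K(5)[OF hu_inv_A[OF C'(1) w] K(4)[OF hu_A[OF C'(1) w] yK]])
    moreover have "z \<in> carrier B" unfolding z_def by (rule conj_B(2)[OF C'(1) w yB])
    ultimately have zJ: "z \<in> ?J" by blast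
    have "z \<odot>\<^bsub>cj w M\<^esub> m \<noteq> \<zero>\<^bsub>cj w M\<^esub>"
      using M(3) conj_conj[OF C'(1) w BA[OF yB]] by (simp add: z_def)
    then have "B.idem {module_type B (cj w M)} \<in> ?J"
      using M(2) by (intro B.ideal_contains_idem[OF J Jl Jr irreducible_cj[OF M(1) C'(1) w] zJ]) simp_all
    then show ?thesis
      unfolding C'(2) c_def act_module_type[OF M(1) C'(1) w] .
  qed
  \<comment> \<open>The orbit idempotent is the sum of the idempotents of its members, written over
    singletons to match \<open>idem_finsum\<close>.\<close>
  have fin: "finite ((\<lambda>d. {d}) ` orb c)"
    using finite_subset[OF orb_subset[OF c] B.finite_Irr] by simp
  have "finsum B B.idem ((\<lambda>d. {d}) ` orb c) \<in> ?J"
    by (rule finsum_mem[OF B.abelian_group_A J]) (use idc in auto)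
  moreover have "finsum B B.idem ((\<lambda>d. {d}) ` orb c) = B.idem (\<Union>((\<lambda>d. {d}) ` orb c))"
    by (rule B.idem_finsum[OF fin]) auto
  ultimately have "B.idem (orb c) \<in> ?J" by simp
  then show ?thesis using c by blast
qed

lemma idem_orb_nonzero: assumes "c \<in> Irr B" shows "B.idem (orb c) \<noteq> \<zero>\<^bsub>A\<^esub>"
proof
  assume z: "B.idem (orb c) = \<zero>\<^bsub>A\<^esub>"
  obtain M where M: "irreducible_module B M" "c = module_type B M" using assms(1) by (rule Irr_cases)
  obtain m where m: "m \<in> carrier M" "m \<noteq> \<zero>\<^bsub>M\<^esub>" using irreducible_nonzero[OF M(1)] .
  interpret M: left_module B M using M(1) by (rule irreducible_left_module)
  have "B.idem (orb c) \<odot>\<^bsub>M\<^esub> m = m"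
    using B.idem_acts[OF M(1) m(1), of "orb c"] orb_self[OF assms] M(2) by simp
  moreover have "B.idem (orb c) \<odot>\<^bsub>M\<^esub> m = \<zero>\<^bsub>M\<^esub>"
    using M.smult_zero_left[OF m(1)] z by simp
  ultimately show False using m(2) by simp
qed

lemma idem_orb_mult:
  assumes "c \<in> Irr B" "d \<in> Irr B"
  shows "B.idem (orb c) \<cdot> B.idem (orb d) = (if orb c = orb d then B.idem (orb c) else \<zero>\<^bsub>A\<^esub>)"
proof -
  have "B.idem (orb c) \<cdot> B.idem (orb d) = B.idem (orb c \<inter> orb d)"
    using B.idem_mult[of "orb c" "orb d"] B_mult[OF B.idem_closed B.idem_closed, of "orb c" "orb d"] by simp
  moreover have "orb c \<inter> orb d = {}" if "orb c \<noteq> orb d"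
    using orbits_disjoint[of "orb c" "orb d"] assms that unfolding orbits_eq by blast
  ultimately show ?thesis using B.idem_empty by simp
qed

lemma idem_orb_mem_sm:
  assumes "c \<in> Irr B" "d \<in> Irr B" "B.idem (orb c) \<in> sm (B.idem (orb d))" shows "orb c = orb d"
  using assms(3) idem_orb_mult[OF assms(1,2)] idem_orb_nonzero[OF assms(1)] unfolding sm_iff by metis

text \<open>A graded ideal of the summand is a graded ideal of \<open>A\<close>, as multiplying its
  elements by \<open>a\<close> amounts to multiplying them by \<open>a\<close> times the unit of the
  summand. A nonzero one contains the idempotent of some orbit, and orthogonality leaves only the
  orbit of \<open>c\<close>.\<close>

lemma graded_simple_sm:
  assumes c: "c \<in> Irr B"
  shows "graded_simple \<Gamma> (ideal_algebra A (sm (B.idem (orb c)))) (\<lambda>C. sm (B.idem (orb c)) \<inter> D C)"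
proof -
  interpret central_idem G \<alpha> N "B.idem (orb c)" by (rule central_idem_orb[OF c])
  show ?thesis
    unfolding graded_simple_def
  proof (intro conjI allI impI)
    show "graded_algebra \<Gamma> SA (\<lambda>C. S \<inter> D C)" by (rule S_graded_algebra)
    show "carrier SA \<noteq> {\<zero>\<^bsub>SA\<^esub>}" using e_S idem_orb_nonzero[OF c] by auto
    fix I assume I: "graded_ideal \<Gamma> SA (\<lambda>C. S \<inter> D C) I"
    then have iI: "ideal I SA" unfolding graded_ideal_def by blast
    then interpret I: ideal I SA .
    have IS: "x \<in> S" if "x \<in> I" for x using I.Icarr[OF that] by simp
    have "internal_direct_sum SA I (carrier \<Gamma>) (\<lambda>C. I \<inter> (S \<inter> D C))"
      using I unfolding graded_ideal_def by blast
    moreover have "(\<lambda>C. I \<inter> (S \<inter> D C)) = (\<lambda>C. I \<inter> D C)" using IS by blast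
    ultimately have gr: "internal_direct_sum A I (carrier \<Gamma>) (\<lambda>C. I \<inter> D C)"
      using internal_direct_sum_ideal_algebra[OF abelian_group_A abelian_group_SA sm_A,
          of "carrier \<Gamma>" "\<lambda>C. I \<inter> D C" I] IS by auto
    show "I = {\<zero>\<^bsub>SA\<^esub>} \<or> I = carrier SA"
    proof (rule disjCI)
      assume "I \<noteq> carrier SA"
      then have IneS: "I \<noteq> S" by simp
      show "I = {\<zero>\<^bsub>SA\<^esub>}"
      proof (rule ccontr)
        assume "I \<noteq> {\<zero>\<^bsub>SA\<^esub>}"
        then have ne: "I \<noteq> {\<zero>\<^bsub>A\<^esub>}" by simp
        have Il: "a \<cdot> x \<in> I" if "a \<in> carrier A" "x \<in> I" for a x
          using I.I_l_closed[OF that(2), of "a \<cdot> B.idem (orb c)"] mult_e_S[OF that(1)]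
            A.m_assoc[OF that(1) eA S_A[OF IS[OF that(2)]]] e_S_left[OF IS[OF that(2)]] by simp
        have Ir: "x \<cdot> a \<in> I" if "a \<in> carrier A" "x \<in> I" for a x
          using I.I_r_closed[OF that(2), of "a \<cdot> B.idem (orb c)"] mult_e_S[OF that(1)]
            central[OF that(1)]
            A.m_assoc[OF S_A[OF IS[OF that(2)]] eA that(1)] S_e[OF IS[OF that(2)]] by simp
        obtain d where d: "d \<in> Irr B" "B.idem (orb d) \<in> I"
        proof -
          have "\<exists>d\<in>Irr B. B.idem (orb d) \<in> I"
          proof (rule graded_ideal_contains_idem[OF _ _ _ Il Ir gr ne])
            show "I \<subseteq> carrier A" using IS S_A by blast
            show "\<zero>\<^bsub>A\<^esub> \<in> I" using additive_subgroup.zero_closed[OF ideal.axioms(1)[OF iI]] by simp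
            show "x \<oplus>\<^bsub>A\<^esub> y \<in> I" if "x \<in> I" "y \<in> I" for x y using additive_subgroup.a_closed[OF ideal.axioms(1)[OF iI] that] by simp
          qed
          then show ?thesis using that by blast
        qed
        have "orb d = orb c" by (rule idem_orb_mem_sm[OF d(1) c IS[OF d(2)]])
        then have "B.idem (orb c) \<in> I" using d(2) by simp
        then have "S \<subseteq> I" using Il[OF S_A] S_e by fastforce
        then show False using IneS IS by blast
      qed
    qed
  qed
qed

section \<open>The decomposition into the ideals of the orbits\<close>

abbreviation "Orb \<equiv> orbits \<Gamma> (Irr B) act"

lemma Orb_cases: assumes "Q \<in> Orb" obtains c where "c \<in> Irr B" "Q = orb c"
  using assms unfolding orbits_eq by blast

definition summand :: "('a \<Rightarrow> complex, 'a \<Rightarrow> complex) module set set \<Rightarrow> ('a \<Rightarrow> complex) set" where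
  "summand Q = sm (B.idem Q)"

lemma inj_summand: "inj_on summand Orb"
proof (rule inj_onI)
  fix P Q assume P: "P \<in> Orb" and Q: "Q \<in> Orb" and eq: "summand P = summand Q"
  obtain c where c: "c \<in> Irr B" "P = orb c" using P by (rule Orb_cases)
  obtain d where d: "d \<in> Irr B" "Q = orb d" using Q by (rule Orb_cases)
  have "B.idem (orb c) \<in> sm (B.idem (orb d))"
    using central_idem.e_S[OF central_idem_orb[OF c(1)]] eq c(2) d(2) by (simp add: summand_def)
  then show "P = Q" using idem_orb_mem_sm[OF c(1) d(1)] c(2) d(2) by simp
qed

lemma finite_Orb: "finite Orb"
  unfolding orbits_eq using B.finite_Irr by simp

text \<open>The orbits partition \<open>Irr B\<close>, so their idempotents add up to the unit of
  \<open>B\<close>, which is that of \<open>A\<close>.\<close>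

lemma sum_idem_Orb: "finsum A B.idem Orb = \<one>\<^bsub>A\<^esub>"
proof -
  have "finsum B B.idem Orb = B.idem (\<Union>Orb)"
    by (rule B.idem_finsum[OF finite_Orb orbits_disjoint])
  then have "finsum B B.idem Orb = \<one>\<^bsub>A\<^esub>" using orbits_Union B.idem_all B_one by simp
  moreover have "finsum B B.idem Orb = finsum A B.idem Orb"
    using A_finsum[OF finite_Orb BA[OF B.idem_closed], of "\<lambda>x. x"]
      B.A_finsum[OF finite_Orb B.idem_closed, of "\<lambda>x. x"] by simp
  ultimately show ?thesis by simp
qed

lemma summand_decomposition: "simply_graded_decomposition \<Gamma> A D (summand ` Orb)"
  unfolding simply_graded_decomposition_def
proof (intro conjI ballI)
  fix I assume "I \<in> summand ` Orb"
  then obtain c where c: "c \<in> Irr B" "I = sm (B.idem (orb c))"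
    unfolding orbits_eq summand_def by blast
  show "graded_ideal \<Gamma> A D I"
    unfolding c(2) by (rule central_idem.S_graded_ideal[OF central_idem_orb[OF c(1)]])
  show "graded_simple \<Gamma> (ideal_algebra A I) (\<lambda>C. I \<inter> D C)"
    unfolding c(2) by (rule graded_simple_sm[OF c(1)])
next
  \<comment> \<open>Recovers the idempotent from the ideal, as the direct sum is indexed by ideals
    and not by orbits.\<close>
  define E where "E I = B.idem (the_inv_into Orb summand I)" for I
  have E: "E (summand Q) = B.idem Q" if "Q \<in> Orb" for Q
    unfolding E_def using the_inv_into_f_f[OF inj_summand that] by simp
  have EA: "E I \<in> carrier A" for I unfolding E_def by (rule BA[OF B.idem_closed])
  have idA: "B.idem Q \<in> carrier A" for Q by (rule BA[OF B.idem_closed])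
  show "internal_direct_sum A (carrier A) (summand ` Orb) (\<lambda>I. I)"
    unfolding internal_direct_sum_def
  proof (intro conjI allI impI ballI)
    show "carrier A = family_sum A (summand ` Orb) (\<lambda>I. I)"
    proof (intro equalityI subsetI)
      fix a assume a: "a \<in> carrier A"
      have "a = a \<cdot> finsum A B.idem Orb" unfolding sum_idem_Orb using A.r_one[OF a] by simp
      also have "\<dots> = finsum A (\<lambda>Q. a \<cdot> B.idem Q) Orb"
        by (rule A.finsum_rdistr[OF finite_Orb a Pi_I[OF idA]])
      also have "\<dots> = finsum A (\<lambda>Q. a \<cdot> E (summand Q)) Orb"
        by (rule A.finsum_cong'[OF refl Pi_I[OF A.m_closed[OF a EA]]]) (simp only: E)
      also have "\<dots> = finsum A (\<lambda>I. a \<cdot> E I) (summand ` Orb)"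
        by (rule A.finsum_reindex[symmetric, OF Pi_I[OF A.m_closed[OF a EA]] inj_summand])
      finally have "a = finsum A (\<lambda>I. a \<cdot> E I) (summand ` Orb)" .
      moreover have "(\<lambda>I. a \<cdot> E I) \<in> Pi (summand ` Orb) (\<lambda>I. I)"
      proof (rule Pi_I)
        fix I assume "I \<in> summand ` Orb"
        then obtain Q where Q: "Q \<in> Orb" "I = summand Q" by blast
        obtain c where c: "c \<in> Irr B" "Q = orb c" using Q(1) by (rule Orb_cases)
        show "a \<cdot> E I \<in> I"
          unfolding Q(2) E[OF Q(1)] unfolding summand_def c(2)
          by (rule central_idem.mult_e_S[OF central_idem_orb[OF c(1)] a])
      qed
      ultimately show "a \<in> family_sum A (summand ` Orb) (\<lambda>I. I)"
        unfolding family_sum_def using finite_Orb by blast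
    next
      fix a assume "a \<in> family_sum A (summand ` Orb) (\<lambda>I. I)"
      then obtain f J where f: "a = finsum A f J" "J \<subseteq> summand ` Orb" "f \<in> Pi J (\<lambda>I. I)"
        unfolding family_sum_def by blast
      have "f I \<in> carrier A" if I: "I \<in> J" for I
      proof -
        obtain Q where "I = summand Q" using I f(2) by blast
        then show ?thesis using Pi_mem[OF f(3) I] sm_A unfolding summand_def by blast
      qed
      then show "a \<in> carrier A" unfolding f(1) by (intro A.finsum_closed Pi_I)
    qed
  next
    fix J f I
    assume h: "finite J \<and> J \<subseteq> summand ` Orb \<and> f \<in> Pi J (\<lambda>I. I) \<and> finsum A f J = \<zero>\<^bsub>A\<^esub>" and I: "I \<in> J"
    have fA: "f K \<in> carrier A" "f K \<cdot> E K = f K" if K: "K \<in> J" for K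
    proof -
      obtain Q where Q: "Q \<in> Orb" "K = summand Q" using K h by blast
      have "f K \<in> K" using h K by blast
      then have "f K \<in> sm (E K)" unfolding Q(2) E[OF Q(1)] by (simp add: summand_def)
      then show "f K \<in> carrier A" "f K \<cdot> E K = f K" unfolding sm_iff by blast+
    qed
    have EE: "E K \<cdot> E I = \<zero>\<^bsub>A\<^esub>" if K: "K \<in> J" "K \<noteq> I" for K
    proof -
      obtain P where P: "P \<in> Orb" "K = summand P" using K h by blast
      obtain Q where Q: "Q \<in> Orb" "I = summand Q" using I h by blast
      obtain c where c: "c \<in> Irr B" "P = orb c" using P(1) by (rule Orb_cases)
      obtain d where d: "d \<in> Irr B" "Q = orb d" using Q(1) by (rule Orb_cases)
      have "orb c \<noteq> orb d"
      proof
        assume "orb c = orb d"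
        then have "K = I" unfolding P(2) Q(2) c(2) d(2) by simp
        with K(2) show False by simp
      qed
      then show ?thesis
        unfolding P(2) Q(2) E[OF P(1)] E[OF Q(1)] unfolding c(2) d(2)
        using idem_orb_mult[OF c(1) d(1)] by simp
    qed
    \<comment> \<open>Multiplication by the idempotent of \<open>I\<close> isolates the term of
      \<open>I\<close>, the idempotents being orthogonal.\<close>
    have "\<zero>\<^bsub>A\<^esub> = finsum A f J \<cdot> E I" using h A.l_null[OF EA] by simp
    also have "\<dots> = finsum A (\<lambda>K. f K \<cdot> E I) J"
      by (rule A.finsum_ldistr[OF _ EA Pi_I[OF fA(1)]]) (use h in blast)
    also have "\<dots> = f I \<cdot> E I"
    proof (rule finsum_single[OF abelian_group_A])
      show "finite J" using h by blast
      show "I \<in> J" by (rule I)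
      show "f I \<cdot> E I \<in> carrier A" by (rule A.m_closed[OF fA(1)[OF I] EA])
      fix K assume K: "K \<in> J" "K \<noteq> I"
      have "f K \<cdot> E I = f K \<cdot> (E K \<cdot> E I)"
        using A.m_assoc[OF fA(1)[OF K(1)] EA EA, of K I] fA(2)[OF K(1)] by simp
      then show "f K \<cdot> E I = \<zero>\<^bsub>A\<^esub>"
        unfolding EE[OF K] using A.r_null[OF fA(1)[OF K(1)]] by simp
    qed
    finally show "f I = \<zero>\<^bsub>A\<^esub>" using fA(2)[OF I] by simp
  qed
qed

text \<open>An arbitrary simply graded summand \<open>I\<close> contains an orbit idempotent, hence
  the ideal generated by it; that ideal is graded in \<open>I\<close>, so simplicity makes the two
  equal. Thus the summands do not depend on the decomposition.\<close>

lemma simply_graded_summands_eq: "simply_graded_summands \<Gamma> A D = summand ` Orb"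
proof (intro equalityI subsetI)
  fix I assume "I \<in> summand ` Orb"
  then show "I \<in> simply_graded_summands \<Gamma> A D"
    unfolding simply_graded_summands_def using summand_decomposition by blast
next
  fix I assume "I \<in> simply_graded_summands \<Gamma> A D"
  then obtain X where X: "simply_graded_decomposition \<Gamma> A D X" "I \<in> X"
    unfolding simply_graded_summands_def by blast
  have gi: "graded_ideal \<Gamma> A D I"
    and gs: "graded_simple \<Gamma> (ideal_algebra A I) (\<lambda>C. I \<inter> D C)"
    using X unfolding simply_graded_decomposition_def by blast+
  have iI: "ideal I A" using gi unfolding graded_ideal_def by blast
  then interpret I: ideal I A .
  have IA: "I \<subseteq> carrier A" using I.Icarr by blast
  have gr: "internal_direct_sum A I (carrier \<Gamma>) (\<lambda>C. I \<inter> D C)"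
    using gi unfolding graded_ideal_def by blast
  have alg: "complex_algebra (ideal_algebra A I)"
    using gs unfolding graded_simple_def graded_algebra_def by blast
  then have ring: "ring (ideal_algebra A I)" by (simp add: complex_algebra_def)
  then interpret IA: ring "ideal_algebra A I" .
  have ne: "I \<noteq> {\<zero>\<^bsub>A\<^esub>}" using gs unfolding graded_simple_def by simp
  obtain c where c: "c \<in> Irr B" "B.idem (orb c) \<in> I"
  proof -
    have "\<exists>c\<in>Irr B. B.idem (orb c) \<in> I"
    proof (rule graded_ideal_contains_idem[OF IA _ _ _ _ gr ne])
      show "\<zero>\<^bsub>A\<^esub> \<in> I" by (rule additive_subgroup.zero_closed[OF ideal.axioms(1)[OF iI]])
      show "x \<oplus>\<^bsub>A\<^esub> y \<in> I" if "x \<in> I" "y \<in> I" for x y by (rule additive_subgroup.a_closed[OF ideal.axioms(1)[OF iI] that])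
      show "a \<cdot> x \<in> I" if "a \<in> carrier A" "x \<in> I" for a x by (rule I.I_l_closed[OF that(2,1)])
      show "x \<cdot> a \<in> I" if "a \<in> carrier A" "x \<in> I" for a x by (rule I.I_r_closed[OF that(2,1)])
    qed
    then show ?thesis using that by blast
  qed
  interpret central_idem G \<alpha> N "B.idem (orb c)" by (rule central_idem_orb[OF c(1)])
  have SI: "S \<subseteq> I"
  proof
    fix x assume x: "x \<in> S"
    show "x \<in> I" using I.I_l_closed[OF c(2) S_A[OF x]] unfolding S_e[OF x] .
  qed
  have "graded_ideal \<Gamma> (ideal_algebra A I) (\<lambda>C. I \<inter> D C) S"
    unfolding graded_ideal_def
  proof
    show "ideal S (ideal_algebra A I)"
    proof (rule idealI[OF ring])
      show "subgroup S (add_monoid (ideal_algebra A I))"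
      proof (rule IA.add.subgroupI)
        show "S \<subseteq> carrier (ideal_algebra A I)" using SI by simp
        show "S \<noteq> {}" using e_S by blast
        fix x assume x: "x \<in> S"
        have "\<ominus>\<^bsub>ideal_algebra A I\<^esub> x = (- 1) \<odot>\<^bsub>A\<^esub> x"
        proof (rule IA.minus_equality)
          show "(- 1) \<odot>\<^bsub>A\<^esub> x \<oplus>\<^bsub>ideal_algebra A I\<^esub> x = \<zero>\<^bsub>ideal_algebra A I\<^esub>" by simp
        qed (use SI x sm_scale[OF eA x, of "- 1"] in auto)
        then show "\<ominus>\<^bsub>ideal_algebra A I\<^esub> x \<in> S" using sm_scale[OF eA x, of "- 1"] by (simp del: TGA_simps)
      qed (use sm_add[OF eA] in simp)
    qed (use sm_l[OF eA _ _] sm_r IA in \<open>simp_all add: subset_iff del: TGA_simps\<close>)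
    have "S \<inter> (I \<inter> D C) = S \<inter> D C" for C using SI by blast
    then show "internal_direct_sum (ideal_algebra A I) S (carrier \<Gamma>) (\<lambda>C. S \<inter> (I \<inter> D C))"
      using internal_direct_sum_ideal_algebra[OF abelian_group_A IA.is_abelian_group IA,
          of "carrier \<Gamma>" "\<lambda>C. S \<inter> D C" S] S_direct_sum SI by auto
  qed
  then have "S = {\<zero>\<^bsub>ideal_algebra A I\<^esub>} \<or> S = carrier (ideal_algebra A I)"
    using gs unfolding graded_simple_def by blast
  moreover have "S \<noteq> {\<zero>\<^bsub>A\<^esub>}" using e_S idem_orb_nonzero[OF c(1)] by blast
  ultimately have "I = summand (orb c)" by (simp add: summand_def)
  then show "I \<in> summand ` Orb" unfolding orbits_eq using c(1) by blast
qed

lemma bij_summand: "bij_betw summand Orb (simply_graded_summands \<Gamma> A D)"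
  unfolding bij_betw_def using inj_summand simply_graded_summands_eq by simp

end

section \<open>Extension of scalars\<close>

locale scalar_extension = A: ring A + left_module R M
  for A :: "('a, 'x) ring_scheme" and R :: "('a, 'y) ring_scheme" and M :: "('a, 'm, 'z) module_scheme" +
  assumes R_A: "r \<in> carrier R ==> r \<in> carrier A"
begin

abbreviation "F \<equiv> tensor_free A M"
abbreviation "K \<equiv> tensor_relations A R M"
abbreviation "W \<equiv> extension_of_scalars A R M"
abbreviation "tens \<equiv> pure_tensor A R M"

definition cls :: "('a \<times> 'm \<Rightarrow>\<^sub>0 int) \<Rightarrow> ('a \<times> 'm \<Rightarrow>\<^sub>0 int) set" where "cls z = K #>\<^bsub>F\<^esub> z"

lemma F_add: "y \<in> carrier F ==> z \<in> carrier F ==> y + z \<in> carrier F"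
  using monoid.m_closed[OF group.is_monoid[OF group_free_Abelian_group], of y "carrier A \<times> carrier M" z] by simp

lemma F_minus: "z \<in> carrier F ==> - z \<in> carrier F"
  by simp

lemma F_diff: "y \<in> carrier F ==> z \<in> carrier F ==> y - z \<in> carrier F"
  using F_add[OF _ F_minus] by fastforce

lemma F_of: "x \<in> carrier A ==> m \<in> carrier M ==> frag_of (x, m) \<in> carrier F"
  by simp

definition rels where
  "rels = {frag_of (x \<oplus>\<^bsub>A\<^esub> y, m) - frag_of (x, m) - frag_of (y, m) | x y m.
        x \<in> carrier A \<and> y \<in> carrier A \<and> m \<in> carrier M} \<union>
     {frag_of (x, m \<oplus>\<^bsub>M\<^esub> n) - frag_of (x, m) - frag_of (x, n) | x m n.
        x \<in> carrier A \<and> m \<in> carrier M \<and> n \<in> carrier M} \<union>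
     {frag_of (x \<otimes>\<^bsub>A\<^esub> r, m) - frag_of (x, r \<odot>\<^bsub>M\<^esub> m) | x r m.
        x \<in> carrier A \<and> r \<in> carrier R \<and> m \<in> carrier M}"

lemma K_rels: "K = generate F rels"
  by (simp only: tensor_relations_def rels_def)

lemma rels_cases:
  assumes "z \<in> rels"
  obtains (1) x y m where "z = frag_of (x \<oplus>\<^bsub>A\<^esub> y, m) - frag_of (x, m) - frag_of (y, m)"
      "x \<in> carrier A" "y \<in> carrier A" "m \<in> carrier M"
  | (2) x m n where "z = frag_of (x, m \<oplus>\<^bsub>M\<^esub> n) - frag_of (x, m) - frag_of (x, n)"
      "x \<in> carrier A" "m \<in> carrier M" "n \<in> carrier M"
  | (3) x r m where "z = frag_of (x \<otimes>\<^bsub>A\<^esub> r, m) - frag_of (x, r \<odot>\<^bsub>M\<^esub> m)"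
      "x \<in> carrier A" "r \<in> carrier R" "m \<in> carrier M"
  using assms unfolding rels_def by blast

lemma relations_F: "rels \<subseteq> carrier F"
proof
  fix z assume "z \<in> rels"
  then show "z \<in> carrier F"
  proof (cases rule: rels_cases)
    case 1 then show ?thesis by (simp only:) (intro F_diff F_of A.a_closed)
  next
    case 2 then show ?thesis by (simp only:) (intro F_diff F_of M.a_closed)
  next
    case (3 x r m)
    show ?thesis unfolding 3(1) by (intro F_diff F_of A.m_closed smult_closed 3(2,4) R_A[OF 3(3)] 3(3))
  qed
qed

lemma group_F: "group F"
  by (rule group_free_Abelian_group)

lemma subgroup_K: "subgroup K F"
  unfolding K_rels by (rule group.generate_is_subgroup, rule group_F, rule relations_F)

lemma K_least:
  assumes H: "subgroup H F"
    and "\<And>x y m. \<lbrakk>x \<in> carrier A; y \<in> carrier A; m \<in> carrier M\<rbrakk> \<Longrightarrow>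
      frag_of (x \<oplus>\<^bsub>A\<^esub> y, m) - frag_of (x, m) - frag_of (y, m) \<in> H"
    and "\<And>x m n. \<lbrakk>x \<in> carrier A; m \<in> carrier M; n \<in> carrier M\<rbrakk> \<Longrightarrow>
      frag_of (x, m \<oplus>\<^bsub>M\<^esub> n) - frag_of (x, m) - frag_of (x, n) \<in> H"
    and "\<And>x r m. \<lbrakk>x \<in> carrier A; r \<in> carrier R; m \<in> carrier M\<rbrakk> \<Longrightarrow>
      frag_of (x \<otimes>\<^bsub>A\<^esub> r, m) - frag_of (x, r \<odot>\<^bsub>M\<^esub> m) \<in> H"
  shows "K \<subseteq> H"
  unfolding K_rels
proof (rule group.generate_subgroup_incl[OF group_F _ H], rule subsetI)
  fix z assume "z \<in> rels"
  then show "z \<in> H" by (rule rels_cases) (simp_all only: assms(2-4))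
qed

lemma relation_mem:
  "\<lbrakk>x \<in> carrier A; y \<in> carrier A; m \<in> carrier M\<rbrakk> \<Longrightarrow>
      frag_of (x \<oplus>\<^bsub>A\<^esub> y, m) - frag_of (x, m) - frag_of (y, m) \<in> K"
  "\<lbrakk>x \<in> carrier A; m \<in> carrier M; n \<in> carrier M\<rbrakk> \<Longrightarrow>
      frag_of (x, m \<oplus>\<^bsub>M\<^esub> n) - frag_of (x, m) - frag_of (x, n) \<in> K"
  "\<lbrakk>x \<in> carrier A; r \<in> carrier R; m \<in> carrier M\<rbrakk> \<Longrightarrow>
      frag_of (x \<otimes>\<^bsub>A\<^esub> r, m) - frag_of (x, r \<odot>\<^bsub>M\<^esub> m) \<in> K"
  unfolding K_rels rels_def by (rule generate.incl, blast)+

lemma K_F: "z \<in> K ==> z \<in> carrier F"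
  by (rule subgroup.mem_carrier[OF subgroup_K])

lemma K_zero: "0 \<in> K"
  using subgroup.one_closed[OF subgroup_K] by simp

lemma K_add: "y \<in> K ==> z \<in> K ==> y + z \<in> K"
  using subgroup.m_closed[OF subgroup_K, of y z] by simp

lemma K_minus: "z \<in> K ==> - z \<in> K"
  using subgroup.m_inv_closed[OF subgroup_K, of z] K_F[of z] by simp

lemma cls_iff: "x \<in> cls z \<longleftrightarrow> x - z \<in> K"
proof -
  have "x \<in> cls z \<longleftrightarrow> (\<exists>k\<in>K. x = k + z)" unfolding cls_def r_coset_def by simp
  also have "\<dots> \<longleftrightarrow> x - z \<in> K" by (metis add_diff_cancel_right' diff_add_cancel)
  finally show ?thesis .
qed

lemma cls_eq_iff: "cls y = cls z \<longleftrightarrow> y - z \<in> K"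
proof
  assume "cls y = cls z"
  moreover have "y \<in> cls y" unfolding cls_iff using K_zero by simp
  ultimately show "y - z \<in> K" unfolding cls_iff[symmetric] by simp
next
  assume yz: "y - z \<in> K"
  have "x - y \<in> K \<longleftrightarrow> x - z \<in> K" for x
    using K_add[OF _ yz, of "x - y"] K_add[OF _ K_minus[OF yz], of "x - z"] by auto
  then show "cls y = cls z" by (auto simp: cls_iff)
qed

lemma tens_cls: "tens x m = cls (frag_of (x, m))"
  unfolding pure_tensor_def cls_def ..

lemma comm_group_quotient: "comm_group (F Mod K)"
  by (rule comm_group.abelian_FactGroup[OF abelian_free_Abelian_group subgroup_K])

lemma normal_K: "K \<lhd> F"
  using comm_group.normal_iff_subgroup[OF abelian_free_Abelian_group] subgroup_K by blast

lemma W_simps: "carrier W = carrier (F Mod K)" "\<zero>\<^bsub>W\<^esub> = \<one>\<^bsub>F Mod K\<^esub>" "add W = monoid.mult (F Mod K)"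
  by (simp_all add: extension_of_scalars_def Let_def)

lemma abelian_group_W: "abelian_group W"
proof -
  interpret Q: comm_group "F Mod K" by (rule comm_group_quotient)
  show ?thesis
  proof (rule abelian_groupI; unfold W_simps)
    show "\<exists>y\<in>carrier (F Mod K). y \<otimes>\<^bsub>F Mod K\<^esub> x = \<one>\<^bsub>F Mod K\<^esub>" if "x \<in> carrier (F Mod K)" for x
      using Q.l_inv[OF that] Q.inv_closed[OF that] by blast
  qed (fact Q.m_closed Q.one_closed Q.m_assoc Q.m_comm Q.l_one)+
qed

sublocale W: abelian_group W by (rule abelian_group_W)

lemma carrier_W: "carrier W = cls ` carrier F"
  unfolding W_simps FactGroup_def RCOSETS_def cls_def by auto

lemma cls_closed: "z \<in> carrier F ==> cls z \<in> carrier W"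
  unfolding carrier_W by blast

lemma cls_add: "y \<in> carrier F ==> z \<in> carrier F ==> cls y \<oplus>\<^bsub>W\<^esub> cls z = cls (y + z)"
  using normal.rcos_sum[OF normal_K, of y z] unfolding W_simps cls_def by simp

lemma cls_zero: "cls 0 = \<zero>\<^bsub>W\<^esub>"
  using W.l_zero[OF cls_closed[of 0]] cls_add[of 0 0] W.add.r_cancel_one[of "cls 0" "cls 0"]
    cls_closed[of 0] by simp

lemma cls_minus: "z \<in> carrier F ==> \<ominus>\<^bsub>W\<^esub> cls z = cls (- z)"
  using W.minus_equality[of "cls (- z)" "cls z"] cls_add[of "- z" z] cls_closed[of z] cls_closed[of "- z"]
    cls_zero by simp

lemma tens_closed: "x \<in> carrier A ==> m \<in> carrier M ==> tens x m \<in> carrier W"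
  unfolding tens_cls by (intro cls_closed F_of)

lemma tens_add_left:
  "\<lbrakk>x \<in> carrier A; y \<in> carrier A; m \<in> carrier M\<rbrakk> \<Longrightarrow> tens (x \<oplus>\<^bsub>A\<^esub> y) m = tens x m \<oplus>\<^bsub>W\<^esub> tens y m"
  unfolding tens_cls
  by (subst cls_add, simp, simp) (use relation_mem(1)[of x y m] in \<open>simp add: cls_eq_iff diff_diff_add\<close>)

lemma tens_add_right:
  "\<lbrakk>x \<in> carrier A; m \<in> carrier M; n \<in> carrier M\<rbrakk> \<Longrightarrow> tens x (m \<oplus>\<^bsub>M\<^esub> n) = tens x m \<oplus>\<^bsub>W\<^esub> tens x n"
  unfolding tens_cls
  by (subst cls_add, simp, simp) (use relation_mem(2)[of x m n] in \<open>simp add: cls_eq_iff diff_diff_add\<close>)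

lemma tens_balanced:
  "\<lbrakk>x \<in> carrier A; r \<in> carrier R; m \<in> carrier M\<rbrakk> \<Longrightarrow> tens (x \<otimes>\<^bsub>A\<^esub> r) m = tens x (r \<odot>\<^bsub>M\<^esub> m)"
  unfolding tens_cls using relation_mem(3)[of x r m] by (simp add: cls_eq_iff)

lemma tens_zero_right: "x \<in> carrier A ==> tens x \<zero>\<^bsub>M\<^esub> = \<zero>\<^bsub>W\<^esub>"
  using tens_add_right[of x "\<zero>\<^bsub>M\<^esub>" "\<zero>\<^bsub>M\<^esub>"] tens_closed[of x "\<zero>\<^bsub>M\<^esub>"]
    W.add.r_cancel_one'[of "tens x \<zero>\<^bsub>M\<^esub>" "tens x \<zero>\<^bsub>M\<^esub>"] by simp

lemma tens_zero_left: "m \<in> carrier M ==> tens \<zero>\<^bsub>A\<^esub> m = \<zero>\<^bsub>W\<^esub>"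
  using tens_add_left[of "\<zero>\<^bsub>A\<^esub>" "\<zero>\<^bsub>A\<^esub>" m] tens_closed[of "\<zero>\<^bsub>A\<^esub>" m]
    W.add.r_cancel_one'[of "tens \<zero>\<^bsub>A\<^esub> m" "tens \<zero>\<^bsub>A\<^esub> m"] by simp

lemma tens_minus: "x \<in> carrier A ==> m \<in> carrier M ==> \<ominus>\<^bsub>W\<^esub> tens x m = tens (\<ominus>\<^bsub>A\<^esub> x) m"
  using W.minus_equality[of "tens (\<ominus>\<^bsub>A\<^esub> x) m" "tens x m"] tens_add_left[of "\<ominus>\<^bsub>A\<^esub> x" x m]
    tens_zero_left[of m] tens_closed[of x m] tens_closed[of "\<ominus>\<^bsub>A\<^esub> x" m] A.l_neg[of x] by simp

lemma tens_induct [consumes 1, case_names zero add tens]: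
  assumes w: "w \<in> carrier W" and zero: "P \<zero>\<^bsub>W\<^esub>"
    and add: "\<And>u v. \<lbrakk>u \<in> carrier W; v \<in> carrier W; P u; P v\<rbrakk> \<Longrightarrow> P (u \<oplus>\<^bsub>W\<^esub> v)"
    and tens: "\<And>x m. \<lbrakk>x \<in> carrier A; m \<in> carrier M\<rbrakk> \<Longrightarrow> P (tens x m)"
  shows "P w"
proof -
  obtain z where z: "z \<in> carrier F" "w = cls z" using w unfolding carrier_W by blast
  have "Poly_Mapping.keys z \<subseteq> carrier A \<times> carrier M" using z(1) by simp
  \<comment> \<open>The induction on the free group builds elements by differences, so the claim is
    carried along for \<open>z\<close> and \<open>- z\<close> together.\<close>
  then have "P (cls z) \<and> P (cls (- z))"
  proof (induction rule: free_Abelian_group_induct[consumes 1, case_names zero diff of])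
    case zero
    then show ?case using assms(2) cls_zero by simp
  next
    case (diff x y)
    have F: "x \<in> carrier F" "y \<in> carrier F" using diff by auto
    have "P (cls x \<oplus>\<^bsub>W\<^esub> cls (- y))" "P (cls (- x) \<oplus>\<^bsub>W\<^esub> cls y)"
      using diff(3,4) F F_minus by (blast intro: add cls_closed)+
    then show ?case
      using F F_minus[OF F(1)] F_minus[OF F(2)] cls_add[of x "- y"] cls_add[of "- x" y] by simp
  next
    case (of a)
    then obtain x m where a: "a = (x, m)" "x \<in> carrier A" "m \<in> carrier M" by blast
    have "cls (- frag_of a) = tens (\<ominus>\<^bsub>A\<^esub> x) m"
      using cls_minus[of "frag_of (x, m)"] tens_minus[OF a(2,3)] a by (simp add: tens_cls)
    then show ?case using tens[OF a(2,3)] tens[OF A.a_inv_closed[OF a(2)] a(3)] a(1) tens_cls by simp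
  qed
  then show ?thesis using z(2) by blast
qed

lemma hom_F_diff:
  assumes V: "abelian_group V" and h: "h \<in> hom F (add_monoid V)" and "y \<in> carrier F" "z \<in> carrier F"
  shows "h (y - z) = h y \<oplus>\<^bsub>V\<^esub> \<ominus>\<^bsub>V\<^esub> h z"
proof -
  interpret V: abelian_group V by fact
  have "h (- z) = \<ominus>\<^bsub>V\<^esub> h z"
    using group_hom.hom_inv[of F "add_monoid V" h z] h V.a_group assms(4) group_F
    by (simp add: group_hom_def group_hom_axioms_def a_inv_def)
  moreover have "h (y + - z) = h y \<oplus>\<^bsub>V\<^esub> h (- z)"
    using hom_mult[OF h assms(3) F_minus[OF assms(4)]] by simp
  ultimately show ?thesis by simp
qed

text \<open>The balanced map extends to the free group, its kernel contains the three kinds of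
  relations, and so it descends to the quotient. Only additivity is asserted; further properties are
  obtained afterwards with \<open>tens_induct\<close>.\<close>

lemma tens_universal:
  assumes V: "abelian_group V"
    and f: "\<And>x m. \<lbrakk>x \<in> carrier A; m \<in> carrier M\<rbrakk> \<Longrightarrow> f x m \<in> carrier V"
    and add_left: "\<And>x y m. \<lbrakk>x \<in> carrier A; y \<in> carrier A; m \<in> carrier M\<rbrakk> \<Longrightarrow>
      f (x \<oplus>\<^bsub>A\<^esub> y) m = f x m \<oplus>\<^bsub>V\<^esub> f y m"
    and add_right: "\<And>x m n. \<lbrakk>x \<in> carrier A; m \<in> carrier M; n \<in> carrier M\<rbrakk> \<Longrightarrow>
      f x (m \<oplus>\<^bsub>M\<^esub> n) = f x m \<oplus>\<^bsub>V\<^esub> f x n"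
    and balanced: "\<And>x r m. \<lbrakk>x \<in> carrier A; r \<in> carrier R; m \<in> carrier M\<rbrakk> \<Longrightarrow>
      f (x \<otimes>\<^bsub>A\<^esub> r) m = f x (r \<odot>\<^bsub>M\<^esub> m)"
  obtains h where "h \<in> hom (add_monoid W) (add_monoid V)"
    and "\<And>x m. \<lbrakk>x \<in> carrier A; m \<in> carrier M\<rbrakk> \<Longrightarrow> h (tens x m) = f x m"
proof -
  interpret V: abelian_group V by fact
  have cancel: "u \<oplus>\<^bsub>V\<^esub> v \<oplus>\<^bsub>V\<^esub> \<ominus>\<^bsub>V\<^esub> u \<oplus>\<^bsub>V\<^esub> \<ominus>\<^bsub>V\<^esub> v = \<zero>\<^bsub>V\<^esub>" if "u \<in> carrier V" "v \<in> carrier V" for u v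
    using that by (metis V.a_closed V.a_inv_closed V.a_assoc V.minus_add V.r_neg)
  obtain g where g: "g \<in> hom F (add_monoid V)"
    and g_of: "\<And>a. a \<in> carrier A \<times> carrier M ==> g (frag_of a) = (\<lambda>(x, m). f x m) a"
    by (rule comm_group.free_Abelian_group_universal[OF V.a_comm_group,
        of "\<lambda>(x, m). f x m" "carrier A \<times> carrier M"]) (use f in auto)
  have g_of': "g (frag_of (x, m)) = f x m" if "x \<in> carrier A" "m \<in> carrier M" for x m
    using g_of that by simp
  have gh: "group_hom F (add_monoid V) g"
    using g V.a_group by (simp add: group_hom_def group_hom_axioms_def)
  have rel: "z \<in> kernel F (add_monoid V) g" if "z \<in> carrier F" "g z = \<zero>\<^bsub>V\<^esub>" for z
    using that by (simp add: kernel_def)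
  have K: "K \<subseteq> kernel F (add_monoid V) g"
  proof (rule K_least[OF group_hom.subgroup_kernel[OF gh]])
    fix x y m assume h: "x \<in> carrier A" "y \<in> carrier A" "m \<in> carrier M"
    show "frag_of (x \<oplus>\<^bsub>A\<^esub> y, m) - frag_of (x, m) - frag_of (y, m) \<in> kernel F (add_monoid V) g"
    proof (rule rel)
      show "frag_of (x \<oplus>\<^bsub>A\<^esub> y, m) - frag_of (x, m) - frag_of (y, m) \<in> carrier F"
        by (rule K_F[OF relation_mem(1)[OF h]])
      have "g (frag_of (x \<oplus>\<^bsub>A\<^esub> y, m) - frag_of (x, m) - frag_of (y, m))
          = f x m \<oplus>\<^bsub>V\<^esub> f y m \<oplus>\<^bsub>V\<^esub> \<ominus>\<^bsub>V\<^esub> f x m \<oplus>\<^bsub>V\<^esub> \<ominus>\<^bsub>V\<^esub> f y m"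
        using h by (simp only: hom_F_diff[OF V g] F_diff F_of A.a_closed g_of' add_left)
      also have "\<dots> = \<zero>\<^bsub>V\<^esub>"
        by (rule cancel[OF f[OF h(1,3)] f[OF h(2,3)]])
      finally show "g (frag_of (x \<oplus>\<^bsub>A\<^esub> y, m) - frag_of (x, m) - frag_of (y, m)) = \<zero>\<^bsub>V\<^esub>" .
    qed
  next
    fix x m n assume h: "x \<in> carrier A" "m \<in> carrier M" "n \<in> carrier M"
    show "frag_of (x, m \<oplus>\<^bsub>M\<^esub> n) - frag_of (x, m) - frag_of (x, n) \<in> kernel F (add_monoid V) g"
    proof (rule rel)
      show "frag_of (x, m \<oplus>\<^bsub>M\<^esub> n) - frag_of (x, m) - frag_of (x, n) \<in> carrier F"
        by (rule K_F[OF relation_mem(2)[OF h]])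
      have "g (frag_of (x, m \<oplus>\<^bsub>M\<^esub> n) - frag_of (x, m) - frag_of (x, n))
          = f x m \<oplus>\<^bsub>V\<^esub> f x n \<oplus>\<^bsub>V\<^esub> \<ominus>\<^bsub>V\<^esub> f x m \<oplus>\<^bsub>V\<^esub> \<ominus>\<^bsub>V\<^esub> f x n"
        using h by (simp only: hom_F_diff[OF V g] F_diff F_of M.a_closed g_of' add_right)
      also have "\<dots> = \<zero>\<^bsub>V\<^esub>"
        by (rule cancel[OF f[OF h(1,2)] f[OF h(1,3)]])
      finally show "g (frag_of (x, m \<oplus>\<^bsub>M\<^esub> n) - frag_of (x, m) - frag_of (x, n)) = \<zero>\<^bsub>V\<^esub>" .
    qed
  next
    fix x r m assume h: "x \<in> carrier A" "r \<in> carrier R" "m \<in> carrier M"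
    show "frag_of (x \<otimes>\<^bsub>A\<^esub> r, m) - frag_of (x, r \<odot>\<^bsub>M\<^esub> m) \<in> kernel F (add_monoid V) g"
    proof (rule rel)
      show "frag_of (x \<otimes>\<^bsub>A\<^esub> r, m) - frag_of (x, r \<odot>\<^bsub>M\<^esub> m) \<in> carrier F"
        by (rule K_F[OF relation_mem(3)[OF h]])
      have "g (frag_of (x \<otimes>\<^bsub>A\<^esub> r, m) - frag_of (x, r \<odot>\<^bsub>M\<^esub> m)) = f x (r \<odot>\<^bsub>M\<^esub> m) \<oplus>\<^bsub>V\<^esub> \<ominus>\<^bsub>V\<^esub> f x (r \<odot>\<^bsub>M\<^esub> m)"
        using h by (simp only: hom_F_diff[OF V g] F_of A.m_closed R_A smult_closed g_of' balanced)
      also have "\<dots> = \<zero>\<^bsub>V\<^esub>" using f[OF h(1) smult_closed[OF h(2,3)]] by (rule V.r_neg)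
      finally show "g (frag_of (x \<otimes>\<^bsub>A\<^esub> r, m) - frag_of (x, r \<odot>\<^bsub>M\<^esub> m)) = \<zero>\<^bsub>V\<^esub>" .
    qed
  qed
  obtain k where k: "k \<in> hom (F Mod K) (add_monoid V)" "\<And>z. z \<in> carrier F ==> k (cls z) = g z"
    using group_hom.FactGroup_universal_kernel[OF gh normal_K K] unfolding cls_def by blast
  show thesis
    by (rule that[of k]) (use k g_of' in \<open>simp_all add: hom_def W_simps tens_cls\<close>)
qed

text \<open>Left multiplication by \<open>a\<close> maps relations to relations, so all the cosets
  in the union defining the scalar multiplication coincide.\<close>

lemma smult_cls:
  assumes a: "a \<in> carrier A" and z: "z \<in> carrier F"
  shows "frag_extend (\<lambda>(x, m). frag_of (a \<otimes>\<^bsub>A\<^esub> x, m)) z \<in> carrier F"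
    and "a \<odot>\<^bsub>W\<^esub> cls z = cls (frag_extend (\<lambda>(x, m). frag_of (a \<otimes>\<^bsub>A\<^esub> x, m)) z)"
proof -
  define g :: "('a \<times> 'm \<Rightarrow>\<^sub>0 int) \<Rightarrow> ('a \<times> 'm \<Rightarrow>\<^sub>0 int)" where "g = frag_extend (\<lambda>(x, m). frag_of (a \<otimes>\<^bsub>A\<^esub> x, m))"
  have g_F: "g y \<in> carrier F" if "y \<in> carrier F" for y
  proof -
    have "Poly_Mapping.keys y \<subseteq> carrier A \<times> carrier M" using that by simp
    then show ?thesis
    proof (induction rule: free_Abelian_group_induct[consumes 1, case_names zero diff of])
      case (diff x y) then show ?case unfolding g_def frag_extend_diff by (intro F_diff)
    qed (use a in \<open>auto simp: g_def\<close>)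
  qed
  then show "frag_extend (\<lambda>(x, m). frag_of (a \<otimes>\<^bsub>A\<^esub> x, m)) z \<in> carrier F" using z unfolding g_def by blast
  have sub: "subgroup {y \<in> carrier F. g y \<in> K} F"
  proof (rule group.subgroupI[OF group_F])
    show "{y \<in> carrier F. g y \<in> K} \<noteq> {}" using K_zero K_F[OF K_zero] by (auto simp: g_def)
  qed (use K_add K_minus F_add in \<open>auto simp: g_def frag_extend_add frag_extend_minus\<close>)
  have K_g: "K \<subseteq> {y \<in> carrier F. g y \<in> K}"
  proof (rule K_least[OF sub], safe)
    fix x y m assume h: "x \<in> carrier A" "y \<in> carrier A" "m \<in> carrier M"
    show "frag_of (x \<oplus>\<^bsub>A\<^esub> y, m) - frag_of (x, m) - frag_of (y, m) \<in> carrier F"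
      by (rule K_F[OF relation_mem(1)[OF h]])
    show "g (frag_of (x \<oplus>\<^bsub>A\<^esub> y, m) - frag_of (x, m) - frag_of (y, m)) \<in> K"
      using relation_mem(1)[of "a \<otimes>\<^bsub>A\<^esub> x" "a \<otimes>\<^bsub>A\<^esub> y" m] h a by (simp add: g_def frag_extend_diff A.r_distr)
  next
    fix x m n assume h: "x \<in> carrier A" "m \<in> carrier M" "n \<in> carrier M"
    show "frag_of (x, m \<oplus>\<^bsub>M\<^esub> n) - frag_of (x, m) - frag_of (x, n) \<in> carrier F"
      by (rule K_F[OF relation_mem(2)[OF h]])
    show "g (frag_of (x, m \<oplus>\<^bsub>M\<^esub> n) - frag_of (x, m) - frag_of (x, n)) \<in> K"
      using relation_mem(2)[of "a \<otimes>\<^bsub>A\<^esub> x" m n] h a by (simp add: g_def frag_extend_diff)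
  next
    fix x r m assume h: "x \<in> carrier A" "r \<in> carrier R" "m \<in> carrier M"
    show "frag_of (x \<otimes>\<^bsub>A\<^esub> r, m) - frag_of (x, r \<odot>\<^bsub>M\<^esub> m) \<in> carrier F"
      by (rule K_F[OF relation_mem(3)[OF h]])
    show "g (frag_of (x \<otimes>\<^bsub>A\<^esub> r, m) - frag_of (x, r \<odot>\<^bsub>M\<^esub> m)) \<in> K"
      using relation_mem(3)[of "a \<otimes>\<^bsub>A\<^esub> x" r m] h a R_A by (simp add: g_def frag_extend_diff A.m_assoc)
  qed
  have "cls (g y) = cls (g z)" if "y \<in> cls z" for y
  proof -
    have "g (y - z) \<in> K" using that K_g unfolding cls_iff by blast
    then show ?thesis unfolding cls_eq_iff by (simp add: g_def frag_extend_diff)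
  qed
  moreover have "z \<in> cls z" unfolding cls_iff using K_zero by simp
  ultimately have "(\<Union>y\<in>cls z. cls (g y)) = cls (g z)" by blast
  then show "a \<odot>\<^bsub>W\<^esub> cls z = cls (frag_extend (\<lambda>(x, m). frag_of (a \<otimes>\<^bsub>A\<^esub> x, m)) z)"
    unfolding g_def by (simp add: extension_of_scalars_def Let_def cls_def)
qed

lemma W_smult_closed: "a \<in> carrier A ==> w \<in> carrier W ==> a \<odot>\<^bsub>W\<^esub> w \<in> carrier W"
  unfolding carrier_W using smult_cls by blast

lemma W_smult_add:
  assumes "a \<in> carrier A" "v \<in> carrier W" "w \<in> carrier W"
  shows "a \<odot>\<^bsub>W\<^esub> (v \<oplus>\<^bsub>W\<^esub> w) = a \<odot>\<^bsub>W\<^esub> v \<oplus>\<^bsub>W\<^esub> a \<odot>\<^bsub>W\<^esub> w"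
proof -
  obtain y z where "y \<in> carrier F" "z \<in> carrier F" "v = cls y" "w = cls z" using assms unfolding carrier_W by blast
  then show ?thesis using assms(1) by (simp only: cls_add smult_cls F_add frag_extend_add)
qed

lemma smult_tens:
  "\<lbrakk>a \<in> carrier A; x \<in> carrier A; m \<in> carrier M\<rbrakk> \<Longrightarrow> a \<odot>\<^bsub>W\<^esub> tens x m = tens (a \<otimes>\<^bsub>A\<^esub> x) m"
  unfolding tens_cls using smult_cls(2)[of a "frag_of (x, m)"] by simp

lemma W_smult_zero: "a \<in> carrier A ==> a \<odot>\<^bsub>W\<^esub> \<zero>\<^bsub>W\<^esub> = \<zero>\<^bsub>W\<^esub>"
  using W_smult_add[of a "\<zero>\<^bsub>W\<^esub>" "\<zero>\<^bsub>W\<^esub>"] W_smult_closed[of a "\<zero>\<^bsub>W\<^esub>"]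
    W.add.r_cancel_one'[of "a \<odot>\<^bsub>W\<^esub> \<zero>\<^bsub>W\<^esub>" "a \<odot>\<^bsub>W\<^esub> \<zero>\<^bsub>W\<^esub>"] by simp

lemma left_module_W: "left_module A W"
proof (intro left_module.intro A.ring_axioms abelian_group_W left_module_axioms.intro)
  fix a b w assume h: "a \<in> carrier A" "b \<in> carrier A" "w \<in> carrier W"
  show "(a \<oplus>\<^bsub>A\<^esub> b) \<odot>\<^bsub>W\<^esub> w = a \<odot>\<^bsub>W\<^esub> w \<oplus>\<^bsub>W\<^esub> b \<odot>\<^bsub>W\<^esub> w"
    using h(3)
  proof (induction rule: tens_induct)
    case (add u v)
    then show ?case using h(1,2) by (simp add: W_smult_add W_smult_closed W.a_ac)
  qed (use h(1,2) in \<open>simp_all add: W_smult_zero smult_tens A.l_distr tens_add_left\<close>)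
  show "(a \<otimes>\<^bsub>A\<^esub> b) \<odot>\<^bsub>W\<^esub> w = a \<odot>\<^bsub>W\<^esub> (b \<odot>\<^bsub>W\<^esub> w)"
    using h(3)
  proof (induction rule: tens_induct)
    case (add u v)
    then show ?case using h(1,2) by (simp add: W_smult_add W_smult_closed)
  qed (use h(1,2) in \<open>simp_all add: W_smult_zero smult_tens A.m_assoc\<close>)
next
  fix w assume "w \<in> carrier W"
  then show "\<one>\<^bsub>A\<^esub> \<odot>\<^bsub>W\<^esub> w = w"
  proof (induction rule: tens_induct)
    case (add u v)
    then show ?case by (simp add: W_smult_add)
  qed (simp_all add: W_smult_zero smult_tens)
qed (use W_smult_closed W_smult_add in blast)+

end

section \<open>The induced module\<close>

declare TGA_simps [simp del] mult_FactGroup [simp del] one_FactGroup [simp del]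

context crossed
begin

lemma restr_closed [simp]: "C \<in> carrier \<Gamma> ==> restr C a \<in> carrier A"
  by (rule restr_A)

lemma restr_finsum:
  assumes "C \<in> carrier \<Gamma>" "\<And>i. i \<in> I ==> x i \<in> carrier A"
  shows "restr C (finsum A x I) = finsum A (\<lambda>i. restr C (x i)) I"
  by (rule additive_finsum[OF abelian_group_A abelian_group_A]) (use assms restr_add in auto)

text \<open>Left multiplication by \<open>v\<close> shifts degrees by \<open>C\<close>, injectively;
  only the component of degree \<open>C'\<close> of \<open>a\<close> lands in degree
  \<open>C \<star> C'\<close>.\<close>

lemma restr_mult_left:
  assumes C: "C \<in> carrier \<Gamma>" "C' \<in> carrier \<Gamma>" and v: "v \<in> D C" and a: "a \<in> carrier A"
  shows "restr (C \<star> C') (v \<cdot> a) = v \<cdot> restr C' a"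
proof -
  note vA = D_A[OF C(1) v] and CC = \<Gamma>.m_closed[OF C]
  have "v \<cdot> a = v \<cdot> finsum A (\<lambda>C. restr C a) (carrier \<Gamma>)"
    using restr_decompose[OF a] by simp
  also have "\<dots> = finsum A (\<lambda>C. v \<cdot> restr C a) (carrier \<Gamma>)"
    by (rule A.finsum_rdistr[OF finite_\<Gamma> vA]) auto
  finally have "restr (C \<star> C') (v \<cdot> a)
      = finsum A (\<lambda>C''. restr (C \<star> C') (v \<cdot> restr C'' a)) (carrier \<Gamma>)"
    using restr_finsum[OF CC, of "carrier \<Gamma>" "\<lambda>C. v \<cdot> restr C a"] A.m_closed[OF vA restr_closed] by simp
  also have "\<dots> = restr (C \<star> C') (v \<cdot> restr C' a)"
  proof (rule finsum_single[OF abelian_group_A finite_\<Gamma> C(2)])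
    fix C'' assume C'': "C'' \<in> carrier \<Gamma>" "C'' \<noteq> C'"
    then have "C \<star> C'' \<noteq> C \<star> C'" using C by simp
    then show "restr (C \<star> C') (v \<cdot> restr C'' a) = \<zero>\<^bsub>A\<^esub>"
      using restr_eq_zero[OF \<Gamma>.m_closed[OF C(1) C''(1)] CC] D_mult[OF C(1) C''(1) v restr_D[OF C''(1)]]
      by simp
  qed (use CC in simp)
  also have "\<dots> = v \<cdot> restr C' a"
    by (rule restr_eq[OF CC D_mult[OF C v restr_D[OF C(2)]]])
  finally show ?thesis .
qed

lemma restr_mult_D:
  assumes C: "C \<in> carrier \<Gamma>" "C' \<in> carrier \<Gamma>" and v: "v \<in> D C'" and a: "a \<in> carrier A"
  shows "restr (C \<star> C') (a \<cdot> v) = restr C a \<cdot> v"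
proof -
  note vA = D_A[OF C(2) v] and CC = \<Gamma>.m_closed[OF C]
  have "a \<cdot> v = finsum A (\<lambda>C. restr C a) (carrier \<Gamma>) \<cdot> v"
    using restr_decompose[OF a] by simp
  also have "\<dots> = finsum A (\<lambda>C. restr C a \<cdot> v) (carrier \<Gamma>)"
    by (rule A.finsum_ldistr[OF finite_\<Gamma> vA]) auto
  finally have "restr (C \<star> C') (a \<cdot> v)
      = finsum A (\<lambda>C''. restr (C \<star> C') (restr C'' a \<cdot> v)) (carrier \<Gamma>)"
    using restr_finsum[OF CC, of "carrier \<Gamma>" "\<lambda>C. restr C a \<cdot> v"] A.m_closed[OF restr_closed vA] by simp
  also have "\<dots> = restr (C \<star> C') (restr C a \<cdot> v)"
  proof (rule finsum_single[OF abelian_group_A finite_\<Gamma> C(1)])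
    fix C'' assume C'': "C'' \<in> carrier \<Gamma>" "C'' \<noteq> C"
    then have "C'' \<star> C' \<noteq> C \<star> C'" using C by simp
    then show "restr (C \<star> C') (restr C'' a \<cdot> v) = \<zero>\<^bsub>A\<^esub>"
      using restr_eq_zero[OF \<Gamma>.m_closed[OF C''(1) C(2)] CC] D_mult[OF C''(1) C(2) restr_D[OF C''(1)] v]
      by simp
  qed (use CC in simp)
  also have "\<dots> = restr C a \<cdot> v"
    by (rule restr_eq[OF CC D_mult[OF C restr_D[OF C(1)] v]])
  finally show ?thesis .
qed

lemma \<Gamma>_mult_N [simp]: "C \<in> carrier \<Gamma> ==> C \<star> N = C" "C \<in> carrier \<Gamma> ==> N \<star> C = C"
  using \<Gamma>.r_one[of C] \<Gamma>.l_one[of C] unfolding one_\<Gamma> by blast+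

lemma restr_hu:
  assumes C: "C \<in> carrier \<Gamma>" and v: "v \<in> hu C" and a: "a \<in> carrier A"
  shows "restr C a = v \<cdot> restr N (inv\<^bsub>A\<^esub> v \<cdot> a)"
  using restr_mult_left[OF C N_\<Gamma> hu_D[OF C v], of "inv\<^bsub>A\<^esub> v \<cdot> a"] C a hu_r_cancel[OF C v a] hu_inv_A[OF C v] by simp

lemma restr_N_B [simp]: "restr N a \<in> carrier B"
  using restr_D[OF N_\<Gamma>] unfolding D_N .

lemma restr_N_add: "restr N (a \<oplus>\<^bsub>A\<^esub> b) = restr N a \<oplus>\<^bsub>B\<^esub> restr N b"
  unfolding restr_add by (simp add: TGA_simps)

text \<open>A fixed unit in each degree; the choices in different degrees are unrelated.\<close>

definition homu :: "'a set \<Rightarrow> 'a \<Rightarrow> complex" where "homu C = (SOME v. v \<in> hu C)"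

lemma homu: "C \<in> carrier \<Gamma> ==> homu C \<in> hu C"
  unfolding homu_def by (metis hu_ex someI)

end

section \<open>Coordinates and components of the induced module\<close>

locale mackey = crossed +
  fixes M :: "('a \<Rightarrow> complex, 'a \<Rightarrow> complex) module"
  assumes irr: "irreducible_module B M"
begin

sublocale M: complex_left_module B M
  by (rule B.complex_left_module_A[OF irreducible_left_module[OF irr]])

sublocale T: scalar_extension A B M
  by (intro scalar_extension.intro A.ring_axioms M.left_module_axioms scalar_extension_axioms.intro BA)

abbreviation W where "W \<equiv> mackey_module G \<alpha> N M"
abbreviation tens where "tens \<equiv> T.tens"
abbreviation Inertia where "Inertia \<equiv> inertia_group G \<alpha> N M"

sublocale W: complex_left_module A W
  by (rule complex_left_module_A[OF T.left_module_W])

text \<open>The coordinate of \<open>W\<close> in the degree of \<open>v\<close>: that component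
  consists of the tensors with left factor \<open>v\<close>, and \<open>pr v\<close> returns the
  right factor, while it kills the other components. The value depends on \<open>v\<close>, not only
  on the degree, and is therefore indexed by the unit.\<close>

definition pr :: "('a \<Rightarrow> complex) \<Rightarrow> (('a \<Rightarrow> complex) \<times> ('a \<Rightarrow> complex) \<Rightarrow>\<^sub>0 int) set \<Rightarrow> 'a \<Rightarrow> complex" where
  "pr v = (SOME h. h \<in> hom (add_monoid W) (add_monoid M) \<and>
     (\<forall>x\<in>carrier A. \<forall>m\<in>carrier M. h (tens x m) = restr N (inv\<^bsub>A\<^esub> v \<cdot> x) \<odot>\<^bsub>M\<^esub> m))"

text \<open>The assignment is balanced because projecting to degree \<open>N\<close> commutes with
  right multiplication by \<open>B\<close>.\<close>

lemma pr_exists: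
  assumes C: "C \<in> carrier \<Gamma>" and v: "v \<in> hu C"
  shows "pr v \<in> hom (add_monoid W) (add_monoid M)"
    and "x \<in> carrier A ==> m \<in> carrier M ==> pr v (tens x m) = restr N (inv\<^bsub>A\<^esub> v \<cdot> x) \<odot>\<^bsub>M\<^esub> m"
proof -
  note viA = hu_inv_A[OF C v]
  have "\<exists>h. h \<in> hom (add_monoid W) (add_monoid M) \<and>
     (\<forall>x\<in>carrier A. \<forall>m\<in>carrier M. h (tens x m) = restr N (inv\<^bsub>A\<^esub> v \<cdot> x) \<odot>\<^bsub>M\<^esub> m)"
  proof (rule T.tens_universal[of M "\<lambda>x m. restr N (inv\<^bsub>A\<^esub> v \<cdot> x) \<odot>\<^bsub>M\<^esub> m"])
    fix x r m assume h: "x \<in> carrier A" "r \<in> carrier B" "m \<in> carrier M"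
    have "restr N (inv\<^bsub>A\<^esub> v \<cdot> (x \<cdot> r)) = restr N (inv\<^bsub>A\<^esub> v \<cdot> x) \<otimes>\<^bsub>B\<^esub> r"
      using restr_mult_right[OF N_\<Gamma> A.m_closed[OF viA h(1)] h(2)] A.m_assoc[OF viA h(1) BA[OF h(2)]]
        B_mult[OF restr_N_B h(2)] by simp
    then show "restr N (inv\<^bsub>A\<^esub> v \<cdot> (x \<cdot> r)) \<odot>\<^bsub>M\<^esub> m = restr N (inv\<^bsub>A\<^esub> v \<cdot> x) \<odot>\<^bsub>M\<^esub> (r \<odot>\<^bsub>M\<^esub> m)"
      using M.smult_assoc[OF restr_N_B h(2,3)] by simp
  qed (use viA in \<open>auto simp: M.smult_closed A.r_distr restr_N_add M.smult_l_distr M.smult_r_distr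
      M.abelian_group_axioms\<close>)
  from someI_ex[OF this]
  show "pr v \<in> hom (add_monoid W) (add_monoid M)"
    and "x \<in> carrier A ==> m \<in> carrier M ==> pr v (tens x m) = restr N (inv\<^bsub>A\<^esub> v \<cdot> x) \<odot>\<^bsub>M\<^esub> m"
    unfolding pr_def[symmetric] by blast+
qed

lemma pr_closed:
  "C \<in> carrier \<Gamma> ==> v \<in> hu C ==> w \<in> carrier W ==> pr v w \<in> carrier M"
  using hom_in_carrier[OF pr_exists(1), of C v w] by simp

lemma pr_add: "C \<in> carrier \<Gamma> ==> v \<in> hu C ==> w \<in> carrier W ==> w' \<in> carrier W ==>
    pr v (w \<oplus>\<^bsub>W\<^esub> w') = pr v w \<oplus>\<^bsub>M\<^esub> pr v w'"
  using hom_mult[OF pr_exists(1), of C v w w'] by simp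

lemma pr_finsum:
  assumes "C \<in> carrier \<Gamma>" "v \<in> hu C" "\<And>i. i \<in> I ==> x i \<in> carrier W"
  shows "pr v (finsum W x I) = finsum M (\<lambda>i. pr v (x i)) I"
  by (rule additive_finsum[OF T.W.abelian_group_axioms M.M.abelian_group_axioms])
    (use pr_closed[OF assms(1,2)] pr_add[OF assms(1,2)] assms(3) in auto)

lemma pr_zero: "C \<in> carrier \<Gamma> ==> v \<in> hu C ==> pr v \<zero>\<^bsub>W\<^esub> = \<zero>\<^bsub>M\<^esub>"
  by (rule additive_zero[OF T.W.abelian_group_axioms M.M.abelian_group_axioms])
    (use pr_closed pr_add in auto)

lemma pr_tens_same:
  assumes "C \<in> carrier \<Gamma>" "v \<in> hu C" "m \<in> carrier M"
  shows "pr v (tens v m) = m"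
  using pr_exists(2)[OF assms(1,2) hu_A[OF assms(1,2)] assms(3)] hu_l_inv[OF assms(1,2)]
    restr_eq[OF N_\<Gamma>, of "\<one>\<^bsub>A\<^esub>"] hu_D[OF N_\<Gamma> one_hu] M.smult_one[OF assms(3)] by (simp add: B_one)

lemma pr_tens_other:
  assumes C: "C \<in> carrier \<Gamma>" "C' \<in> carrier \<Gamma>" "C \<noteq> C'" and v: "v \<in> hu C" and v': "v' \<in> hu C'"
    and m: "m \<in> carrier M"
  shows "pr v (tens v' m) = \<zero>\<^bsub>M\<^esub>"
proof -
  have D: "inv\<^bsub>A\<^esub> v \<cdot> v' \<in> D (inv\<^bsub>\<Gamma>\<^esub> C \<star> C')"
    by (rule D_mult[OF \<Gamma>.inv_closed[OF C(1)] C(2) hu_D[OF \<Gamma>.inv_closed[OF C(1)] hu_inv[OF C(1) v]] hu_D[OF C(2) v']])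
  have "inv\<^bsub>\<Gamma>\<^esub> C \<star> C' \<noteq> N"
    using C N_\<Gamma> \<Gamma>.inv_solve_left'[of N C C'] by auto
  then have "restr N (inv\<^bsub>A\<^esub> v \<cdot> v') = \<zero>\<^bsub>B\<^esub>"
    using restr_eq_zero[OF _ N_\<Gamma> _ D] C by (simp add: TGA_simps)
  then show ?thesis using pr_exists(2)[OF C(1) v hu_A[OF C(2) v'] m] m by simp
qed

lemma tens_finsum_left:
  assumes "\<And>i. i \<in> I ==> x i \<in> carrier A" "m \<in> carrier M"
  shows "tens (finsum A x I) m = finsum W (\<lambda>i. tens (x i) m) I"
  by (rule additive_finsum[OF abelian_group_A T.W.abelian_group_axioms, where f="\<lambda>a. tens a m"])
    (use assms T.tens_closed T.tens_add_left in auto)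

lemma tens_shift:
  assumes C: "C \<in> carrier \<Gamma>" and v: "v \<in> hu C" and a: "a \<in> D C" and m: "m \<in> carrier M"
  shows "tens a m = tens v ((inv\<^bsub>A\<^esub> v \<cdot> a) \<odot>\<^bsub>M\<^esub> m)"
  using T.tens_balanced[OF hu_A[OF C v] D_shift[OF C v a] m] hu_r_cancel[OF C v D_A[OF C a]] by simp

text \<open>On a pure tensor this is the decomposition of the left factor into components, each of
  which is \<open>v C\<close> times an element of \<open>B\<close> that can be moved across the
  tensor sign.\<close>

lemma tens_decompose:
  assumes w: "w \<in> carrier W" and v: "\<And>C. C \<in> carrier \<Gamma> ==> v C \<in> hu C"
  shows "w = finsum W (\<lambda>C. tens (v C) (pr (v C) w)) (carrier \<Gamma>)"
  using w
proof (induction rule: T.tens_induct)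
  case zero
  have "finsum W (\<lambda>C. tens (v C) (pr (v C) \<zero>\<^bsub>W\<^esub>)) (carrier \<Gamma>) = finsum W (\<lambda>C. \<zero>\<^bsub>W\<^esub>) (carrier \<Gamma>)"
    by (rule T.W.finsum_cong') (use pr_zero v T.tens_zero_right hu_A in auto)
  then show ?case by simp
next
  case (add u w)
  have "finsum W (\<lambda>C. tens (v C) (pr (v C) (u \<oplus>\<^bsub>W\<^esub> w))) (carrier \<Gamma>)
      = finsum W (\<lambda>C. tens (v C) (pr (v C) u) \<oplus>\<^bsub>W\<^esub> tens (v C) (pr (v C) w)) (carrier \<Gamma>)"
    by (rule T.W.finsum_cong')
      (use pr_add v T.tens_add_right hu_A pr_closed add(1,2) T.tens_closed in \<open>auto intro!: T.W.a_closed\<close>)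
  also have "\<dots> = finsum W (\<lambda>C. tens (v C) (pr (v C) u)) (carrier \<Gamma>) \<oplus>\<^bsub>W\<^esub> finsum W (\<lambda>C. tens (v C) (pr (v C) w)) (carrier \<Gamma>)"
    by (rule T.W.finsum_addf) (use v hu_A pr_closed add(1,2) T.tens_closed in blast)+
  finally show ?case using add(3,4) by simp
next
  case (tens x m)
  have "tens x m = tens (finsum A (\<lambda>C. restr C x) (carrier \<Gamma>)) m" using restr_decompose[OF tens(1)] by simp
  also have "\<dots> = finsum W (\<lambda>C. tens (restr C x) m) (carrier \<Gamma>)"
    by (rule tens_finsum_left[OF restr_closed tens(2)])
  also have "\<dots> = finsum W (\<lambda>C. tens (v C) (pr (v C) (tens x m))) (carrier \<Gamma>)"
  proof (rule T.W.finsum_cong')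
    fix C assume C: "C \<in> carrier \<Gamma>"
    show "tens (restr C x) m = tens (v C) (pr (v C) (tens x m))"
      unfolding restr_hu[OF C v[OF C] tens(1)] pr_exists(2)[OF C v[OF C] tens]
      by (rule T.tens_balanced[OF hu_A[OF C v[OF C]] restr_N_B tens(2)])
  qed (use v hu_A pr_closed T.tens_closed tens in auto)
  finally show ?case .
qed

lemma pr_smult:
  assumes C: "C \<in> carrier \<Gamma>" "C' \<in> carrier \<Gamma>" and v: "v \<in> hu C" "v' \<in> hu C'" and w: "w \<in> carrier W"
  shows "pr (v \<cdot> v') (v \<odot>\<^bsub>W\<^esub> w) = pr v' w"
  using w
proof (induction rule: T.tens_induct)
  note vv = hu_mult[OF C v] and CC = \<Gamma>.m_closed[OF C] and vA = hu_A[OF C(1) v(1)]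
  case zero
  show ?case using pr_zero[OF CC vv] pr_zero[OF C(2) v(2)] vA by simp
next
  note vv = hu_mult[OF C v] and CC = \<Gamma>.m_closed[OF C] and vA = hu_A[OF C(1) v(1)]
  case (add u w)
  then show ?case
    using pr_add[OF CC vv W.smult_closed[OF vA add(1)] W.smult_closed[OF vA add(2)]]
      pr_add[OF C(2) v(2) add(1,2)] vA by (simp add: W.smult_r_distr)
next
  note vv = hu_mult[OF C v] and CC = \<Gamma>.m_closed[OF C] and vA = hu_A[OF C(1) v(1)]
  case (tens x m)
  have "inv\<^bsub>A\<^esub> (v \<cdot> v') \<cdot> (v \<cdot> x) = inv\<^bsub>A\<^esub> v' \<cdot> x"
    using hu_inv_mult[OF C v] A.m_assoc[OF hu_inv_A[OF C(2) v(2)] hu_inv_A[OF C(1) v(1)] A.m_closed[OF vA tens(1)]]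
      hu_l_cancel[OF C(1) v(1) tens(1)] by simp
  then show ?case
    using tens vA T.smult_tens pr_exists(2)[OF CC vv A.m_closed[OF vA tens(1)] tens(2)]
      pr_exists(2)[OF C(2) v(2) tens] by simp
qed

abbreviation comp where "comp \<equiv> mackey_component G \<alpha> N M"

lemma generate_incl_subset: "X \<subseteq> generate H X"
  by (auto intro: generate.incl)

text \<open>Moving elements of \<open>B\<close> across the tensor sign turns every generator of the
  component into a tensor with left factor \<open>v\<close>, and these already form a
  subgroup.\<close>

lemma comp_eq:
  assumes C: "C \<in> carrier \<Gamma>" and v: "v \<in> hu C"
  shows "comp C = {tens v m | m. m \<in> carrier M}"
proof
  let ?T = "{tens v m | m. m \<in> carrier M}"
  note vA = hu_A[OF C v]
  have grp: "group (add_monoid W)" by (rule T.W.a_group)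
  show "comp C \<subseteq> ?T"
    unfolding mackey_component_def
  proof (rule group.generate_subgroup_incl[OF grp])
    show "{tens (basis_elt g \<cdot> r) m |g r m. g \<in> C \<and> r \<in> carrier B \<and> m \<in> carrier M} \<subseteq> ?T"
    proof
      fix w assume "w \<in> {tens (basis_elt g \<cdot> r) m |g r m. g \<in> C \<and> r \<in> carrier B \<and> m \<in> carrier M}"
      then obtain g r m where w: "w = tens (basis_elt g \<cdot> r) m" "g \<in> C" "r \<in> carrier B" "m \<in> carrier M" by blast
      have "basis_elt g \<cdot> r \<in> D (C \<star> N)"
        by (rule D_mult[OF C N_\<Gamma> hu_D[OF C basis_elt_hu[OF w(2)]]]) (use w(3) D_N in simp)
      then have D: "basis_elt g \<cdot> r \<in> D C" using C by simp
      show "w \<in> ?T" unfolding w(1) tens_shift[OF C v D w(4)]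
        using M.smult_closed[OF D_shift[OF C v D] w(4)] by blast
    qed
    show "subgroup ?T (add_monoid W)"
    proof (rule group.subgroupI[OF grp])
      show "?T \<subseteq> carrier (add_monoid W)" using T.tens_closed[OF vA] by auto
      show "?T \<noteq> {}" using M.M.zero_closed by blast
      fix x assume "x \<in> ?T"
      then obtain m where m: "x = tens v m" "m \<in> carrier M" by blast
      have "\<ominus>\<^bsub>W\<^esub> x = tens v (\<ominus>\<^bsub>M\<^esub> m)"
        unfolding m(1)
        by (rule additive_minus[OF M.M.abelian_group_axioms T.W.abelian_group_axioms, where f="tens v", symmetric])
          (use m(2) vA T.tens_closed T.tens_add_right in auto)
      then show "inv\<^bsub>add_monoid W\<^esub> x \<in> ?T" using m(2) unfolding a_inv_def by auto
      fix y assume "y \<in> ?T"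
      then obtain n where n: "y = tens v n" "n \<in> carrier M" by blast
      show "x \<otimes>\<^bsub>add_monoid W\<^esub> y \<in> ?T"
        using m n T.tens_add_right[OF vA m(2) n(2)] by auto
    qed
  qed
  obtain g c where g: "g \<in> C" "c \<noteq> 0" "v = c \<odot>\<^bsub>A\<^esub> basis_elt g" using v unfolding hu_def by blast
  \<comment> \<open>Conversely \<open>v\<close> is a basis element times a scalar, and scalars lie
    in \<open>B\<close>, so the tensors with left factor \<open>v\<close> are among the
    generators.\<close>
  have "v = basis_elt g \<cdot> (c \<odot>\<^bsub>B\<^esub> \<one>\<^bsub>B\<^esub>)"
    using g(3) hu_A[OF C basis_elt_hu[OF g(1)]] Alg.scalar_mult_right by (simp add: B_one B_scalar)
  then show "?T \<subseteq> comp C"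
    unfolding mackey_component_def using g(1) B.Alg.scalar_closed[of c]
    by (intro subset_trans[OF _ generate_incl_subset]) blast
qed

lemma comp_W: "C \<in> carrier \<Gamma> ==> comp C \<subseteq> carrier W"
  using comp_eq[OF _ homu, of C] T.tens_closed[OF hu_A[OF _ homu], of C] by auto

lemma comp_pr:
  assumes C: "C \<in> carrier \<Gamma>" and v: "v \<in> hu C" and w: "w \<in> comp C"
  shows "w = tens v (pr v w)"
  using w pr_tens_same[OF C v] unfolding comp_eq[OF C v] by auto

lemma comp_pr_other:
  assumes C: "C \<in> carrier \<Gamma>" "C' \<in> carrier \<Gamma>" "C \<noteq> C'" and v: "v \<in> hu C'" and w: "w \<in> comp C"
  shows "pr v w = \<zero>\<^bsub>M\<^esub>"
  using w pr_tens_other[OF C(2,1) C(3)[symmetric] v homu[OF C(1)]] unfolding comp_eq[OF C(1) homu[OF C(1)]] by auto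

lemma W_eqI:
  assumes w: "w \<in> carrier W" "w' \<in> carrier W" and v: "\<And>C. C \<in> carrier \<Gamma> ==> v C \<in> hu C"
    and eq: "\<And>C. C \<in> carrier \<Gamma> ==> pr (v C) w = pr (v C) w'"
  shows "w = w'"
proof -
  have "w = finsum W (\<lambda>C. tens (v C) (pr (v C) w)) (carrier \<Gamma>)" by (rule tens_decompose[OF w(1) v])
  also have "\<dots> = finsum W (\<lambda>C. tens (v C) (pr (v C) w')) (carrier \<Gamma>)"
    by (rule T.W.finsum_cong') (use eq v hu_A pr_closed T.tens_closed w in auto)
  also have "\<dots> = w'" by (rule tens_decompose[OF w(2) v, symmetric])
  finally show ?thesis .
qed

lemma comp_smult:
  assumes C: "C \<in> carrier \<Gamma>" "C' \<in> carrier \<Gamma>" and a: "a \<in> D C" and w: "w \<in> comp C'"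
  shows "a \<odot>\<^bsub>W\<^esub> w \<in> comp (C \<star> C')"
proof -
  note CC = \<Gamma>.m_closed[OF C]
  obtain m where m: "w = tens (homu C') m" "m \<in> carrier M" using w unfolding comp_eq[OF C(2) homu[OF C(2)]] by blast
  have D: "a \<cdot> homu C' \<in> D (C \<star> C')" by (rule D_mult[OF C a hu_D[OF C(2) homu[OF C(2)]]])
  have "a \<odot>\<^bsub>W\<^esub> w = tens (a \<cdot> homu C') m"
    unfolding m(1) by (rule T.smult_tens[OF D_A[OF C(1) a] hu_A[OF C(2) homu[OF C(2)]] m(2)])
  then show ?thesis
    unfolding comp_eq[OF CC homu[OF CC]] tens_shift[OF CC homu[OF CC] D m(2)]
    using M.smult_closed[OF D_shift[OF CC homu[OF CC] D] m(2)] by blast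
qed

text \<open>\<open>W\<close> is generated over \<open>A\<close> by the tensors with left factor
  \<open>\<one>\<close>, the copy of \<open>M\<close> in degree \<open>N\<close>.\<close>

lemma W_hom_eqI:
  assumes f: "f \<in> LinearCombinations.module_hom A W W" "f' \<in> LinearCombinations.module_hom A W W"
    and eq: "\<And>m. m \<in> carrier M ==> f (tens \<one>\<^bsub>A\<^esub> m) = f' (tens \<one>\<^bsub>A\<^esub> m)" and w: "w \<in> carrier W"
  shows "f w = f' w"
  using w
proof (induction rule: T.tens_induct)
  case zero
  show ?case using module_hom_zero[OF W.left_module_axioms W.left_module_axioms f(1)]
    module_hom_zero[OF W.left_module_axioms W.left_module_axioms f(2)] by simp
next
  case (add u v)
  then show ?case using module_homD(2)[OF f(1)] module_homD(2)[OF f(2)] by simp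
next
  case (tens x m)
  have "tens x m = x \<odot>\<^bsub>W\<^esub> tens \<one>\<^bsub>A\<^esub> m" using T.smult_tens[OF tens(1) A.one_closed tens(2)] tens(1) by simp
  then show ?case
    using module_homD(3)[OF f(1) tens(1) T.tens_closed[OF A.one_closed tens(2)]]
      module_homD(3)[OF f(2) tens(1) T.tens_closed[OF A.one_closed tens(2)]] eq[OF tens(2)] by simp
qed

end

section \<open>Transport of algebra structures\<close>

text \<open>The target is a bare record here. Such a bijection carries the algebra laws and the
  grading over to it; this is how the endomorphism algebra and the matrix algebra become
  algebras.\<close>

definition algebra_bij ::
  "('a \<Rightarrow> 'b) \<Rightarrow> (complex, 'a, 'x) module_scheme \<Rightarrow> (complex, 'b, 'y) module_scheme \<Rightarrow> bool" where
  "algebra_bij f X Y \<longleftrightarrow> bij_betw f (carrier X) (carrier Y) \<and> f \<one>\<^bsub>X\<^esub> = \<one>\<^bsub>Y\<^esub> \<and> f \<zero>\<^bsub>X\<^esub> = \<zero>\<^bsub>Y\<^esub> \<and>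
     (\<forall>x\<in>carrier X. \<forall>y\<in>carrier X. f (x \<otimes>\<^bsub>X\<^esub> y) = f x \<otimes>\<^bsub>Y\<^esub> f y) \<and>
     (\<forall>x\<in>carrier X. \<forall>y\<in>carrier X. f (x \<oplus>\<^bsub>X\<^esub> y) = f x \<oplus>\<^bsub>Y\<^esub> f y) \<and>
     (\<forall>c. \<forall>x\<in>carrier X. f (c \<odot>\<^bsub>X\<^esub> x) = c \<odot>\<^bsub>Y\<^esub> f x)"

lemma carrier_class_ring: "c \<in> carrier (class_ring :: complex ring)"
  by simp

context
  fixes f and X :: "(complex, 'a, 'x) module_scheme" and Y :: "(complex, 'b, 'y) module_scheme"
  assumes f: "algebra_bij f X Y" and alg: "complex_algebra X"
begin

interpretation X: complex_algebra X by (rule alg)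

lemma transport_simps:
  "f \<one>\<^bsub>X\<^esub> = \<one>\<^bsub>Y\<^esub>" "f \<zero>\<^bsub>X\<^esub> = \<zero>\<^bsub>Y\<^esub>" "x \<in> carrier X ==> f x \<in> carrier Y"
  "x \<in> carrier X ==> y \<in> carrier X ==> f (x \<otimes>\<^bsub>X\<^esub> y) = f x \<otimes>\<^bsub>Y\<^esub> f y"
  "x \<in> carrier X ==> y \<in> carrier X ==> f (x \<oplus>\<^bsub>X\<^esub> y) = f x \<oplus>\<^bsub>Y\<^esub> f y"
  "x \<in> carrier X ==> f (c \<odot>\<^bsub>X\<^esub> x) = c \<odot>\<^bsub>Y\<^esub> f x"
  using f unfolding algebra_bij_def bij_betw_def by blast+

lemma transport_carrier: "carrier Y = f ` carrier X"
  using f unfolding algebra_bij_def bij_betw_def by blast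

lemma transport_inj: "inj_on f (carrier X)"
  using f unfolding algebra_bij_def bij_betw_def by blast

lemma abelian_group_transport: "abelian_group Y"
proof (rule abelian_groupI; unfold transport_carrier, (elim imageE, clarify)?)
  fix x y z assume c: "x \<in> carrier X" "y \<in> carrier X" "z \<in> carrier X"
  show "f x \<oplus>\<^bsub>Y\<^esub> f y \<oplus>\<^bsub>Y\<^esub> f z = f x \<oplus>\<^bsub>Y\<^esub> (f y \<oplus>\<^bsub>Y\<^esub> f z)"
    using c X.a_assoc[OF c] by (simp add: transport_simps(5)[symmetric])
next
  fix x y assume c: "x \<in> carrier X" "y \<in> carrier X"
  show "f x \<oplus>\<^bsub>Y\<^esub> f y \<in> f ` carrier X" "f x \<oplus>\<^bsub>Y\<^esub> f y = f y \<oplus>\<^bsub>Y\<^esub> f x"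
    using c X.a_comm[OF c] by (simp_all add: transport_simps(5)[symmetric])
next
  fix x assume c: "x \<in> carrier X"
  show "\<zero>\<^bsub>Y\<^esub> \<oplus>\<^bsub>Y\<^esub> f x = f x" 
    using transport_simps(5)[OF X.zero_closed c] unfolding X.l_zero[OF c] transport_simps(2) by (rule sym)
  have "f (\<ominus>\<^bsub>X\<^esub> x) \<oplus>\<^bsub>Y\<^esub> f x = \<zero>\<^bsub>Y\<^esub>"
    unfolding transport_simps(5)[OF X.a_inv_closed[OF c] c, symmetric] X.l_neg[OF c] by (rule transport_simps(2))
  then show "\<exists>y\<in>f ` carrier X. y \<oplus>\<^bsub>Y\<^esub> f x = \<zero>\<^bsub>Y\<^esub>"
    by (rule bexI[OF _ imageI[OF X.a_inv_closed[OF c]]])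
next
  show "\<zero>\<^bsub>Y\<^esub> \<in> f ` carrier X" unfolding transport_simps(2)[symmetric] by (rule imageI[OF X.zero_closed])
qed

lemma complex_algebra_transport: "complex_algebra Y"
proof -
  have mon: "Group.monoid Y"
  proof (rule monoidI; unfold transport_carrier, (elim imageE, clarify)?)
    fix x y z assume c: "x \<in> carrier X" "y \<in> carrier X" "z \<in> carrier X"
    show "f x \<otimes>\<^bsub>Y\<^esub> f y \<otimes>\<^bsub>Y\<^esub> f z = f x \<otimes>\<^bsub>Y\<^esub> (f y \<otimes>\<^bsub>Y\<^esub> f z)"
      using c X.m_assoc[OF c] by (simp add: transport_simps(4)[symmetric])
  next
    fix x y assume c: "x \<in> carrier X" "y \<in> carrier X"
    show "f x \<otimes>\<^bsub>Y\<^esub> f y \<in> f ` carrier X" using c by (simp add: transport_simps(4)[symmetric])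
  next
    fix x assume c: "x \<in> carrier X"
    show "\<one>\<^bsub>Y\<^esub> \<otimes>\<^bsub>Y\<^esub> f x = f x" "f x \<otimes>\<^bsub>Y\<^esub> \<one>\<^bsub>Y\<^esub> = f x"
      using transport_simps(4)[OF X.one_closed c, symmetric] transport_simps(4)[OF c X.one_closed, symmetric]
      unfolding X.l_one[OF c] X.r_one[OF c] transport_simps(1) by blast+
  next
    show "\<one>\<^bsub>Y\<^esub> \<in> f ` carrier X" unfolding transport_simps(1)[symmetric] by (rule imageI[OF X.one_closed])
  qed
  have ring: "ring Y"
  proof (rule ringI[OF abelian_group_transport mon]; unfold transport_carrier, elim imageE, clarify)
    fix x y z assume c: "x \<in> carrier X" "y \<in> carrier X" "z \<in> carrier X"
    show "(f x \<oplus>\<^bsub>Y\<^esub> f y) \<otimes>\<^bsub>Y\<^esub> f z = f x \<otimes>\<^bsub>Y\<^esub> f z \<oplus>\<^bsub>Y\<^esub> f y \<otimes>\<^bsub>Y\<^esub> f z"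
      "f z \<otimes>\<^bsub>Y\<^esub> (f x \<oplus>\<^bsub>Y\<^esub> f y) = f z \<otimes>\<^bsub>Y\<^esub> f x \<oplus>\<^bsub>Y\<^esub> f z \<otimes>\<^bsub>Y\<^esub> f y"
      using c X.l_distr[OF c] X.r_distr[OF c] by (simp_all add: transport_simps(4,5)[symmetric])
  qed
  have smult: "Module.module class_ring Y"
  proof (rule Module.moduleI[OF _ abelian_group_transport]; (unfold transport_carrier, elim imageE, clarify)?)
    show "cring (class_ring :: complex ring)" by (rule domain.axioms(1)[OF field.axioms(1)[OF class_field]])
    fix x assume c: "x \<in> carrier X"
    show "\<one>\<^bsub>class_ring\<^esub> \<odot>\<^bsub>Y\<^esub> f x = f x"
      using c X.smult_one[OF c] by (simp only: transport_simps(6)[symmetric])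
    fix a :: complex
    show "a \<odot>\<^bsub>Y\<^esub> f x \<in> f ` carrier X"
      using X.smult_closed[OF carrier_class_ring c] by (simp only: transport_simps(6)[OF c, symmetric]) blast
    fix b :: complex
    show "(a \<oplus>\<^bsub>class_ring\<^esub> b) \<odot>\<^bsub>Y\<^esub> f x = a \<odot>\<^bsub>Y\<^esub> f x \<oplus>\<^bsub>Y\<^esub> b \<odot>\<^bsub>Y\<^esub> f x"
      "(a \<otimes>\<^bsub>class_ring\<^esub> b) \<odot>\<^bsub>Y\<^esub> f x = a \<odot>\<^bsub>Y\<^esub> (b \<odot>\<^bsub>Y\<^esub> f x)"
      using X.smult_l_distr[OF carrier_class_ring carrier_class_ring c, of a b]
        X.smult_assoc1[OF carrier_class_ring carrier_class_ring c, of a b] c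
        X.smult_closed[OF carrier_class_ring c]
      by (simp_all only: transport_simps(5,6)[symmetric])
    fix y assume c': "y \<in> carrier X"
    show "a \<odot>\<^bsub>Y\<^esub> (f x \<oplus>\<^bsub>Y\<^esub> f y) = a \<odot>\<^bsub>Y\<^esub> f x \<oplus>\<^bsub>Y\<^esub> a \<odot>\<^bsub>Y\<^esub> f y"
      using X.smult_r_distr[OF carrier_class_ring c c', of a] c c'
        X.smult_closed[OF carrier_class_ring c] X.smult_closed[OF carrier_class_ring c'] X.a_closed
      by (simp only: transport_simps(5,6)[symmetric])
  qed
  show ?thesis
  proof (intro complex_algebra.intro ring smult complex_algebra_axioms.intro; unfold transport_carrier, elim imageE, clarify)
    fix x y c assume c: "x \<in> carrier X" "y \<in> carrier X"
    show "(c \<odot>\<^bsub>Y\<^esub> f x) \<otimes>\<^bsub>Y\<^esub> f y = c \<odot>\<^bsub>Y\<^esub> (f x \<otimes>\<^bsub>Y\<^esub> f y)"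
      "f x \<otimes>\<^bsub>Y\<^esub> (c \<odot>\<^bsub>Y\<^esub> f y) = c \<odot>\<^bsub>Y\<^esub> (f x \<otimes>\<^bsub>Y\<^esub> f y)"
      using X.smult_mult_left[OF c] X.smult_mult_right[OF c] c X.smult_closed_complex X.m_closed
      by (simp_all only: transport_simps(4,6)[symmetric])
  qed
qed

lemma transport_algebra_iso: "f \<in> algebra_iso X Y"
  unfolding algebra_iso_def ring_iso_def
proof (intro IntI CollectI conjI ring_hom_memI module_homI)
  show "bij_betw f (carrier X) (carrier Y)" using f unfolding algebra_bij_def by blast
qed (simp_all add: transport_simps)

lemma algebra_bij_inverse: "algebra_bij (the_inv_into (carrier X) f) Y X"
proof -
  note inv = the_inv_into_f_f[OF transport_inj]
  have "bij_betw (the_inv_into (carrier X) f) (carrier Y) (carrier X)"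
    using f unfolding algebra_bij_def by (intro bij_betw_the_inv_into) blast
  then show ?thesis
    unfolding algebra_bij_def unfolding transport_carrier
    using inv X.smult_closed_complex
    by (simp add: transport_simps(1,2)[symmetric] transport_simps(4,5,6)[symmetric])
qed

lemma graded_algebra_transport:
  assumes gr: "graded_algebra \<Gamma> X D" and E: "\<And>\<gamma>. \<gamma> \<in> carrier \<Gamma> ==> E \<gamma> = f ` D \<gamma>"
  shows "graded_algebra \<Gamma> Y E"
proof -
  interpret Y: complex_algebra Y by (rule complex_algebra_transport)
  have sub: "Module.submodule (D \<gamma>) class_ring X" if "\<gamma> \<in> carrier \<Gamma>" for \<gamma>
    using gr that unfolding graded_algebra_def by blast
  have DX: "D \<gamma> \<subseteq> carrier X" if "\<gamma> \<in> carrier \<Gamma>" for \<gamma>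
    using sub[OF that] X.submoduleE(1) by blast
  have ids: "internal_direct_sum X (carrier X) (carrier \<Gamma>) D"
    using gr unfolding graded_algebra_def by blast
  have fs: "f (finsum X h J) = finsum Y (\<lambda>i. f (h i)) J" if "J \<subseteq> carrier \<Gamma>" "h \<in> Pi J D" for h J
    by (rule additive_finsum[OF X.abelian_group_axioms Y.abelian_group_axioms])
      (use that DX in \<open>auto simp: transport_simps Pi_iff\<close>)
  have lift: "\<exists>h'. h' \<in> Pi J D \<and> (\<forall>j\<in>J. h j = f (h' j))" if "J \<subseteq> carrier \<Gamma>" "h \<in> Pi J E" for h J
  proof -
    have "\<exists>d. d \<in> D j \<and> h j = f d" if j: "j \<in> J" for j
    proof -
      have "j \<in> carrier \<Gamma>" using j \<open>J \<subseteq> carrier \<Gamma>\<close> by blast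
      then show ?thesis using Pi_mem[OF \<open>h \<in> Pi J E\<close> j] E by blast
    qed
    then obtain h' where "\<forall>j\<in>J. h' j \<in> D j \<and> h j = f (h' j)" by metis
    then show ?thesis by (intro exI[of _ h']) blast
  qed
  have cong: "finsum Y h J = finsum Y (\<lambda>j. f (h' j)) J"
    if "J \<subseteq> carrier \<Gamma>" "h' \<in> Pi J D" "\<forall>j\<in>J. h j = f (h' j)" for h h' J
  proof (rule Y.finsum_cong'[OF refl Pi_I])
    fix i assume i: "i \<in> J"
    then have "i \<in> carrier \<Gamma>" using that(1) by blast
    then have "h' i \<in> carrier X" using DX Pi_mem[OF that(2) i] by blast
    then show "f (h' i) \<in> carrier Y" by (rule transport_simps(3))
    show "h i = f (h' i)" using that(3) i by blast
  qed
  show ?thesis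
    unfolding graded_algebra_def
  proof (intro conjI ballI)
    show "group \<Gamma>" using gr unfolding graded_algebra_def by blast
    show "complex_algebra Y" by (rule complex_algebra_transport)
    fix \<gamma> assume \<gamma>: "\<gamma> \<in> carrier \<Gamma>"
    note s = X.submoduleE[OF sub[OF \<gamma>]]
    show "Module.submodule (E \<gamma>) class_ring Y"
      unfolding E[OF \<gamma>]
    proof (rule Y.submoduleI)
      show "f ` D \<gamma> \<subseteq> carrier Y" using DX[OF \<gamma>] transport_simps(3) by blast
      show "\<zero>\<^bsub>Y\<^esub> \<in> f ` D \<gamma>"
        using subgroup.one_closed[OF Module.submodule.axioms(1)[OF sub[OF \<gamma>]]]
        unfolding transport_simps(2)[symmetric] by simp
      fix y assume "y \<in> f ` D \<gamma>"
      then obtain x where x: "x \<in> D \<gamma>" "y = f x" by blast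
      have xX: "x \<in> carrier X" using x(1) DX[OF \<gamma>] by blast
      show "a \<odot>\<^bsub>Y\<^esub> y \<in> f ` D \<gamma>" for a
        using s(4)[OF carrier_class_ring x(1), of a] unfolding x(2) transport_simps(6)[OF xX, symmetric] by blast
      have "\<ominus>\<^bsub>Y\<^esub> y = f (\<ominus>\<^bsub>X\<^esub> x)" unfolding x(2)
        by (rule additive_minus[OF X.abelian_group_axioms Y.abelian_group_axioms, symmetric])
          (use xX in \<open>simp_all add: transport_simps\<close>)
      then show "\<ominus>\<^bsub>Y\<^esub> y \<in> f ` D \<gamma>" using s(3)[OF x(1)] by blast
      fix y' assume "y' \<in> f ` D \<gamma>"
      then obtain x' where x': "x' \<in> D \<gamma>" "y' = f x'" by blast
      have "y \<oplus>\<^bsub>Y\<^esub> y' = f (x \<oplus>\<^bsub>X\<^esub> x')"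
        unfolding x(2) x'(2) using x(1) x'(1) DX[OF \<gamma>] by (intro transport_simps(5)[symmetric]) blast+
      then show "y \<oplus>\<^bsub>Y\<^esub> y' \<in> f ` D \<gamma>" using s(5)[OF x(1) x'(1)] by blast
    qed
    fix \<delta> y y' assume \<delta>: "\<delta> \<in> carrier \<Gamma>" and y: "y \<in> E \<gamma>" and y': "y' \<in> E \<delta>"
    have gm: "\<gamma> \<otimes>\<^bsub>\<Gamma>\<^esub> \<delta> \<in> carrier \<Gamma>"
      using gr \<gamma> \<delta> unfolding graded_algebra_def by (blast intro: monoid.m_closed group.is_monoid)
    obtain x x' where x: "x \<in> D \<gamma>" "y = f x" "x' \<in> D \<delta>" "y' = f x'" using y y' E[OF \<gamma>] E[OF \<delta>] by blast
    have "x \<otimes>\<^bsub>X\<^esub> x' \<in> D (\<gamma> \<otimes>\<^bsub>\<Gamma>\<^esub> \<delta>)" using gr \<gamma> \<delta> x(1,3) unfolding graded_algebra_def by blast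
    moreover have "y \<otimes>\<^bsub>Y\<^esub> y' = f (x \<otimes>\<^bsub>X\<^esub> x')"
      unfolding x(2,4) using x(1,3) DX[OF \<gamma>] DX[OF \<delta>] by (intro transport_simps(4)[symmetric]) blast+
    ultimately show "y \<otimes>\<^bsub>Y\<^esub> y' \<in> E (\<gamma> \<otimes>\<^bsub>\<Gamma>\<^esub> \<delta>)" unfolding E[OF gm] by blast
  next
    show "internal_direct_sum Y (carrier Y) (carrier \<Gamma>) E"
      unfolding internal_direct_sum_def
    proof (intro conjI allI impI ballI)
      show "carrier Y = family_sum Y (carrier \<Gamma>) E"
      proof (intro equalityI subsetI)
        fix y assume "y \<in> carrier Y"
        then obtain x where x: "x \<in> carrier X" "y = f x" unfolding transport_carrier by blast
        obtain h J where h: "x = finsum X h J" "finite J" "J \<subseteq> carrier \<Gamma>" "h \<in> Pi J D"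
          using x(1) ids unfolding internal_direct_sum_def family_sum_def by blast
        have "(\<lambda>i. f (h i)) \<in> Pi J E"
        proof (rule Pi_I)
          fix i assume i: "i \<in> J"
          then have "i \<in> carrier \<Gamma>" using h(3) by blast
          then show "f (h i) \<in> E i" using Pi_mem[OF h(4) i] E by blast
        qed
        then show "y \<in> family_sum Y (carrier \<Gamma>) E"
          unfolding family_sum_def using fs[OF h(3,4)] h(1-3) x(2) by blast
      next
        fix y assume "y \<in> family_sum Y (carrier \<Gamma>) E"
        then obtain h J where h: "y = finsum Y h J" "finite J" "J \<subseteq> carrier \<Gamma>" "h \<in> Pi J E"
          unfolding family_sum_def by blast
        have "h j \<in> carrier Y" if jJ: "j \<in> J" for j
        proof -
          have j: "j \<in> carrier \<Gamma>" using jJ h(3) by blast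
          have "h j \<in> f ` D j" using Pi_mem[OF h(4) jJ] unfolding E[OF j] .
          then obtain d where d: "h j = f d" "d \<in> D j" by (rule imageE)
          have "d \<in> carrier X" using DX[OF j] d(2) by blast
          then show ?thesis unfolding d(1) by (rule transport_simps(3))
        qed
        then show "y \<in> carrier Y" unfolding h(1) by (intro Y.finsum_closed Pi_I)
      qed
    next
      fix J h j
      assume h: "finite J \<and> J \<subseteq> carrier \<Gamma> \<and> h \<in> Pi J E \<and> finsum Y h J = \<zero>\<^bsub>Y\<^esub>" and j: "j \<in> J"
      obtain h' where h': "h' \<in> Pi J D" "\<forall>j\<in>J. h j = f (h' j)" using lift[of J h] h by blast
      have J: "J \<subseteq> carrier \<Gamma>" using h by blast
      have "finsum Y h J = \<zero>\<^bsub>Y\<^esub>" using h by blast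
      then have eq: "f (finsum X h' J) = f \<zero>\<^bsub>X\<^esub>"
        unfolding fs[OF J h'(1)] cong[OF J h'] transport_simps(2) .
      have "finsum X h' J \<in> carrier X"
      proof (rule X.finsum_closed, rule Pi_I)
        fix i assume i: "i \<in> J"
        then have "i \<in> carrier \<Gamma>" using J by blast
        then show "h' i \<in> carrier X" using DX Pi_mem[OF h'(1) i] by blast
      qed
      then have z: "finsum X h' J = \<zero>\<^bsub>X\<^esub>" using inj_onD[OF transport_inj eq] X.zero_closed by blast
      have "\<forall>J f. finite J \<and> J \<subseteq> carrier \<Gamma> \<and> f \<in> Pi J D \<and> finsum X f J = \<zero>\<^bsub>X\<^esub> \<longrightarrow> (\<forall>j\<in>J. f j = \<zero>\<^bsub>X\<^esub>)"
        using ids unfolding internal_direct_sum_def by (rule conjunct2)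
      from this[rule_format, of J h' j] have "h' j = \<zero>\<^bsub>X\<^esub>" using h J h'(1) z j by blast
      then show "h j = \<zero>\<^bsub>Y\<^esub>" using h'(2) j transport_simps(2) by simp
    qed
  qed
qed

lemma graded_isomorphic_transport:
  assumes gr: "graded_algebra \<Gamma> X D" and E: "\<And>\<gamma>. \<gamma> \<in> carrier \<Gamma> ==> E \<gamma> = f ` D \<gamma>"
  shows "graded_isomorphic \<Gamma> X D Y E"
  unfolding graded_isomorphic_def
  using gr graded_algebra_transport[OF gr E] transport_algebra_iso E by blast

end

text \<open>The obstruction class is defined by isomorphisms starting from the endomorphism algebra,
  whereas the bijection will be constructed in the opposite direction.\<close>

lemma graded_isomorphic_transport_sym:
  assumes f: "algebra_bij f X Y" and gr: "graded_algebra \<Gamma> X D" and E: "\<And>\<gamma>. \<gamma> \<in> carrier \<Gamma> ==> E \<gamma> = f ` D \<gamma>"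
  shows "graded_isomorphic \<Gamma> Y E X D"
proof -
  have alg: "complex_algebra X" using gr unfolding graded_algebra_def by blast
  interpret X: complex_algebra X by (rule alg)
  note gY = graded_algebra_transport[OF f alg gr E]
  have algY: "complex_algebra Y" using gY unfolding graded_algebra_def by blast
  show ?thesis
  proof (rule graded_isomorphic_transport[OF algebra_bij_inverse[OF f alg] algY gY])
    fix \<gamma> assume \<gamma>: "\<gamma> \<in> carrier \<Gamma>"
    have "D \<gamma> \<subseteq> carrier X" using gr \<gamma> X.submoduleE(1) unfolding graded_algebra_def by blast
    then show "D \<gamma> = the_inv_into (carrier X) f ` E \<gamma>"
      unfolding E[OF \<gamma>] using the_inv_into_f_f[OF transport_inj[OF f alg]] by force
  qed
qed

section \<open>Cohomology classes\<close>

lemma cohomologous_equiv: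
  assumes "group H" shows "equiv (cocycles2 H) (cohomologous H)"
proof (rule equivI)
  interpret H: group H by fact
  show "refl_on (cocycles2 H) (cohomologous H)"
    by (rule refl_onI) (auto simp: cohomologous_def intro!: exI[of _ "\<lambda>_. 1"])
  show "cohomologous H \<subseteq> cocycles2 H \<times> cocycles2 H" by (auto simp: cohomologous_def)
  show "sym (cohomologous H)"
  proof (rule symI)
    fix \<alpha> \<beta> assume "(\<alpha>, \<beta>) \<in> cohomologous H"
    then obtain f where ab: "\<alpha> \<in> cocycles2 H" "\<beta> \<in> cocycles2 H"
      and f: "\<forall>g\<in>carrier H. f g \<noteq> 0"
        "\<forall>g\<in>carrier H. \<forall>h\<in>carrier H. \<beta> g h = f g * f h / f (g \<otimes>\<^bsub>H\<^esub> h) * \<alpha> g h"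
      unfolding cohomologous_def by blast
    have "\<alpha> g h = inverse (f g) * inverse (f h) / inverse (f (g \<otimes>\<^bsub>H\<^esub> h)) * \<beta> g h"
      if "g \<in> carrier H" "h \<in> carrier H" for g h
      using f that by (simp add: field_simps)
    then show "(\<beta>, \<alpha>) \<in> cohomologous H"
      unfolding cohomologous_def using ab f(1) by (auto intro!: exI[of _ "\<lambda>g. inverse (f g)"])
  qed
  show "trans (cohomologous H)"
  proof (rule transI)
    fix \<alpha> \<beta> \<gamma> assume "(\<alpha>, \<beta>) \<in> cohomologous H" "(\<beta>, \<gamma>) \<in> cohomologous H"
    then obtain f k where ab: "\<alpha> \<in> cocycles2 H" "\<gamma> \<in> cocycles2 H"
      and f: "\<forall>g\<in>carrier H. f g \<noteq> 0" "\<forall>g\<in>carrier H. k g \<noteq> 0"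
        "\<forall>g\<in>carrier H. \<forall>h\<in>carrier H. \<beta> g h = f g * f h / f (g \<otimes>\<^bsub>H\<^esub> h) * \<alpha> g h"
        "\<forall>g\<in>carrier H. \<forall>h\<in>carrier H. \<gamma> g h = k g * k h / k (g \<otimes>\<^bsub>H\<^esub> h) * \<beta> g h"
      unfolding cohomologous_def by blast
    have "\<gamma> g h = (f g * k g) * (f h * k h) / (f (g \<otimes>\<^bsub>H\<^esub> h) * k (g \<otimes>\<^bsub>H\<^esub> h)) * \<alpha> g h"
      if "g \<in> carrier H" "h \<in> carrier H" for g h
      unfolding f(4)[rule_format, OF that] f(3)[rule_format, OF that] by (simp add: mult_ac)
    then show "(\<alpha>, \<gamma>) \<in> cohomologous H"
      unfolding cohomologous_def using ab f(1,2) by (auto intro!: exI[of _ "\<lambda>g. f g * k g"])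
  qed
qed

section \<open>The canonical grading of a twisted group algebra of a subgroup\<close>

lemma (in twisted) A_induct [consumes 1, case_names zero add basis]:
  assumes f: "f \<in> carrier A" and zero: "P \<zero>\<^bsub>A\<^esub>"
    and add: "\<And>x y. x \<in> carrier A ==> y \<in> carrier A ==> P x ==> P y ==> P (x \<oplus>\<^bsub>A\<^esub> y)"
    and basis: "\<And>g c. g \<in> carrier G ==> P (c \<odot>\<^bsub>A\<^esub> basis_elt g)"
  shows "P f"
proof -
  have "J \<subseteq> carrier G ==> P (finsum A (\<lambda>g. f g \<odot>\<^bsub>A\<^esub> basis_elt g) J)" if "finite J" for J
    using that
  proof (induction J rule: finite_induct)
    case (insert j J)
    have "finsum A (\<lambda>g. f g \<odot>\<^bsub>A\<^esub> basis_elt g) (insert j J)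
        = f j \<odot>\<^bsub>A\<^esub> basis_elt j \<oplus>\<^bsub>A\<^esub> finsum A (\<lambda>g. f g \<odot>\<^bsub>A\<^esub> basis_elt g) J"
      by (rule A.finsum_insert) (use insert Alg.smult_closed_complex basis_elt_closed in auto)
    moreover have "P \<dots>"
      by (rule add) (use insert basis Alg.smult_closed_complex basis_elt_closed in \<open>auto intro!: A.finsum_closed\<close>)
    ultimately show ?case by simp
  qed (simp add: zero)
  from this[OF fin] show ?thesis using A_expand[OF f] by simp
qed

text \<open>One description for degrees inside and outside the subgroup: an element of the algebra
  supported at a point outside the group is zero.\<close>

lemma (in twisted) extend_grading_iff:
  "f \<in> extend_grading A (carrier G) twisted_grading \<gamma> \<longleftrightarrow> f \<in> carrier A \<and> (\<forall>x. x \<noteq> \<gamma> \<longrightarrow> f x = 0)"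
proof (cases "\<gamma> \<in> carrier G")
  case True
  have "f \<in> twisted_grading \<gamma> \<longleftrightarrow> (\<forall>x. x \<noteq> \<gamma> \<longrightarrow> f x = 0)"
  proof
    show "f \<in> twisted_grading \<gamma>" if "\<forall>x. x \<noteq> \<gamma> \<longrightarrow> f x = 0"
      unfolding twisted_grading_def using that by (auto simp: basis_elt_def fun_eq_iff intro!: range_eqI[of _ _ "f \<gamma>"])
  qed (auto simp: twisted_grading_def basis_elt_def)
  then show ?thesis using True by (auto simp: extend_grading_def TGA_simps)
next
  case False
  then show ?thesis by (auto simp: extend_grading_def TGA_simps fun_eq_iff)
qed

lemma (in twisted) graded_algebra_extend:
  assumes grp: "group \<Gamma>" and H: "subgroup H \<Gamma>" "G = \<Gamma>\<lparr>carrier := H\<rparr>"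
  shows "graded_algebra \<Gamma> A (extend_grading A H twisted_grading)"
proof -
  let ?E = "extend_grading A H twisted_grading"
  have cG: "carrier G = H" "\<And>x y. x \<otimes>\<^bsub>G\<^esub> y = x \<otimes>\<^bsub>\<Gamma>\<^esub> y" using H(2) by simp_all
  have HG: "H \<subseteq> carrier \<Gamma>" using H(1) by (rule subgroup.subset)
  have E_iff: "f \<in> ?E \<gamma> \<longleftrightarrow> f \<in> carrier A \<and> (\<forall>x. x \<noteq> \<gamma> \<longrightarrow> f x = 0)" for f \<gamma>
    using extend_grading_iff[of f \<gamma>] unfolding cG .
  show ?thesis
    unfolding graded_algebra_def
  proof (intro conjI ballI)
    show "group \<Gamma>" by (rule grp)
    show "complex_algebra A" by (rule Alg.complex_algebra_axioms)
    fix \<gamma> assume \<gamma>: "\<gamma> \<in> carrier \<Gamma>"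
    show "Module.submodule (?E \<gamma>) class_ring A"
    proof (rule Alg.submoduleI)
      fix x assume "x \<in> ?E \<gamma>"
      then show "\<ominus>\<^bsub>A\<^esub> x \<in> ?E \<gamma>" using A_minus[of x] A.a_inv_closed[of x] by (simp add: E_iff)
    next
      fix c x assume "x \<in> ?E \<gamma>"
      then show "c \<odot>\<^bsub>A\<^esub> x \<in> ?E \<gamma>" using Alg.smult_closed_complex[of x c] unfolding E_iff by (simp add: TGA_simps)
    qed (auto simp: E_iff TGA_simps)
    fix \<delta> x y assume \<delta>: "\<delta> \<in> carrier \<Gamma>" and x: "x \<in> ?E \<gamma>" and y: "y \<in> ?E \<delta>"
    have "(x \<otimes>\<^bsub>A\<^esub> y) z = 0" if "z \<noteq> \<gamma> \<otimes>\<^bsub>\<Gamma>\<^esub> \<delta>" for z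
      unfolding A_mult using x y that by (intro sum.neutral ballI) (auto simp: E_iff cG)
    then show "x \<otimes>\<^bsub>A\<^esub> y \<in> ?E (\<gamma> \<otimes>\<^bsub>\<Gamma>\<^esub> \<delta>)" using x y unfolding E_iff by blast
  next
    show "internal_direct_sum A (carrier A) (carrier \<Gamma>) ?E"
      unfolding internal_direct_sum_def
    proof (intro conjI allI impI ballI)
      show "carrier A = family_sum A (carrier \<Gamma>) ?E"
      proof (intro equalityI subsetI)
        fix f assume f: "f \<in> carrier A"
        have "(\<lambda>g. f g \<odot>\<^bsub>A\<^esub> basis_elt g) \<in> Pi H ?E"
          by (auto simp: E_iff cG TGA_simps basis_elt_def)
        then show "f \<in> family_sum A (carrier \<Gamma>) ?E"
          using A_expand[OF f] fin HG unfolding cG family_sum_def by blast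
      next
        fix f assume "f \<in> family_sum A (carrier \<Gamma>) ?E"
        then obtain h J where h: "f = finsum A h J" "h \<in> Pi J ?E" unfolding family_sum_def by blast
        show "f \<in> carrier A" unfolding h(1) by (rule A.finsum_closed, rule Pi_I) (use Pi_mem[OF h(2)] E_iff in simp)
      qed
    next
      fix J f j
      assume h: "finite J \<and> J \<subseteq> carrier \<Gamma> \<and> f \<in> Pi J ?E \<and> finsum A f J = \<zero>\<^bsub>A\<^esub>" and j: "j \<in> J"
      have fE: "f i \<in> carrier A" "\<forall>x. x \<noteq> i \<longrightarrow> f i x = 0" if "i \<in> J" for i
      proof -
        have "f i \<in> ?E i" using h that by (blast dest: Pi_mem)
        then show "f i \<in> carrier A" "\<forall>x. x \<noteq> i \<longrightarrow> f i x = 0" unfolding E_iff by blast+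
      qed
      have J: "finite J" and z: "finsum A f J = \<zero>\<^bsub>A\<^esub>" using h by blast+
      have "(\<lambda>x. \<Sum>i\<in>J. f i x) = \<zero>\<^bsub>A\<^esub>"
        using A_finsum[OF J fE(1)] z by simp
      then have "(\<Sum>i\<in>J. f i j) = 0" unfolding TGA_simps by (rule fun_cong)
      moreover have "(\<Sum>i\<in>J. f i j) = (\<Sum>i\<in>J. if i = j then f j j else 0)"
      proof (rule sum.cong[OF refl])
        fix i assume "i \<in> J"
        then show "f i j = (if i = j then f j j else 0)" using fE(2)[of i] by simp
      qed
      ultimately have "f j j = 0" using J j by simp
      then have "f j x = 0" for x using fE(2)[OF j] by (cases "x = j") auto
      then show "f j = \<zero>\<^bsub>A\<^esub>" by (auto simp: TGA_simps)
    qed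
  qed
qed

section \<open>The endomorphism algebra of the induced module\<close>

lemma (in complex_left_module) cscale_cancel:
  assumes m: "m \<in> carrier M" "m \<noteq> \<zero>\<^bsub>M\<^esub>" and eq: "cscale R M a m = cscale R M b m"
  shows "a = b"
proof (rule ccontr)
  assume "a \<noteq> b"
  have "cscale R M (a + - b) m = cscale R M a m \<oplus>\<^bsub>M\<^esub> cscale R M (- b) m"
    by (rule cscale_add_left[OF m(1)])
  also have "\<dots> = cscale R M (b + - b) m" unfolding eq by (rule cscale_add_left[OF m(1), symmetric])
  also have "\<dots> = \<zero>\<^bsub>M\<^esub>" using m(1) by simp
  finally have "cscale R M (inverse (a - b)) (cscale R M (a - b) m) = \<zero>\<^bsub>M\<^esub>" by simp
  then show False using cscale_cscale[OF m(1), of "inverse (a - b)" "a - b"] \<open>a \<noteq> b\<close> m by simp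
qed

context mackey
begin

lemma Inertia_eq: "Inertia = {C \<in> carrier \<Gamma>. act C (module_type B M) = module_type B M}"
  by (simp add: inertia_group_def stabilizer_def)

lemma Inertia_\<Gamma>: "C \<in> Inertia ==> C \<in> carrier \<Gamma>"
  by (simp add: Inertia_eq)

lemma Inertia_iff:
  assumes C: "C \<in> carrier \<Gamma>" and v: "v \<in> hu C"
  shows "C \<in> Inertia \<longleftrightarrow> module_isomorphic B M (cj v M)"
  using C module_type_eq_iff[OF irr irreducible_cj[OF irr C v]] act_module_type[OF irr C v]
  by (auto simp: Inertia_eq)

lemma subgroup_Inertia: "subgroup Inertia \<Gamma>"
proof (rule \<Gamma>.subgroupI)
  note c = module_type_in_Irr[OF irr]
  show "Inertia \<subseteq> carrier \<Gamma>" using Inertia_\<Gamma> by blast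
  show "Inertia \<noteq> {}" using act_one[OF c] N_\<Gamma> unfolding Inertia_eq by blast
  show "inv\<^bsub>\<Gamma>\<^esub> C \<in> Inertia" if "C \<in> Inertia" for C
    using that act_inv_eq[OF c, of C] unfolding Inertia_eq by auto
  show "C \<star> C' \<in> Inertia" if "C \<in> Inertia" "C' \<in> Inertia" for C C'
    using that act_mult[OF c, of C C'] unfolding Inertia_eq by auto
qed

abbreviation IG where "IG \<equiv> \<Gamma>\<lparr>carrier := Inertia\<rparr>"

lemma group_IG: "group IG"
  by (rule \<Gamma>.subgroup_imp_group[OF subgroup_Inertia])

lemma Inertia_mult: "C \<in> Inertia ==> C' \<in> Inertia ==> C \<star> C' \<in> Inertia"
  by (rule subgroup.m_closed[OF subgroup_Inertia])

lemma N_Inertia: "N \<in> Inertia"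
  using subgroup.one_closed[OF subgroup_Inertia] unfolding one_\<Gamma> .

lemma finite_Inertia: "finite Inertia"
  using finite_\<Gamma> Inertia_\<Gamma> by (rule rev_finite_subset[OF _ subsetI])

lemma conj_scalar:
  assumes C: "C \<in> carrier \<Gamma>" and v: "v \<in> hu C"
  shows "inv\<^bsub>A\<^esub> v \<cdot> (c \<odot>\<^bsub>B\<^esub> \<one>\<^bsub>B\<^esub>) \<cdot> v = c \<odot>\<^bsub>B\<^esub> \<one>\<^bsub>B\<^esub>"
  unfolding B_scalar B_one
  using Alg.scalar_mult_right[OF hu_inv_A[OF C v], of c] Alg.smult_mult_left[OF hu_inv_A[OF C v] hu_A[OF C v], of c]
    hu_l_inv[OF C v] by simp

lemma cscale_cj:
  assumes "C \<in> carrier \<Gamma>" "v \<in> hu C" shows "cscale B (cj v M) c m = cscale B M c m"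
  unfolding cscale_def using conj_scalar[OF assms] by simp

text \<open>Composing with the inverse of the isomorphism \<open>\<theta>\<close> turns
  \<open>h\<close> into an endomorphism of \<open>M\<close>, a scalar by Schur's lemma.\<close>

lemma hom_scalar:
  assumes C: "C \<in> carrier \<Gamma>" and v: "v \<in> hu C"
    and \<theta>: "\<theta> \<in> LinearCombinations.module_hom B M (cj v M)" "bij_betw \<theta> (carrier M) (carrier M)"
    and h: "h \<in> LinearCombinations.module_hom B M (cj v M)"
  shows "\<exists>c. \<forall>m\<in>carrier M. h m = cscale B M c (\<theta> m)"
proof -
  have bij: "bij_betw \<theta> (carrier M) (carrier (cj v M))" using \<theta>(2) by simp
  let ?g = "the_inv_into (carrier M) \<theta>"
  have g: "?g \<in> LinearCombinations.module_hom B (cj v M) M"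
    by (rule module_hom_inverse(1)[OF M.left_module_axioms \<theta>(1) bij])
  obtain \<beta> \<kappa> where co: "coord_system B M \<beta> (\<lambda>x. x) \<kappa>" using B.irreducible_coord_system[OF irr] by blast
  obtain c where c: "\<forall>m\<in>carrier M. (?g \<circ> h) m = cscale B M c m"
    using schur_scalar[OF B.Alg.complex_algebra_axioms irr co module_hom_comp[OF h g]] by blast
  have "h m = cscale B M c (\<theta> m)" if m: "m \<in> carrier M" for m
  proof -
    have hm: "h m \<in> carrier M" using module_homD(1)[OF h m] by simp
    have "h m = \<theta> (?g (h m))" using f_the_inv_into_f_bij_betw[OF \<theta>(2)] hm by simp
    also have "\<dots> = \<theta> (cscale B M c m)" using c m by simp
    also have "\<dots> = cscale B (cj v M) c (\<theta> m)"
      by (rule module_hom_cscale[OF B.Alg.complex_algebra_axioms \<theta>(1) m])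
    finally show ?thesis unfolding cscale_cj[OF C v] .
  qed
  then show ?thesis by blast
qed

text \<open>As a module over \<open>B\<close>, the component of \<open>W\<close> in the degree of
  \<open>v\<close> is the conjugate of \<open>M\<close> by \<open>v\<close>.\<close>

lemma pr_B:
  assumes C: "C \<in> carrier \<Gamma>" and v: "v \<in> hu C" and b: "b \<in> carrier B" and w: "w \<in> carrier W"
  shows "pr v (b \<odot>\<^bsub>W\<^esub> w) = (inv\<^bsub>A\<^esub> v \<cdot> b \<cdot> v) \<odot>\<^bsub>M\<^esub> pr v w"
proof -
  note bA = BA[OF b] and vA = hu_A[OF C v] and viA = hu_inv_A[OF C v] and cB = conj_B(1)[OF C v b]
  show ?thesis
    using w
  proof (induction rule: T.tens_induct)
    case zero
    show ?case using pr_zero[OF C v] bA cB by simp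
  next
    case (add x y)
    show ?case
      using add pr_add[OF C v W.smult_closed[OF bA add(1)] W.smult_closed[OF bA add(2)]] pr_add[OF C v add(1,2)]
        W.smult_r_distr[OF bA add(1,2)] M.smult_r_distr[OF cB pr_closed[OF C v add(1)] pr_closed[OF C v add(2)]]
      by simp
  next
    case (tens x m)
    have iA: "inv\<^bsub>A\<^esub> v \<cdot> x \<in> carrier A" using viA tens(1) by simp
    have "inv\<^bsub>A\<^esub> v \<cdot> (b \<cdot> x) = (inv\<^bsub>A\<^esub> v \<cdot> b \<cdot> v) \<cdot> (inv\<^bsub>A\<^esub> v \<cdot> x)"
      using viA bA vA tens(1) hu_r_cancel[OF C v tens(1)] by (simp add: A.m_assoc)
    moreover have "restr N \<dots> = (inv\<^bsub>A\<^esub> v \<cdot> b \<cdot> v) \<otimes>\<^bsub>B\<^esub> restr N (inv\<^bsub>A\<^esub> v \<cdot> x)"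
      using restr_mult_left[OF N_\<Gamma> N_\<Gamma> _ iA] cB B_mult[OF cB restr_N_B] N_\<Gamma> unfolding D_N by simp
    ultimately show ?case
      using T.smult_tens[OF bA tens] pr_exists(2)[OF C v A.m_closed[OF bA tens(1)] tens(2)]
        pr_exists(2)[OF C v tens] M.smult_assoc[OF cB restr_N_B tens(2)] by simp
  qed
qed

lemma pr_cscale:
  assumes C: "C \<in> carrier \<Gamma>" and v: "v \<in> hu C" and w: "w \<in> carrier W"
  shows "pr v (cscale A W c w) = cscale B M c (pr v w)"
  using pr_B[OF C v B.Alg.scalar_closed[of c] w] conj_scalar[OF C v, of c]
  by (simp add: cscale_def B_scalar B_one)

lemma tens_cscale:
  assumes "x \<in> carrier A" "m \<in> carrier M"
  shows "tens x (cscale B M c m) = cscale A W c (tens x m)"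
  unfolding cscale_def
  using T.tens_balanced[OF assms(1) B.Alg.scalar_closed[of c] assms(2)] T.smult_tens[OF Alg.scalar_closed[of c] assms]
    Alg.scalar_mult_left[OF assms(1), of c] Alg.scalar_mult_right[OF assms(1), of c]
  by (simp add: B_scalar B_one)

lemma restr_conj:
  assumes C: "C \<in> carrier \<Gamma>" and v: "v \<in> hu C" and y: "y \<in> carrier A"
  shows "restr N (inv\<^bsub>A\<^esub> v \<cdot> y \<cdot> v) = inv\<^bsub>A\<^esub> v \<cdot> restr N y \<cdot> v"
proof -
  note Ci = \<Gamma>.inv_closed[OF C]
  have "restr (inv\<^bsub>\<Gamma>\<^esub> C \<star> C) (inv\<^bsub>A\<^esub> v \<cdot> y \<cdot> v) = restr (inv\<^bsub>\<Gamma>\<^esub> C) (inv\<^bsub>A\<^esub> v \<cdot> y) \<cdot> v"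
    by (rule restr_mult_D[OF Ci C hu_D[OF C v] A.m_closed[OF hu_inv_A[OF C v] y]])
  moreover have "inv\<^bsub>\<Gamma>\<^esub> C \<star> C = N" using \<Gamma>.l_inv[OF C] unfolding one_\<Gamma> .
  moreover have "restr (inv\<^bsub>\<Gamma>\<^esub> C) (inv\<^bsub>A\<^esub> v \<cdot> y) = inv\<^bsub>A\<^esub> v \<cdot> restr N y"
    using restr_mult_left[OF Ci N_\<Gamma> hu_D[OF Ci hu_inv[OF C v]] y] Ci by simp
  ultimately show ?thesis by simp
qed

abbreviation E where "E \<equiv> right_endomorphism_algebra A W"

lemma one_tens_comp: "m \<in> carrier M ==> tens \<one>\<^bsub>A\<^esub> m \<in> comp N"
  unfolding comp_eq[OF N_\<Gamma> one_hu] by blast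

end

text \<open>The choices behind an obstruction cocycle: homogeneous units \<open>v C\<close> and
  isomorphisms \<open>\<theta> C\<close> from \<open>M\<close> to its conjugates, for
  \<open>C\<close> in the stabiliser. The element of \<open>B\<close> in front makes up for the
  units not being multiplicative; \<open>\<theta> C\<close> is applied before
  \<open>\<theta> C'\<close>, in accordance with endomorphisms acting from the right.\<close>

locale mackey_family = mackey +
  fixes v :: "'a set \<Rightarrow> 'a \<Rightarrow> complex" and \<theta> :: "'a set \<Rightarrow> ('a \<Rightarrow> complex) \<Rightarrow> 'a \<Rightarrow> complex"
    and \<omega> :: "'a set \<Rightarrow> 'a set \<Rightarrow> complex"
  assumes v: "C \<in> Inertia ==> v C \<in> hu C"
    and \<theta>: "C \<in> Inertia ==> \<theta> C \<in> LinearCombinations.module_hom B M (cj (v C) M)"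
    and \<theta>_bij: "C \<in> Inertia ==> bij_betw (\<theta> C) (carrier M) (carrier M)"
    and \<theta>_\<omega>: "\<lbrakk>C \<in> Inertia; C' \<in> Inertia; m \<in> carrier M\<rbrakk> \<Longrightarrow>
      (inv\<^bsub>A\<^esub> (v (C \<star> C')) \<cdot> (v C \<cdot> v C')) \<odot>\<^bsub>M\<^esub> \<theta> C' (\<theta> C m)
        = cscale B M (\<omega> C C') (\<theta> (C \<star> C') m)"

text \<open>The composite of \<open>\<theta>\<close> and \<open>\<theta>'\<close> intertwines
  \<open>M\<close> with its conjugate by \<open>v \<cdot> v'\<close>; acting with the element of
  \<open>B\<close> by which \<open>v \<cdot> v'\<close> differs from \<open>v''\<close> leads to the
  conjugate by \<open>v''\<close>.\<close>

lemma (in mackey) transition_hom: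
  assumes C: "C \<in> carrier \<Gamma>" "C' \<in> carrier \<Gamma>" and v: "v \<in> hu C" "v' \<in> hu C'" "v'' \<in> hu (C \<star> C')"
    and \<theta>: "\<theta> \<in> LinearCombinations.module_hom B M (cj v M)" "\<theta>' \<in> LinearCombinations.module_hom B M (cj v' M)"
  shows "(\<lambda>m. (inv\<^bsub>A\<^esub> v'' \<cdot> (v \<cdot> v')) \<odot>\<^bsub>M\<^esub> \<theta>' (\<theta> m)) \<in> LinearCombinations.module_hom B M (cj v'' M)"
proof -
  note CC = \<Gamma>.m_closed[OF C] and vv = hu_mult[OF C v(1,2)]
  note vA = hu_A[OF C(1) v(1)] hu_A[OF C(2) v(2)] hu_A[OF CC v(3)]
  note viA = hu_inv_A[OF C(1) v(1)] hu_inv_A[OF C(2) v(2)] hu_inv_A[OF CC v(3)]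
  have u: "inv\<^bsub>A\<^esub> v'' \<cdot> (v \<cdot> v') \<in> carrier B" (is "?u \<in> _")
    by (rule D_shift[OF CC v(3) hu_D[OF CC vv]])
  have \<theta>M: "\<theta> m \<in> carrier M" "\<theta>' m \<in> carrier M" if "m \<in> carrier M" for m
    using module_homD(1)[OF \<theta>(1) that] module_homD(1)[OF \<theta>(2) that] by simp_all
  show ?thesis
  proof (rule module_homI)
    show "?u \<odot>\<^bsub>M\<^esub> \<theta>' (\<theta> m) \<in> carrier (cj v'' M)" if "m \<in> carrier M" for m
      using M.smult_closed[OF u \<theta>M(2)[OF \<theta>M(1)[OF that]]] by simp
    show "?u \<odot>\<^bsub>M\<^esub> \<theta>' (\<theta> (m \<oplus>\<^bsub>M\<^esub> n)) = ?u \<odot>\<^bsub>M\<^esub> \<theta>' (\<theta> m) \<oplus>\<^bsub>cj v'' M\<^esub> ?u \<odot>\<^bsub>M\<^esub> \<theta>' (\<theta> n)"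
      if m: "m \<in> carrier M" "n \<in> carrier M" for m n
      using module_homD(2)[OF \<theta>(1) m] module_homD(2)[OF \<theta>(2) \<theta>M(1)[OF m(1)] \<theta>M(1)[OF m(2)]]
        M.smult_r_distr[OF u \<theta>M(2)[OF \<theta>M(1)[OF m(1)]] \<theta>M(2)[OF \<theta>M(1)[OF m(2)]]] by simp
    fix b m assume b: "b \<in> carrier B" and m: "m \<in> carrier M"
    note bA = BA[OF b]
    have b1: "inv\<^bsub>A\<^esub> v \<cdot> b \<cdot> v \<in> carrier B" (is "?b1 \<in> _") by (rule conj_B(1)[OF C(1) v(1) b])
    have b2: "inv\<^bsub>A\<^esub> v' \<cdot> ?b1 \<cdot> v' \<in> carrier B" (is "?b2 \<in> _") by (rule conj_B(1)[OF C(2) v(2) b1])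
    have b3: "inv\<^bsub>A\<^esub> v'' \<cdot> b \<cdot> v'' \<in> carrier B" (is "?b3 \<in> _") by (rule conj_B(1)[OF CC v(3) b])
    have vb1: "v \<cdot> ?b1 = b \<cdot> v"
      using hu_r_cancel[OF C(1) v(1) A.m_closed[OF bA vA(1)]] A.m_assoc[OF viA(1) bA vA(1)] by simp
    have vb2: "v' \<cdot> ?b2 = ?b1 \<cdot> v'"
      using hu_r_cancel[OF C(2) v(2) A.m_closed[OF BA[OF b1] vA(2)]] A.m_assoc[OF viA(2) BA[OF b1] vA(2)] by simp
    have vvb: "(v \<cdot> v') \<cdot> ?b2 = b \<cdot> (v \<cdot> v')"
      using A.m_assoc[OF vA(1,2) BA[OF b2]] A.m_assoc[OF vA(1) BA[OF b1] vA(2)] A.m_assoc[OF bA vA(1,2)] vb1 vb2 by simp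
    have "?u \<cdot> ?b2 = inv\<^bsub>A\<^esub> v'' \<cdot> (b \<cdot> (v \<cdot> v'))"
      using A.m_assoc[OF viA(3) A.m_closed[OF vA(1,2)] BA[OF b2]] vvb by simp
    also have "\<dots> = ?b3 \<cdot> ?u"
      using A.m_assoc[OF A.m_closed[OF viA(3) bA] vA(3) BA[OF u]] hu_r_cancel[OF CC v(3) A.m_closed[OF vA(1,2)]]
        A.m_assoc[OF viA(3) bA A.m_closed[OF vA(1,2)]] by simp
    finally have eq: "?u \<otimes>\<^bsub>B\<^esub> ?b2 = ?b3 \<otimes>\<^bsub>B\<^esub> ?u" unfolding B_mult[OF u b2] B_mult[OF b3 u] .
    have "\<theta>' (\<theta> (b \<odot>\<^bsub>M\<^esub> m)) = ?b2 \<odot>\<^bsub>M\<^esub> \<theta>' (\<theta> m)"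
      using module_homD(3)[OF \<theta>(1) b m] module_homD(3)[OF \<theta>(2) b1 \<theta>M(1)[OF m]] by simp
    then have "?u \<odot>\<^bsub>M\<^esub> \<theta>' (\<theta> (b \<odot>\<^bsub>M\<^esub> m)) = (?u \<otimes>\<^bsub>B\<^esub> ?b2) \<odot>\<^bsub>M\<^esub> \<theta>' (\<theta> m)"
      using M.smult_assoc[OF u b2 \<theta>M(2)[OF \<theta>M(1)[OF m]]] by simp
    also have "\<dots> = ?b3 \<odot>\<^bsub>M\<^esub> (?u \<odot>\<^bsub>M\<^esub> \<theta>' (\<theta> m))"
      unfolding eq by (rule M.smult_assoc[OF b3 u \<theta>M(2)[OF \<theta>M(1)[OF m]]])
    finally show "?u \<odot>\<^bsub>M\<^esub> \<theta>' (\<theta> (b \<odot>\<^bsub>M\<^esub> m)) = b \<odot>\<^bsub>cj v'' M\<^esub> (?u \<odot>\<^bsub>M\<^esub> \<theta>' (\<theta> m))" by simp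
  qed
qed

text \<open>The isomorphisms exist by definition of the stabiliser; \<open>\<omega> C C'\<close> is
  the scalar that Schur's lemma puts between the map of \<open>transition_hom\<close> and
  \<open>\<theta> (C \<star> C')\<close>.\<close>

lemma (in mackey) mackey_family_exists: "\<exists>v \<theta> \<omega>. mackey_family G \<alpha> N M v \<theta> \<omega>"
proof -
  have "\<exists>\<theta>. \<theta> \<in> LinearCombinations.module_hom B M (cj (homu C) M) \<and> bij_betw \<theta> (carrier M) (carrier M)"
    if C: "C \<in> Inertia" for C
    using Inertia_iff[OF Inertia_\<Gamma>[OF C] homu[OF Inertia_\<Gamma>[OF C]]] C unfolding module_isomorphic_def by auto
  then obtain \<theta> where \<theta>: "\<And>C. C \<in> Inertia ==> \<theta> C \<in> LinearCombinations.module_hom B M (cj (homu C) M)"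
    "\<And>C. C \<in> Inertia ==> bij_betw (\<theta> C) (carrier M) (carrier M)" by metis
  have "\<exists>c. \<forall>m\<in>carrier M. (inv\<^bsub>A\<^esub> (homu (C \<star> C')) \<cdot> (homu C \<cdot> homu C')) \<odot>\<^bsub>M\<^esub> \<theta> C' (\<theta> C m)
        = cscale B M c (\<theta> (C \<star> C') m)" if C: "C \<in> Inertia" "C' \<in> Inertia" for C C'
  proof -
    note g = Inertia_\<Gamma>[OF C(1)] Inertia_\<Gamma>[OF C(2)] and CC = Inertia_mult[OF C]
    show ?thesis
      by (rule hom_scalar[OF Inertia_\<Gamma>[OF CC] homu[OF Inertia_\<Gamma>[OF CC]] \<theta>[OF CC]
          transition_hom[OF g homu[OF g(1)] homu[OF g(2)] homu[OF Inertia_\<Gamma>[OF CC]] \<theta>(1)[OF C(1)] \<theta>(1)[OF C(2)]]])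
  qed
  then obtain \<omega> where \<omega>: "\<And>C C' m. C \<in> Inertia ==> C' \<in> Inertia ==> m \<in> carrier M ==>
      (inv\<^bsub>A\<^esub> (homu (C \<star> C')) \<cdot> (homu C \<cdot> homu C')) \<odot>\<^bsub>M\<^esub> \<theta> C' (\<theta> C m)
        = cscale B M (\<omega> C C') (\<theta> (C \<star> C') m)" by metis
  have "mackey_family G \<alpha> N M homu \<theta> \<omega>"
    by (intro mackey_family.intro mackey_axioms mackey_family_axioms.intro homu Inertia_\<Gamma> \<theta> \<omega>)
  then show ?thesis by blast
qed

section \<open>The homogeneous endomorphisms and their products\<close>

context mackey_family
begin

lemma \<theta>_closed [simp]: "C \<in> Inertia ==> m \<in> carrier M ==> \<theta> C m \<in> carrier M"
  using module_homD(1)[OF \<theta>, of C m] by simp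

lemma \<theta>_add: "C \<in> Inertia ==> m \<in> carrier M ==> n \<in> carrier M ==> \<theta> C (m \<oplus>\<^bsub>M\<^esub> n) = \<theta> C m \<oplus>\<^bsub>M\<^esub> \<theta> C n"
  using module_homD(2)[OF \<theta>, of C m n] by simp

lemma \<theta>_smult: "C \<in> Inertia ==> b \<in> carrier B ==> m \<in> carrier M ==>
    \<theta> C (b \<odot>\<^bsub>M\<^esub> m) = (inv\<^bsub>A\<^esub> (v C) \<cdot> b \<cdot> v C) \<odot>\<^bsub>M\<^esub> \<theta> C m"
  using module_homD(3)[OF \<theta>, of C b m] by simp

lemma \<theta>_zero: "C \<in> Inertia ==> \<theta> C \<zero>\<^bsub>M\<^esub> = \<zero>\<^bsub>M\<^esub>"
  by (rule additive_zero[OF M.M.abelian_group_axioms M.M.abelian_group_axioms]) (auto simp: \<theta>_add)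

lemma \<theta>_nonzero: "C \<in> Inertia ==> m \<in> carrier M ==> m \<noteq> \<zero>\<^bsub>M\<^esub> ==> \<theta> C m \<noteq> \<zero>\<^bsub>M\<^esub>"
  using \<theta>_bij[of C] \<theta>_zero[of C] unfolding bij_betw_def inj_on_def by (metis M.M.zero_closed)

lemma vA: "C \<in> Inertia ==> v C \<in> carrier A"
  by (rule hu_A[OF Inertia_\<Gamma> v])

text \<open>Multiplying the left factor by \<open>v C\<close> from the right is in general not
  balanced over \<open>B\<close>; applying the intertwiner \<open>\<theta> C\<close> to the right
  factor repairs this. The restriction to the carrier makes the map an element of the endomorphism
  algebra, whose elements are extensional.\<close>

definition phi where
  "phi C = restrict (SOME h. h \<in> hom (add_monoid W) (add_monoid W) \<and>
     (\<forall>x\<in>carrier A. \<forall>m\<in>carrier M. h (tens x m) = tens (x \<cdot> v C) (\<theta> C m))) (carrier W)"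

lemma phi_exists:
  assumes C: "C \<in> Inertia"
  shows "phi C \<in> hom (add_monoid W) (add_monoid W)"
    and phi_tens: "x \<in> carrier A ==> m \<in> carrier M ==> phi C (tens x m) = tens (x \<cdot> v C) (\<theta> C m)"
    and "phi C \<in> extensional (carrier W)"
proof -
  let ?P = "\<lambda>h. h \<in> hom (add_monoid W) (add_monoid W) \<and>
     (\<forall>x\<in>carrier A. \<forall>m\<in>carrier M. h (tens x m) = tens (x \<cdot> v C) (\<theta> C m))"
  note CG = Inertia_\<Gamma>[OF C]
  have "\<exists>h. ?P h"
  proof (rule T.tens_universal[of W "\<lambda>x m. tens (x \<cdot> v C) (\<theta> C m)"])
    fix x r m assume h: "x \<in> carrier A" "r \<in> carrier B" "m \<in> carrier M"
    note rA = BA[OF h(2)] and cB = conj_B(1)[OF CG v[OF C] h(2)]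
    have "x \<cdot> r \<cdot> v C = (x \<cdot> v C) \<cdot> (inv\<^bsub>A\<^esub> (v C) \<cdot> r \<cdot> v C)"
      using A.m_assoc[OF h(1) rA vA[OF C]] A.m_assoc[OF h(1) vA[OF C] BA[OF cB]]
        A.m_assoc[OF hu_inv_A[OF CG v[OF C]] rA vA[OF C]] hu_r_cancel[OF CG v[OF C] A.m_closed[OF rA vA[OF C]]] by simp
    then show "tens (x \<cdot> r \<cdot> v C) (\<theta> C m) = tens (x \<cdot> v C) (\<theta> C (r \<odot>\<^bsub>M\<^esub> m))"
      using T.tens_balanced[OF A.m_closed[OF h(1) vA[OF C]] cB \<theta>_closed[OF C h(3)]] \<theta>_smult[OF C h(2,3)] by simp
  qed (use C vA in \<open>auto simp: T.abelian_group_W T.tens_closed A.l_distr T.tens_add_left \<theta>_add T.tens_add_right\<close>)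
  from someI_ex[OF this] have P: "?P (SOME h. ?P h)" .
  show "phi C \<in> hom (add_monoid W) (add_monoid W)"
    using P unfolding phi_def hom_def by (auto simp: Pi_iff)
  show "phi C (tens x m) = tens (x \<cdot> v C) (\<theta> C m)" if "x \<in> carrier A" "m \<in> carrier M"
    using P that T.tens_closed[OF that] unfolding phi_def by simp
  show "phi C \<in> extensional (carrier W)" unfolding phi_def by (rule restrict_extensional)
qed

lemma phi_closed [simp]: "C \<in> Inertia ==> w \<in> carrier W ==> phi C w \<in> carrier W"
  using hom_in_carrier[OF phi_exists(1), of C w] by simp

lemma phi_hom:
  assumes C: "C \<in> Inertia" shows "phi C \<in> LinearCombinations.module_hom A W W"
proof (rule module_homI)
  show add: "phi C (x \<oplus>\<^bsub>W\<^esub> y) = phi C x \<oplus>\<^bsub>W\<^esub> phi C y" if "x \<in> carrier W" "y \<in> carrier W" for x y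
    using hom_mult[OF phi_exists(1)[OF C], of x y] that by simp
  have zero: "phi C \<zero>\<^bsub>W\<^esub> = \<zero>\<^bsub>W\<^esub>"
    by (rule additive_zero[OF T.abelian_group_W T.abelian_group_W]) (use C add in auto)
  fix a w assume a: "a \<in> carrier A" and w: "w \<in> carrier W"
  from w show "phi C (a \<odot>\<^bsub>W\<^esub> w) = a \<odot>\<^bsub>W\<^esub> phi C w"
  proof (induction rule: T.tens_induct)
    case zero
    show ?case using zero a \<open>phi C \<zero>\<^bsub>W\<^esub> = \<zero>\<^bsub>W\<^esub>\<close> by simp
  next
    case (add x y)
    then show ?case
      using \<open>\<And>x y. x \<in> carrier W ==> y \<in> carrier W ==> phi C (x \<oplus>\<^bsub>W\<^esub> y) = phi C x \<oplus>\<^bsub>W\<^esub> phi C y\<close>[of "a \<odot>\<^bsub>W\<^esub> x" "a \<odot>\<^bsub>W\<^esub> y"]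
        \<open>\<And>x y. x \<in> carrier W ==> y \<in> carrier W ==> phi C (x \<oplus>\<^bsub>W\<^esub> y) = phi C x \<oplus>\<^bsub>W\<^esub> phi C y\<close>[of x y]
        W.smult_closed[OF a] C W.smult_r_distr[OF a] by simp
  next
    case (tens x m)
    then show ?case
      using T.smult_tens[OF a tens] phi_tens[OF C tens] phi_tens[OF C A.m_closed[OF a tens(1)] tens(2)]
        T.smult_tens[OF a A.m_closed[OF tens(1) vA[OF C]] \<theta>_closed[OF C tens(2)]] A.m_assoc[OF a tens(1) vA[OF C]] by simp
  qed
qed (use C in simp)

lemmas phi_add = module_homD(2)[OF phi_hom] and phi_smult = module_homD(3)[OF phi_hom]

lemma phi_zero: "C \<in> Inertia ==> phi C \<zero>\<^bsub>W\<^esub> = \<zero>\<^bsub>W\<^esub>"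
  by (rule module_hom_zero[OF W.left_module_axioms W.left_module_axioms phi_hom])

lemma phi_cscale: "C \<in> Inertia ==> w \<in> carrier W ==> phi C (cscale A W c w) = cscale A W c (phi C w)"
  by (rule module_hom_cscale[OF Alg.complex_algebra_axioms phi_hom])

text \<open>In coordinates \<open>phi C\<close> is \<open>\<theta> C\<close>, moving the degree of
  \<open>u\<close> to that of \<open>u \<cdot> v C\<close>.\<close>

lemma pr_phi:
  assumes C: "C \<in> Inertia" and C': "C' \<in> carrier \<Gamma>" and u: "u \<in> hu C'" and w: "w \<in> carrier W"
  shows "pr (u \<cdot> v C) (phi C w) = \<theta> C (pr u w)"
proof -
  note CG = Inertia_\<Gamma>[OF C] note CC = \<Gamma>.m_closed[OF C' CG] and uv = hu_mult[OF C' CG u v[OF C]]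
  show ?thesis
    using w
  proof (induction rule: T.tens_induct)
    case zero
    show ?case using phi_zero[OF C] pr_zero[OF CC uv] pr_zero[OF C' u] \<theta>_zero[OF C] by simp
  next
    case (add x y)
    then show ?case
      using phi_add[OF C add(1,2)] pr_add[OF CC uv phi_closed[OF C add(1)] phi_closed[OF C add(2)]]
        pr_add[OF C' u add(1,2)] \<theta>_add[OF C pr_closed[OF C' u add(1)] pr_closed[OF C' u add(2)]] by simp
  next
    case (tens x m)
    note viA = hu_inv_A[OF CG v[OF C]] and uiA = hu_inv_A[OF C' u]
    have y: "inv\<^bsub>A\<^esub> u \<cdot> x \<in> carrier A" using uiA tens(1) by simp
    have "inv\<^bsub>A\<^esub> (u \<cdot> v C) \<cdot> (x \<cdot> v C) = inv\<^bsub>A\<^esub> (v C) \<cdot> (inv\<^bsub>A\<^esub> u \<cdot> x) \<cdot> v C"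
      unfolding hu_inv_mult[OF C' CG u v[OF C]] using viA uiA tens(1) vA[OF C] by (simp add: A.m_assoc)
    then have "pr (u \<cdot> v C) (phi C (tens x m)) = restr N (inv\<^bsub>A\<^esub> (v C) \<cdot> (inv\<^bsub>A\<^esub> u \<cdot> x) \<cdot> v C) \<odot>\<^bsub>M\<^esub> \<theta> C m"
      using phi_tens[OF C tens] pr_exists(2)[OF CC uv A.m_closed[OF tens(1) vA[OF C]] \<theta>_closed[OF C tens(2)]] by simp
    also have "\<dots> = \<theta> C (restr N (inv\<^bsub>A\<^esub> u \<cdot> x) \<odot>\<^bsub>M\<^esub> m)"
      unfolding restr_conj[OF CG v[OF C] y] \<theta>_smult[OF C restr_N_B tens(2)] ..
    finally show ?case unfolding pr_exists(2)[OF C' u tens] .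
  qed
qed

lemma phi_comp:
  assumes C: "C \<in> Inertia" and C': "C' \<in> carrier \<Gamma>" and w: "w \<in> comp C'"
  shows "phi C w \<in> comp (C' \<star> C)"
proof -
  note CG = Inertia_\<Gamma>[OF C]
  obtain m where m: "w = tens (homu C') m" "m \<in> carrier M" using w unfolding comp_eq[OF C' homu[OF C']] by blast
  show ?thesis
    unfolding comp_eq[OF \<Gamma>.m_closed[OF C' CG] hu_mult[OF C' CG homu[OF C'] v[OF C]]] m(1)
      phi_tens[OF C hu_A[OF C' homu[OF C']] m(2)] using \<theta>_closed[OF C m(2)] by blast
qed

lemma phi_one: "C \<in> Inertia ==> m \<in> carrier M ==> phi C (tens \<one>\<^bsub>A\<^esub> m) = tens (v C) (\<theta> C m)"
  using phi_tens[of C "\<one>\<^bsub>A\<^esub>" m] vA[of C] by simp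

lemma cscale_hom:
  assumes "f \<in> LinearCombinations.module_hom A W W"
  shows "(\<lambda>w. cscale A W c (f w)) \<in> LinearCombinations.module_hom A W W"
  using module_homD[OF assms] by (intro module_homI) (simp_all add: W.cscale_add W.smult_cscale)

text \<open>Compared on the tensors with left factor \<open>\<one>\<close>: there both sides become
  tensors with left factor \<open>v (C \<star> C')\<close>, and what remains is the defining
  property of \<open>\<omega>\<close>.\<close>

lemma phi_mult:
  assumes C: "C \<in> Inertia" "C' \<in> Inertia" and w: "w \<in> carrier W"
  shows "phi C' (phi C w) = cscale A W (\<omega> C C') (phi (C \<star> C') w)"
proof -
  note CC = Inertia_mult[OF C] note g = Inertia_\<Gamma>[OF C(1)] Inertia_\<Gamma>[OF C(2)] Inertia_\<Gamma>[OF CC]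
  have "(phi C' \<circ> phi C) w = cscale A W (\<omega> C C') (phi (C \<star> C') w)"
  proof (rule W_hom_eqI[OF module_hom_comp[OF phi_hom[OF C(1)] phi_hom[OF C(2)]] cscale_hom[OF phi_hom[OF CC]] _ w])
    fix m assume m: "m \<in> carrier M"
    have \<theta>m: "\<theta> C' (\<theta> C m) \<in> carrier M" using C m by simp
    have D: "v C \<cdot> v C' \<in> D (C \<star> C')" by (rule hu_D[OF g(3) hu_mult[OF g(1,2) v[OF C(1)] v[OF C(2)]]])
    have "(phi C' \<circ> phi C) (tens \<one>\<^bsub>A\<^esub> m) = tens (v C \<cdot> v C') (\<theta> C' (\<theta> C m))"
      using phi_one[OF C(1) m] phi_tens[OF C(2) vA[OF C(1)] \<theta>_closed[OF C(1) m]] by simp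
    also have "\<dots> = tens (v (C \<star> C')) (cscale B M (\<omega> C C') (\<theta> (C \<star> C') m))"
      unfolding tens_shift[OF g(3) v[OF CC] D \<theta>m] \<theta>_\<omega>[OF C m] ..
    also have "\<dots> = cscale A W (\<omega> C C') (phi (C \<star> C') (tens \<one>\<^bsub>A\<^esub> m))"
      unfolding phi_one[OF CC m] by (rule tens_cscale[OF vA[OF CC] \<theta>_closed[OF CC m]])
    finally show "(phi C' \<circ> phi C) (tens \<one>\<^bsub>A\<^esub> m) = cscale A W (\<omega> C C') (phi (C \<star> C') (tens \<one>\<^bsub>A\<^esub> m))" .
  qed
  then show ?thesis by simp
qed

lemma pr_v_phi_one: "C \<in> Inertia ==> m \<in> carrier M ==> pr (v C) (phi C (tens \<one>\<^bsub>A\<^esub> m)) = \<theta> C m"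
  using phi_one[of C m] pr_tens_same[OF Inertia_\<Gamma> v, of C "\<theta> C m"] by simp

lemma one_tens_W: "m \<in> carrier M ==> tens \<one>\<^bsub>A\<^esub> m \<in> carrier W"
  by (rule T.tens_closed[OF A.one_closed])

lemma nonzero_M: obtains m where "m \<in> carrier M" "m \<noteq> \<zero>\<^bsub>M\<^esub>"
  using irreducible_nonzero[OF irr] by auto

lemma phi_cancel:
  assumes C: "C \<in> Inertia" and eq: "\<And>w. w \<in> carrier W ==> cscale A W a (phi C w) = cscale A W b (phi C w)"
  shows "a = b"
proof -
  obtain m where m: "m \<in> carrier M" "m \<noteq> \<zero>\<^bsub>M\<^esub>" by (rule nonzero_M)
  note w = one_tens_W[OF m(1)] and CG = Inertia_\<Gamma>[OF C]
  have "cscale B M a (\<theta> C m) = cscale B M b (\<theta> C m)"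
    using eq[OF w] pr_cscale[OF CG v[OF C] phi_closed[OF C w], of a]
      pr_cscale[OF CG v[OF C] phi_closed[OF C w], of b] pr_v_phi_one[OF C m(1)] by simp
  then show ?thesis by (rule M.cscale_cancel[OF \<theta>_closed[OF C m(1)] \<theta>_nonzero[OF C m]])
qed

text \<open>Nonvanishing holds because a composite of the bijections \<open>\<theta>\<close> is
  injective. The identity is associativity of composition, the scalars being read off from a nonzero
  endomorphism by \<open>phi_cancel\<close>.\<close>

lemma \<omega>_cocycle: "\<omega> \<in> cocycles2 IG"
  unfolding cocycles2_def
proof (intro CollectI conjI ballI)
  fix C C' assume "C \<in> carrier IG" "C' \<in> carrier IG"
  then have C: "C \<in> Inertia" "C' \<in> Inertia" by simp_all
  obtain m where m: "m \<in> carrier M" "m \<noteq> \<zero>\<^bsub>M\<^esub>" by (rule nonzero_M)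
  note w = one_tens_W[OF m(1)] and g = Inertia_\<Gamma>[OF C(1)] Inertia_\<Gamma>[OF C(2)]
  have "pr (v C \<cdot> v C') (phi C' (phi C (tens \<one>\<^bsub>A\<^esub> m))) = \<theta> C' (\<theta> C m)"
    using pr_phi[OF C(2) g(1) v[OF C(1)] phi_closed[OF C(1) w]] pr_v_phi_one[OF C(1) m(1)] by simp
  moreover have "\<theta> C' (\<theta> C m) \<noteq> \<zero>\<^bsub>M\<^esub>"
    by (rule \<theta>_nonzero[OF C(2) \<theta>_closed[OF C(1) m(1)] \<theta>_nonzero[OF C(1) m]])
  ultimately show "\<omega> C C' \<noteq> 0"
    using phi_mult[OF C w] phi_closed[OF Inertia_mult[OF C] w]
      pr_zero[OF \<Gamma>.m_closed[OF g] hu_mult[OF g v[OF C(1)] v[OF C(2)]]] by auto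
  fix C'' assume "C'' \<in> carrier IG"
  then have C'': "C'' \<in> Inertia" by simp
  note CC = Inertia_mult[OF C] Inertia_mult[OF C(2) C'']
  have ass: "C \<star> C' \<star> C'' = C \<star> (C' \<star> C'')"
    by (rule \<Gamma>.m_assoc[OF g Inertia_\<Gamma>[OF C'']])
  have "cscale A W (\<omega> C C' * \<omega> (C \<star> C') C'') (phi (C \<star> (C' \<star> C'')) w)
      = cscale A W (\<omega> C (C' \<star> C'') * \<omega> C' C'') (phi (C \<star> (C' \<star> C'')) w)"
    if w: "w \<in> carrier W" for w
  proof -
    note p = phi_closed[OF Inertia_mult[OF C(1) CC(2)] w]
    have "phi C'' (phi C' (phi C w)) = cscale A W (\<omega> C C' * \<omega> (C \<star> C') C'') (phi (C \<star> (C' \<star> C'')) w)"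
      unfolding phi_mult[OF C w] phi_cscale[OF C'' phi_closed[OF CC(1) w]] phi_mult[OF CC(1) C'' w] ass
      by (rule W.cscale_cscale[OF p])
    moreover have "phi C'' (phi C' (phi C w)) = cscale A W (\<omega> C' C'' * \<omega> C (C' \<star> C'')) (phi (C \<star> (C' \<star> C'')) w)"
      unfolding phi_mult[OF C(2) C'' phi_closed[OF C(1) w]] phi_mult[OF C(1) CC(2) w]
      by (rule W.cscale_cscale[OF p])
    ultimately show ?thesis by (simp add: mult.commute)
  qed
  from phi_cancel[OF Inertia_mult[OF C(1) CC(2)] this]
  show "\<omega> C C' * \<omega> (C \<otimes>\<^bsub>IG\<^esub> C') C'' = \<omega> C (C' \<otimes>\<^bsub>IG\<^esub> C'') * \<omega> C' C''" by simp
qed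

end

section \<open>The obstruction class\<close>

context mackey
begin

lemma E_simps:
  "\<phi> \<in> carrier E \<longleftrightarrow> \<phi> \<in> LinearCombinations.module_hom A W W \<and> \<phi> \<in> extensional (carrier W)"
  "\<phi> \<otimes>\<^bsub>E\<^esub> \<psi> = (\<lambda>w\<in>carrier W. \<psi> (\<phi> w))" "\<one>\<^bsub>E\<^esub> = (\<lambda>w\<in>carrier W. w)" "\<zero>\<^bsub>E\<^esub> = (\<lambda>w\<in>carrier W. \<zero>\<^bsub>W\<^esub>)"
  "\<phi> \<oplus>\<^bsub>E\<^esub> \<psi> = (\<lambda>w\<in>carrier W. \<phi> w \<oplus>\<^bsub>W\<^esub> \<psi> w)" "c \<odot>\<^bsub>E\<^esub> \<phi> = (\<lambda>w\<in>carrier W. cscale A W c (\<phi> w))"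
  by (auto simp: right_endomorphism_algebra_def cscale_def)

end

context mackey_family
begin

abbreviation X where "X \<equiv> twisted_subgroup_algebra \<Gamma> \<omega> Inertia"

sublocale X: twisted IG \<omega>
  by (intro twisted.intro group_IG twisted_axioms.intro \<omega>_cocycle) (simp add: finite_Inertia)

definition Phi where
  "Phi f = (\<lambda>w\<in>carrier W. finsum W (\<lambda>C. cscale A W (f C) (phi C w)) Inertia)"

lemma Phi_apply: "w \<in> carrier W ==> Phi f w = finsum W (\<lambda>C. cscale A W (f C) (phi C w)) Inertia"
  by (simp add: Phi_def)

lemma term_closed [simp]: "C \<in> Inertia ==> w \<in> carrier W ==> cscale A W c (phi C w) \<in> carrier W"
  by simp

lemma Phi_closed [simp]: "w \<in> carrier W ==> Phi f w \<in> carrier W"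
  unfolding Phi_apply by (rule T.W.finsum_closed) simp

lemma Phi_hom: "Phi f \<in> LinearCombinations.module_hom A W W"
proof (rule module_homI)
  fix x y assume w: "x \<in> carrier W" "y \<in> carrier W"
  have "finsum W (\<lambda>C. cscale A W (f C) (phi C (x \<oplus>\<^bsub>W\<^esub> y))) Inertia
      = finsum W (\<lambda>C. cscale A W (f C) (phi C x) \<oplus>\<^bsub>W\<^esub> cscale A W (f C) (phi C y)) Inertia"
    by (rule T.W.finsum_cong'[OF refl Pi_I]) (use w in \<open>simp_all add: phi_add W.cscale_add\<close>)
  also have "\<dots> = finsum W (\<lambda>C. cscale A W (f C) (phi C x)) Inertia \<oplus>\<^bsub>W\<^esub> finsum W (\<lambda>C. cscale A W (f C) (phi C y)) Inertia"
    by (rule T.W.finsum_addf) (use w in auto)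
  finally show "Phi f (x \<oplus>\<^bsub>W\<^esub> y) = Phi f x \<oplus>\<^bsub>W\<^esub> Phi f y" using w by (simp add: Phi_apply)
next
  fix a w assume a: "a \<in> carrier A" and w: "w \<in> carrier W"
  have "a \<odot>\<^bsub>W\<^esub> finsum W (\<lambda>C. cscale A W (f C) (phi C w)) Inertia
      = finsum W (\<lambda>C. a \<odot>\<^bsub>W\<^esub> cscale A W (f C) (phi C w)) Inertia"
    by (rule W.smult_finsum_right[OF _ a]) (use w in simp)
  also have "\<dots> = finsum W (\<lambda>C. cscale A W (f C) (phi C (a \<odot>\<^bsub>W\<^esub> w))) Inertia"
    by (rule T.W.finsum_cong'[OF refl Pi_I]) (use a w W.smult_closed in \<open>simp_all add: phi_smult W.smult_cscale\<close>)
  finally show "Phi f (a \<odot>\<^bsub>W\<^esub> w) = a \<odot>\<^bsub>W\<^esub> Phi f w" using a w W.smult_closed by (simp add: Phi_apply)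
qed simp

lemma Phi_E: "Phi f \<in> carrier E"
  unfolding E_simps using Phi_hom by (simp add: Phi_def)

lemma Phi_add:
  assumes w: "w \<in> carrier W" shows "Phi (f \<oplus>\<^bsub>X\<^esub> h) w = Phi f w \<oplus>\<^bsub>W\<^esub> Phi h w"
proof -
  have "finsum W (\<lambda>C. cscale A W ((f \<oplus>\<^bsub>X\<^esub> h) C) (phi C w)) Inertia
      = finsum W (\<lambda>C. cscale A W (f C) (phi C w) \<oplus>\<^bsub>W\<^esub> cscale A W (h C) (phi C w)) Inertia"
    by (rule T.W.finsum_cong'[OF refl Pi_I]) (use w in \<open>simp_all add: TGA_simps W.cscale_add_left\<close>)
  also have "\<dots> = Phi f w \<oplus>\<^bsub>W\<^esub> Phi h w"
    unfolding Phi_apply[OF w] by (rule T.W.finsum_addf) (use w in auto)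
  finally show ?thesis unfolding Phi_apply[OF w] .
qed

lemma Phi_smult:
  assumes w: "w \<in> carrier W" shows "Phi (c \<odot>\<^bsub>X\<^esub> f) w = cscale A W c (Phi f w)"
proof -
  have "cscale A W c (Phi f w) = finsum W (\<lambda>C. cscale A W c (cscale A W (f C) (phi C w))) Inertia"
    unfolding Phi_apply[OF w] by (rule W.cscale_finsum) (use w in simp)
  also have "\<dots> = finsum W (\<lambda>C. cscale A W ((c \<odot>\<^bsub>X\<^esub> f) C) (phi C w)) Inertia"
    by (rule T.W.finsum_cong'[OF refl Pi_I]) (use w in \<open>simp_all add: TGA_simps W.cscale_cscale\<close>)
  finally show ?thesis unfolding Phi_apply[OF w] by simp
qed

lemma Phi_basis:
  assumes C: "C \<in> Inertia" and w: "w \<in> carrier W"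
  shows "Phi (c \<odot>\<^bsub>X\<^esub> basis_elt C) w = cscale A W c (phi C w)"
proof -
  have "finsum W (\<lambda>C'. cscale A W ((c \<odot>\<^bsub>X\<^esub> basis_elt C) C') (phi C' w)) Inertia
      = cscale A W ((c \<odot>\<^bsub>X\<^esub> basis_elt C) C) (phi C w)"
    by (rule finsum_single[OF T.abelian_group_W finite_Inertia C])
      (use C w in \<open>simp_all add: TGA_simps basis_elt_def\<close>)
  then show ?thesis unfolding Phi_apply[OF w] by (simp add: TGA_simps basis_elt_def)
qed

lemma Phi_zero: "w \<in> carrier W ==> Phi \<zero>\<^bsub>X\<^esub> w = \<zero>\<^bsub>W\<^esub>"
  using Phi_basis[OF N_Inertia, of w 0] N_Inertia by (simp add: TGA_simps)

lemma Phi_at_zero: "Phi f \<zero>\<^bsub>W\<^esub> = \<zero>\<^bsub>W\<^esub>"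
  by (rule module_hom_zero[OF W.left_module_axioms W.left_module_axioms Phi_hom])

lemmas Phi_plus = module_homD(2)[OF Phi_hom] and Phi_cscale = module_hom_cscale[OF Alg.complex_algebra_axioms Phi_hom]

lemma X_basis_mult:
  assumes C: "C \<in> Inertia" "C' \<in> Inertia"
  shows "(c \<odot>\<^bsub>X\<^esub> basis_elt C) \<otimes>\<^bsub>X\<^esub> (d \<odot>\<^bsub>X\<^esub> basis_elt C') = (c * d * \<omega> C C') \<odot>\<^bsub>X\<^esub> basis_elt (C \<star> C')"
proof -
  have b: "basis_elt C \<in> carrier X" "basis_elt C' \<in> carrier X" using C by (simp_all add: X.basis_elt_closed)
  have "(c \<odot>\<^bsub>X\<^esub> basis_elt C) \<otimes>\<^bsub>X\<^esub> (d \<odot>\<^bsub>X\<^esub> basis_elt C') = c \<odot>\<^bsub>X\<^esub> (d \<odot>\<^bsub>X\<^esub> (basis_elt C \<otimes>\<^bsub>X\<^esub> basis_elt C'))"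
    using X.Alg.smult_mult_left[OF b(1) X.Alg.smult_closed_complex[OF b(2)]] X.Alg.smult_mult_right[OF b] by simp
  also have "basis_elt C \<otimes>\<^bsub>X\<^esub> basis_elt C' = (\<lambda>x. \<omega> C C' * basis_elt (C \<star> C') x)"
    using X.basis_mult_basis[of C C'] C by simp
  finally show ?thesis by (simp add: TGA_simps mult_ac)
qed

text \<open>By bilinearity a matter of basis elements, that is of \<open>phi_mult\<close>. The
  factor \<open>f\<close> acts first, as for endomorphisms written on the right.\<close>

lemma Phi_mult:
  assumes f: "f \<in> carrier X" and h: "h \<in> carrier X" and w: "w \<in> carrier W"
  shows "Phi (f \<otimes>\<^bsub>X\<^esub> h) w = Phi h (Phi f w)"
  using f
proof (induction rule: X.A_induct)
  case zero
  show ?case using X.A.l_null[OF h] Phi_zero[OF w] Phi_at_zero by simp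
next
  case (add x y)
  then show ?case
    using X.A.l_distr[OF add(1,2) h] Phi_add[OF w] Phi_plus[OF Phi_closed[OF w] Phi_closed[OF w]] by simp
next
  case (basis C c)
  then have C: "C \<in> Inertia" by simp
  have b: "c \<odot>\<^bsub>X\<^esub> basis_elt C \<in> carrier X"
    using X.Alg.smult_closed_complex[OF X.basis_elt_closed[OF basis]] by simp
  show ?case
    using h
  proof (induction rule: X.A_induct)
    case zero
    show ?case using X.A.r_null[OF b] Phi_zero w by simp
  next
    case (add x y)
    then show ?case
      using X.A.r_distr[OF add(1,2) b] Phi_add[OF w] Phi_add[OF Phi_closed[OF w]] by simp
  next
    case (basis C' d)
    then have C': "C' \<in> Inertia" by simp
    note p = phi_closed[OF C w] and CC = Inertia_mult[OF C C']
    show ?case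
      unfolding X_basis_mult[OF C C'] Phi_basis[OF CC w] Phi_basis[OF C w] Phi_basis[OF C' W.cscale_closed[OF p]]
        phi_cscale[OF C' p] phi_mult[OF C C' w]
      using phi_closed[OF CC w] by (simp add: W.cscale_cscale mult_ac)
  qed
qed

text \<open>Singles out the coefficient \<open>f C\<close>, as the other terms lie in other degrees.
  Injectivity of \<open>Phi\<close> and the comparison of the gradings rest on it.\<close>

lemma Phi_pr:
  assumes C: "C \<in> Inertia" and m: "m \<in> carrier M"
  shows "pr (v C) (Phi f (tens \<one>\<^bsub>A\<^esub> m)) = cscale B M (f C) (\<theta> C m)"
proof -
  note w = one_tens_W[OF m] and g = Inertia_\<Gamma>[OF C]
  have "pr (v C) (Phi f (tens \<one>\<^bsub>A\<^esub> m)) = finsum M (\<lambda>C'. pr (v C) (cscale A W (f C') (phi C' (tens \<one>\<^bsub>A\<^esub> m)))) Inertia"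
    unfolding Phi_apply[OF w] by (rule pr_finsum[OF g v[OF C]]) (use w in simp)
  also have "\<dots> = pr (v C) (cscale A W (f C) (phi C (tens \<one>\<^bsub>A\<^esub> m)))"
  proof (rule finsum_single[OF M.M.abelian_group_axioms finite_Inertia C])
    show "pr (v C) (cscale A W (f C) (phi C (tens \<one>\<^bsub>A\<^esub> m))) \<in> carrier M"
      by (rule pr_closed[OF g v[OF C]]) (use C w in simp)
    fix C' assume C': "C' \<in> Inertia" "C' \<noteq> C"
    have "pr (v C) (phi C' (tens \<one>\<^bsub>A\<^esub> m)) = \<zero>\<^bsub>M\<^esub>"
      unfolding phi_one[OF C'(1) m]
      by (rule pr_tens_other[OF g Inertia_\<Gamma>[OF C'(1)] C'(2)[symmetric] v[OF C] v[OF C'(1)] \<theta>_closed[OF C'(1) m]])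
    then show "pr (v C) (cscale A W (f C') (phi C' (tens \<one>\<^bsub>A\<^esub> m))) = \<zero>\<^bsub>M\<^esub>"
      using pr_cscale[OF g v[OF C] phi_closed[OF C'(1) w]] by simp
  qed
  finally show ?thesis
    using pr_cscale[OF g v[OF C] phi_closed[OF C w]] pr_v_phi_one[OF C m] by simp
qed

lemma Phi_pr_other:
  assumes C: "C \<in> carrier \<Gamma>" "C \<notin> Inertia" and u: "u \<in> hu C" and m: "m \<in> carrier M"
  shows "pr u (Phi f (tens \<one>\<^bsub>A\<^esub> m)) = \<zero>\<^bsub>M\<^esub>"
proof -
  note w = one_tens_W[OF m]
  have "pr u (Phi f (tens \<one>\<^bsub>A\<^esub> m)) = finsum M (\<lambda>C'. pr u (cscale A W (f C') (phi C' (tens \<one>\<^bsub>A\<^esub> m)))) Inertia"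
    unfolding Phi_apply[OF w] by (rule pr_finsum[OF C(1) u]) (use w in simp)
  also have "\<dots> = finsum M (\<lambda>C'. \<zero>\<^bsub>M\<^esub>) Inertia"
  proof (rule M.M.finsum_cong'[OF refl Pi_I])
    fix C' assume C': "C' \<in> Inertia"
    then have ne: "C \<noteq> C'" using C(2) by blast
    have "pr u (phi C' (tens \<one>\<^bsub>A\<^esub> m)) = \<zero>\<^bsub>M\<^esub>"
      unfolding phi_one[OF C' m]
      by (rule pr_tens_other[OF C(1) Inertia_\<Gamma>[OF C'] ne u v[OF C'] \<theta>_closed[OF C' m]])
    then show "pr u (cscale A W (f C') (phi C' (tens \<one>\<^bsub>A\<^esub> m))) = \<zero>\<^bsub>M\<^esub>"
      using pr_cscale[OF C(1) u phi_closed[OF C' w]] by simp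
  qed simp
  finally show ?thesis by simp
qed

lemma Phi_inj: "inj_on Phi (carrier X)"
proof (rule inj_onI)
  fix f h assume f: "f \<in> carrier X" and h: "h \<in> carrier X" and eq: "Phi f = Phi h"
  obtain m where m: "m \<in> carrier M" "m \<noteq> \<zero>\<^bsub>M\<^esub>" by (rule nonzero_M)
  have "f C = h C" for C
  proof (cases "C \<in> Inertia")
    case True
    have "cscale B M (f C) (\<theta> C m) = cscale B M (h C) (\<theta> C m)"
      unfolding Phi_pr[OF True m(1), symmetric] eq ..
    then show ?thesis by (rule M.cscale_cancel[OF \<theta>_closed[OF True m(1)] \<theta>_nonzero[OF True m]])
  next
    case False
    then show ?thesis using f h by (simp add: TGA_simps)
  qed
  then show "f = h" by (rule ext)
qed

text \<open>An endomorphism is determined by its coordinates on the copy of \<open>M\<close> in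
  degree \<open>N\<close>. These are homomorphisms from \<open>M\<close> to its conjugates, so by
  Schur's lemma they vanish outside the stabiliser and are multiples of \<open>\<theta> C\<close>
  inside it; the multiples are the coefficients sought.\<close>

lemma Phi_surj:
  assumes \<phi>: "\<phi> \<in> carrier E" shows "\<phi> \<in> Phi ` carrier X"
proof -
  have \<phi>h: "\<phi> \<in> LinearCombinations.module_hom A W W" and \<phi>e: "\<phi> \<in> extensional (carrier W)"
    using \<phi> unfolding E_simps by blast+
  \<comment> \<open>Units in all degrees, agreeing with \<open>v\<close> on the stabiliser, where
    \<open>\<theta> C\<close> maps to the conjugate by \<open>v C\<close>.\<close>
  define u where "u C = (if C \<in> Inertia then v C else homu C)" for C
  have u: "u C \<in> hu C" if "C \<in> carrier \<Gamma>" for C using v homu[OF that] by (simp add: u_def)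
  define h where "h C m = pr (u C) (\<phi> (tens \<one>\<^bsub>A\<^esub> m))" for C m
  have \<phi>W: "\<phi> (tens \<one>\<^bsub>A\<^esub> m) \<in> carrier W" if "m \<in> carrier M" for m
    by (rule module_homD(1)[OF \<phi>h one_tens_W[OF that]])
  have hh: "h C \<in> LinearCombinations.module_hom B M (cj (u C) M)" if C: "C \<in> carrier \<Gamma>" for C
  proof (rule module_homI)
    show "h C m \<in> carrier (cj (u C) M)" if "m \<in> carrier M" for m
      using pr_closed[OF C u[OF C] \<phi>W[OF that]] by (simp add: h_def)
    show "h C (m \<oplus>\<^bsub>M\<^esub> n) = h C m \<oplus>\<^bsub>cj (u C) M\<^esub> h C n" if m: "m \<in> carrier M" "n \<in> carrier M" for m n
      using T.tens_add_right[OF A.one_closed m] module_homD(2)[OF \<phi>h one_tens_W[OF m(1)] one_tens_W[OF m(2)]]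
        pr_add[OF C u[OF C] \<phi>W[OF m(1)] \<phi>W[OF m(2)]] by (simp add: h_def)
    fix b m assume b: "b \<in> carrier B" and m: "m \<in> carrier M"
    note bA = BA[OF b]
    have "tens \<one>\<^bsub>A\<^esub> (b \<odot>\<^bsub>M\<^esub> m) = b \<odot>\<^bsub>W\<^esub> tens \<one>\<^bsub>A\<^esub> m"
      using T.tens_balanced[OF A.one_closed b m] T.smult_tens[OF bA A.one_closed m] bA by simp
    then show "h C (b \<odot>\<^bsub>M\<^esub> m) = b \<odot>\<^bsub>cj (u C) M\<^esub> h C m"
      using module_homD(3)[OF \<phi>h bA one_tens_W[OF m]] pr_B[OF C u[OF C] b \<phi>W[OF m]] by (simp add: h_def)
  qed
  have z: "h C m = \<zero>\<^bsub>M\<^esub>" if C: "C \<in> carrier \<Gamma>" "C \<notin> Inertia" and m: "m \<in> carrier M" for C m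
  proof (rule ccontr)
    assume "h C m \<noteq> \<zero>\<^bsub>M\<^esub>"
    then have "bij_betw (h C) (carrier M) (carrier (cj (u C) M))"
      using schur[OF irr irreducible_cj[OF irr C(1) u[OF C(1)]] hh[OF C(1)] m] by simp
    then show False
      using Inertia_iff[OF C(1) u[OF C(1)]] C(2) hh[OF C(1)] unfolding module_isomorphic_def by blast
  qed
  have "\<exists>c. \<forall>m\<in>carrier M. h C m = cscale B M c (\<theta> C m)" if C: "C \<in> Inertia" for C
    by (rule hom_scalar[OF Inertia_\<Gamma>[OF C] v[OF C] \<theta>[OF C] \<theta>_bij[OF C]])
      (use hh[OF Inertia_\<Gamma>[OF C]] C in \<open>simp add: u_def\<close>)
  then obtain c where c: "\<And>C m. C \<in> Inertia ==> m \<in> carrier M ==> h C m = cscale B M (c C) (\<theta> C m)" by metis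
  define f where "f C = (if C \<in> Inertia then c C else 0)" for C
  have f: "f \<in> carrier X" by (simp add: TGA_simps f_def)
  have "Phi f w = \<phi> w" if w: "w \<in> carrier W" for w
  proof (rule W_hom_eqI[OF Phi_hom \<phi>h _ w])
    fix m assume m: "m \<in> carrier M"
    show "Phi f (tens \<one>\<^bsub>A\<^esub> m) = \<phi> (tens \<one>\<^bsub>A\<^esub> m)"
    proof (rule W_eqI[OF Phi_closed[OF one_tens_W[OF m]] \<phi>W[OF m] u])
      fix C assume C: "C \<in> carrier \<Gamma>"
      show "pr (u C) (Phi f (tens \<one>\<^bsub>A\<^esub> m)) = pr (u C) (\<phi> (tens \<one>\<^bsub>A\<^esub> m))"
      proof (cases "C \<in> Inertia")
        case True
        then show ?thesis using Phi_pr[OF True m, of f] c[OF True m] by (simp add: u_def f_def h_def)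
      next
        case False
        then show ?thesis using Phi_pr_other[OF C False u[OF C] m, of f] z[OF C False m] by (simp add: h_def)
      qed
    qed
  qed
  then have "Phi f = \<phi>"
    by (intro extensionalityI[OF _ \<phi>e]) (auto simp: Phi_def)
  then show ?thesis using f by blast
qed

text \<open>Surjectivity provides some \<open>f\<close> with \<open>Phi f\<close> the identity;
  multiplicativity applied to the product of the unit and \<open>f\<close> then gives the claim
  without evaluating the unnormalised cocycle.\<close>

lemma Phi_one: "w \<in> carrier W ==> Phi \<one>\<^bsub>X\<^esub> w = w"
proof -
  assume w: "w \<in> carrier W"
  have "\<one>\<^bsub>E\<^esub> \<in> carrier E" unfolding E_simps
    by (intro conjI module_homI restrict_extensional) (simp_all add: W.smult_closed)
  then obtain f where f: "f \<in> carrier X" "\<one>\<^bsub>E\<^esub> = Phi f" using Phi_surj by blast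
  have id: "Phi f x = x" if "x \<in> carrier W" for x
    using that unfolding f(2)[symmetric] E_simps by simp
  have "Phi f w = Phi f (Phi \<one>\<^bsub>X\<^esub> w)"
    using Phi_mult[OF X.A.one_closed f(1) w] X.A.l_one[OF f(1)] by simp
  then show ?thesis using id w by simp
qed

lemma Phi_bij: "algebra_bij Phi X E"
  unfolding algebra_bij_def bij_betw_def
proof (intro conjI ballI allI)
  show "inj_on Phi (carrier X)" by (rule Phi_inj)
  show "Phi ` carrier X = carrier E" using Phi_surj Phi_E by blast
  show "Phi \<one>\<^bsub>X\<^esub> = \<one>\<^bsub>E\<^esub>"
    unfolding E_simps using Phi_one
    by (intro extensionalityI[where A="carrier W"]) (simp_all add: Phi_def[of "\<one>\<^bsub>X\<^esub>"])
  show "Phi \<zero>\<^bsub>X\<^esub> = \<zero>\<^bsub>E\<^esub>"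
    unfolding E_simps using Phi_zero
    by (intro extensionalityI[where A="carrier W"]) (simp_all add: Phi_def[of "\<zero>\<^bsub>X\<^esub>"])
  fix f h :: "'a set \<Rightarrow> complex" and c
  show "Phi (f \<otimes>\<^bsub>X\<^esub> h) = Phi f \<otimes>\<^bsub>E\<^esub> Phi h" if "f \<in> carrier X" "h \<in> carrier X"
    unfolding E_simps using Phi_mult[OF that]
    by (intro extensionalityI[where A="carrier W"]) (simp_all add: Phi_def[of "f \<otimes>\<^bsub>X\<^esub> h"])
  show "Phi (f \<oplus>\<^bsub>X\<^esub> h) = Phi f \<oplus>\<^bsub>E\<^esub> Phi h"
    unfolding E_simps using Phi_add[of _ f h]
    by (intro extensionalityI[where A="carrier W"]) (simp_all add: Phi_def[of "f \<oplus>\<^bsub>X\<^esub> h"])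
  show "Phi (c \<odot>\<^bsub>X\<^esub> f) = c \<odot>\<^bsub>E\<^esub> Phi f"
    unfolding E_simps using Phi_smult[of _ c f]
    by (intro extensionalityI[where A="carrier W"]) (simp_all add: Phi_def[of "c \<odot>\<^bsub>X\<^esub> f"])
qed

abbreviation XD where "XD \<equiv> extend_grading X Inertia twisted_grading"
abbreviation ED where "ED \<equiv> endomorphism_grading \<Gamma> A W comp"

lemma XD_iff: "f \<in> XD C \<longleftrightarrow> f \<in> carrier X \<and> (\<forall>x. x \<noteq> C \<longrightarrow> f x = 0)"
  using X.extend_grading_iff[of f C] by simp

lemma XD_cases:
  assumes "f \<in> XD C" obtains "C \<in> Inertia" "f = f C \<odot>\<^bsub>X\<^esub> basis_elt C" | "f = \<zero>\<^bsub>X\<^esub>"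
proof (cases "C \<in> Inertia")
  case True
  have "f = f C \<odot>\<^bsub>X\<^esub> basis_elt C"
  proof
    fix x show "f x = (f C \<odot>\<^bsub>X\<^esub> basis_elt C) x"
      using assms unfolding XD_iff by (cases "x = C") (simp_all add: TGA_simps basis_elt_def)
  qed
  then show ?thesis using that(1)[OF True] by blast
next
  case False
  have "f = \<zero>\<^bsub>X\<^esub>"
  proof
    fix x show "f x = \<zero>\<^bsub>X\<^esub> x"
      using assms False unfolding XD_iff by (cases "x = C") (simp_all add: TGA_simps)
  qed
  then show ?thesis by (rule that(2))
qed

lemma comp_zero: assumes C: "C \<in> carrier \<Gamma>" shows "\<zero>\<^bsub>W\<^esub> \<in> comp C"
  unfolding comp_eq[OF C homu[OF C]]
  by (intro CollectI exI conjI, rule T.tens_zero_right[OF hu_A[OF C homu[OF C]], symmetric], rule M.M.zero_closed)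

lemma comp_cscale:
  assumes C: "C \<in> carrier \<Gamma>" and w: "w \<in> comp C" shows "cscale A W c w \<in> comp C"
proof -
  have "c \<odot>\<^bsub>B\<^esub> \<one>\<^bsub>B\<^esub> \<in> D N" using B.Alg.scalar_closed[of c] unfolding D_N .
  from comp_smult[OF N_\<Gamma> C this w] show ?thesis using C by (simp add: cscale_def B_scalar B_one)
qed

lemma Phi_comp:
  assumes C: "C \<in> carrier \<Gamma>" and C': "C' \<in> carrier \<Gamma>" and f: "f \<in> XD C" and w: "w \<in> comp C'"
  shows "Phi f w \<in> comp (C' \<star> C)"
proof -
  have wW: "w \<in> carrier W" using w comp_W[OF C'] by blast
  note CC = \<Gamma>.m_closed[OF C' C]
  from f show ?thesis
  proof (cases rule: XD_cases)
    case 1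
    have "Phi f w = cscale A W (f C) (phi C w)" using Phi_basis[OF 1(1) wW, of "f C"] 1(2) by simp
    then show ?thesis using comp_cscale[OF CC phi_comp[OF 1(1) C' w]] by simp
  next
    case 2
    then show ?thesis using Phi_zero[OF wW] comp_zero[OF CC] by simp
  qed
qed

text \<open>An endomorphism of degree \<open>C\<close> sends the copy of \<open>M\<close> in degree
  \<open>N\<close> into degree \<open>C\<close>; its coordinates in all other degrees vanish there,
  hence so do the other coefficients.\<close>

lemma ED_eq:
  assumes C: "C \<in> carrier \<Gamma>" shows "ED C = Phi ` XD C"
proof (intro equalityI subsetI)
  fix \<phi> assume "\<phi> \<in> Phi ` XD C"
  then obtain f where f: "f \<in> XD C" "\<phi> = Phi f" by blast
  show "\<phi> \<in> ED C"
    unfolding endomorphism_grading_def f(2)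
  proof (intro CollectI conjI ballI image_subsetI)
    show "Phi f \<in> carrier E" by (rule Phi_E)
    show "Phi f w \<in> comp (C' \<star> C)" if "C' \<in> carrier \<Gamma>" "w \<in> comp C'" for C' w
      by (rule Phi_comp[OF C that(1) f(1) that(2)])
  qed
next
  fix \<phi> assume \<phi>: "\<phi> \<in> ED C"
  note \<phi>' = CollectD[OF \<phi>[unfolded endomorphism_grading_def]]
  obtain f where f: "\<phi> = Phi f" "f \<in> carrier X" using Phi_surj[OF conjunct1[OF \<phi>']] by (rule imageE)
  obtain m where m: "m \<in> carrier M" "m \<noteq> \<zero>\<^bsub>M\<^esub>" by (rule nonzero_M)
  have "\<phi> (tens \<one>\<^bsub>A\<^esub> m) \<in> comp (N \<star> C)"
    by (rule subsetD[OF bspec[OF conjunct2[OF \<phi>'] N_\<Gamma>] imageI[OF one_tens_comp[OF m(1)]]])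
  then have c: "Phi f (tens \<one>\<^bsub>A\<^esub> m) \<in> comp C" using C f(1) by simp
  have "f x = 0" if x: "x \<noteq> C" for x
  proof (cases "x \<in> Inertia")
    case True
    have "cscale B M (f x) (\<theta> x m) = cscale B M 0 (\<theta> x m)"
      using Phi_pr[OF True m(1), of f] comp_pr_other[OF C Inertia_\<Gamma>[OF True] x[symmetric] v[OF True] c]
        \<theta>_closed[OF True m(1)] by simp
    then show ?thesis by (rule M.cscale_cancel[OF \<theta>_closed[OF True m(1)] \<theta>_nonzero[OF True m]])
  next
    case False
    then show ?thesis using f(2) by (simp add: TGA_simps)
  qed
  then have "f \<in> XD C" unfolding XD_iff using f(2) by blast
  then show "\<phi> \<in> Phi ` XD C" unfolding f(1) by (rule imageI)
qed

lemma XD_graded: "graded_algebra \<Gamma> X XD"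
  by (rule X.graded_algebra_extend[OF group_\<Gamma> subgroup_Inertia refl])

lemma E_graded_isomorphic: "graded_isomorphic \<Gamma> E ED X XD"
  by (rule graded_isomorphic_transport_sym[OF Phi_bij XD_graded ED_eq])

text \<open>Rescaling each \<open>\<theta> C\<close> by \<open>f C\<close> changes the cocycle by
  the coboundary of \<open>f\<close>.\<close>

lemma rescale:
  assumes f: "\<And>C. C \<in> Inertia ==> f C \<noteq> 0"
    and \<omega>': "\<And>C C'. C \<in> Inertia ==> C' \<in> Inertia ==> \<omega>' C C' = f C * f C' / f (C \<star> C') * \<omega> C C'"
  shows "mackey_family G \<alpha> N M v (\<lambda>C m. cscale B M (f C) (\<theta> C m)) \<omega>'"
proof (intro mackey_family.intro mackey_axioms mackey_family_axioms.intro v)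
  fix C assume C: "C \<in> Inertia"
  note CG = Inertia_\<Gamma>[OF C]
  show "(\<lambda>m. cscale B M (f C) (\<theta> C m)) \<in> LinearCombinations.module_hom B M (cj (v C) M)"
  proof (rule module_homI)
    fix b m assume b: "b \<in> carrier B" and m: "m \<in> carrier M"
    show "cscale B M (f C) (\<theta> C (b \<odot>\<^bsub>M\<^esub> m)) = b \<odot>\<^bsub>cj (v C) M\<^esub> cscale B M (f C) (\<theta> C m)"
      using \<theta>_smult[OF C b m] M.smult_cscale[OF conj_B(1)[OF CG v[OF C] b] \<theta>_closed[OF C m]] by simp
  qed (use C in \<open>simp_all add: \<theta>_add M.cscale_add\<close>)
  have "bij_betw (\<lambda>m. cscale B M (f C) m) (carrier M) (carrier M)"
    by (rule bij_betwI[where g="\<lambda>m. cscale B M (inverse (f C)) m"])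
      (use f[OF C] in \<open>simp_all add: M.cscale_cscale\<close>)
  from bij_betw_trans[OF \<theta>_bij[OF C] this]
  show "bij_betw (\<lambda>m. cscale B M (f C) (\<theta> C m)) (carrier M) (carrier M)" by (simp add: comp_def)
  fix C' m assume C': "C' \<in> Inertia" and m: "m \<in> carrier M"
  note CC = Inertia_mult[OF C C'] note g = Inertia_\<Gamma>[OF C'] Inertia_\<Gamma>[OF CC]
  let ?u = "inv\<^bsub>A\<^esub> (v (C \<star> C')) \<cdot> (v C \<cdot> v C')"
  have u: "?u \<in> carrier B"
    by (rule D_shift[OF g(2) v[OF CC] hu_D[OF g(2) hu_mult[OF CG g(1) v[OF C] v[OF C']]]])
  note t = \<theta>_closed[OF C m] note tt = \<theta>_closed[OF C' t]
  have "\<theta> C' (cscale B M (f C) (\<theta> C m)) = cscale B M (f C) (\<theta> C' (\<theta> C m))"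
    using module_hom_cscale[OF B.Alg.complex_algebra_axioms \<theta>[OF C'] t] cscale_cj[OF g(1) v[OF C']] by simp
  then have "?u \<odot>\<^bsub>M\<^esub> cscale B M (f C') (\<theta> C' (cscale B M (f C) (\<theta> C m)))
      = cscale B M (f C' * f C) (?u \<odot>\<^bsub>M\<^esub> \<theta> C' (\<theta> C m))"
    using tt by (simp add: M.cscale_cscale M.smult_cscale[OF u])
  also have "\<dots> = cscale B M (f C' * f C * \<omega> C C') (\<theta> (C \<star> C') m)"
    unfolding \<theta>_\<omega>[OF C C' m] by (rule M.cscale_cscale[OF \<theta>_closed[OF CC m]])
  also have "f C' * f C * \<omega> C C' = \<omega>' C C' * f (C \<star> C')"
    using f[OF CC] \<omega>'[OF C C'] by simp
  also have "cscale B M \<dots> (\<theta> (C \<star> C') m)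
      = cscale B M (\<omega>' C C') (cscale B M (f (C \<star> C')) (\<theta> (C \<star> C') m))"
    by (rule M.cscale_cscale[OF \<theta>_closed[OF CC m], symmetric])
  finally show "?u \<odot>\<^bsub>M\<^esub> cscale B M (f C') (\<theta> C' (cscale B M (f C) (\<theta> C m)))
      = cscale B M (\<omega>' C C') (cscale B M (f (C \<star> C')) (\<theta> (C \<star> C') m))" .
qed

text \<open>Every cocycle of the class arises from a family of choices. The theorem speaks of all
  cocycles in the class, so it is not enough to treat one representative.\<close>

lemma cohomologous_family:
  assumes "(\<omega>, \<omega>') \<in> cohomologous IG" shows "\<exists>\<theta>'. mackey_family G \<alpha> N M v \<theta>' \<omega>'"
proof -
  obtain f where f: "\<forall>C\<in>Inertia. f C \<noteq> 0"
    "\<forall>C\<in>Inertia. \<forall>C'\<in>Inertia. \<omega>' C C' = f C * f C' / f (C \<star> C') * \<omega> C C'"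
    using assms unfolding cohomologous_def by auto
  have "mackey_family G \<alpha> N M v (\<lambda>C m. cscale B M (f C) (\<theta> C m)) \<omega>'"
    by (rule rescale) (simp_all add: f)
  then show ?thesis by (rule exI[of "\<lambda>\<theta>'. mackey_family G \<alpha> N M v \<theta>' \<omega>'"])
qed

lemma phi_ED:
  assumes C: "C \<in> Inertia" shows "phi C \<in> ED C"
  unfolding endomorphism_grading_def
proof (intro CollectI conjI ballI image_subsetI)
  show "phi C \<in> carrier E" unfolding E_simps using phi_hom[OF C] phi_exists(3)[OF C] by blast
  show "phi C w \<in> comp (C' \<star> C)" if "C' \<in> carrier \<Gamma>" "w \<in> comp C'" for C' w
    by (rule phi_comp[OF C that])
qed

text \<open>A graded isomorphism has to send \<open>phi C\<close> to a multiple \<open>g C\<close>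
  of the basis element of degree \<open>C\<close>; comparing the images of products shows that the
  cocycles differ by the coboundary of the inverse of \<open>g\<close>.\<close>

lemma cohomologous_unique:
  assumes \<omega>': "\<omega>' \<in> cocycles2 IG"
    and iso: "graded_isomorphic \<Gamma> E ED (twisted_subgroup_algebra \<Gamma> \<omega>' Inertia)
      (extend_grading (twisted_subgroup_algebra \<Gamma> \<omega>' Inertia) Inertia twisted_grading)"
  shows "(\<omega>, \<omega>') \<in> cohomologous IG"
proof -
  interpret X': twisted IG \<omega>'
    by (intro twisted.intro group_IG twisted_axioms.intro \<omega>') (simp add: finite_Inertia)
  let ?X = "twisted_subgroup_algebra \<Gamma> \<omega>' Inertia"
  obtain \<psi> where iso': "\<psi> \<in> algebra_iso E ?X"
    and gr: "\<forall>C\<in>carrier \<Gamma>. \<psi> ` ED C \<subseteq> extend_grading ?X Inertia twisted_grading C"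
    using iso unfolding graded_isomorphic_def by blast
  have hom: "\<psi> \<in> Ring.ring_hom E ?X" and bij: "bij_betw \<psi> (carrier E) (carrier ?X)"
    and lin: "\<psi> \<in> LinearCombinations.module_hom class_ring E ?X"
    using iso' unfolding algebra_iso_def ring_iso_def by blast+
  have phiE: "phi C \<in> carrier E" if "C \<in> Inertia" for C
    by (rule conjunct1[OF CollectD[OF phi_ED[OF that, unfolded endomorphism_grading_def]]])
  have "\<exists>c. \<psi> (phi C) = c \<odot>\<^bsub>?X\<^esub> basis_elt C" if C: "C \<in> Inertia" for C
  proof -
    have "\<psi> (phi C) \<in> extend_grading ?X Inertia twisted_grading C"
      using gr Inertia_\<Gamma>[OF C] phi_ED[OF C] by blast
    then show ?thesis using C by (auto simp: extend_grading_def twisted_grading_def TGA_simps)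
  qed
  then obtain g where g: "\<And>C. C \<in> Inertia ==> \<psi> (phi C) = g C \<odot>\<^bsub>?X\<^esub> basis_elt C" by metis
  have \<psi>s: "\<psi> (c \<odot>\<^bsub>E\<^esub> phi C) = c \<odot>\<^bsub>?X\<^esub> \<psi> (phi C)" if "C \<in> Inertia" for c C
    by (rule module_homD(3)[OF lin _ phiE[OF that]]) simp
  have sE: "c \<odot>\<^bsub>E\<^esub> phi C \<in> carrier E" if C: "C \<in> Inertia" for c C
  proof -
    have "c \<odot>\<^bsub>E\<^esub> phi C = Phi (c \<odot>\<^bsub>X\<^esub> basis_elt C)"
      unfolding E_simps using Phi_basis[OF C, of _ c]
      by (intro extensionalityI[where A="carrier W"]) (simp_all add: Phi_def[of "c \<odot>\<^bsub>X\<^esub> basis_elt C"])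
    then show ?thesis using Phi_E by simp
  qed
  have g0: "g C \<noteq> 0" if C: "C \<in> Inertia" for C
  proof
    assume "g C = 0"
    then have "\<psi> (phi C) = \<zero>\<^bsub>?X\<^esub>" using g[OF C] by (simp add: TGA_simps)
    \<comment> \<open>If \<open>g C\<close> were zero, \<open>\<psi>\<close> would identify
      \<open>phi C\<close> with its double, although \<open>phi C\<close> is nonzero.\<close>
    then have "\<psi> (2 \<odot>\<^bsub>E\<^esub> phi C) = \<psi> (phi C)" unfolding \<psi>s[OF C] by (simp add: TGA_simps)
    then have eq: "2 \<odot>\<^bsub>E\<^esub> phi C = phi C"
      using bij inj_onD[of \<psi> "carrier E"] sE[OF C] phiE[OF C] unfolding bij_betw_def by blast
    have "cscale A W 2 (phi C w) = cscale A W 1 (phi C w)" if w: "w \<in> carrier W" for w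
      using fun_cong[OF eq, of w] w C by (simp add: E_simps)
    from phi_cancel[OF C this] show False by simp
  qed
  have mult: "g C * g C' * \<omega>' C C' = \<omega> C C' * g (C \<star> C')" if C: "C \<in> Inertia" "C' \<in> Inertia" for C C'
  proof -
    note CC = Inertia_mult[OF C]
    have b: "basis_elt C \<in> carrier ?X" "basis_elt C' \<in> carrier ?X" using C by (simp_all add: X'.basis_elt_closed)
    have "phi C \<otimes>\<^bsub>E\<^esub> phi C' = \<omega> C C' \<odot>\<^bsub>E\<^esub> phi (C \<star> C')"
      unfolding E_simps by (rule restrict_ext) (rule phi_mult[OF C])
    then have "\<omega> C C' \<odot>\<^bsub>?X\<^esub> (g (C \<star> C') \<odot>\<^bsub>?X\<^esub> basis_elt (C \<star> C'))
        = (g C \<odot>\<^bsub>?X\<^esub> basis_elt C) \<otimes>\<^bsub>?X\<^esub> (g C' \<odot>\<^bsub>?X\<^esub> basis_elt C')"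
      using ring_hom_mult[OF hom phiE[OF C(1)] phiE[OF C(2)]] \<psi>s[OF CC] g[OF CC] g[OF C(1)] g[OF C(2)] by simp
    also have "\<dots> = g C \<odot>\<^bsub>?X\<^esub> (g C' \<odot>\<^bsub>?X\<^esub> (basis_elt C \<otimes>\<^bsub>?X\<^esub> basis_elt C'))"
      using X'.Alg.smult_mult_left[OF b(1) X'.Alg.smult_closed_complex[OF b(2)]] X'.Alg.smult_mult_right[OF b] by simp
    also have "basis_elt C \<otimes>\<^bsub>?X\<^esub> basis_elt C' = (\<lambda>x. \<omega>' C C' * basis_elt (C \<star> C') x)"
      using X'.basis_mult_basis[of C C'] C by simp
    finally have eq: "\<omega> C C' \<odot>\<^bsub>?X\<^esub> (g (C \<star> C') \<odot>\<^bsub>?X\<^esub> basis_elt (C \<star> C'))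
      = g C \<odot>\<^bsub>?X\<^esub> (g C' \<odot>\<^bsub>?X\<^esub> (\<lambda>x. \<omega>' C C' * basis_elt (C \<star> C') x))" .
    show ?thesis using fun_cong[OF eq, of "C \<star> C'"] by (simp add: TGA_simps basis_elt_def mult_ac)
  qed
  have eq: "\<omega>' C C' = inverse (g C) * inverse (g C') / inverse (g (C \<star> C')) * \<omega> C C'"
    if C: "C \<in> Inertia" "C' \<in> Inertia" for C C'
  proof -
    have "\<omega>' C C' = (g C * g C' * \<omega>' C C') / (g C * g C')" using g0[OF C(1)] g0[OF C(2)] by simp
    also have "\<dots> = (\<omega> C C' * g (C \<star> C')) / (g C * g C')" unfolding mult[OF C] ..
    also have "\<dots> = inverse (g C) * inverse (g C') / inverse (g (C \<star> C')) * \<omega> C C'"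
      by (simp add: divide_inverse mult_ac)
    finally show ?thesis .
  qed
  have "\<exists>f. (\<forall>C\<in>carrier IG. f C \<noteq> 0) \<and> (\<forall>C\<in>carrier IG. \<forall>C'\<in>carrier IG.
      \<omega>' C C' = f C * f C' / f (C \<otimes>\<^bsub>IG\<^esub> C') * \<omega> C C')"
  proof (intro exI[of _ "\<lambda>C. inverse (g C)"] conjI ballI)
    show "inverse (g C) \<noteq> 0" if "C \<in> carrier IG" for C using g0[of C] that by simp
    fix C C' assume C: "C \<in> carrier IG" "C' \<in> carrier IG"
    have m: "C \<otimes>\<^bsub>IG\<^esub> C' = C \<star> C'" by simp
    show "\<omega>' C C' = inverse (g C) * inverse (g C') / inverse (g (C \<otimes>\<^bsub>IG\<^esub> C')) * \<omega> C C'"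
      unfolding m by (rule eq) (use C in simp_all)
  qed
  then show ?thesis unfolding cohomologous_def using \<omega>_cocycle \<omega>' by blast
qed

text \<open>Existence comes from \<open>cohomologous_family\<close>, which gives each cocycle of the
  class its own graded isomorphism; uniqueness from \<open>cohomologous_unique\<close>.\<close>

lemma mackey_class_eq: "mackey_class G \<alpha> N M = cohomologous IG `` {\<omega>}"
  unfolding mackey_class_def Let_def
proof (rule the_equality)
  note equiv = cohomologous_equiv[OF group_IG]
  have "graded_isomorphic \<Gamma> E ED (twisted_subgroup_algebra \<Gamma> \<omega>' Inertia)
      (extend_grading (twisted_subgroup_algebra \<Gamma> \<omega>' Inertia) Inertia twisted_grading)"
    if coh: "\<omega>' \<in> cohomologous IG `` {\<omega>}" for \<omega>'
  proof -
    have "(\<omega>, \<omega>') \<in> cohomologous IG" using coh by blast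
    from cohomologous_family[OF this] obtain \<theta>' where "mackey_family G \<alpha> N M v \<theta>' \<omega>'" by (rule exE)
    then show ?thesis by (rule mackey_family.E_graded_isomorphic)
  qed
  moreover have "cohomologous IG `` {\<omega>} \<in> H2 IG" unfolding H2_def by (rule quotientI[OF \<omega>_cocycle])
  ultimately show "cohomologous IG `` {\<omega>} \<in> H2 IG \<and> (\<forall>\<omega>'\<in>cohomologous IG `` {\<omega>}.
      graded_isomorphic \<Gamma> E ED (twisted_subgroup_algebra \<Gamma> \<omega>' Inertia)
      (extend_grading (twisted_subgroup_algebra \<Gamma> \<omega>' Inertia) Inertia twisted_grading))" by blast
  fix c assume c: "c \<in> H2 IG \<and> (\<forall>\<omega>'\<in>c. graded_isomorphic \<Gamma> E ED (twisted_subgroup_algebra \<Gamma> \<omega>' Inertia)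
      (extend_grading (twisted_subgroup_algebra \<Gamma> \<omega>' Inertia) Inertia twisted_grading))"
  have "c \<in> cocycles2 IG // cohomologous IG" using c unfolding H2_def by (rule conjunct1)
  then obtain \<omega>' where \<omega>': "c = cohomologous IG `` {\<omega>'}" "\<omega>' \<in> cocycles2 IG" by (rule quotientE)
  have "\<omega>' \<in> c" unfolding \<omega>'(1) using equiv \<omega>'(2) by (rule equiv_class_self)
  then have "(\<omega>, \<omega>') \<in> cohomologous IG"
    by (intro cohomologous_unique[OF \<omega>'(2)] bspec[OF conjunct2[OF c]])
  then show "c = cohomologous IG `` {\<omega>}" unfolding \<omega>'(1) by (rule equiv_class_eq[OF equiv, symmetric])
qed

end

lemma (in mackey) mackey_class_H2: "mackey_class G \<alpha> N M \<in> H2 IG"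
proof -
  obtain v \<theta> \<omega> where f: "mackey_family G \<alpha> N M v \<theta> \<omega>" using mackey_family_exists by blast
  show ?thesis
    unfolding mackey_family.mackey_class_eq[OF f] H2_def by (rule quotientI[OF mackey_family.\<omega>_cocycle[OF f]])
qed

lemma (in mackey) mackey_class_family:
  assumes "\<omega> \<in> mackey_class G \<alpha> N M" shows "\<exists>v \<theta>. mackey_family G \<alpha> N M v \<theta> \<omega>"
proof -
  obtain v \<theta> \<omega>' where f: "mackey_family G \<alpha> N M v \<theta> \<omega>'" using mackey_family_exists by blast
  have "(\<omega>', \<omega>) \<in> cohomologous IG" using assms unfolding mackey_family.mackey_class_eq[OF f] by blast
  from mackey_family.cohomologous_family[OF f this] show ?thesis
    by (rule exI[of "\<lambda>v. \<exists>\<theta>. mackey_family G \<alpha> N M v \<theta> \<omega>"])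
qed

section \<open>The matrix algebra over the endomorphism algebra\<close>

context mackey
begin

sublocale CI: central_idem G \<alpha> N "B.idem (orb (module_type B M))"
  by (rule central_idem_orb[OF module_type_in_Irr[OF irr]])

abbreviation e where "e \<equiv> B.idem (orb (module_type B M))"

lemma e_M: "m \<in> carrier M ==> e \<odot>\<^bsub>M\<^esub> m = m"
  using B.idem_acts[OF irr] orb_self[OF module_type_in_Irr[OF irr]] by simp

lemma e_W:
  assumes "w \<in> carrier W" shows "e \<odot>\<^bsub>W\<^esub> w = w"
  using assms
proof (induction rule: T.tens_induct)
  case zero
  show ?case using CI.eA by simp
next
  case (add u v)
  then show ?case using W.smult_r_distr[OF CI.eA] by simp
next
  case (tens x m)
  show ?case
    using T.smult_tens[OF CI.eA tens] CI.central[OF tens(1)] T.tens_balanced[OF tens(1) CI.eB tens(2)] e_M[OF tens(2)]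
    by simp
qed

text \<open>As a module over \<open>B\<close>, \<open>W\<close> contains all conjugates of
  \<open>M\<close>, and \<open>e\<close> kills the other irreducible modules. So each component of
  \<open>a\<close>, shifted into \<open>B\<close>, acts as zero on every irreducible module.\<close>

lemma S_faithful:
  assumes a: "a \<in> CI.S" and z: "\<And>w. w \<in> carrier W ==> a \<odot>\<^bsub>W\<^esub> w = \<zero>\<^bsub>W\<^esub>"
  shows "a = \<zero>\<^bsub>A\<^esub>"
proof -
  note aA = CI.S_A[OF a] and c0 = module_type_in_Irr[OF irr]
  have "restr C a = \<zero>\<^bsub>A\<^esub>" if C: "C \<in> carrier \<Gamma>" for C
  proof -
    let ?u = "homu C" and ?y = "inv\<^bsub>A\<^esub> (homu C) \<cdot> a"
    note u = homu[OF C] note uA = hu_A[OF C u] and uiA = hu_inv_A[OF C u]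
    have y: "?y \<in> carrier A" by (rule A.m_closed[OF uiA aA])
    define b where "b = restr N ?y"
    have bB: "b \<in> carrier B" unfolding b_def by (rule restr_N_B)
    \<comment> \<open>The shifted component is still fixed by right multiplication with
      \<open>e\<close>, because \<open>e\<close> lies in \<open>B\<close>; this settles the types
      outside the orbit.\<close>
    have "?y \<cdot> e = ?y" using A.m_assoc[OF uiA aA CI.eA] CI.S_e[OF a] by simp
    then have be: "b \<otimes>\<^bsub>B\<^esub> e = b"
      using restr_mult_right[OF N_\<Gamma> y CI.eB] unfolding b_def B_mult[OF restr_N_B CI.eB] by simp
    have "b = \<zero>\<^bsub>B\<^esub>"
    proof (rule B.acts_eqI[OF bB B.A.zero_closed])
      fix M' :: "('a \<Rightarrow> complex, 'a \<Rightarrow> complex) module" and m'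
      assume irr': "irreducible_module B M'" and m': "m' \<in> carrier M'"
      interpret M': left_module B M' using irr' by (rule irreducible_left_module)
      have "b \<odot>\<^bsub>M'\<^esub> m' = \<zero>\<^bsub>M'\<^esub>"
      proof (cases "module_type B M' \<in> orb (module_type B M)")
        case False
        then have "e \<odot>\<^bsub>M'\<^esub> m' = \<zero>\<^bsub>M'\<^esub>" using B.idem_acts[OF irr' m'] by simp
        then show ?thesis using M'.smult_assoc[OF bB CI.eB m'] be M'.smult_zero_right[OF bB] by simp
      next
        case True
        then obtain C' where C': "C' \<in> carrier \<Gamma>" "module_type B M' = act C' (module_type B M)"
          unfolding orb_def by blast
        let ?x = "homu C'"
        note x = homu[OF C'(1)] note xA = hu_A[OF C'(1) x] and xiA = hu_inv_A[OF C'(1) x]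
        have "module_isomorphic B (cj ?x M) M'"
          using C'(2) act_module_type[OF irr C'(1) x] module_type_eq_iff[OF irreducible_cj[OF irr C'(1) x] irr'] by simp
        then obtain f where f: "f \<in> LinearCombinations.module_hom B (cj ?x M) M'" "bij_betw f (carrier M) (carrier M')"
          unfolding module_isomorphic_def by auto
        obtain m where m: "m \<in> carrier M" "m' = f m" using f(2) m' unfolding bij_betw_def by blast
        note CC = \<Gamma>.m_closed[OF C C'(1)] and ux = hu_mult[OF C C'(1) u x]
        \<comment> \<open>The action of \<open>b\<close> on the conjugate of \<open>M\<close> by
          \<open>?x\<close> is a coordinate of \<open>a\<close> applied to a tensor with left factor
          \<open>?x\<close>, which is zero.\<close>
        have "inv\<^bsub>A\<^esub> ?x \<cdot> ?y \<cdot> ?x = inv\<^bsub>A\<^esub> (?u \<cdot> ?x) \<cdot> (a \<cdot> ?x)"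
          unfolding hu_inv_mult[OF C C'(1) u x] using xiA uiA aA xA by (simp add: A.m_assoc)
        then have "(inv\<^bsub>A\<^esub> ?x \<cdot> b \<cdot> ?x) \<odot>\<^bsub>M\<^esub> m = pr (?u \<cdot> ?x) (tens (a \<cdot> ?x) m)"
          unfolding b_def restr_conj[OF C'(1) x y, symmetric]
          using pr_exists(2)[OF CC ux A.m_closed[OF aA xA] m(1)] by simp
        also have "tens (a \<cdot> ?x) m = \<zero>\<^bsub>W\<^esub>"
          using T.smult_tens[OF aA xA m(1)] z[OF T.tens_closed[OF xA m(1)]] by simp
        finally have bm: "b \<odot>\<^bsub>cj ?x M\<^esub> m = \<zero>\<^bsub>M\<^esub>" using pr_zero[OF CC ux] by simp
        have "b \<odot>\<^bsub>M'\<^esub> m' = f (b \<odot>\<^bsub>cj ?x M\<^esub> m)"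
          unfolding m(2) by (rule module_homD(3)[OF f(1) bB, symmetric]) (use m(1) in simp)
        also have "\<dots> = f \<zero>\<^bsub>cj ?x M\<^esub>" unfolding bm by simp
        also have "\<dots> = \<zero>\<^bsub>M'\<^esub>"
          by (rule module_hom_zero[OF left_module_cj[OF M.left_module_axioms C'(1) x] M'.left_module_axioms f(1)])
        finally show ?thesis .
      qed
      then show "b \<odot>\<^bsub>M'\<^esub> m' = \<zero>\<^bsub>B\<^esub> \<odot>\<^bsub>M'\<^esub> m'" using M'.smult_zero_left[OF m'] by simp
    qed
    then have "b = \<zero>\<^bsub>A\<^esub>" by (simp add: TGA_simps)
    then show ?thesis using restr_hu[OF C u aA] A.r_null[OF uA] unfolding b_def by simp
  qed
  then have "finsum A (\<lambda>C. restr C a) (carrier \<Gamma>) = finsum A (\<lambda>C. \<zero>\<^bsub>A\<^esub>) (carrier \<Gamma>)"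
    by (intro A.finsum_cong'[OF refl Pi_I]) simp_all
  then show ?thesis using restr_decompose[OF aA] by simp
qed

lemma coord_system_cj:
  assumes C: "C \<in> carrier \<Gamma>" and v: "v \<in> hu C" and co: "coord_system B M I b \<kappa>"
  shows "coord_system B (cj v M) I b \<kappa>"
proof -
  have "finsum (cj v M) f I = finsum M f I" for f by (simp add: finsum_def conjugate_module_def)
  then show ?thesis using co unfolding coord_system_def cscale_cj[OF C v] by simp
qed

end

text \<open>The positions of \<open>\<gamma>s\<close> with entry \<open>t\<close> index a basis of
  \<open>M\<close>: this is how the multiplicity of each \<open>t\<close> enters. Position
  \<open>l\<close> then yields the basis vector \<open>wl l\<close> of \<open>W\<close>, homogeneous
  of degree \<open>\<gamma>s ! l\<close>.\<close>

locale mackey_matrix = mackey_family +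
  fixes T \<gamma>s and b :: "nat \<Rightarrow> 'a \<Rightarrow> complex" and \<kappa> :: "nat \<Rightarrow> ('a \<Rightarrow> complex) \<Rightarrow> complex"
  assumes trans: "left_transversal \<Gamma> Inertia T" and \<gamma>s_T: "set \<gamma>s \<subseteq> T"
    and coord: "t \<in> T ==> coord_system B M {l. l < length \<gamma>s \<and> \<gamma>s ! l = t} b \<kappa>"
begin

abbreviation r where "r \<equiv> length \<gamma>s"
abbreviation L where "L t \<equiv> {l. l < r \<and> \<gamma>s ! l = t}"
abbreviation s where "s l \<equiv> homu (\<gamma>s ! l)"
abbreviation wl where "wl l \<equiv> tens (s l) (b l)"

lemma T_\<Gamma>: "t \<in> T ==> t \<in> carrier \<Gamma>"
  using trans unfolding left_transversal_def by blast

lemmas T_ex1 = bspec[OF conjunct2[OF trans[unfolded left_transversal_def]]]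

lemma T_ex:
  assumes C: "C \<in> carrier \<Gamma>" obtains t h where "t \<in> T" "h \<in> Inertia" "C = t \<star> h"
proof -
  have "\<exists>t. t \<in> T \<and> C \<in> t <#\<^bsub>\<Gamma>\<^esub> Inertia" using T_ex1[OF C] by (rule ex1_implies_ex)
  then obtain t where t: "t \<in> T" "C \<in> t <#\<^bsub>\<Gamma>\<^esub> Inertia" by (elim exE conjE)
  from t(2) have "\<exists>h\<in>Inertia. C = t \<star> h" unfolding l_coset_def by simp
  then obtain h where "h \<in> Inertia" "C = t \<star> h" by (rule bexE)
  then show thesis by (rule that[OF t(1)])
qed

lemma T_unique:
  assumes t: "t \<in> T" "t' \<in> T" and h: "h \<in> Inertia" "h' \<in> Inertia" and eq: "t \<star> h = t' \<star> h'"
  shows "t = t'"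
proof -
  note ex1 = T_ex1[OF \<Gamma>.m_closed[OF T_\<Gamma>[OF t(1)] Inertia_\<Gamma>[OF h(1)]]]
  have 1: "t \<in> T \<and> t \<star> h \<in> t <#\<^bsub>\<Gamma>\<^esub> Inertia" unfolding l_coset_def using h(1) t(1) by blast
  have 2: "t' \<in> T \<and> t \<star> h \<in> t' <#\<^bsub>\<Gamma>\<^esub> Inertia" unfolding l_coset_def eq using h(2) t(2) by blast
  show ?thesis using the1_equality[OF ex1 1] the1_equality[OF ex1 2] by simp
qed

lemma \<gamma>s: assumes "l < r" shows "\<gamma>s ! l \<in> T" "\<gamma>s ! l \<in> carrier \<Gamma>" "s l \<in> hu (\<gamma>s ! l)" "s l \<in> carrier A"
proof -
  show T: "\<gamma>s ! l \<in> T" using \<gamma>s_T nth_mem[OF assms] by blast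
  show G: "\<gamma>s ! l \<in> carrier \<Gamma>" by (rule T_\<Gamma>[OF T])
  show u: "s l \<in> hu (\<gamma>s ! l)" by (rule homu[OF G])
  show "s l \<in> carrier A" by (rule hu_A[OF G u])
qed

lemma b_M: assumes "l < r" shows "b l \<in> carrier M"
  using coord_systemD(2)[OF coord[OF \<gamma>s(1)[OF assms]], of l] assms by simp

lemma wl_W: "l < r ==> wl l \<in> carrier W"
  by (rule T.tens_closed[OF \<gamma>s(4) b_M])

lemma wl_comp: "l < r ==> wl l \<in> comp (\<gamma>s ! l)"
  unfolding comp_eq[OF \<gamma>s(2,3)] using b_M by blast

lemma tens_one_smult: "x \<in> carrier A ==> m \<in> carrier M ==> tens x m = x \<odot>\<^bsub>W\<^esub> tens \<one>\<^bsub>A\<^esub> m"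
  using T.smult_tens[of x "\<one>\<^bsub>A\<^esub>" m] by simp

text \<open>Endomorphisms commute with the action of \<open>u\<close>, which reduces the claim to
  tensors with left factor \<open>\<one>\<close>.\<close>

lemma Phi_pr_shift:
  assumes C: "C \<in> carrier \<Gamma>" and u: "u \<in> hu C" and h: "h \<in> Inertia" and m: "m \<in> carrier M"
  shows "pr (u \<cdot> v h) (Phi f (tens u m)) = cscale B M (f h) (\<theta> h m)"
  unfolding tens_one_smult[OF hu_A[OF C u] m] module_homD(3)[OF Phi_hom hu_A[OF C u] one_tens_W[OF m]]
    pr_smult[OF C Inertia_\<Gamma>[OF h] u v[OF h] Phi_closed[OF one_tens_W[OF m]]] by (rule Phi_pr[OF h m])

lemma Phi_pr_shift_other:
  assumes C: "C \<in> carrier \<Gamma>" "C' \<in> carrier \<Gamma>" and u: "u \<in> hu C" and x: "x \<in> hu C'"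
    and ne: "inv\<^bsub>\<Gamma>\<^esub> C \<star> C' \<notin> Inertia" and m: "m \<in> carrier M"
  shows "pr x (Phi f (tens u m)) = \<zero>\<^bsub>M\<^esub>"
proof -
  note Ci = \<Gamma>.inv_closed[OF C(1)] note CC = \<Gamma>.m_closed[OF Ci C(2)]
  have y: "inv\<^bsub>A\<^esub> u \<cdot> x \<in> hu (inv\<^bsub>\<Gamma>\<^esub> C \<star> C')" by (rule hu_mult[OF Ci C(2) hu_inv[OF C(1) u] x])
  have "x = u \<cdot> (inv\<^bsub>A\<^esub> u \<cdot> x)" by (rule hu_r_cancel[OF C(1) u hu_A[OF C(2) x], symmetric])
  then have "pr x (Phi f (tens u m)) = pr (u \<cdot> (inv\<^bsub>A\<^esub> u \<cdot> x)) (u \<odot>\<^bsub>W\<^esub> Phi f (tens \<one>\<^bsub>A\<^esub> m))"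
    unfolding tens_one_smult[OF hu_A[OF C(1) u] m] module_homD(3)[OF Phi_hom hu_A[OF C(1) u] one_tens_W[OF m]] by simp
  also have "\<dots> = pr (inv\<^bsub>A\<^esub> u \<cdot> x) (Phi f (tens \<one>\<^bsub>A\<^esub> m))"
    by (rule pr_smult[OF C(1) CC u y Phi_closed[OF one_tens_W[OF m]]])
  also have "\<dots> = \<zero>\<^bsub>M\<^esub>" by (rule Phi_pr_other[OF CC ne y m])
  finally show ?thesis .
qed

section \<open>Coordinates of the induced module over its endomorphism algebra\<close>

definition \<theta>' where "\<theta>' h = the_inv_into (carrier M) (\<theta> h)"

lemma \<theta>': assumes h: "h \<in> Inertia"
  shows "m \<in> carrier M ==> \<theta>' h m \<in> carrier M" "m \<in> carrier M ==> \<theta> h (\<theta>' h m) = m"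
    "m \<in> carrier M ==> \<theta>' h (\<theta> h m) = m"
    "m \<in> carrier M ==> n \<in> carrier M ==> \<theta>' h (m \<oplus>\<^bsub>M\<^esub> n) = \<theta>' h m \<oplus>\<^bsub>M\<^esub> \<theta>' h n"
    "m \<in> carrier M ==> \<theta>' h (cscale B M c m) = cscale B M c (\<theta>' h m)" "\<theta>' h \<zero>\<^bsub>M\<^esub> = \<zero>\<^bsub>M\<^esub>"
proof -
  have bij: "bij_betw (\<theta> h) (carrier M) (carrier (cj (v h) M))" using \<theta>_bij[OF h] by simp
  have hom: "\<theta>' h \<in> LinearCombinations.module_hom B (cj (v h) M) M"
    unfolding \<theta>'_def by (rule module_hom_inverse(1)[OF M.left_module_axioms \<theta>[OF h] bij])
  show "m \<in> carrier M ==> \<theta>' h m \<in> carrier M" using module_homD(1)[OF hom, of m] by simp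
  show "m \<in> carrier M ==> \<theta> h (\<theta>' h m) = m"
    unfolding \<theta>'_def by (rule f_the_inv_into_f_bij_betw[OF \<theta>_bij[OF h]])
  show "m \<in> carrier M ==> \<theta>' h (\<theta> h m) = m"
    unfolding \<theta>'_def by (rule the_inv_into_f_f[OF bij_betw_imp_inj_on[OF \<theta>_bij[OF h]]])
  show "m \<in> carrier M ==> n \<in> carrier M ==> \<theta>' h (m \<oplus>\<^bsub>M\<^esub> n) = \<theta>' h m \<oplus>\<^bsub>M\<^esub> \<theta>' h n"
    using module_homD(2)[OF hom, of m n] by simp
  show "m \<in> carrier M ==> \<theta>' h (cscale B M c m) = cscale B M c (\<theta>' h m)"
    using module_hom_cscale[OF B.Alg.complex_algebra_axioms hom, of m c] cscale_cj[OF Inertia_\<Gamma>[OF h] v[OF h]] by simp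
  show "\<theta>' h \<zero>\<^bsub>M\<^esub> = \<zero>\<^bsub>M\<^esub>"
    using module_hom_zero[OF left_module_cj[OF M.left_module_axioms Inertia_\<Gamma>[OF h] v[OF h]] M.left_module_axioms hom] by simp
qed

lemma sv_hu: "l < r ==> h \<in> Inertia ==> s l \<cdot> v h \<in> hu (\<gamma>s ! l \<star> h)"
  by (rule hu_mult[OF \<gamma>s(2) Inertia_\<Gamma> \<gamma>s(3) v])

lemma sv_\<Gamma>: "l < r ==> h \<in> Inertia ==> \<gamma>s ! l \<star> h \<in> carrier \<Gamma>"
  by (rule \<Gamma>.m_closed[OF \<gamma>s(2) Inertia_\<Gamma>])

text \<open>The coordinate of \<open>w\<close> at \<open>wl l\<close>, an element of the twisted
  group algebra of the stabiliser. Its coefficient at \<open>h\<close> sits in the component of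
  degree \<open>\<gamma>s ! l \<star> h\<close>: undoing \<open>\<theta> h\<close> there leaves a
  vector of \<open>M\<close>, whose coordinate at \<open>b l\<close> is taken.\<close>

definition cf where
  "cf l w = (\<lambda>h. if h \<in> Inertia then \<kappa> l (\<theta>' h (pr (s l \<cdot> v h) w)) else 0)"

lemma cf_X [simp]: "cf l w \<in> carrier X"
  by (simp add: cf_def TGA_simps)

lemma cf_add:
  assumes l: "l < r" and w: "w \<in> carrier W" "w' \<in> carrier W"
  shows "cf l (w \<oplus>\<^bsub>W\<^esub> w') = cf l w \<oplus>\<^bsub>X\<^esub> cf l w'"
proof
  fix h show "cf l (w \<oplus>\<^bsub>W\<^esub> w') h = (cf l w \<oplus>\<^bsub>X\<^esub> cf l w') h"
  proof (cases "h \<in> Inertia")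
    case True
    note p = pr_closed[OF sv_\<Gamma>[OF l True] sv_hu[OF l True]]
    have "\<kappa> l (\<theta>' h (pr (s l \<cdot> v h) (w \<oplus>\<^bsub>W\<^esub> w')))
        = \<kappa> l (\<theta>' h (pr (s l \<cdot> v h) w)) + \<kappa> l (\<theta>' h (pr (s l \<cdot> v h) w'))"
      unfolding pr_add[OF sv_\<Gamma>[OF l True] sv_hu[OF l True] w] \<theta>'(4)[OF True p[OF w(1)] p[OF w(2)]]
      by (rule coord_systemD(3)[OF coord[OF \<gamma>s(1)[OF l]] _ \<theta>'(1)[OF True p[OF w(1)]] \<theta>'(1)[OF True p[OF w(2)]]])
        (use l in simp)
    then show ?thesis using True by (simp add: cf_def TGA_simps)
  qed (simp add: cf_def TGA_simps)
qed

lemma cf_cscale: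
  assumes l: "l < r" and w: "w \<in> carrier W"
  shows "cf l (cscale A W c w) = c \<odot>\<^bsub>X\<^esub> cf l w"
proof
  fix h show "cf l (cscale A W c w) h = (c \<odot>\<^bsub>X\<^esub> cf l w) h"
  proof (cases "h \<in> Inertia")
    case True
    note p = pr_closed[OF sv_\<Gamma>[OF l True] sv_hu[OF l True] w]
    have "\<kappa> l (\<theta>' h (pr (s l \<cdot> v h) (cscale A W c w))) = c * \<kappa> l (\<theta>' h (pr (s l \<cdot> v h) w))"
      unfolding pr_cscale[OF sv_\<Gamma>[OF l True] sv_hu[OF l True] w] \<theta>'(5)[OF True p]
      by (rule coord_systemD(4)[OF coord[OF \<gamma>s(1)[OF l]] _ \<theta>'(1)[OF True p]]) (use l in simp)
    then show ?thesis using True by (simp add: cf_def TGA_simps)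
  qed (simp add: cf_def TGA_simps)
qed

lemma cf_finsum:
  assumes "l < r" "\<And>i. i \<in> J ==> x i \<in> carrier W"
  shows "cf l (finsum W x J) = finsum X (\<lambda>i. cf l (x i)) J"
  by (rule additive_finsum[OF T.abelian_group_W X.A.is_abelian_group]) (use assms cf_add in simp_all)

text \<open>Positions with the same entry are separated by the dual basis of \<open>M\<close>,
  positions with different entries by the degree, as distinct elements of the transversal lie in
  distinct cosets of the stabiliser.\<close>

lemma cf_Phi_wl:
  assumes l: "l < r" and k: "k < r" and f: "f \<in> carrier X"
  shows "cf l (Phi f (wl k)) = (if k = l then f else \<zero>\<^bsub>X\<^esub>)"
proof
  fix h show "cf l (Phi f (wl k)) h = (if k = l then f else \<zero>\<^bsub>X\<^esub>) h"
  proof (cases "h \<in> Inertia")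
    case h: True
    note co = coord_systemD[OF coord[OF \<gamma>s(1)[OF l]]]
    have "\<kappa> l (\<theta>' h (pr (s l \<cdot> v h) (Phi f (wl k)))) = (if k = l then f h else 0)"
    proof (cases "\<gamma>s ! k = \<gamma>s ! l")
      case True
      have 1: "pr (s l \<cdot> v h) (Phi f (wl k)) = cscale B M (f h) (\<theta> h (b k))"
        using Phi_pr_shift[OF \<gamma>s(2,3)[OF l] h b_M[OF k], of f] unfolding True .
      have "\<kappa> l (\<theta>' h (pr (s l \<cdot> v h) (Phi f (wl k)))) = \<kappa> l (cscale B M (f h) (b k))"
        unfolding 1 \<theta>'(5)[OF h \<theta>_closed[OF h b_M[OF k]]] \<theta>'(3)[OF h b_M[OF k]] ..
      also have "\<dots> = f h * \<kappa> l (b k)" by (rule co(4)) (use l k b_M in simp_all)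
      also have "\<kappa> l (b k) = (if l = k then 1 else 0)" by (rule co(5)) (use l k True in simp_all)
      finally show ?thesis by simp
    next
      case False
      have "inv\<^bsub>\<Gamma>\<^esub> (\<gamma>s ! k) \<star> (\<gamma>s ! l \<star> h) \<notin> Inertia" (is "?h \<notin> _")
      proof
        assume h': "?h \<in> Inertia"
        have "\<gamma>s ! k \<star> ?h = \<gamma>s ! l \<star> h"
          using \<Gamma>.m_assoc[OF \<gamma>s(2)[OF k] \<Gamma>.inv_closed[OF \<gamma>s(2)[OF k]] sv_\<Gamma>[OF l h]]
            \<Gamma>.r_inv[OF \<gamma>s(2)[OF k]] \<Gamma>.l_one[OF sv_\<Gamma>[OF l h]] by simp
        then show False using T_unique[OF \<gamma>s(1)[OF k] \<gamma>s(1)[OF l] h' h] False by simp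
      qed
      then have z: "pr (s l \<cdot> v h) (Phi f (wl k)) = \<zero>\<^bsub>M\<^esub>"
        by (rule Phi_pr_shift_other[OF \<gamma>s(2)[OF k] sv_\<Gamma>[OF l h] \<gamma>s(3)[OF k] sv_hu[OF l h] _ b_M[OF k]])
      have "\<kappa> l \<zero>\<^bsub>M\<^esub> = 0" by (rule M.coord_zero[OF coord[OF \<gamma>s(1)[OF l]]]) (use l in simp)
      then show ?thesis using z \<theta>'(6)[OF h] False by auto
    qed
    then show ?thesis using h by (simp add: cf_def TGA_simps)
  next
    case False
    then show ?thesis using f by (simp add: cf_def TGA_simps)
  qed
qed

lemma cf_unique:
  assumes l: "l < r" and Y: "\<And>k. k < r ==> Y k \<in> carrier X"
  shows "cf l (finsum W (\<lambda>k. Phi (Y k) (wl k)) {..<r}) = Y l"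
proof -
  have "cf l (finsum W (\<lambda>k. Phi (Y k) (wl k)) {..<r}) = finsum X (\<lambda>k. cf l (Phi (Y k) (wl k))) {..<r}"
    by (rule cf_finsum[OF l]) (use wl_W in simp)
  also have "\<dots> = cf l (Phi (Y l) (wl l))"
    by (rule finsum_single[OF X.A.is_abelian_group]) (use l Y[OF l] cf_Phi_wl[OF l _ Y] in simp_all)
  also have "\<dots> = Y l" using cf_Phi_wl[OF l l Y[OF l]] by simp
  finally show ?thesis .
qed

text \<open>Together with \<open>cf_unique\<close>, \<open>W\<close> is free over the endomorphism
  algebra on the \<open>wl l\<close>. The two sides are compared one degree at a time, the degree
  being written as \<open>t \<star> h\<close> with \<open>t\<close> in the transversal and
  \<open>h\<close> in the stabiliser.\<close>

lemma cf_expand: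
  assumes w: "w \<in> carrier W" shows "w = finsum W (\<lambda>k. Phi (cf k w) (wl k)) {..<r}"
proof -
  have "\<exists>u. u \<in> hu C \<and> pr u w = pr u (finsum W (\<lambda>k. Phi (cf k w) (wl k)) {..<r})" if C: "C \<in> carrier \<Gamma>" for C
  proof -
    obtain t h where t: "t \<in> T" and h: "h \<in> Inertia" and Cth: "C = t \<star> h" using C by (rule T_ex)
    note tG = T_\<Gamma>[OF t]
    let ?u = "homu t \<cdot> v h"
    have u: "?u \<in> hu C" unfolding Cth by (rule hu_mult[OF tG Inertia_\<Gamma>[OF h] homu[OF tG] v[OF h]])
    define m where "m = \<theta>' h (pr ?u w)"
    have m: "m \<in> carrier M" unfolding m_def by (rule \<theta>'(1)[OF h pr_closed[OF C u w]])
    note co = coord[OF t]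
    have trm: "pr ?u (Phi (cf k w) (wl k)) = (if \<gamma>s ! k = t then \<theta> h (cscale B M (\<kappa> k m) (b k)) else \<zero>\<^bsub>M\<^esub>)"
      if k: "k < r" for k
    proof (cases "\<gamma>s ! k = t")
      case True
      have "pr ?u (Phi (cf k w) (wl k)) = cscale B M (cf k w h) (\<theta> h (b k))"
        using Phi_pr_shift[OF \<gamma>s(2,3)[OF k] h b_M[OF k], of "cf k w"] unfolding True .
      also have "cf k w h = \<kappa> k m" using h True by (simp add: cf_def m_def)
      also have "cscale B M (\<kappa> k m) (\<theta> h (b k)) = \<theta> h (cscale B M (\<kappa> k m) (b k))"
        using module_hom_cscale[OF B.Alg.complex_algebra_axioms \<theta>[OF h] b_M[OF k], of "\<kappa> k m"]
          cscale_cj[OF Inertia_\<Gamma>[OF h] v[OF h]] by simp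
      finally show ?thesis using True by simp
    next
      case False
      have "inv\<^bsub>\<Gamma>\<^esub> (\<gamma>s ! k) \<star> C \<notin> Inertia" (is "?h \<notin> _")
      proof
        assume h': "?h \<in> Inertia"
        have "\<gamma>s ! k \<star> ?h = C"
          using \<Gamma>.m_assoc[OF \<gamma>s(2)[OF k] \<Gamma>.inv_closed[OF \<gamma>s(2)[OF k]] C] \<Gamma>.r_inv[OF \<gamma>s(2)[OF k]] \<Gamma>.l_one[OF C] by simp
        then show False using T_unique[OF \<gamma>s(1)[OF k] t h' h] Cth False by simp
      qed
      then show ?thesis using Phi_pr_shift_other[OF \<gamma>s(2)[OF k] C \<gamma>s(3)[OF k] u _ b_M[OF k]] False by simp
    qed
    have cl: "\<theta> h (cscale B M (\<kappa> k m) (b k)) \<in> carrier M" if "k < r" for k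
      using \<theta>_closed[OF h M.cscale_closed[OF b_M[OF that]]] .
    have "pr ?u (finsum W (\<lambda>k. Phi (cf k w) (wl k)) {..<r}) = finsum M (\<lambda>k. pr ?u (Phi (cf k w) (wl k))) {..<r}"
      by (rule pr_finsum[OF C u]) (use wl_W in simp)
    \<comment> \<open>Only positions with entry \<open>t\<close> contribute, and they run through a
      basis of \<open>M\<close>.\<close>
    also have "\<dots> = finsum M (\<lambda>k. \<theta> h (cscale B M (\<kappa> k m) (b k))) (L t)"
      by (rule M.M.add.finprod_mono_neutral_cong_left[symmetric]) (use trm cl in auto)
    also have "\<dots> = \<theta> h (finsum M (\<lambda>k. cscale B M (\<kappa> k m) (b k)) (L t))"
      by (rule additive_finsum[OF M.M.abelian_group_axioms M.M.abelian_group_axioms, symmetric])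
        (use h b_M \<theta>_add in auto)
    also have "finsum M (\<lambda>k. cscale B M (\<kappa> k m) (b k)) (L t) = m"
      by (rule coord_systemD(6)[OF co m, symmetric])
    also have "\<theta> h m = pr ?u w" unfolding m_def by (rule \<theta>'(2)[OF h pr_closed[OF C u w]])
    finally have "pr ?u w = pr ?u (finsum W (\<lambda>k. Phi (cf k w) (wl k)) {..<r})" by (rule sym)
    then show ?thesis using u by blast
  qed
  then have "\<forall>C\<in>carrier \<Gamma>. \<exists>u. u \<in> hu C \<and> pr u w = pr u (finsum W (\<lambda>k. Phi (cf k w) (wl k)) {..<r})"
    by (rule ballI)
  from bchoice[OF this] obtain u where u': "\<forall>C\<in>carrier \<Gamma>. u C \<in> hu C \<and>
      pr (u C) w = pr (u C) (finsum W (\<lambda>k. Phi (cf k w) (wl k)) {..<r})" by (rule exE)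
  note u = conjunct1[OF bspec[OF u']] conjunct2[OF bspec[OF u']]
  show ?thesis
  proof (rule W_eqI[OF w _ u])
    show "finsum W (\<lambda>k. Phi (cf k w) (wl k)) {..<r} \<in> carrier W"
      by (rule T.W.finsum_closed, rule Pi_I) (use wl_W in simp)
  qed
qed

text \<open>Acting with \<open>f\<close> multiplies every coordinate in the expansion of
  \<open>w\<close> by \<open>f\<close> on the right; uniqueness of coordinates does the
  rest.\<close>

lemma cf_Phi:
  assumes l: "l < r" and w: "w \<in> carrier W" and f: "f \<in> carrier X"
  shows "cf l (Phi f w) = cf l w \<otimes>\<^bsub>X\<^esub> f"
proof -
  have "Phi f w = Phi f (finsum W (\<lambda>k. Phi (cf k w) (wl k)) {..<r})" using cf_expand[OF w] by simp
  also have "\<dots> = finsum W (\<lambda>k. Phi f (Phi (cf k w) (wl k))) {..<r}"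
    by (rule additive_finsum[OF T.abelian_group_W T.abelian_group_W]) (use wl_W Phi_plus in simp_all)
  also have "\<dots> = finsum W (\<lambda>k. Phi (cf k w \<otimes>\<^bsub>X\<^esub> f) (wl k)) {..<r}"
    by (rule T.W.finsum_cong'[OF refl Pi_I]) (use Phi_mult[OF cf_X f] wl_W in simp_all)
  finally show ?thesis using cf_unique[OF l, of "\<lambda>k. cf k w \<otimes>\<^bsub>X\<^esub> f"] f by simp
qed

section \<open>The matrix representation of the summand\<close>

abbreviation Mat where "Mat \<equiv> matrix_algebra r X"

text \<open>Column \<open>l\<close> holds the coordinates of the image of \<open>wl l\<close> under
  \<open>a\<close>. The coordinates belong to an algebra acting from the right, hence products keep
  their order.\<close>

definition Psi where "Psi a = (\<lambda>(k, l)\<in>{..<r} \<times> {..<r}. cf k (a \<odot>\<^bsub>W\<^esub> wl l))"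

lemma Psi_apply: "k < r ==> l < r ==> Psi a (k, l) = cf k (a \<odot>\<^bsub>W\<^esub> wl l)"
  by (simp add: Psi_def)

lemma awl_W: "a \<in> carrier A ==> l < r ==> a \<odot>\<^bsub>W\<^esub> wl l \<in> carrier W"
  by (rule W.smult_closed[OF _ wl_W])

lemma wl_faithful:
  assumes a: "a \<in> CI.S" and z: "\<And>l. l < r ==> a \<odot>\<^bsub>W\<^esub> wl l = \<zero>\<^bsub>W\<^esub>"
  shows "a = \<zero>\<^bsub>A\<^esub>"
proof (rule S_faithful[OF a])
  fix w assume w: "w \<in> carrier W"
  note aA = CI.S_A[OF a]
  have "a \<odot>\<^bsub>W\<^esub> w = a \<odot>\<^bsub>W\<^esub> finsum W (\<lambda>k. Phi (cf k w) (wl k)) {..<r}" using cf_expand[OF w] by simp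
  also have "\<dots> = finsum W (\<lambda>k. a \<odot>\<^bsub>W\<^esub> Phi (cf k w) (wl k)) {..<r}"
    by (rule W.smult_finsum_right[OF _ aA]) (use wl_W in simp)
  also have "\<dots> = finsum W (\<lambda>k. \<zero>\<^bsub>W\<^esub>) {..<r}"
    by (rule T.W.finsum_cong'[OF refl Pi_I])
      (use module_homD(3)[OF Phi_hom aA wl_W, symmetric] z Phi_at_zero in simp_all)
  finally show "a \<odot>\<^bsub>W\<^esub> w = \<zero>\<^bsub>W\<^esub>" by simp
qed

text \<open>The source of surjectivity. For each degree \<open>C\<close> the density theorem over
  \<open>B\<close>, applied to the conjugates of \<open>M\<close> along the transversal, gives an
  element producing the coordinates of the targets in the degrees
  \<open>C \<star> \<gamma>s ! l\<close>; the units \<open>homu C\<close> move these elements into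
  their degrees.\<close>

lemma wl_targets:
  assumes y: "\<And>l. l < r ==> y l \<in> carrier W"
  shows "\<exists>a\<in>CI.S. \<forall>l<r. a \<odot>\<^bsub>W\<^esub> wl l = y l"
proof -
  have fT: "finite T" using finite_\<Gamma> T_\<Gamma> by (rule rev_finite_subset[OF _ subsetI])
  have Cl: "C \<star> \<gamma>s ! l \<in> carrier \<Gamma>" "homu C \<cdot> s l \<in> hu (C \<star> \<gamma>s ! l)" if "C \<in> carrier \<Gamma>" "l < r" for C l
    by (rule \<Gamma>.m_closed[OF that(1) \<gamma>s(2)[OF that(2)]], rule hu_mult[OF that(1) \<gamma>s(2)[OF that(2)] homu[OF that(1)] \<gamma>s(3)[OF that(2)]])
  \<comment> \<open>An isomorphism between the conjugates for \<open>t\<close> and \<open>t'\<close>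
    would put the quotient of \<open>t\<close> and \<open>t'\<close> into the stabiliser, so both
    would represent the same coset.\<close>
  have sep: "\<not> module_isomorphic B (cj (homu t) M) (cj (homu t') M)" if t: "t \<in> T" "t' \<in> T" "t \<noteq> t'" for t t'
  proof
    note g = T_\<Gamma>[OF t(1)] T_\<Gamma>[OF t(2)] and c0 = module_type_in_Irr[OF irr]
    note gi = \<Gamma>.inv_closed[OF g(1)]
    assume "module_isomorphic B (cj (homu t) M) (cj (homu t') M)"
    then have eq: "act t (module_type B M) = act t' (module_type B M)"
      unfolding act_module_type[OF irr g(1) homu[OF g(1)]] act_module_type[OF irr g(2) homu[OF g(2)]]
        module_type_eq_iff[OF irreducible_cj[OF irr g(1) homu[OF g(1)]] irreducible_cj[OF irr g(2) homu[OF g(2)]]] .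
    have "act (inv\<^bsub>\<Gamma>\<^esub> t \<star> t') (module_type B M) = module_type B M"
      unfolding act_mult[OF c0 gi g(2)] eq[symmetric] by (rule act_inv_eq[OF c0 g(1)])
    then have h: "inv\<^bsub>\<Gamma>\<^esub> t \<star> t' \<in> Inertia" unfolding Inertia_eq using \<Gamma>.m_closed[OF gi g(2)] by blast
    have "t \<star> (inv\<^bsub>\<Gamma>\<^esub> t \<star> t') = t' \<star> N"
      using \<Gamma>.m_assoc[OF g(1) gi g(2)] \<Gamma>.r_inv[OF g(1)] \<Gamma>.l_one[OF g(2)] g(2) by simp
    from T_unique[OF t(1,2) h N_Inertia this] show False using t(3) by blast
  qed
  have "\<exists>d\<in>carrier B. \<forall>l<r. (inv\<^bsub>A\<^esub> (s l) \<cdot> d \<cdot> s l) \<odot>\<^bsub>M\<^esub> b l = pr (homu C \<cdot> s l) (y l)"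
    if C: "C \<in> carrier \<Gamma>" for C
  proof -
    have "\<exists>d\<in>carrier B. \<forall>t\<in>T. \<forall>l\<in>L t. d \<odot>\<^bsub>cj (homu t) M\<^esub> b l = pr (homu C \<cdot> s l) (y l)"
    proof (rule density[OF B.Alg.complex_algebra_axioms fT])
      show "irreducible_module B (cj (homu t) M)" if "t \<in> T" for t
        by (rule irreducible_cj[OF irr T_\<Gamma>[OF that] homu[OF T_\<Gamma>[OF that]]])
      show "coord_system B (cj (homu t) M) (L t) b \<kappa>" if "t \<in> T" for t
        by (rule coord_system_cj[OF T_\<Gamma>[OF that] homu[OF T_\<Gamma>[OF that]] coord[OF that]])
      show "pr (homu C \<cdot> s l) (y l) \<in> carrier (cj (homu t) M)" if "l \<in> L t" for t l
        using pr_closed[OF Cl[OF C, of l] y[of l]] that by simp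
    qed (rule sep)
    then obtain d where d: "d \<in> carrier B" "\<forall>t\<in>T. \<forall>l\<in>L t. d \<odot>\<^bsub>cj (homu t) M\<^esub> b l = pr (homu C \<cdot> s l) (y l)" by blast
    have "(inv\<^bsub>A\<^esub> (s l) \<cdot> d \<cdot> s l) \<odot>\<^bsub>M\<^esub> b l = pr (homu C \<cdot> s l) (y l)" if l: "l < r" for l
      using bspec[OF bspec[OF d(2) \<gamma>s(1)[OF l]], of l] l by simp
    then show ?thesis using d(1) by blast
  qed
  then have "\<forall>C\<in>carrier \<Gamma>. \<exists>d. d \<in> carrier B \<and>
      (\<forall>l<r. (inv\<^bsub>A\<^esub> (s l) \<cdot> d \<cdot> s l) \<odot>\<^bsub>M\<^esub> b l = pr (homu C \<cdot> s l) (y l))"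
    unfolding Bex_def by (rule ballI)
  from bchoice[OF this] obtain d where d': "\<forall>C\<in>carrier \<Gamma>. d C \<in> carrier B \<and>
      (\<forall>l<r. (inv\<^bsub>A\<^esub> (s l) \<cdot> d C \<cdot> s l) \<odot>\<^bsub>M\<^esub> b l = pr (homu C \<cdot> s l) (y l))" by (rule exE)
  note d = conjunct1[OF bspec[OF d']] conjunct2[OF bspec[OF d'], rule_format]
  have ud: "homu C \<cdot> d C \<in> carrier A" if "C \<in> carrier \<Gamma>" for C
    by (rule A.m_closed[OF hu_A[OF that homu[OF that]] BA[OF d(1)[OF that]]])
  define a where "a = finsum A (\<lambda>C. homu C \<cdot> d C) (carrier \<Gamma>)"
  have aA: "a \<in> carrier A" unfolding a_def by (rule A.finsum_closed[OF Pi_I[OF ud]])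
  \<comment> \<open>Multiplication by \<open>e\<close> lands in the summand and does not change the
    action on \<open>W\<close>.\<close>
  have "(a \<cdot> e) \<odot>\<^bsub>W\<^esub> wl l = y l" if l: "l < r" for l
  proof -
    have "(a \<cdot> e) \<odot>\<^bsub>W\<^esub> wl l = a \<odot>\<^bsub>W\<^esub> wl l"
      unfolding W.smult_assoc[OF aA CI.eA wl_W[OF l]] e_W[OF wl_W[OF l]] ..
    also have "\<dots> = finsum W (\<lambda>C. (homu C \<cdot> d C) \<odot>\<^bsub>W\<^esub> wl l) (carrier \<Gamma>)"
      unfolding a_def by (rule W.smult_finsum_left[OF ud wl_W[OF l]])
    also have "\<dots> = finsum W (\<lambda>C. tens (homu C \<cdot> s l) (pr (homu C \<cdot> s l) (y l))) (carrier \<Gamma>)"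
    proof (rule T.W.finsum_cong'[OF refl Pi_I])
      fix C assume C: "C \<in> carrier \<Gamma>"
      note uA = hu_A[OF C homu[OF C]] and dA = BA[OF d(1)[OF C]] and sA = \<gamma>s(4)[OF l]
      note c = conj_B(1)[OF \<gamma>s(2,3)[OF l] d(1)[OF C]]
      show "tens (homu C \<cdot> s l) (pr (homu C \<cdot> s l) (y l)) \<in> carrier W"
        by (rule T.tens_closed[OF A.m_closed[OF uA sA] pr_closed[OF Cl[OF C l] y[OF l]]])
      have "s l \<cdot> (inv\<^bsub>A\<^esub> (s l) \<cdot> d C \<cdot> s l) = d C \<cdot> s l"
        using A.m_assoc[OF hu_inv_A[OF \<gamma>s(2,3)[OF l]] dA sA] hu_r_cancel[OF \<gamma>s(2,3)[OF l] A.m_closed[OF dA sA]] by simp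
      then have "(homu C \<cdot> d C) \<cdot> s l = (homu C \<cdot> s l) \<cdot> (inv\<^bsub>A\<^esub> (s l) \<cdot> d C \<cdot> s l)"
        using A.m_assoc[OF uA dA sA] A.m_assoc[OF uA sA BA[OF c]] by simp
      then show "(homu C \<cdot> d C) \<odot>\<^bsub>W\<^esub> wl l = tens (homu C \<cdot> s l) (pr (homu C \<cdot> s l) (y l))"
        using T.smult_tens[OF ud[OF C] sA b_M[OF l]] T.tens_balanced[OF A.m_closed[OF uA sA] c b_M[OF l]] d(2)[OF C l] by simp
    qed
    also have "\<dots> = y l"
    proof (rule W_eqI)
      note gi = \<Gamma>.inv_closed[OF \<gamma>s(2)[OF l]]
      \<comment> \<open>The products \<open>homu C' \<cdot> s l\<close> supply a unit in every
        degree. Testing coordinates with exactly these units leaves a single term of the sum, the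
        one with \<open>C'\<close> equal to \<open>C\<close> times the inverse of
        \<open>\<gamma>s ! l\<close>.\<close>
      let ?u = "\<lambda>C. homu (C \<star> inv\<^bsub>\<Gamma>\<^esub> (\<gamma>s ! l)) \<cdot> s l"
      have tW: "tens (homu C \<cdot> s l) (pr (homu C \<cdot> s l) (y l)) \<in> carrier W" if C: "C \<in> carrier \<Gamma>" for C
        by (rule T.tens_closed[OF hu_A[OF Cl[OF C l]] pr_closed[OF Cl[OF C l] y[OF l]]])
      show "finsum W (\<lambda>C. tens (homu C \<cdot> s l) (pr (homu C \<cdot> s l) (y l))) (carrier \<Gamma>) \<in> carrier W"
        by (rule T.W.finsum_closed[OF Pi_I[OF tW]])
      show "y l \<in> carrier W" by (rule y[OF l])
      fix C assume C: "C \<in> carrier \<Gamma>"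
      note C' = \<Gamma>.m_closed[OF C gi]
      have CC: "C \<star> inv\<^bsub>\<Gamma>\<^esub> (\<gamma>s ! l) \<star> \<gamma>s ! l = C"
        using \<Gamma>.m_assoc[OF C gi \<gamma>s(2)[OF l]] \<Gamma>.l_inv[OF \<gamma>s(2)[OF l]] \<Gamma>.r_one[OF C] by simp
      show u: "?u C \<in> hu C" using Cl(2)[OF C' l] unfolding CC .
      have "pr (?u C) (finsum W (\<lambda>C. tens (homu C \<cdot> s l) (pr (homu C \<cdot> s l) (y l))) (carrier \<Gamma>))
          = finsum M (\<lambda>C'. pr (?u C) (tens (homu C' \<cdot> s l) (pr (homu C' \<cdot> s l) (y l)))) (carrier \<Gamma>)"
        by (rule pr_finsum[OF C u tW])
      also have "\<dots> = pr (?u C) (tens (?u C) (pr (?u C) (y l)))"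
      proof (rule finsum_single[OF M.M.abelian_group_axioms finite_\<Gamma> C'])
        show "pr (?u C) (tens (?u C) (pr (?u C) (y l))) \<in> carrier M" by (rule pr_closed[OF C u tW[OF C']])
        fix C'' assume C'': "C'' \<in> carrier \<Gamma>" "C'' \<noteq> C \<star> inv\<^bsub>\<Gamma>\<^esub> (\<gamma>s ! l)"
        have "C \<noteq> C'' \<star> \<gamma>s ! l"
          using C''(2) \<Gamma>.m_assoc[OF C''(1) \<gamma>s(2)[OF l] gi] \<Gamma>.r_inv[OF \<gamma>s(2)[OF l]] \<Gamma>.r_one[OF C''(1)] by auto
        then show "pr (?u C) (tens (homu C'' \<cdot> s l) (pr (homu C'' \<cdot> s l) (y l))) = \<zero>\<^bsub>M\<^esub>"
          by (rule pr_tens_other[OF C Cl(1)[OF C''(1) l] _ u Cl(2)[OF C''(1) l] pr_closed[OF Cl[OF C''(1) l] y[OF l]]])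
      qed
      also have "\<dots> = pr (?u C) (y l)" by (rule pr_tens_same[OF C u pr_closed[OF C u y[OF l]]])
      finally show "pr (?u C) (finsum W (\<lambda>C. tens (homu C \<cdot> s l) (pr (homu C \<cdot> s l) (y l))) (carrier \<Gamma>))
          = pr (?u C) (y l)" .
    qed
    finally show ?thesis .
  qed
  then show ?thesis using CI.mult_e_S[OF aA] by blast
qed

lemma Mat_simps:
  "carrier Mat = ({..<r} \<times> {..<r}) \<rightarrow>\<^sub>E carrier X"
  "P \<otimes>\<^bsub>Mat\<^esub> Q = (\<lambda>(i, j)\<in>{..<r} \<times> {..<r}. \<Oplus>\<^bsub>X\<^esub>k\<in>{..<r}. P (i, k) \<otimes>\<^bsub>X\<^esub> Q (k, j))"
  "\<one>\<^bsub>Mat\<^esub> = (\<lambda>(i, j)\<in>{..<r} \<times> {..<r}. if i = j then \<one>\<^bsub>X\<^esub> else \<zero>\<^bsub>X\<^esub>)"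
  "\<zero>\<^bsub>Mat\<^esub> = (\<lambda>p\<in>{..<r} \<times> {..<r}. \<zero>\<^bsub>X\<^esub>)" "P \<oplus>\<^bsub>Mat\<^esub> Q = (\<lambda>p\<in>{..<r} \<times> {..<r}. P p \<oplus>\<^bsub>X\<^esub> Q p)"
  "c \<odot>\<^bsub>Mat\<^esub> P = (\<lambda>p\<in>{..<r} \<times> {..<r}. c \<odot>\<^bsub>X\<^esub> P p)"
  by (simp_all add: matrix_algebra_def)

lemma Psi_ext: "Psi a \<in> extensional ({..<r} \<times> {..<r})"
  unfolding Psi_def by (rule restrict_extensional)

lemma Psi_eqI:
  assumes "Q \<in> extensional ({..<r} \<times> {..<r})" "\<And>k l. k < r ==> l < r ==> cf k (a \<odot>\<^bsub>W\<^esub> wl l) = Q (k, l)"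
  shows "Psi a = Q"
proof (rule extensionalityI[OF Psi_ext assms(1)])
  fix p assume "p \<in> {..<r} \<times> {..<r}"
  then obtain k l where "p = (k, l)" "k < r" "l < r" by blast
  then show "Psi a p = Q p" using assms(2) Psi_apply by simp
qed

lemma Psi_mult:
  assumes a: "a \<in> carrier A" "a' \<in> carrier A" shows "Psi (a \<cdot> a') = Psi a \<otimes>\<^bsub>Mat\<^esub> Psi a'"
proof (rule Psi_eqI)
  show "Psi a \<otimes>\<^bsub>Mat\<^esub> Psi a' \<in> extensional ({..<r} \<times> {..<r})" unfolding Mat_simps by (rule restrict_extensional)
  fix i l assume il: "i < r" "l < r"
  note w = awl_W[OF a(2) il(2)]
  have "(a \<cdot> a') \<odot>\<^bsub>W\<^esub> wl l = a \<odot>\<^bsub>W\<^esub> finsum W (\<lambda>k. Phi (cf k (a' \<odot>\<^bsub>W\<^esub> wl l)) (wl k)) {..<r}"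
    using W.smult_assoc[OF a wl_W[OF il(2)]] cf_expand[OF w] by simp
  also have "\<dots> = finsum W (\<lambda>k. a \<odot>\<^bsub>W\<^esub> Phi (cf k (a' \<odot>\<^bsub>W\<^esub> wl l)) (wl k)) {..<r}"
    by (rule W.smult_finsum_right[OF _ a(1)]) (use wl_W in simp)
  also have "\<dots> = finsum W (\<lambda>k. Phi (cf k (a' \<odot>\<^bsub>W\<^esub> wl l)) (a \<odot>\<^bsub>W\<^esub> wl k)) {..<r}"
    by (rule T.W.finsum_cong'[OF refl Pi_I]) (use W.smult_closed[OF a(1)] wl_W module_homD(3)[OF Phi_hom a(1) wl_W] in simp_all)
  finally have "cf i ((a \<cdot> a') \<odot>\<^bsub>W\<^esub> wl l) = cf i (finsum W (\<lambda>k. Phi (cf k (a' \<odot>\<^bsub>W\<^esub> wl l)) (a \<odot>\<^bsub>W\<^esub> wl k)) {..<r})"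
    by simp
  also have "\<dots> = finsum X (\<lambda>k. cf i (Phi (cf k (a' \<odot>\<^bsub>W\<^esub> wl l)) (a \<odot>\<^bsub>W\<^esub> wl k))) {..<r}"
    by (rule cf_finsum[OF il(1)]) (use awl_W[OF a(1)] in simp)
  also have "\<dots> = finsum X (\<lambda>k. Psi a (i, k) \<otimes>\<^bsub>X\<^esub> Psi a' (k, l)) {..<r}"
    by (rule X.A.finsum_cong'[OF refl Pi_I])
      (use cf_Phi[OF il(1) awl_W[OF a(1)] cf_X] il in \<open>simp_all add: Psi_apply\<close>)
  finally show "cf i ((a \<cdot> a') \<odot>\<^bsub>W\<^esub> wl l) = (Psi a \<otimes>\<^bsub>Mat\<^esub> Psi a') (i, l)" using il by (simp add: Mat_simps)
qed

lemma smult_conv_cscale: "a \<in> carrier A ==> w \<in> carrier W ==> (c \<odot>\<^bsub>A\<^esub> a) \<odot>\<^bsub>W\<^esub> w = cscale A W c (a \<odot>\<^bsub>W\<^esub> w)"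
  using W.smult_assoc[OF Alg.scalar_closed[of c], of a w] Alg.scalar_mult_left[of a c] by (simp add: cscale_def)

lemma cf_zero: "k < r ==> cf k \<zero>\<^bsub>W\<^esub> = \<zero>\<^bsub>X\<^esub>"
  by (rule additive_zero[OF T.abelian_group_W X.A.is_abelian_group]) (use cf_add in simp_all)

lemma Psi_bij: "algebra_bij Psi CI.SA Mat"
  unfolding algebra_bij_def bij_betw_def CI.SA_one
proof (intro conjI ballI allI)
  show "inj_on Psi (carrier CI.SA)"
  proof (rule inj_onI)
    fix a a' assume a: "a \<in> carrier CI.SA" "a' \<in> carrier CI.SA" and eq: "Psi a = Psi a'"
    have aA: "a \<in> carrier A" "a' \<in> carrier A" using a CI.S_A by simp_all
    have wl: "a \<odot>\<^bsub>W\<^esub> wl l = a' \<odot>\<^bsub>W\<^esub> wl l" if l: "l < r" for l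
    proof -
      have "a \<odot>\<^bsub>W\<^esub> wl l = finsum W (\<lambda>k. Phi (cf k (a \<odot>\<^bsub>W\<^esub> wl l)) (wl k)) {..<r}" by (rule cf_expand[OF awl_W[OF aA(1) l]])
      also have "\<dots> = finsum W (\<lambda>k. Phi (cf k (a' \<odot>\<^bsub>W\<^esub> wl l)) (wl k)) {..<r}"
      proof (rule T.W.finsum_cong'[OF refl Pi_I])
        fix k assume k: "k \<in> {..<r}"
        then show "Phi (cf k (a' \<odot>\<^bsub>W\<^esub> wl l)) (wl k) \<in> carrier W" using wl_W by simp
        have "cf k (a \<odot>\<^bsub>W\<^esub> wl l) = cf k (a' \<odot>\<^bsub>W\<^esub> wl l)"
          using Psi_apply[OF _ l, of k a] Psi_apply[OF _ l, of k a'] k eq by simp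
        then show "Phi (cf k (a \<odot>\<^bsub>W\<^esub> wl l)) (wl k) = Phi (cf k (a' \<odot>\<^bsub>W\<^esub> wl l)) (wl k)" by simp
      qed
      also have "\<dots> = a' \<odot>\<^bsub>W\<^esub> wl l" by (rule cf_expand[OF awl_W[OF aA(2) l], symmetric])
      finally show ?thesis .
    qed
    \<comment> \<open>Injectivity through faithfulness: the difference of \<open>a\<close> and
      \<open>a'\<close> lies in the summand and kills all the \<open>wl l\<close>.\<close>
    define d where "d = (- 1) \<odot>\<^bsub>A\<^esub> a'"
    have d: "d \<in> CI.S" unfolding d_def using a(2) by (intro sm_scale[OF CI.eA]) simp
    have "a \<oplus>\<^bsub>A\<^esub> d = \<zero>\<^bsub>A\<^esub>"
    proof (rule wl_faithful)
      show "a \<oplus>\<^bsub>A\<^esub> d \<in> CI.S" using a(1) d by (intro sm_add[OF CI.eA]) simp_all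
      fix l assume l: "l < r"
      have "(a \<oplus>\<^bsub>A\<^esub> d) \<odot>\<^bsub>W\<^esub> wl l = a' \<odot>\<^bsub>W\<^esub> wl l \<oplus>\<^bsub>W\<^esub> cscale A W (- 1) (a' \<odot>\<^bsub>W\<^esub> wl l)"
        using W.smult_l_distr[OF aA(1) CI.S_A[OF d] wl_W[OF l]] wl[OF l] smult_conv_cscale[OF aA(2) wl_W[OF l], of "- 1"]
        unfolding d_def by simp
      also have "\<dots> = \<zero>\<^bsub>W\<^esub>"
        unfolding W.minus_conv_cscale[OF awl_W[OF aA(2) l], symmetric] by (rule T.W.r_neg[OF awl_W[OF aA(2) l]])
      finally show "(a \<oplus>\<^bsub>A\<^esub> d) \<odot>\<^bsub>W\<^esub> wl l = \<zero>\<^bsub>W\<^esub>" .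
    qed
    then show "a = a'" unfolding d_def by (simp add: TGA_simps fun_eq_iff)
  qed
  show "Psi ` carrier CI.SA = carrier Mat"
  proof (intro equalityI subsetI)
    fix Q assume "Q \<in> Psi ` carrier CI.SA"
    then obtain a where "Q = Psi a" by blast
    then show "Q \<in> carrier Mat" unfolding Mat_simps by (auto simp: Psi_def PiE_def)
  next
    fix Q assume Q: "Q \<in> carrier Mat"
    have QX: "Q (k, l) \<in> carrier X" if "k < r" "l < r" for k l using Q that unfolding Mat_simps by (auto dest: PiE_mem)
    have "\<exists>a\<in>CI.S. \<forall>l<r. a \<odot>\<^bsub>W\<^esub> wl l = finsum W (\<lambda>k. Phi (Q (k, l)) (wl k)) {..<r}"
      by (rule wl_targets, rule T.W.finsum_closed, rule Pi_I) (use wl_W in simp)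
    then obtain a where a: "a \<in> CI.S" "\<And>l. l < r ==> a \<odot>\<^bsub>W\<^esub> wl l = finsum W (\<lambda>k. Phi (Q (k, l)) (wl k)) {..<r}" by blast
    have "Psi a = Q"
    proof (rule Psi_eqI)
      show "Q \<in> extensional ({..<r} \<times> {..<r})" using Q unfolding Mat_simps by (auto simp: PiE_def)
      show "cf k (a \<odot>\<^bsub>W\<^esub> wl l) = Q (k, l)" if "k < r" "l < r" for k l
        unfolding a(2)[OF that(2)] using cf_unique[OF that(1), of "\<lambda>k. Q (k, l)"] QX[OF _ that(2)] by simp
    qed
    then show "Q \<in> Psi ` carrier CI.SA" using a(1) by force
  qed
  show "Psi e = \<one>\<^bsub>Mat\<^esub>"
  proof (rule Psi_eqI)
    fix k l assume kl: "k < r" "l < r"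
    have "cf k (Phi \<one>\<^bsub>X\<^esub> (wl l)) = (if l = k then \<one>\<^bsub>X\<^esub> else \<zero>\<^bsub>X\<^esub>)" by (rule cf_Phi_wl[OF kl X.A.one_closed])
    then show "cf k (e \<odot>\<^bsub>W\<^esub> wl l) = \<one>\<^bsub>Mat\<^esub> (k, l)"
      unfolding e_W[OF wl_W[OF kl(2)]] Phi_one[OF wl_W[OF kl(2)]] using kl by (auto simp: Mat_simps)
  qed (simp add: Mat_simps)
  show "Psi \<zero>\<^bsub>CI.SA\<^esub> = \<zero>\<^bsub>Mat\<^esub>"
    by (rule Psi_eqI) (use wl_W cf_zero in \<open>simp_all add: Mat_simps\<close>)
  fix a a' c
  assume "a \<in> carrier CI.SA"
  then have aA: "a \<in> carrier A" using CI.S_A by simp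
  show "Psi (c \<odot>\<^bsub>CI.SA\<^esub> a) = c \<odot>\<^bsub>Mat\<^esub> Psi a"
    by (rule Psi_eqI)
      (use aA wl_W in \<open>simp_all add: Mat_simps Psi_apply smult_conv_cscale cf_cscale awl_W\<close>)
  assume "a' \<in> carrier CI.SA"
  then have aA': "a' \<in> carrier A" using CI.S_A by simp
  show "Psi (a \<otimes>\<^bsub>CI.SA\<^esub> a') = Psi a \<otimes>\<^bsub>Mat\<^esub> Psi a'" using Psi_mult[OF aA aA'] by simp
  show "Psi (a \<oplus>\<^bsub>CI.SA\<^esub> a') = Psi a \<oplus>\<^bsub>Mat\<^esub> Psi a'"
    by (rule Psi_eqI)
      (use aA aA' wl_W in \<open>simp_all add: Mat_simps Psi_apply W.smult_l_distr cf_add awl_W\<close>)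
qed

end

section \<open>Degrees of the matrix entries\<close>

context mackey_matrix
begin

abbreviation MatD where "MatD \<equiv> induced_grading \<Gamma> \<gamma>s X XD"

text \<open>A vector of degree \<open>C\<close> has a nonzero coefficient at \<open>h\<close> only
  if \<open>\<gamma>s ! k \<star> h\<close> is \<open>C\<close>, which determines
  \<open>h\<close>.\<close>

lemma cf_XD:
  assumes C: "C \<in> carrier \<Gamma>" and w: "w \<in> comp C" and k: "k < r"
  shows "cf k w \<in> XD (inv\<^bsub>\<Gamma>\<^esub> (\<gamma>s ! k) \<star> C)"
  unfolding XD_iff
proof (intro conjI allI impI cf_X)
  fix h assume ne: "h \<noteq> inv\<^bsub>\<Gamma>\<^esub> (\<gamma>s ! k) \<star> C"
  note kG = \<gamma>s(2)[OF k]
  show "cf k w h = 0"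
  proof (cases "h \<in> Inertia")
    case True
    have "C \<noteq> \<gamma>s ! k \<star> h"
      using ne \<Gamma>.m_assoc[OF \<Gamma>.inv_closed[OF kG] kG Inertia_\<Gamma>[OF True]] \<Gamma>.l_inv[OF kG] \<Gamma>.l_one[OF Inertia_\<Gamma>[OF True]]
      by auto
    then have "pr (s k \<cdot> v h) w = \<zero>\<^bsub>M\<^esub>"
      by (rule comp_pr_other[OF C sv_\<Gamma>[OF k True] _ sv_hu[OF k True] w])
    moreover have "\<kappa> k \<zero>\<^bsub>M\<^esub> = 0" by (rule M.coord_zero[OF coord[OF \<gamma>s(1)[OF k]]]) (use k in simp)
    ultimately show ?thesis using \<theta>'(6)[OF True] by (simp add: cf_def)
  qed (simp add: cf_def)
qed

lemma comp_add:
  assumes C: "C \<in> carrier \<Gamma>" and w: "w \<in> comp C" "w' \<in> comp C" shows "w \<oplus>\<^bsub>W\<^esub> w' \<in> comp C"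
proof -
  note u = homu[OF C]
  obtain m where m: "w = tens (homu C) m" "m \<in> carrier M" using w(1) unfolding comp_eq[OF C u] by blast
  obtain n where n: "w' = tens (homu C) n" "n \<in> carrier M" using w(2) unfolding comp_eq[OF C u] by blast
  show ?thesis
    unfolding m(1) n(1) comp_eq[OF C u] T.tens_add_right[OF hu_A[OF C u] m(2) n(2), symmetric]
    using M.M.a_closed[OF m(2) n(2)] by blast
qed

lemma XD_comp:
  assumes C: "C \<in> carrier \<Gamma>" and Y: "\<And>k. k < r ==> Y k \<in> XD (inv\<^bsub>\<Gamma>\<^esub> (\<gamma>s ! k) \<star> C)"
  shows "finsum W (\<lambda>k. Phi (Y k) (wl k)) {..<r} \<in> comp C"
proof (rule finsum_mem[OF T.abelian_group_W comp_W[OF C] comp_zero[OF C] comp_add[OF C]])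
  fix k assume "k \<in> {..<r}"
  then have k: "k < r" by simp
  note kG = \<gamma>s(2)[OF k] note ki = \<Gamma>.inv_closed[OF kG]
  have "\<gamma>s ! k \<star> (inv\<^bsub>\<Gamma>\<^esub> (\<gamma>s ! k) \<star> C) = C"
    using \<Gamma>.m_assoc[OF kG ki C] \<Gamma>.r_inv[OF kG] \<Gamma>.l_one[OF C] by simp
  then show "Phi (Y k) (wl k) \<in> comp C"
    using Phi_comp[OF \<Gamma>.m_closed[OF ki C] kG Y[OF k] wl_comp[OF k]] by simp
qed

text \<open>The component of \<open>a\<close> of degree \<open>C\<close> is the only one that moves
  \<open>wl l\<close> into degree \<open>C \<star> \<gamma>s ! l\<close>.\<close>

lemma pr_restr_wl:
  assumes a: "a \<in> carrier A" and C: "C \<in> carrier \<Gamma>" and l: "l < r" and x: "x \<in> hu (C \<star> \<gamma>s ! l)"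
  shows "pr x (restr C a \<odot>\<^bsub>W\<^esub> wl l) = pr x (a \<odot>\<^bsub>W\<^esub> wl l)"
proof -
  note lG = \<gamma>s(2)[OF l] note CC = \<Gamma>.m_closed[OF C lG]
  have "a \<odot>\<^bsub>W\<^esub> wl l = finsum A (\<lambda>C. restr C a) (carrier \<Gamma>) \<odot>\<^bsub>W\<^esub> wl l" using restr_decompose[OF a] by simp
  also have "\<dots> = finsum W (\<lambda>C. restr C a \<odot>\<^bsub>W\<^esub> wl l) (carrier \<Gamma>)"
    by (rule W.smult_finsum_left[OF restr_closed wl_W[OF l]])
  finally have "pr x (a \<odot>\<^bsub>W\<^esub> wl l) = finsum M (\<lambda>C. pr x (restr C a \<odot>\<^bsub>W\<^esub> wl l)) (carrier \<Gamma>)"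
    using pr_finsum[OF CC x, of "carrier \<Gamma>" "\<lambda>C. restr C a \<odot>\<^bsub>W\<^esub> wl l"] awl_W[OF restr_closed l] by simp
  also have "\<dots> = pr x (restr C a \<odot>\<^bsub>W\<^esub> wl l)"
  proof (rule finsum_single[OF M.M.abelian_group_axioms finite_\<Gamma> C])
    show "pr x (restr C a \<odot>\<^bsub>W\<^esub> wl l) \<in> carrier M" by (rule pr_closed[OF CC x awl_W[OF restr_closed[OF C] l]])
    fix C' assume C': "C' \<in> carrier \<Gamma>" "C' \<noteq> C"
    then have ne: "C' \<star> \<gamma>s ! l \<noteq> C \<star> \<gamma>s ! l" using C lG by simp
    show "pr x (restr C' a \<odot>\<^bsub>W\<^esub> wl l) = \<zero>\<^bsub>M\<^esub>"
      by (rule comp_pr_other[OF \<Gamma>.m_closed[OF C'(1) lG] CC ne x comp_smult[OF C'(1) lG restr_D[OF C'(1)] wl_comp[OF l]]])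
  qed
  finally show ?thesis by (rule sym)
qed

text \<open>An element of degree \<open>\<gamma>\<close> moves \<open>wl l\<close> into degree
  \<open>\<gamma> \<star> \<gamma>s ! l\<close>, which by \<open>cf_XD\<close> gives the entry at
  \<open>(k, l)\<close> the degree that \<open>induced_grading\<close> asks for. Conversely, such
  entries confine the image of \<open>wl l\<close> to that degree.\<close>

lemma MatD_eq:
  assumes \<gamma>: "\<gamma> \<in> carrier \<Gamma>" shows "MatD \<gamma> = Psi ` (CI.S \<inter> D \<gamma>)"
proof (intro equalityI subsetI)
  fix Q assume "Q \<in> Psi ` (CI.S \<inter> D \<gamma>)"
  then obtain a where a: "Q = Psi a" "a \<in> CI.S" "a \<in> D \<gamma>" by blast
  have "Psi ` carrier CI.SA = carrier Mat" using Psi_bij unfolding algebra_bij_def bij_betw_def by blast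
  then have QM: "Q \<in> carrier Mat" using a(1,2) by auto
  show "Q \<in> MatD \<gamma>"
    unfolding induced_grading_def
  proof (intro CollectI conjI allI impI QM)
    fix k l assume k: "k < r" and l: "l < r"
    note lG = \<gamma>s(2)[OF l] and ki = \<Gamma>.inv_closed[OF \<gamma>s(2)[OF k]]
    show "Q (k, l) \<in> XD (inv\<^bsub>\<Gamma>\<^esub> (\<gamma>s ! k) \<star> \<gamma> \<star> \<gamma>s ! l)"
      unfolding a(1) Psi_apply[OF k l] \<Gamma>.m_assoc[OF ki \<gamma> lG]
      by (rule cf_XD[OF \<Gamma>.m_closed[OF \<gamma> lG] comp_smult[OF \<gamma> lG a(3) wl_comp[OF l]] k])
  qed
next
  fix Q assume "Q \<in> MatD \<gamma>"
  then have Q: "Q \<in> carrier Mat"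
    and QD: "\<And>k l. k < r ==> l < r ==> Q (k, l) \<in> XD (inv\<^bsub>\<Gamma>\<^esub> (\<gamma>s ! k) \<star> \<gamma> \<star> \<gamma>s ! l)"
    unfolding induced_grading_def by simp_all
  have "Psi ` carrier CI.SA = carrier Mat" using Psi_bij unfolding algebra_bij_def bij_betw_def by blast
  then obtain a where a: "Q = Psi a" "a \<in> CI.S" using Q by auto
  note aA = CI.S_A[OF a(2)]
  have awl: "a \<odot>\<^bsub>W\<^esub> wl l \<in> comp (\<gamma> \<star> \<gamma>s ! l)" if l: "l < r" for l
  proof -
    note lG = \<gamma>s(2)[OF l]
    have "cf k (a \<odot>\<^bsub>W\<^esub> wl l) \<in> XD (inv\<^bsub>\<Gamma>\<^esub> (\<gamma>s ! k) \<star> (\<gamma> \<star> \<gamma>s ! l))" if k: "k < r" for k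
      using QD[OF k l] unfolding a(1) Psi_apply[OF k l] \<Gamma>.m_assoc[OF \<Gamma>.inv_closed[OF \<gamma>s(2)[OF k]] \<gamma> lG] .
    from XD_comp[OF \<Gamma>.m_closed[OF \<gamma> lG] this] show ?thesis using cf_expand[OF awl_W[OF aA l]] by simp
  qed
  \<comment> \<open>The component of \<open>a\<close> of another degree \<open>C\<close> sends
    \<open>wl l\<close> into degree \<open>C \<star> \<gamma>s ! l\<close>, where the image of
    \<open>wl l\<close> under \<open>a\<close> has no part; by faithfulness it vanishes.\<close>
  have z: "restr C a = \<zero>\<^bsub>A\<^esub>" if C: "C \<in> carrier \<Gamma>" "C \<noteq> \<gamma>" for C
  proof (rule wl_faithful[OF CI.S_restr[OF C(1) a(2)]])
    fix l assume l: "l < r"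
    note lG = \<gamma>s(2)[OF l] note CC = \<Gamma>.m_closed[OF C(1) lG]
    note x = homu[OF CC]
    have ne: "\<gamma> \<star> \<gamma>s ! l \<noteq> C \<star> \<gamma>s ! l" using C \<gamma> lG by simp
    have "pr (homu (C \<star> \<gamma>s ! l)) (restr C a \<odot>\<^bsub>W\<^esub> wl l) = \<zero>\<^bsub>M\<^esub>"
      unfolding pr_restr_wl[OF aA C(1) l x]
      by (rule comp_pr_other[OF \<Gamma>.m_closed[OF \<gamma> lG] CC ne x awl[OF l]])
    then show "restr C a \<odot>\<^bsub>W\<^esub> wl l = \<zero>\<^bsub>W\<^esub>"
      using comp_pr[OF CC x comp_smult[OF C(1) lG restr_D[OF C(1), of a] wl_comp[OF l]]] T.tens_zero_right[OF hu_A[OF CC x]]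
      by simp
  qed
  have "a = finsum A (\<lambda>C. restr C a) (carrier \<Gamma>)" by (rule restr_decompose[OF aA])
  also have "\<dots> = restr \<gamma> a" by (rule finsum_single[OF abelian_group_A finite_\<Gamma> \<gamma>]) (use \<gamma> z in simp_all)
  finally have "a = restr \<gamma> a" .
  then have "a \<in> D \<gamma>" using restr_D[OF \<gamma>, of a] by simp
  then show "Q \<in> Psi ` (CI.S \<inter> D \<gamma>)" unfolding a(1) using a(2) by (intro imageI IntI)
qed

lemma summand_equivalent:
  "graded_equivalent \<Gamma> CI.SA (\<lambda>C. CI.S \<inter> D C) \<Gamma> Mat MatD"
proof -
  have iso: "graded_isomorphic \<Gamma> CI.SA (\<lambda>C. CI.S \<inter> D C) Mat MatD"
    by (rule graded_isomorphic_transport[OF Psi_bij CI.complex_algebra_SA CI.S_graded_algebra MatD_eq])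
  have "(\<lambda>x. x) \<in> iso \<Gamma> \<Gamma>" by (rule iso_set_refl)
  with iso show ?thesis
    unfolding graded_isomorphic_def graded_equivalent_def
    by (elim conjE bexE) (intro conjI bexI[of _ "\<lambda>x. x"] bexI; assumption)
qed

end

text \<open>Each \<open>t\<close> occurs in \<open>\<gamma>s\<close> as often as the dimension of
  \<open>M\<close> says, so its positions are in bijection with a basis of \<open>M\<close>; the
  bijections for the various \<open>t\<close> are joined into one function of the position.\<close>

lemma (in mackey_family) mackey_matrix_exists:
  assumes trans: "left_transversal \<Gamma> Inertia T" and \<gamma>s: "mset \<gamma>s = repeat_mset (complex_dim B M) (\<Sum>t\<in>T. {#t#})"
  shows "\<exists>b \<kappa>. mackey_matrix G \<alpha> N M v \<theta> \<omega> T \<gamma>s b \<kappa>"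
proof -
  let ?L = "\<lambda>t. {l. l < length \<gamma>s \<and> \<gamma>s ! l = t}"
  have "T \<subseteq> carrier \<Gamma>" using trans unfolding left_transversal_def by (rule conjunct1)
  then have fT: "finite T" using finite_\<Gamma> by (rule finite_subset)
  have "count (\<Sum>t\<in>T. {#t#}) t = (if t \<in> T then 1 else 0)" for t
    using fT by (simp add: count_sum)
  then have cnt: "count (mset \<gamma>s) t = (if t \<in> T then complex_dim B M else 0)" for t
    unfolding \<gamma>s count_repeat_mset by simp
  have sub: "set \<gamma>s \<subseteq> T"
  proof
    fix x assume "x \<in> set \<gamma>s"
    then have "count (mset \<gamma>s) x > 0" by (rule count_mset_gt_0)
    then show "x \<in> T" unfolding cnt by (simp split: if_splits)
  qed
  obtain \<beta> \<kappa>\<^sub>0 where co: "coord_system B M \<beta> (\<lambda>x. x) \<kappa>\<^sub>0" and card: "card \<beta> = complex_dim B M"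
    using B.irreducible_coord_system[OF irr] by blast
  have "\<exists>g. bij_betw g (?L t) \<beta>" if t: "t \<in> T" for t
  proof (rule finite_same_card_bij)
    have "count (mset \<gamma>s) t = card {l. l < length \<gamma>s \<and> t = \<gamma>s ! l}"
      by (simp only: count_mset count_list_eq_length_filter length_filter_conv_card)
    moreover have "{l. l < length \<gamma>s \<and> t = \<gamma>s ! l} = ?L t" by blast
    ultimately show "card (?L t) = card \<beta>" using cnt[of t] t card by simp
    show "finite \<beta>" by (rule coord_systemD(1)[OF co])
  qed simp
  then have "\<forall>t\<in>T. \<exists>g. bij_betw g (?L t) \<beta>" by (rule ballI)
  from bchoice[OF this] obtain g where g: "\<forall>t\<in>T. bij_betw (g t) (?L t) \<beta>" by (rule exE)
  define b where "b l = g (\<gamma>s ! l) l" for l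
  have bij: "bij_betw b (?L t) \<beta>" if t: "t \<in> T" for t
    using bspec[OF g t] by (rule bij_betw_cong[THEN iffD1, rotated]) (simp add: b_def)
  have "mackey_matrix G \<alpha> N M v \<theta> \<omega> T \<gamma>s b (\<lambda>j. \<kappa>\<^sub>0 (b j))"
  proof (intro mackey_matrix.intro mackey_family_axioms mackey_matrix_axioms.intro trans sub)
    show "coord_system B M (?L t) b (\<lambda>j. \<kappa>\<^sub>0 (b j))" if "t \<in> T" for t
      by (rule coord_system_reindex[OF M.complex_left_module_axioms co bij[OF that]])
  qed
  then show ?thesis
    by (intro exI[of "\<lambda>b. \<exists>\<kappa>. mackey_matrix G \<alpha> N M v \<theta> \<omega> T \<gamma>s b \<kappa>" b]
      exI[of "\<lambda>\<kappa>. mackey_matrix G \<alpha> N M v \<theta> \<omega> T \<gamma>s b \<kappa>" "\<lambda>j. \<kappa>\<^sub>0 (b j)"])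
qed

lemma (in mackey) summand_class:
  assumes \<omega>: "\<omega> \<in> mackey_class G \<alpha> N M" and T: "left_transversal \<Gamma> Inertia T"
    and \<gamma>s: "mset \<gamma>s = repeat_mset (complex_dim B M) (\<Sum>t\<in>T. {#t#})"
  shows "graded_equivalent \<Gamma> (ideal_algebra A (sm e)) (\<lambda>C. sm e \<inter> D C)
    \<Gamma> (matrix_algebra (length \<gamma>s) (twisted_subgroup_algebra \<Gamma> \<omega> Inertia))
      (induced_grading \<Gamma> \<gamma>s (twisted_subgroup_algebra \<Gamma> \<omega> Inertia)
        (extend_grading (twisted_subgroup_algebra \<Gamma> \<omega> Inertia) Inertia twisted_grading))"
proof -
  from mackey_class_family[OF \<omega>] obtain v \<theta> where f: "mackey_family G \<alpha> N M v \<theta> \<omega>" by (elim exE)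
  from mackey_family.mackey_matrix_exists[OF f T \<gamma>s] obtain b \<kappa> where
    m: "mackey_matrix G \<alpha> N M v \<theta> \<omega> T \<gamma>s b \<kappa>" by (elim exE)
  show ?thesis by (rule mackey_matrix.summand_equivalent[OF m])
qed

theorem theoremA:
  fixes G :: "('g, 'x) monoid_scheme"
    and \<alpha> :: "'g \<Rightarrow> 'g \<Rightarrow> complex"
    and N :: "'g set"
  assumes "group G" and "finite (carrier G)"
    and "\<alpha> \<in> cocycles2 G"
    and "N \<lhd> G"
  shows
    "let \<Gamma> = G Mod N;
         A = twisted_group_algebra G \<alpha>;
         B = twisted_subgroup_algebra G \<alpha> N;
         D = quotient_grading A twisted_grading;
         act = irr_action G \<alpha> N
     in \<exists>summand.
          bij_betw summand (orbits \<Gamma> (Irr B) act) (simply_graded_summands \<Gamma> A D) \<and>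
          (\<forall>M T. irreducible_module B M \<and> left_transversal \<Gamma> (inertia_group G \<alpha> N M) T \<longrightarrow>
            (let S = summand (orbit \<Gamma> act (module_type B M));
                 I = inertia_group G \<alpha> N M;
                 x = repeat_mset (complex_dim B M) (\<Sum>t\<in>T. {#t#})
             in (\<exists>a\<in>S \<inter> carrier B. \<exists>m\<in>carrier M. a \<odot>\<^bsub>M\<^esub> m \<noteq> \<zero>\<^bsub>M\<^esub>) \<and>
                mackey_class G \<alpha> N M \<in> H2 (\<Gamma>\<lparr>carrier := I\<rparr>) \<and>
                (\<forall>\<omega>\<in>mackey_class G \<alpha> N M. \<forall>\<gamma>s. mset \<gamma>s = x \<longrightarrow>
                   (let C = twisted_subgroup_algebra \<Gamma> \<omega> I
                    in graded_equivalent
                         \<Gamma> (ideal_algebra A S) (\<lambda>\<gamma>. S \<inter> D \<gamma>)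
                         \<Gamma> (matrix_algebra (length \<gamma>s) C)
                           (induced_grading \<Gamma> \<gamma>s C (extend_grading C I twisted_grading))))))"
proof -
  interpret crossed G \<alpha> N
    by (intro crossed.intro twisted.intro twisted_axioms.intro assms)
  have "\<forall>M T. irreducible_module B M \<and> left_transversal \<Gamma> (inertia_group G \<alpha> N M) T \<longrightarrow>
    (\<exists>a\<in>summand (orb (module_type B M)) \<inter> carrier B. \<exists>m\<in>carrier M. a \<odot>\<^bsub>M\<^esub> m \<noteq> \<zero>\<^bsub>M\<^esub>) \<and>
    mackey_class G \<alpha> N M \<in> H2 (\<Gamma>\<lparr>carrier := inertia_group G \<alpha> N M\<rparr>) \<and>
    (\<forall>\<omega>\<in>mackey_class G \<alpha> N M. \<forall>\<gamma>s. mset \<gamma>s = repeat_mset (complex_dim B M) (\<Sum>t\<in>T. {#t#}) \<longrightarrow>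
      graded_equivalent \<Gamma> (ideal_algebra A (summand (orb (module_type B M))))
        (\<lambda>\<gamma>. summand (orb (module_type B M)) \<inter> D \<gamma>)
        \<Gamma> (matrix_algebra (length \<gamma>s) (twisted_subgroup_algebra \<Gamma> \<omega> (inertia_group G \<alpha> N M)))
        (induced_grading \<Gamma> \<gamma>s (twisted_subgroup_algebra \<Gamma> \<omega> (inertia_group G \<alpha> N M))
          (extend_grading (twisted_subgroup_algebra \<Gamma> \<omega> (inertia_group G \<alpha> N M))
            (inertia_group G \<alpha> N M) twisted_grading)))"
  proof (intro allI impI, elim conjE, intro conjI ballI allI impI)
    fix M T assume irr: "irreducible_module B M" and T: "left_transversal \<Gamma> (inertia_group G \<alpha> N M) T"
    interpret mackey G \<alpha> N M by (intro mackey.intro crossed_axioms mackey_axioms.intro irr)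
    obtain m where m: "m \<in> carrier M" "m \<noteq> \<zero>\<^bsub>M\<^esub>" using irreducible_nonzero[OF irr] by auto
    \<comment> \<open>This clause ties the bijection to the orbit of \<open>M\<close>: the orbit
      idempotent lies in its summand and in \<open>B\<close>, and acts as the identity on
      \<open>M\<close>.\<close>
    show "\<exists>a\<in>summand (orb (module_type B M)) \<inter> carrier B. \<exists>m\<in>carrier M. a \<odot>\<^bsub>M\<^esub> m \<noteq> \<zero>\<^bsub>M\<^esub>"
    proof (intro bexI)
      show "B.idem (orb (module_type B M)) \<odot>\<^bsub>M\<^esub> m \<noteq> \<zero>\<^bsub>M\<^esub>" unfolding e_M[OF m(1)] by (rule m(2))
      show "B.idem (orb (module_type B M)) \<in> summand (orb (module_type B M)) \<inter> carrier B"
        unfolding summand_def by (intro IntI CI.e_S CI.eB)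
    qed (rule m(1))
    show "mackey_class G \<alpha> N M \<in> H2 (\<Gamma>\<lparr>carrier := inertia_group G \<alpha> N M\<rparr>)" by (rule mackey_class_H2)
    fix \<omega> \<gamma>s assume "\<omega> \<in> mackey_class G \<alpha> N M"
      and "mset \<gamma>s = repeat_mset (complex_dim B M) (\<Sum>t\<in>T. {#t#})"
    then show "graded_equivalent \<Gamma> (ideal_algebra A (summand (orb (module_type B M))))
        (\<lambda>\<gamma>. summand (orb (module_type B M)) \<inter> D \<gamma>)
        \<Gamma> (matrix_algebra (length \<gamma>s) (twisted_subgroup_algebra \<Gamma> \<omega> (inertia_group G \<alpha> N M)))
        (induced_grading \<Gamma> \<gamma>s (twisted_subgroup_algebra \<Gamma> \<omega> (inertia_group G \<alpha> N M))
          (extend_grading (twisted_subgroup_algebra \<Gamma> \<omega> (inertia_group G \<alpha> N M))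
            (inertia_group G \<alpha> N M) twisted_grading))"
      unfolding summand_def using T by (intro summand_class)
  qed
  then show ?thesis
    unfolding Let_def by (intro exI[of _ summand] conjI bij_summand)
qed

end
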